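(* Let $(S,\Omega)$ be a relative Sierpiński carpet. Let $u_n:S\to\mathbb R$, $n\in\mathbb N$, be a sequence of (normalized) carpet-harmonic functions that are locally uniformly bounded. Then there exists a subsequence of $u_n$ that converges locally uniformly to a carpet-harmonic function $u:S\to\mathbb R$.
   Context: Relative Sierpiński carpets. Let $\Omega\subset\mathbb C$ be a connected open set and $\{Q_i\}_{i\in\mathbb N}$ open Jordan regions compactly contained in $\Omega$, with pairwise disjoint closures, such that $S:=\Omega\setminus\bigcup_iQ_i$ has empty interior and is locally connected. Then $(S,\Omega)$ is a relative Sierpiński carpet with peripheral disks $Q_i$. Standing assumptions on every relative Sierpiński carpet: (i) $\mathcal H^2(S)=0$; (ii) there is $K_0\ge1$ such that for each $i$ there are concentric balls $B(x,r)\subset Q_i\subset B(x,R)$ with $R/r\le K_0$; (iii) there is $K_1>0$ such that $\mathcal H^2(B(x,r)\cap Q_i)\ge K_1r^2$ for all $i$, $x\in Q_i$, $0<r<\operatorname{diam}(Q_i)$. $\mathcal H^m$ is Hausdorff measure normalized to agree with Lebesgue measure. Notation. Locally uniformly (convergence, boundedness): uniformly on $S\cap K$ for each compact $K\subset\Omega$. $\widehat{\mathbb R}=\mathbb R\cup\{\pm\infty\}$. $V\subset\subset\Omega$: $\overline V$ is compact and contained in $\Omega$. $I_V=\{i:Q_i\cap V\ne\emptyset\}$. $S^\circ$: points of $S$ on no $\partial Q_i$. A path is a continuous map from a bounded interval to $\mathbb C$ with a continuous extension to the closed interval (also its image); it is open if the interval is open; subpaths are restrictions to subintervals. For $g:S\to\widehat{\mathbb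 R}$: $M_{Q_i}(g)=\sup_{\partial Q_i}g$, $m_{Q_i}(g)=\inf_{\partial Q_i}g$, $\operatorname{osc}_{Q_i}(g)=M_{Q_i}(g)-m_{Q_i}(g)$. Moduli of a path family $\Gamma$ in $\Omega$. $\mathrm{mod}_2(\Gamma)=\inf\int\lambda^2d\mathcal H^2$ over Borel $\lambda\ge0$ with $\int_\gamma\lambda\,ds\ge1$ for all $\gamma\in\Gamma$ (with $\int_\gamma\lambda\,ds:=\infty$ if $\gamma$ is not locally rectifiable). Weak modulus $\mathrm{mod}_w(\Gamma)=\inf\sum_i\rho(Q_i)^2$ over non-negative sequences for which there is $\Gamma_0\subset\Gamma$ with $\mathrm{mod}_2(\Gamma_0)=0$ and $\sum_{i:Q_i\cap\gamma\ne\emptyset}\rho(Q_i)\ge1$ for $\gamma\in\Gamma\setminus\Gamma_0$. Strong modulus $\mathrm{mod}_s(\Gamma)$: the same infimum over sequences satisfying this inequality for all $\gamma\in\Gamma$ with $\mathcal H^1(\gamma\cap S)=0$. Sobolev spaces. $\{\rho(Q_i)\}$ is a weak (strong) upper gradient of $g:S\to\widehat{\mathbb R}$ if there is $\Gamma_0$ with $\mathrm{mod}_w(\Gamma_0)=0$ ($\mathrm{mod}_s(\Gamma_0)=0$) such that for all paths $\gamma\subset\Omega$, $\gamma\notin\Gamma_0$, and $x,y\in\gamma\cap S$: $g(x),g(y)\neq\pm\infty$ and $|g(x)-g(y)|\le\sum_{i:Q_i\cap\gamma\ne\emptyset}\rho(Q_i)$. $g\in\mathcal W^{1,2}_{\mathrm{loc}}(S)$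 if $M_{Q_i}(g),m_{Q_i}(g)$ are finite for all $i$, $\sum_{i\in I_B}M_{Q_i}(g)^2\operatorname{diam}(Q_i)^2<\infty$ and $\sum_{i\in I_B}\operatorname{osc}_{Q_i}(g)^2<\infty$ for every ball $B\subset\subset\Omega$, and $\{\operatorname{osc}_{Q_i}(g)\}$ is an upper gradient of $g$; $g\in\mathcal W^{1,2}(S)$ if moreover the sums over all $i\in\mathbb N$ are finite. There is a weak and a strong version; the statement holds for each, with one version fixed throughout. Dirichlet energy: $D_V(g)=\sum_{i\in I_V}\operatorname{osc}_{Q_i}(g)^2$. $u\in\mathcal W^{1,2}_{\mathrm{loc}}(S)$ is carpet-harmonic if $D_V(u)\le D_V(u+\zeta)$ for every open $V\subset\subset\Omega$ and $\zeta\in\mathcal W^{1,2}(S)$ with $\zeta|_{S\setminus V}\equiv0$. Normalized functions. For $g\in\mathcal W^{1,2}_{\mathrm{loc}}(S)$ let $\hat g(Q_i)=M_{Q_i}(g)$. Let $\mathcal G_{\hat g}$ be the family of non-constant paths $\gamma\subset\Omega$ with: $\mathcal H^1(\gamma\cap S)=0$; for every subpath $\gamma'$ of $\gamma$ and $Q_{i_1},Q_{i_2}$ meeting $\gamma'$, $|\hat g(Q_{i_1})-\hat g(Q_{i_2})|\le\sum_{i:Q_i\cap\gamma'\neq\emptyset}\operatorname{osc}_{Q_i}(g)$; $\sum_{i:Q_i\cap\gamma'\ne\emptyset}\operatorname{osc}_{Q_i}(g)<\infty$ for subpaths $\gamma'\subset\subset\Omega$; and, if $\sum_{i\in\mathbb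 N}\operatorname{osc}_{Q_i}(g)^2<\infty$, also $\sum_{i:Q_i\cap\gamma\ne\emptyset}\operatorname{osc}_{Q_i}(g)<\infty$. A point $x\in S$ is accessible by $\gamma_0$ if $x\in\gamma_0\cap S^\circ$ (put $\gamma=\gamma_0$), or there is an open subpath $\gamma$ of $\gamma_0$ with $x\in\overline\gamma\setminus\gamma$ and $\gamma\cap Q_{i_0}=\emptyset$ whenever $x\in\partial Q_{i_0}$. The normalized version $\tilde g$ of $g$ is: $\tilde g(x)=\liminf_{Q_i\to x,\,Q_i\cap\gamma\ne\emptyset}\hat g(Q_i)$ if $x$ is accessible by a path $\gamma_0\in\mathcal G_{\hat g}$, where $\gamma=\gamma_0$ if $x\in\gamma_0\cap S^\circ$, and otherwise $\gamma$ is an open subpath of $\gamma_0$ with $x\in\overline\gamma\setminus\gamma$ and $\gamma\cap Q_{i_0}=\emptyset$ whenever $x\in\partial Q_{i_0}$ (the value is independent of $\gamma$); for non-accessible $x\in\partial Q_{i_0}$, $\tilde g(x)=\liminf\tilde g(y)$ as $y\to x$ through accessible $y\in\partial Q_{i_0}$; for all other $x$, $\tilde g(x)=\liminf\tilde g(y)$ as $y\to x$ through accessible $y$. A function is normalized if it equals the normalized version of some function in the Sobolev space. Standing convention: carpet-harmonic functions are normalized. *)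

theory Defs
  imports "HOL-Analysis.Analysis"
begin

section \<open>Hausdorff measure\<close>

text \<open>The constant makes the $m$-dimensional measure agree with Lebesgue measure on
  Euclidean $m$-space; only $m \ge 1$ is meant.\<close>

definition hausdorff_pre :: "nat \<Rightarrow> real \<Rightarrow> 'a::metric_space set \<Rightarrow> ennreal" where
  "hausdorff_pre m \<delta> A =
     (INF U\<in>{U :: nat \<Rightarrow> 'a set. A \<subseteq> (\<Union>j. U j) \<and> (\<forall>j. bounded (U j) \<and> diameter (U j) \<le> \<delta>)}.
        \<Sum>j. ennreal (unit_ball_vol (real m) * (diameter (U j) / 2) ^ m))"

definition hausdorff :: "nat \<Rightarrow> 'a::metric_space set \<Rightarrow> ennreal" where
  "hausdorff m A = (SUP \<delta>\<in>{0<..}. hausdorff_pre m \<delta> A)"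

definition hausdorff_measure :: "nat \<Rightarrow> 'a::metric_space measure" where
  "hausdorff_measure m = measure_of UNIV (sets borel) (hausdorff m)"

text \<open>\<open>hausdorff m\<close> is a metric outer measure, so the Borel measure obtained from it is not
  degenerate.\<close>

lemma hausdorff_pre_mono: "A \<subseteq> B \<Longrightarrow> hausdorff_pre m \<delta> A \<le> hausdorff_pre m \<delta> B"
  unfolding hausdorff_pre_def by (rule INF_superset_mono) auto

lemma hausdorff_pre_antimono: "\<delta>' \<le> \<delta> \<Longrightarrow> hausdorff_pre m \<delta> A \<le> hausdorff_pre m \<delta>' A"
  unfolding hausdorff_pre_def by (rule INF_superset_mono) (auto intro: order_trans)

lemma hausdorff_mono: "A \<subseteq> B \<Longrightarrow> hausdorff m A \<le> hausdorff m B"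
  unfolding hausdorff_def by (intro SUP_mono) (auto intro: hausdorff_pre_mono)

lemma hausdorff_pre_empty: "0 < m \<Longrightarrow> 0 \<le> \<delta> \<Longrightarrow> hausdorff_pre m \<delta> {} = 0"
  unfolding hausdorff_pre_def
  by (rule antisym[OF INF_lower2[where i="\<lambda>_. {}"]]) (auto simp: power_0_left)

lemma hausdorff_empty: "0 < m \<Longrightarrow> hausdorff m {} = 0"
  unfolding hausdorff_def by (auto simp: hausdorff_pre_empty intro!: SUP_eq_const)

lemma hausdorff_pre_subadd:
  "hausdorff_pre m \<delta> (\<Union>i. A i) \<le> (\<Sum>i::nat. hausdorff_pre m \<delta> (A i))"
proof (rule ennreal_le_epsilon)
  fix e :: real assume e: "0 < e" and fin: "(\<Sum>i. hausdorff_pre m \<delta> (A i)) < top"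
  let ?v = "\<lambda>U. \<Sum>j. ennreal (unit_ball_vol (real m) * (diameter (U j) / 2) ^ m)"
  have "\<exists>U. A i \<subseteq> (\<Union>j. U j) \<and> (\<forall>j. bounded (U j) \<and> diameter (U j) \<le> \<delta>) \<and>
     ?v U \<le> hausdorff_pre m \<delta> (A i) + ennreal (e * (1/2) ^ Suc i)" for i
  proof -
    have "hausdorff_pre m \<delta> (A i) < top"
      using fin ennreal_suminf_lessD by blast
    then have "hausdorff_pre m \<delta> (A i) < hausdorff_pre m \<delta> (A i) + ennreal (e * (1/2) ^ Suc i)"
      using e by (cases "hausdorff_pre m \<delta> (A i)") (auto simp flip: ennreal_plus intro!: ennreal_lessI add_nonneg_pos)
    then show ?thesis
      unfolding hausdorff_pre_def[of m \<delta> "A i"] INF_less_iff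
      by (auto intro: less_imp_le)
  qed
  then obtain U where U: "\<And>i. A i \<subseteq> (\<Union>j. U i j)" "\<And>i j. bounded (U i j)"
     "\<And>i j. diameter (U i j) \<le> \<delta>" "\<And>i. ?v (U i) \<le> hausdorff_pre m \<delta> (A i) + ennreal (e * (1/2) ^ Suc i)"
    by metis
  let ?W = "\<lambda>k. case prod_decode k of (i, j) \<Rightarrow> U i j"
  have "hausdorff_pre m \<delta> (\<Union>i. A i) \<le> ?v ?W"
    unfolding hausdorff_pre_def
  proof (rule INF_lower, safe)
    fix x i assume "x \<in> A i"
    then obtain j where "x \<in> U i j" using U(1) by blast
    then have "x \<in> ?W (prod_encode (i, j))" by simp
    then show "x \<in> (\<Union>k. ?W k)" by (rule UN_I[OF UNIV_I])
  next
    fix k show "bounded (?W k)" using U(2) by (simp split: prod.split)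
    show "diameter (?W k) \<le> \<delta>" using U(3) by (simp split: prod.split)
  qed
  also have "?v ?W = (\<Sum>i. ?v (U i))"
    using suminf_ennreal_2dimen[of "\<lambda>i. ?v (U i)"
        "\<lambda>(i,j). ennreal (unit_ball_vol (real m) * (diameter (U i j) / 2) ^ m)"]
    by (simp add: o_def case_prod_beta)
  also have "\<dots> \<le> (\<Sum>i. hausdorff_pre m \<delta> (A i) + ennreal (e * (1/2) ^ Suc i))"
    by (intro suminf_le U(4)) auto
  also have "\<dots> = (\<Sum>i. hausdorff_pre m \<delta> (A i)) + (\<Sum>i. ennreal (e * (1/2) ^ Suc i))"
    by (rule suminf_add[symmetric]) auto
  also have "(\<Sum>i. ennreal (e * (1/2) ^ Suc i)) = ennreal e"
    using e sums_mult[OF power_half_series, of e] by (intro suminf_ennreal_eq) auto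
  finally show "hausdorff_pre m \<delta> (\<Union>i. A i) \<le> (\<Sum>i. hausdorff_pre m \<delta> (A i)) + ennreal e" .
qed

lemma hausdorff_subadd: "hausdorff m (\<Union>i. A i) \<le> (\<Sum>i::nat. hausdorff m (A i))"
  unfolding hausdorff_def[of m "\<Union>i. A i"]
proof (rule SUP_least)
  fix \<delta> :: real assume "\<delta> \<in> {0<..}"
  then have "hausdorff_pre m \<delta> (A i) \<le> hausdorff m (A i)" for i
    unfolding hausdorff_def by (rule SUP_upper)
  then have "(\<Sum>i. hausdorff_pre m \<delta> (A i)) \<le> (\<Sum>i. hausdorff m (A i))"
    by (intro suminf_le) auto
  then show "hausdorff_pre m \<delta> (\<Union>i. A i) \<le> (\<Sum>i. hausdorff m (A i))"
    using hausdorff_pre_subadd order_trans by blast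
qed

lemma hausdorff_subadd2: assumes "0 < m" shows "hausdorff m (A \<union> B) \<le> hausdorff m A + hausdorff m B"
proof -
  let ?A = "\<lambda>i::nat. if i = 0 then A else if i = 1 then B else {}"
  have "hausdorff m (\<Union>i. ?A i) \<le> (\<Sum>i. hausdorff m (?A i))" by (rule hausdorff_subadd)
  also have "(\<Sum>i. hausdorff m (?A i)) = (\<Sum>i\<in>{0,1}. hausdorff m (?A i))"
    by (rule suminf_finite) (auto simp: hausdorff_empty assms)
  also have "(\<Union>i. ?A i) = A \<union> B" by (auto split: if_splits)
  finally show ?thesis by simp
qed

lemma hausdorff_metric:
  fixes A B :: "'a::metric_space set"
  assumes m: "0 < m" and d: "0 < d" and sep: "\<And>x y. x \<in> A \<Longrightarrow> y \<in> B \<Longrightarrow> d \<le> dist x y"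
  shows "hausdorff m A + hausdorff m B \<le> hausdorff m (A \<union> B)"
proof -
  let ?v = "\<lambda>U :: nat \<Rightarrow> 'a set. \<Sum>j. ennreal (unit_ball_vol (real m) * (diameter (U j) / 2) ^ m)"
  have *: "hausdorff_pre m \<delta> A + hausdorff_pre m \<delta> B \<le> hausdorff m (A \<union> B)"
    if \<delta>: "0 < \<delta>" "\<delta> < d" for \<delta>
  proof -
    have "hausdorff_pre m \<delta> A + hausdorff_pre m \<delta> B \<le> hausdorff_pre m \<delta> (A \<union> B)"
      unfolding hausdorff_pre_def[of m \<delta> "A \<union> B"]
    proof (rule INF_greatest, safe)
      fix U :: "nat \<Rightarrow> 'a set"
      assume cov: "A \<union> B \<subseteq> (\<Union>j. U j)" and U: "\<forall>j. bounded (U j) \<and> diameter (U j) \<le> \<delta>"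
      let ?f = "\<lambda>C j. if U j \<inter> C = {} then {} else U j"
      have P: "hausdorff_pre m \<delta> C \<le> ?v (?f C)" if "C \<subseteq> (\<Union>j. U j)" for C
        unfolding hausdorff_pre_def
      proof (rule INF_lower, safe)
        fix x assume "x \<in> C"
        with that have "x \<in> (\<Union>j. U j)" by blast
        then obtain j where "x \<in> U j" by blast
        then have "x \<in> ?f C j" using \<open>x \<in> C\<close> by auto
        then show "x \<in> (\<Union>j. ?f C j)" by blast
      qed (use U \<delta> in auto)
      have no: "U j \<inter> A = {} \<or> U j \<inter> B = {}" for j
      proof (rule ccontr)
        assume "\<not> ?thesis"
        then obtain x y where "x \<in> U j" "x \<in> A" "y \<in> U j" "y \<in> B" by blast
        then have "dist x y \<le> diameter (U j)" "d \<le> dist x y"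
          using U diameter_bounded_bound sep by blast+
        then show False using U \<delta> by (meson dual_order.strict_trans2 not_less order_trans)
      qed
      have "hausdorff_pre m \<delta> A + hausdorff_pre m \<delta> B \<le> ?v (?f A) + ?v (?f B)"
        using P cov by (intro add_mono) auto
      also have "\<dots> = (\<Sum>j. ennreal (unit_ball_vol (real m) * (diameter (?f A j) / 2) ^ m) +
           ennreal (unit_ball_vol (real m) * (diameter (?f B j) / 2) ^ m))"
        by (rule suminf_add) auto
      also have "\<dots> \<le> ?v U"
        using no m by (intro suminf_le) (auto simp: power_0_left)
      finally show "hausdorff_pre m \<delta> A + hausdorff_pre m \<delta> B \<le> ?v U" .
    qed
    also have "\<dots> \<le> hausdorff m (A \<union> B)"
      unfolding hausdorff_def using \<delta> by (intro SUP_upper) auto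
    finally show ?thesis .
  qed
  have le: "hausdorff_pre m \<delta>1 A + hausdorff_pre m \<delta>2 B \<le> hausdorff m (A \<union> B)"
    if "0 < \<delta>1" "0 < \<delta>2" for \<delta>1 \<delta>2
  proof -
    define \<delta> where "\<delta> = Min {\<delta>1, \<delta>2, d/2}"
    have \<delta>: "0 < \<delta>" "\<delta> < d" "\<delta> \<le> \<delta>1" "\<delta> \<le> \<delta>2" using that d by (auto simp: \<delta>_def)
    have "hausdorff_pre m \<delta>1 A + hausdorff_pre m \<delta>2 B \<le> hausdorff_pre m \<delta> A + hausdorff_pre m \<delta> B"
      using \<delta> by (intro add_mono hausdorff_pre_antimono)
    then show ?thesis using *[OF \<delta>(1,2)] by simp
  qed
  have "hausdorff m A + hausdorff m B =
     (SUP \<delta>1\<in>{0<..}. SUP \<delta>2\<in>{0<..}. hausdorff_pre m \<delta>1 A + hausdorff_pre m \<delta>2 B)"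
    unfolding hausdorff_def
    by (subst ennreal_SUP_add_left[symmetric]; simp add: ennreal_SUP_add_right)
  also have "\<dots> \<le> hausdorff m (A \<union> B)"
    using le by (intro SUP_least) auto
  finally show ?thesis .
qed

lemma hausdorff_closed:
  fixes F T :: "'a::metric_space set"
  assumes m: "0 < m" and F: "closed F"
  shows "hausdorff m (T \<inter> F) + hausdorff m (T - F) \<le> hausdorff m T"
proof (cases "F = {} \<or> hausdorff m T = top")
  case True
  then show ?thesis using m by (auto simp: hausdorff_empty)
next
  case False
  then have ne: "F \<noteq> {}" and fin: "hausdorff m T < top" by (auto simp: top.not_eq_extremum)
  define f where "f x = infdist x F" for x
  define R where "R k = {x\<in>T. 1 / real (k+2) \<le> f x \<and> f x < 1 / real (k+1)}" for k
  define T' where "T' n = {x\<in>T. 1 / real (n+1) \<le> f x}" for n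
  have lip: "f x \<le> f y + dist x y" for x y
    unfolding f_def by (rule infdist_triangle)
  have par: "(\<Sum>k<N. hausdorff m (R (2*k+p))) \<le> hausdorff m (\<Union>k<N. R (2*k+p))" for N p
  proof (induction N)
    case (Suc N)
    have "(\<Sum>k<Suc N. hausdorff m (R (2*k+p))) \<le>
        hausdorff m (\<Union>k<N. R (2*k+p)) + hausdorff m (R (2*N+p))"
      using Suc by (simp add: add_right_mono)
    also have "\<dots> \<le> hausdorff m ((\<Union>k<N. R (2*k+p)) \<union> R (2*N+p))"
    proof (cases "N = 0")
      case True
      then show ?thesis using m by (simp add: hausdorff_empty)
    next
      case False
      show ?thesis
      proof (rule hausdorff_metric[OF m, where d = "1 / real (2*N+p) - 1 / real (2*N+p+1)"])
        show "0 < 1 / real (2*N+p) - 1 / real (2*N+p+1)"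
          using False by (simp add: frac_less2)
        fix x y assume "x \<in> (\<Union>k<N. R (2*k+p))" and y: "y \<in> R (2*N+p)"
        then obtain k where k: "k < N" "1 / real (2*k+p+2) \<le> f x" by (auto simp: R_def)
        have "1 / real (2*N+p) \<le> 1 / real (2*k+p+2)"
          using k(1) by (intro divide_left_mono) auto
        moreover have "f y < 1 / real (2*N+p+1)" using y by (simp add: R_def)
        ultimately show "1 / real (2*N+p) - 1 / real (2*N+p+1) \<le> dist x y"
          using lip[of x y] k(2) by linarith
      qed
    qed
    also have "(\<Union>k<N. R (2*k+p)) \<union> R (2*N+p) = (\<Union>k<Suc N. R (2*k+p))"
      by (auto simp: lessThan_Suc)
    finally show ?case .
  qed simp
  have parT: "(\<Sum>k<N. hausdorff m (R (2*k+p))) \<le> hausdorff m T" for N p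
    by (rule order_trans[OF par hausdorff_mono]) (auto simp: R_def)
  have split: "(\<Sum>k<2*N. g k) = (\<Sum>k<N. g (2*k+0)) + (\<Sum>k<N. g (2*k+1))" for g :: "nat \<Rightarrow> ennreal" and N
    by (induction N) (auto simp: ac_simps)
  have "(\<Sum>k<N. hausdorff m (R k)) \<le> hausdorff m T + hausdorff m T" for N
  proof -
    have "(\<Sum>k<N. hausdorff m (R k)) \<le> (\<Sum>k<2*N. hausdorff m (R k))"
      by (intro sum_mono2) auto
    also have "\<dots> \<le> hausdorff m T + hausdorff m T"
      unfolding split by (intro add_mono parT)
    finally show ?thesis .
  qed
  then have "(\<Sum>k. hausdorff m (R k)) \<le> hausdorff m T + hausdorff m T"
    by (intro suminf_le_const) auto
  then have finS: "(\<Sum>k. hausdorff m (R k)) < top"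
    using fin by (auto intro: le_less_trans)
  define r where "r k = enn2real (hausdorff m (R k))" for k
  have r: "hausdorff m (R k) = ennreal (r k)" "0 \<le> r k" for k
    using ennreal_suminf_lessD[OF finS, of k] by (auto simp: r_def)
  have sr: "summable r"
    using finS r by (intro summable_suminf_not_top) auto
  show ?thesis
  proof (rule ennreal_le_epsilon)
    fix e :: real assume e: "0 < e"
    obtain n where n: "norm (\<Sum>k. r (k + n)) < e"
      using suminf_exist_split[OF e sr] by blast
    have sub: "T - F \<subseteq> T' n \<union> (\<Union>k. R (k + n))"
    proof
      fix x assume x: "x \<in> T - F"
      then have pos: "0 < f x"
        unfolding f_def using F ne by (simp add: infdist_pos_not_in_closed)
      show "x \<in> T' n \<union> (\<Union>k. R (k + n))"
      proof (cases "1 / real (n+1) \<le> f x")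
        case True
        then show ?thesis using x by (auto simp: T'_def)
      next
        case False
        define P where "P k \<longleftrightarrow> 1 / real (k + n + 2) \<le> f x" for k
        obtain k0 where "1 / f x < real k0" using reals_Archimedean2 by blast
        then have "1 / real (k0 + n + 2) \<le> f x"
          using pos by (simp add: field_simps) (smt (verit) mult_nonneg_nonneg of_nat_0_le_iff)
        then have Pk0: "P k0" by (simp add: P_def)
        define k where "k = (LEAST k. P k)"
        have "P k" unfolding k_def using Pk0 by (rule LeastI)
        moreover have "f x < 1 / real (k + n + 1)"
        proof (cases k)
          case 0
          then show ?thesis using False by simp
        next
          case (Suc k')
          then have "\<not> P k'" using not_less_Least[of k' P] by (simp add: k_def)
          then show ?thesis using Suc by (simp add: P_def ac_simps)
        qed
        ultimately have "x \<in> R (k + n)" using x by (auto simp: R_def P_def)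
        then show ?thesis by blast
      qed
    qed
    have "hausdorff m (T - F) \<le> hausdorff m (T' n) + hausdorff m (\<Union>k. R (k + n))"
      using hausdorff_mono[OF sub] hausdorff_subadd2[OF m] order_trans by blast
    also have "hausdorff m (\<Union>k. R (k + n)) \<le> (\<Sum>k. ennreal (r (k + n)))"
      using hausdorff_subadd[of m "\<lambda>k. R (k + n)"] by (simp add: r)
    also have "(\<Sum>k. ennreal (r (k + n))) = ennreal (\<Sum>k. r (k + n))"
      using sr r by (intro suminf_ennreal2) (auto simp: summable_iff_shift)
    also have "\<dots> \<le> ennreal e"
      using n by (intro ennreal_leI) simp
    finally have "hausdorff m (T - F) \<le> hausdorff m (T' n) + ennreal e"
      by (simp add: add_left_mono)
    then have "hausdorff m (T \<inter> F) + hausdorff m (T - F) \<le>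
        hausdorff m (T \<inter> F) + hausdorff m (T' n) + ennreal e"
      by (simp add: add_left_mono add.assoc)
    also have "hausdorff m (T \<inter> F) + hausdorff m (T' n) \<le> hausdorff m (T \<inter> F \<union> T' n)"
    proof (rule hausdorff_metric[OF m, where d = "1 / real (n + 1)"])
      fix x y assume "x \<in> T \<inter> F" "y \<in> T' n"
      then have "f x = 0" "1 / real (n+1) \<le> f y" by (auto simp: f_def T'_def)
      then show "1 / real (n + 1) \<le> dist x y"
        using lip[of y x] by (simp add: dist_commute)
    qed simp
    also have "\<dots> \<le> hausdorff m T"
      by (rule hausdorff_mono) (auto simp: T'_def)
    finally show "hausdorff m (T \<inter> F) + hausdorff m (T - F) \<le> hausdorff m T + ennreal e"
      by (simp add: add_right_mono)
  qed
qed

proposition emeasure_hausdorff_measure: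
  fixes A :: "'a::metric_space set"
  assumes m: "0 < m" and A: "A \<in> sets borel"
  shows "emeasure (hausdorff_measure m) A = hausdorff m A"
proof -
  let ?h = "hausdorff m :: 'a set \<Rightarrow> ennreal"
  let ?L = "lambda_system UNIV (UNIV :: 'a set set) ?h"
  interpret U: sigma_algebra "UNIV :: 'a set" "UNIV :: 'a set set"
    using sigma_algebra_Pow[of "UNIV :: 'a set"] by simp
  have "outer_measure_space UNIV ?h"
    unfolding outer_measure_space_def positive_def increasing_def countably_subadditive_def
    using m by (auto simp: hausdorff_empty hausdorff_mono hausdorff_subadd)
  then have ms: "measure_space UNIV ?L ?h"
    by (rule U.caratheodory_lemma)
  then interpret L: sigma_algebra UNIV ?L
    by (simp add: measure_space_def)
  have "F \<in> ?L" if "closed F" for F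
    unfolding U.lambda_system_eq
  proof (safe, simp)
    fix T :: "'a set"
    have "?h T \<le> ?h (T \<inter> F) + ?h (T - F)"
      using hausdorff_subadd2[OF m, of "T \<inter> F" "T - F"] by (simp add: Int_Diff_Un)
    then show "?h (T \<inter> F) + ?h (T - F) = ?h T"
      using hausdorff_closed[OF m that] by (simp add: antisym)
  qed
  then have sub: "sets (borel :: 'a measure) \<subseteq> ?L"
    unfolding borel_eq_closed by (auto intro!: L.sigma_sets_subset)
  have "emeasure (measure_of UNIV (sets borel) ?h) A = ?h A"
  proof (rule emeasure_measure_of_sigma)
    show "sigma_algebra UNIV (sets (borel :: 'a measure))"
      using sets.sigma_algebra_axioms[of borel] by simp
    show "positive (sets borel) ?h"
      using m by (simp add: positive_def hausdorff_empty)
    show "countably_additive (sets borel) ?h"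
      using ms sub unfolding measure_space_def countably_additive_def by blast
  qed (rule A)
  then show ?thesis by (simp add: hausdorff_measure_def)
qed


section \<open>Relative Sierpinski carpets\<close>

definition ccontained :: "complex set \<Rightarrow> complex set \<Rightarrow> bool" (infix "\<subset>\<subset>" 50) where
  "V \<subset>\<subset> W \<longleftrightarrow> compact (closure V) \<and> closure V \<subseteq> W"

definition jordan_region :: "complex set \<Rightarrow> bool" where
  "jordan_region U \<longleftrightarrow>
     (\<exists>c. simple_path c \<and> pathfinish c = pathstart c \<and> U = inside (path_image c))"

definition carpet :: "complex set \<Rightarrow> (nat \<Rightarrow> complex set) \<Rightarrow> complex set" where
  "carpet \<Omega> Q = \<Omega> - (\<Union>i. Q i)"

definition relative_sierpinski_carpet :: "complex set \<Rightarrow> (nat \<Rightarrow> complex set) \<Rightarrow> bool" where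
  "relative_sierpinski_carpet \<Omega> Q \<longleftrightarrow>
     open \<Omega> \<and> connected \<Omega> \<and>
     (\<forall>i. jordan_region (Q i) \<and> Q i \<subset>\<subset> \<Omega>) \<and>
     (\<forall>i j. i \<noteq> j \<longrightarrow> closure (Q i) \<inter> closure (Q j) = {}) \<and>
     interior (carpet \<Omega> Q) = {} \<and>
     locally connected (carpet \<Omega> Q)"

definition standing_assumptions :: "complex set \<Rightarrow> (nat \<Rightarrow> complex set) \<Rightarrow> bool" where
  "standing_assumptions \<Omega> Q \<longleftrightarrow>
     hausdorff 2 (carpet \<Omega> Q) = 0 \<and>
     (\<exists>K\<^sub>0\<ge>1. \<forall>i. \<exists>x r R. 0 < r \<and> ball x r \<subseteq> Q i \<and> Q i \<subseteq> ball x R \<and> R / r \<le> K\<^sub>0) \<and>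
     (\<exists>K\<^sub>1>0. \<forall>i. \<forall>x\<in>Q i. \<forall>r. 0 < r \<and> r < diameter (Q i) \<longrightarrow>
        hausdorff 2 (ball x r \<inter> Q i) \<ge> ennreal (K\<^sub>1 * r\<^sup>2))"

definition carpet_core :: "complex set \<Rightarrow> (nat \<Rightarrow> complex set) \<Rightarrow> complex set" where
  "carpet_core \<Omega> Q = {x \<in> carpet \<Omega> Q. \<forall>i. x \<notin> frontier (Q i)}"

definition meeting :: "(nat \<Rightarrow> complex set) \<Rightarrow> complex set \<Rightarrow> nat set" where
  "meeting Q V = {i. Q i \<inter> V \<noteq> {}}"


section \<open>Paths and line integrals\<close>

text \<open>A path is a pair of its parameter interval and a parametrization; the continuous extension
  to the closed interval is the same function, and its values off the closure are irrelevant.\<close>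

type_synonym plane_path = "real set \<times> (real \<Rightarrow> complex)"

definition is_plane_path :: "plane_path \<Rightarrow> bool" where
  "is_plane_path \<gamma> \<longleftrightarrow> is_interval (fst \<gamma>) \<and> bounded (fst \<gamma>) \<and> fst \<gamma> \<noteq> {} \<and>
     continuous_on (closure (fst \<gamma>)) (snd \<gamma>)"

definition img :: "plane_path \<Rightarrow> complex set" where
  "img \<gamma> = snd \<gamma> ` fst \<gamma>"

definition paths_in :: "complex set \<Rightarrow> plane_path set" where
  "paths_in \<Omega> = {\<gamma>. is_plane_path \<gamma> \<and> img \<gamma> \<subseteq> \<Omega>}"

definition subpath_of :: "plane_path \<Rightarrow> plane_path \<Rightarrow> bool" where
  "subpath_of \<gamma>' \<gamma> \<longleftrightarrow>
     snd \<gamma>' = snd \<gamma> \<and> fst \<gamma>' \<subseteq> fst \<gamma> \<and> is_interval (fst \<gamma>') \<and> fst \<gamma>' \<noteq> {}"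

definition curve_length :: "(real \<Rightarrow> complex) \<Rightarrow> real set \<Rightarrow> ennreal" where
  "curve_length h J =
     (SUP (n, t)\<in>{(n :: nat, t :: nat \<Rightarrow> real). mono_on {..n} t \<and> t ` {..n} \<subseteq> J}.
        \<Sum>k<n. ennreal (dist (h (t k)) (h (t (Suc k)))))"

definition locally_rectifiable :: "plane_path \<Rightarrow> bool" where
  "locally_rectifiable \<gamma> \<longleftrightarrow>
     (\<forall>a b. a \<le> b \<and> {a..b} \<subseteq> fst \<gamma> \<longrightarrow> curve_length (snd \<gamma>) {a..b} < \<infinity>)"

text \<open>Any two parameters with the same arc length have the same image, so the choice
  does not matter.\<close>

definition arclength_param :: "(real \<Rightarrow> complex) \<Rightarrow> real \<Rightarrow> real \<Rightarrow> real \<Rightarrow> complex" where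
  "arclength_param h a b s = h (SOME t. t \<in> {a..b} \<and> curve_length h {a..t} = ennreal s)"

definition line_integral :: "(complex \<Rightarrow> ennreal) \<Rightarrow> plane_path \<Rightarrow> ennreal" where
  "line_integral w \<gamma> =
     (if locally_rectifiable \<gamma>
      then (SUP (a, b)\<in>{(a, b). a \<le> b \<and> {a..b} \<subseteq> fst \<gamma>}.
              \<integral>\<^sup>+s\<in>{0..enn2real (curve_length (snd \<gamma>) {a..b})}.
                 w (arclength_param (snd \<gamma>) a b s) \<partial>lborel)
      else \<infinity>)"


section \<open>Moduli\<close>

definition mod2 :: "plane_path set \<Rightarrow> ennreal" where
  "mod2 \<Gamma> =
     (INF w\<in>{w \<in> borel_measurable borel. \<forall>\<gamma>\<in>\<Gamma>. line_integral w \<gamma> \<ge> 1}.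
        \<integral>\<^sup>+z. (w z)\<^sup>2 \<partial>hausdorff_measure 2)"

text \<open>Weights may take the value infinity, which does not affect the infima below.\<close>

definition sum_along :: "(nat \<Rightarrow> complex set) \<Rightarrow> plane_path \<Rightarrow> (nat \<Rightarrow> ennreal) \<Rightarrow> ennreal" where
  "sum_along Q \<gamma> \<rho> = (\<Sum>\<^sub>\<infinity>i\<in>meeting Q (img \<gamma>). \<rho> i)"

definition mod_weak :: "(nat \<Rightarrow> complex set) \<Rightarrow> plane_path set \<Rightarrow> ennreal" where
  "mod_weak Q \<Gamma> =
     (INF \<rho>\<in>{\<rho>. \<exists>\<Gamma>\<^sub>0\<subseteq>\<Gamma>. mod2 \<Gamma>\<^sub>0 = 0 \<and> (\<forall>\<gamma>\<in>\<Gamma> - \<Gamma>\<^sub>0. sum_along Q \<gamma> \<rho> \<ge> 1)}.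
        \<Sum>\<^sub>\<infinity>i. (\<rho> i)\<^sup>2)"

definition mod_strong :: "complex set \<Rightarrow> (nat \<Rightarrow> complex set) \<Rightarrow> plane_path set \<Rightarrow> ennreal" where
  "mod_strong \<Omega> Q \<Gamma> =
     (INF \<rho>\<in>{\<rho>. \<forall>\<gamma>\<in>\<Gamma>. hausdorff 1 (img \<gamma> \<inter> carpet \<Omega> Q) = 0 \<longrightarrow> sum_along Q \<gamma> \<rho> \<ge> 1}.
        \<Sum>\<^sub>\<infinity>i. (\<rho> i)\<^sup>2)"

datatype version = Weak | Strong

fun carpet_mod :: "version \<Rightarrow> complex set \<Rightarrow> (nat \<Rightarrow> complex set) \<Rightarrow> plane_path set \<Rightarrow> ennreal" where
  "carpet_mod Weak \<Omega> Q \<Gamma> = mod_weak Q \<Gamma>"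
| "carpet_mod Strong \<Omega> Q \<Gamma> = mod_strong \<Omega> Q \<Gamma>"


section \<open>Sobolev spaces and carpet-harmonic functions\<close>

text \<open>Functions on the carpet are total functions of which only the values on the carpet matter.\<close>

definition peri_sup :: "(nat \<Rightarrow> complex set) \<Rightarrow> (complex \<Rightarrow> ereal) \<Rightarrow> nat \<Rightarrow> ereal" where
  "peri_sup Q g i = (SUP x\<in>frontier (Q i). g x)"

definition peri_inf :: "(nat \<Rightarrow> complex set) \<Rightarrow> (complex \<Rightarrow> ereal) \<Rightarrow> nat \<Rightarrow> ereal" where
  "peri_inf Q g i = (INF x\<in>frontier (Q i). g x)"

definition osc :: "(nat \<Rightarrow> complex set) \<Rightarrow> (complex \<Rightarrow> ereal) \<Rightarrow> nat \<Rightarrow> ennreal" where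
  "osc Q g i = e2ennreal (peri_sup Q g i - peri_inf Q g i)"

text \<open>Constant paths are not excluded. A family containing a constant path at a point of the carpet
  has infinite modulus, so a function with an upper gradient is finite on the carpet.\<close>

definition upper_gradient ::
  "version \<Rightarrow> complex set \<Rightarrow> (nat \<Rightarrow> complex set) \<Rightarrow> (complex \<Rightarrow> ereal) \<Rightarrow> (nat \<Rightarrow> ennreal) \<Rightarrow> bool" where
  "upper_gradient ver \<Omega> Q g \<rho> \<longleftrightarrow>
     (\<exists>\<Gamma>\<^sub>0\<subseteq>paths_in \<Omega>. carpet_mod ver \<Omega> Q \<Gamma>\<^sub>0 = 0 \<and>
        (\<forall>\<gamma>\<in>paths_in \<Omega> - \<Gamma>\<^sub>0. \<forall>x\<in>img \<gamma> \<inter> carpet \<Omega> Q. \<forall>y\<in>img \<gamma> \<inter> carpet \<Omega> Q.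
           \<bar>g x\<bar> \<noteq> \<infinity> \<and> \<bar>g y\<bar> \<noteq> \<infinity> \<and> \<bar>g x - g y\<bar> \<le> enn2ereal (sum_along Q \<gamma> \<rho>)))"

definition W12_loc ::
  "version \<Rightarrow> complex set \<Rightarrow> (nat \<Rightarrow> complex set) \<Rightarrow> (complex \<Rightarrow> ereal) set" where
  "W12_loc ver \<Omega> Q = {g.
     (\<forall>i. \<bar>peri_sup Q g i\<bar> \<noteq> \<infinity> \<and> \<bar>peri_inf Q g i\<bar> \<noteq> \<infinity>) \<and>
     (\<forall>x r. ball x r \<subset>\<subset> \<Omega> \<longrightarrow>
        (\<Sum>\<^sub>\<infinity>i\<in>meeting Q (ball x r). e2ennreal ((peri_sup Q g i)\<^sup>2 * ereal ((diameter (Q i))\<^sup>2))) < \<infinity> \<and>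
        (\<Sum>\<^sub>\<infinity>i\<in>meeting Q (ball x r). (osc Q g i)\<^sup>2) < \<infinity>) \<and>
     upper_gradient ver \<Omega> Q g (osc Q g)}"

definition W12 ::
  "version \<Rightarrow> complex set \<Rightarrow> (nat \<Rightarrow> complex set) \<Rightarrow> (complex \<Rightarrow> ereal) set" where
  "W12 ver \<Omega> Q = {g \<in> W12_loc ver \<Omega> Q.
     (\<Sum>\<^sub>\<infinity>i. e2ennreal ((peri_sup Q g i)\<^sup>2 * ereal ((diameter (Q i))\<^sup>2))) < \<infinity> \<and>
     (\<Sum>\<^sub>\<infinity>i. (osc Q g i)\<^sup>2) < \<infinity>}"

definition energy :: "(nat \<Rightarrow> complex set) \<Rightarrow> complex set \<Rightarrow> (complex \<Rightarrow> ereal) \<Rightarrow> ennreal" where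
  "energy Q V g = (\<Sum>\<^sub>\<infinity>i\<in>meeting Q V. (osc Q g i)\<^sup>2)"

definition carpet_harmonic ::
  "version \<Rightarrow> complex set \<Rightarrow> (nat \<Rightarrow> complex set) \<Rightarrow> (complex \<Rightarrow> ereal) \<Rightarrow> bool" where
  "carpet_harmonic ver \<Omega> Q u \<longleftrightarrow>
     u \<in> W12_loc ver \<Omega> Q \<and>
     (\<forall>V \<zeta>. open V \<and> V \<subset>\<subset> \<Omega> \<and> \<zeta> \<in> W12 ver \<Omega> Q \<and> (\<forall>x\<in>carpet \<Omega> Q - V. \<zeta> x = 0) \<longrightarrow>
        energy Q V u \<le> energy Q V (\<lambda>x. u x + \<zeta> x))"


section \<open>Normalized functions\<close>

definition good_paths ::
  "complex set \<Rightarrow> (nat \<Rightarrow> complex set) \<Rightarrow> (complex \<Rightarrow> ereal) \<Rightarrow> plane_path set" where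
  "good_paths \<Omega> Q g = {\<gamma> \<in> paths_in \<Omega>.
     (\<exists>s\<in>fst \<gamma>. \<exists>t\<in>fst \<gamma>. snd \<gamma> s \<noteq> snd \<gamma> t) \<and>
     hausdorff 1 (img \<gamma> \<inter> carpet \<Omega> Q) = 0 \<and>
     (\<forall>\<gamma>'. subpath_of \<gamma>' \<gamma> \<longrightarrow>
        (\<forall>i\<in>meeting Q (img \<gamma>'). \<forall>j\<in>meeting Q (img \<gamma>').
           \<bar>peri_sup Q g i - peri_sup Q g j\<bar> \<le> enn2ereal (sum_along Q \<gamma>' (osc Q g)))) \<and>
     (\<forall>\<gamma>'. subpath_of \<gamma>' \<gamma> \<and> img \<gamma>' \<subset>\<subset> \<Omega> \<longrightarrow> sum_along Q \<gamma>' (osc Q g) < \<infinity>) \<and>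
     ((\<Sum>\<^sub>\<infinity>i. (osc Q g i)\<^sup>2) < \<infinity> \<longrightarrow> sum_along Q \<gamma> (osc Q g) < \<infinity>)}"

definition accesses ::
  "complex set \<Rightarrow> (nat \<Rightarrow> complex set) \<Rightarrow> complex \<Rightarrow> plane_path \<Rightarrow> plane_path \<Rightarrow> bool" where
  "accesses \<Omega> Q x \<gamma>\<^sub>0 \<gamma> \<longleftrightarrow>
     (if x \<in> img \<gamma>\<^sub>0 \<inter> carpet_core \<Omega> Q then \<gamma> = \<gamma>\<^sub>0
      else subpath_of \<gamma> \<gamma>\<^sub>0 \<and> open (fst \<gamma>) \<and> x \<in> closure (img \<gamma>) - img \<gamma> \<and>
           (\<forall>i. x \<in> frontier (Q i) \<longrightarrow> img \<gamma> \<inter> Q i = {}))"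

definition accessible ::
  "complex set \<Rightarrow> (nat \<Rightarrow> complex set) \<Rightarrow> (complex \<Rightarrow> ereal) \<Rightarrow> complex \<Rightarrow> bool" where
  "accessible \<Omega> Q g x \<longleftrightarrow>
     x \<in> carpet \<Omega> Q \<and> (\<exists>\<gamma>\<^sub>0\<in>good_paths \<Omega> Q g. \<exists>\<gamma>. accesses \<Omega> Q x \<gamma>\<^sub>0 \<gamma>)"

text \<open>The peripheral disks that meet the path tend to the point when they are eventually contained
  in each ball about it.\<close>

definition disks_to :: "(nat \<Rightarrow> complex set) \<Rightarrow> plane_path \<Rightarrow> complex \<Rightarrow> nat filter" where
  "disks_to Q \<gamma> x = (INF r\<in>{0<..}. principal {i \<in> meeting Q (img \<gamma>). Q i \<subseteq> ball x r})"

text \<open>The value does not depend on the chosen path.\<close>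

definition access_value ::
  "complex set \<Rightarrow> (nat \<Rightarrow> complex set) \<Rightarrow> (complex \<Rightarrow> ereal) \<Rightarrow> complex \<Rightarrow> ereal" where
  "access_value \<Omega> Q g x =
     Liminf (disks_to Q (SOME \<gamma>. \<exists>\<gamma>\<^sub>0\<in>good_paths \<Omega> Q g. accesses \<Omega> Q x \<gamma>\<^sub>0 \<gamma>) x) (peri_sup Q g)"

definition normalized_version ::
  "complex set \<Rightarrow> (nat \<Rightarrow> complex set) \<Rightarrow> (complex \<Rightarrow> ereal) \<Rightarrow> complex \<Rightarrow> ereal" where
  "normalized_version \<Omega> Q g x =
     (if accessible \<Omega> Q g x then access_value \<Omega> Q g x
      else if \<exists>i. x \<in> frontier (Q i)
      then Liminf (at x within {y \<in> frontier (Q (THE i. x \<in> frontier (Q i))). accessible \<Omega> Q g y})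
             (access_value \<Omega> Q g)
      else Liminf (at x within {y. accessible \<Omega> Q g y}) (access_value \<Omega> Q g))"

definition normalized ::
  "version \<Rightarrow> complex set \<Rightarrow> (nat \<Rightarrow> complex set) \<Rightarrow> (complex \<Rightarrow> ereal) \<Rightarrow> bool" where
  "normalized ver \<Omega> Q u \<longleftrightarrow>
     (\<exists>g\<in>W12_loc ver \<Omega> Q. \<forall>x\<in>carpet \<Omega> Q. u x = normalized_version \<Omega> Q g x)"

end

theory Submission
  imports Defs "HOL-Complex_Analysis.Great_Picard"
begin

text \<open>A Caccioppoli inequality bounds the energies of the given functions locally. Among many squares at
sparse scales about a point, one therefore has small oscillation of all the functions' disk values along it
(Courant--Lebesgue). At a point of a peripheral circle a Janiszewski argument extracts from the square a single
crosscut that separates the point, and the maximum principle behind the crosscut makes the disk values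
equicontinuous. Normalization carries this over to the points of the carpet, so Arzela--Ascoli gives a limit. Its
upper gradient comes from an almost orthogonal subsequence of the oscillations, its minimality from gluing the limit
to the approximating functions by a cutoff, and by continuity the limit is its own normalized version.\<close>

section \<open>Sums over index sets and squares\<close>

text \<open>Three exchanges carry the proof. A locally square summable upper gradient can be
  exchanged for the oscillation, because a path can be cut at the circles of finitely many disks and
  the gaps jumped there (\<open>chain_bound\<close>); this is what keeps sums and cutoffs of Sobolev
  functions in the space. Almost every path can be exchanged for almost every horizontal or vertical
  line, which is why squares replace round discs. A value attached to a point inside a disk can be
  exchanged for any value on its circle (\<open>vals\<close>). At a point x of a circle the obstacle
  is its own disk: it comes into every small square and its oscillation does not become small. It is
  left out of the energy, so the curve on which oscillation is controlled has to avoid it. In the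
  limit the obstacle is that oscillations converge only weakly in l2. Along a single path sums and
  not energies have to converge, and for minimality only the positive part of the energy excess of
  the limit over the sequence is under control.\<close>

abbreviation "eN == ennreal"

abbreviation "iN \<equiv> \<infinity>"

text \<open>An integral for counting measure, so that Fatou, monotone and dominated convergence
  apply to sums over index sets; \<open>ns_infsum\<close> translates the sums of the
  statement.\<close>

definition ns :: "nat set => (nat => ennreal) => ennreal" where
 "ns A f = (\<integral>\<^sup>+i. f i * indicator A i \<partial>count_space UNIV)"

lemma ns_suminf: "ns A f = (\<Sum>i. f i * indicator A i)"
 unfolding ns_def by (rule nn_integral_count_space_nat)

lemma ns_mono: "A <= B ==> (!!i. i : A ==> f i <= g i) ==> ns A f <= ns B g"
 unfolding ns_def by (intro nn_integral_mono) (auto split: split_indicator)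

lemma ns_cong: "A = B ==> (!!i. i : B ==> f i = g i) ==> ns A f = ns B g"
 unfolding ns_def by (intro nn_integral_cong) (auto split: split_indicator)

lemma ns_add: "ns A (%i. f i + g i) = ns A f + ns A g"
 unfolding ns_def by (subst nn_integral_add[symmetric]) (auto simp: distrib_right)

lemma ns_cmult: "ns A (%i. c * f i) = c * ns A f"
 unfolding ns_def by (subst nn_integral_cmult[symmetric]) (auto simp: mult.assoc)

lemma ns_Un_le: "ns (A Un B) f <= ns A f + ns B f"
 unfolding ns_def by (subst nn_integral_add[symmetric]) (auto intro!: nn_integral_mono split: split_indicator)

lemma ns_Un_disj: "A Int B = {} ==> ns (A Un B) f = ns A f + ns B f"
 unfolding ns_def by (subst nn_integral_add[symmetric]) (auto intro!: nn_integral_cong split: split_indicator)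

lemma ns_finite: "finite A ==> ns A f = (\<Sum>i\<in>A. f i)"
 unfolding ns_suminf by (subst suminf_finite[of A]) (auto intro!: sum.cong)

lemma ns_single: "i : A ==> f i <= ns A f"
 using ns_mono[of "{i}" A f f] by (simp add: ns_finite)

lemma ns_0 [simp]: "ns A (%i. 0) = 0" "ns {} f = 0"
 by (simp_all add: ns_def)

lemma ns_infsum: "infsum f A = ns A f"
proof -
 have "infsum f A = (SUP F\<in>{F. finite F & F <= A}. sum f F)"
 by (rule nonneg_infsum_complete) simp
 also have "... = ns A f"
 proof (rule antisym)
 show "(SUP F\<in>{F. finite F & F <= A}. sum f F) <= ns A f"
 by (rule SUP_least) (auto simp: ns_finite[symmetric] intro: ns_mono)
 have "(\<Sum>i<n. f i * indicator A i) <= (SUP F\<in>{F. finite F & F <= A}. sum f F)" for n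
 proof -
 have "(\<Sum>i<n. f i * indicator A i) = sum f ({..<n} Int A)"
 proof -
 have "(\<Sum>i<n. f i * indicator A i) = (\<Sum>i<n. if i : A then f i else 0)" by (intro sum.cong) (auto simp: indicator_def)
 then show ?thesis using sum.inter_restrict[of "{..<n}" f A] by simp
 qed
 then show ?thesis by (auto intro!: SUP_upper)
 qed
 then show "ns A f <= (SUP F\<in>{F. finite F & F <= A}. sum f F)"
 unfolding ns_suminf by (intro suminf_le_const) auto
 qed
 finally show ?thesis .
qed

lemma ns_tail:
 assumes "ns A f < iN" "e > 0"
 shows "EX F. finite F & ns (A - F) f < eN e"
proof -
 define r where "r i = enn2real (f i * indicator A i)" for i
 have fin: "(\<Sum>i. f i * indicator A i) < top" using assms by (simp add: ns_suminf)
 have r: "f i * indicator A i = eN (r i)" "0 <= r i" for i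
 using ennreal_suminf_lessD[OF fin, of i] unfolding r_def by auto
 have sr: "summable r" using fin r by (intro summable_suminf_not_top) auto
 obtain n where n: "norm (\<Sum>k. r (k + n)) < e"
 using suminf_exist_split[OF assms(2) sr] by blast
 have "ns (A - {..<n}) f = (\<Sum>i. f i * indicator (A - {..<n}) i)" by (rule ns_suminf)
 also have "... = (\<Sum>i. f (i+n) * indicator (A - {..<n}) (i+n)) + (\<Sum>i<n. f i * indicator (A - {..<n}) i)"
 by (rule suminf_offset) auto
 also have "(\<Sum>i<n. f i * indicator (A - {..<n}) i) = 0" by (intro sum.neutral) auto
 also have "(\<Sum>i. f (i+n) * indicator (A - {..<n}) (i+n)) = (\<Sum>i. eN (r (i+n)))"
 by (intro suminf_cong) (auto simp: r(1)[symmetric] split: split_indicator)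
 also have "... = eN (\<Sum>k. r (k + n))"
 using sr r by (intro suminf_ennreal2) (auto simp: summable_iff_shift)
 finally have "ns (A - {..<n}) f = eN (\<Sum>k. r (k + n))" by simp
 also have "... < eN e" using n assms by (intro ennreal_lessI) auto
 finally show ?thesis by blast
qed

lemma ns_suminf_swap: "ns A (%i. \<Sum>n. f n i) = (\<Sum>n. ns A (f n))"
 unfolding ns_def
 by (subst nn_integral_suminf[symmetric]) (auto simp: ennreal_suminf_multc)

lemma ns_Fatou: "ns A (%i. liminf (%n. f n i)) <= liminf (%n. ns A (f n))"
proof -
 have "ns A (%i. liminf (%n. f n i)) = (\<integral>\<^sup>+i. liminf (%n. f n i * indicator A i) \<partial>count_space UNIV)"
 unfolding ns_def by (intro nn_integral_cong) (auto simp: Liminf_const split: split_indicator)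
 also have "... <= liminf (%n. ns A (f n))"
 unfolding ns_def by (rule nn_integral_liminf) auto
 finally show ?thesis .
qed

lemma ns_dominated:
 assumes "ns A w < iN" "!!n i. i : A ==> f n i <= w i" "!!i. i : A ==> (%n. f n i) \<longlonglongrightarrow> 0"
 shows "(%n. ns A (f n)) \<longlonglongrightarrow> 0"
proof -
 have "(%n. ns A (f n)) \<longlonglongrightarrow> (\<integral>\<^sup>+i. 0 \<partial>count_space (UNIV::nat set))"
 unfolding ns_def
 proof (rule nn_integral_dominated_convergence)
 show "(\<integral>\<^sup>+i. w i * indicator A i \<partial>count_space UNIV) < iN" using assms(1) by (simp add: ns_def)
 show "AE i in count_space UNIV. f n i * indicator A i <= w i * indicator A i" for n
 using assms(2) by (auto split: split_indicator)
 show "AE i in count_space UNIV. (%n. f n i * indicator A i) \<longlonglongrightarrow> 0"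
 using assms(3) by (auto simp: AE_count_space split: split_indicator)
 qed auto
 then show ?thesis by simp
qed

section \<open>The maximum norm and its squares\<close>

definition ninf :: "complex => real" where "ninf z = max (abs(Re z)) (abs(Im z))"

lemma ninf_le_norm: "ninf z <= norm z"
 unfolding ninf_def by (simp add: abs_Re_le_cmod abs_Im_le_cmod)

lemma norm_le_ninf: "norm z <= 2 * ninf z"
 unfolding ninf_def using cmod_le[of z] by linarith

lemma ninf_nonneg [simp]: "0 <= ninf z" by (simp add: ninf_def)

lemma ninf_eq_0 [simp]: "ninf z = 0 \<longleftrightarrow> z = 0"
 using norm_le_ninf[of z] ninf_le_norm[of z] by (auto simp: ninf_def complex_eq_iff)

lemma ninf_triangle: "ninf (a + b) <= ninf a + ninf b"
 unfolding ninf_def by auto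

lemma ninf_minus: "ninf (- a) = ninf a" "ninf (a - b) = ninf (b - a)"
 unfolding ninf_def by auto

lemma ninf_diff_le: "(abs(ninf (a - x) - ninf (b - x))) <= dist a b"
proof -
 have "ninf (a - x) <= ninf (b - x) + ninf (a - b)" "ninf (b - x) <= ninf (a - x) + ninf (b - a)"
 using ninf_triangle[of "b - x" "a - b"] ninf_triangle[of "a - x" "b - a"] by auto
 then show ?thesis using ninf_le_norm[of "a - b"] by (simp add: ninf_minus(2)[of b a] dist_norm)
qed

lemma continuous_on_ninf [continuous_intros]: "continuous_on A f ==> continuous_on A (%x. ninf (f x))"
 unfolding ninf_def by (intro continuous_intros)

lemma ninf_scale: "ninf (of_real c * z) = (abs(c)) * ninf z"
 unfolding ninf_def by (simp add: abs_mult max_mult_distrib_left)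

text \<open>Squares are used because their boundaries consist of four horizontal and vertical
  segments, the curves for which generic behaviour is established below.\<close>

definition sqr :: "complex => real => complex set" where "sqr x s = {z. ninf (z - x) < s}"
definition csqr :: "complex => real => complex set" where "csqr x s = {z. ninf (z - x) <= s}"

lemma open_sqr [simp]: "open (sqr x s)"
 unfolding sqr_def by (intro open_Collect_less continuous_intros)

lemma csqr_subset_cball: "csqr x s <= cball x (2 * s)"
proof
 fix z assume "z : csqr x s"
 then show "z : cball x (2 * s)"
 using norm_le_ninf[of "z - x"] by (auto simp: csqr_def dist_norm norm_minus_commute)
qed

lemma compact_csqr [simp]: "compact (csqr x s)"
proof -
 have "closed (csqr x s)" unfolding csqr_def by (intro closed_Collect_le continuous_intros)
 then show ?thesis
 using csqr_subset_cball bounded_cball bounded_subset compact_eq_bounded_closed by metis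
qed

lemma ball_subset_sqr: "ball x s <= sqr x s"
proof
 fix z assume "z : ball x s"
 then show "z : sqr x s" using ninf_le_norm[of "z - x"]
 by (auto simp: sqr_def dist_norm norm_minus_commute)
qed

lemma sqr_subset_csqr: "sqr x s <= csqr x s" by (auto simp: sqr_def csqr_def)

text \<open>A grid of mesh \<open>t\<close> suffices: a cell has diameter at most
  \<open>2 * t\<close>, pi is bounded by 4, and the total is \<open>4 * (2 * s)^2\<close>.\<close>

lemma hausdorff_csqr:
 assumes s: "0 < s"
 shows "hausdorff 2 (csqr x s) <= eN (16 * s^2)"
 unfolding hausdorff_def
proof (rule SUP_least)
 fix dl :: real assume "dl : {0<..}" then have dl: "0 < dl" by simp
 obtain N :: nat where N: "4 * s / dl < N" using reals_Archimedean2 by blast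
 have N0: "0 < real N" using N s dl by (smt (verit) divide_pos_pos)
 define t where "t = 2 * s / N"
 have t: "0 < t" using N0 s by (simp add: t_def)
 have tdl: "2 * t <= dl" using N N0 dl by (simp add: t_def field_simps)
 define a b where "a = Re x - s" and "b = Im x - s"
 \<comment> \<open>Quotient and remainder of \<open>k\<close> number the cells; all later members of
   the cover are empty.\<close>
 define U where "U k = (if k < N * N then {z. a + real (k div N) * t <= Re z & Re z <= a + real (k div N) * t + t
 & b + real (k mod N) * t <= Im z & Im z <= b + real (k mod N) * t + t} else {})" for k
 have dist: "dist y z <= 2 * t" if "y : U k" "z : U k" for y z k
 proof -
 have "(abs(Re (y - z))) <= t" "(abs(Im (y - z))) <= t" using that by (auto simp: U_def split: if_splits)
 then show ?thesis using cmod_le[of "y - z"] by (simp add: dist_norm)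
 qed
 have bd: "bounded (U k)" for k
 proof (cases "U k = {}")
 case False then obtain y where "y : U k" by blast
 then show ?thesis using dist unfolding bounded_def by blast
 qed simp
 have di: "diameter (U k) <= 2 * t" for k
 using dist t by (intro diameter_le) (auto simp: dist_norm)
 have cov: "csqr x s <= (\<Union>k. U k)"
 proof
 fix z assume "z : csqr x s"
 then have z: "a <= Re z" "Re z <= a + 2 * s" "b <= Im z" "Im z <= b + 2 * s"
 by (auto simp: csqr_def ninf_def a_def b_def)
 have ex: "EX m<N. c + real m * t <= y & y <= c + real m * t + t" if "c <= y" "y <= c + 2 * s" for c y
 proof (cases "y = c + 2 * s")
 \<comment> \<open>The floor would give the right end the index \<open>N\<close>, so it is assigned
   to the last cell.\<close>
 case True
 then show ?thesis using N0 s by (intro exI[of _ "N - 1"]) (auto simp: t_def field_simps of_nat_diff)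
 next
 case False
 define m where "m = nat \<lfloor>(y - c) / t\<rfloor>"
 have 0: "0 <= (y - c) / t" using that t by simp
 have m: "real m <= (y - c) / t" "(y - c) / t < real m + 1" using 0 by (auto simp: m_def)
 have "(y - c) / t < 2 * s / t" using False that t by (intro divide_strict_right_mono) auto
 also have "2 * s / t = N" using N0 s by (simp add: t_def)
 finally have "(y - c) / t < N" .
 then have "m < N" using m by linarith
 then show ?thesis using m t by (intro exI[of _ m]) (auto simp: field_simps)
 qed
 obtain m where m: "m < N" "a + real m * t <= Re z" "Re z <= a + real m * t + t" using ex z by blast
 obtain n where n: "n < N" "b + real n * t <= Im z" "Im z <= b + real n * t + t" using ex z by blast
 have "m * N + n < Suc m * N" "Suc m * N <= N * N" using m n by (auto intro: mult_le_mono1 simp del: mult_Suc) simp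
 then have "m * N + n < N * N" by linarith
 then have "z : U (m * N + n)" using m n by (auto simp: U_def)
 then show "z : (\<Union>k. U k)" by blast
 qed
 have "hausdorff_pre 2 dl (csqr x s) <= (\<Sum>k. eN (unit_ball_vol (real 2) * (diameter (U k) / 2) ^ 2))"
 unfolding hausdorff_pre_def using cov bd di tdl
 by (intro INF_lower) (auto intro: order_trans)
 also have "... = (\<Sum>k<N*N. eN (unit_ball_vol (real 2) * (diameter (U k) / 2) ^ 2))"
 by (rule suminf_finite) (auto simp: U_def)
 also have "... <= (\<Sum>k<N*N. eN (4 * t^2))"
 proof (intro sum_mono ennreal_leI)
 fix k
 have "(diameter (U k) / 2)^2 <= t^2"
 using di[of k] by (intro power_mono) (auto simp: diameter_ge_0 bd)
 then have "pi * (diameter (U k) / 2)^2 <= 4 * t^2"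
 using pi_less_4 by (intro mult_mono) auto
 then show "unit_ball_vol (real 2) * (diameter (U k) / 2)^2 <= 4 * t^2"
 by (simp add: unit_ball_vol_2)
 qed
 also have "... = eN (real (N * N) * (4 * t^2))"
 using ennreal_of_nat_eq_real_of_nat by (simp flip: ennreal_mult' add: ennreal_of_nat_eq_real_of_nat)
 also have "real (N * N) * (4 * t^2) = 16 * s^2"
 using N0 by (simp add: t_def field_simps power2_eq_square)
 finally show "hausdorff_pre 2 dl (csqr x s) <= eN (16 * s^2)" .
qed

section \<open>Geometry of the peripheral disks\<close>

locale rel_carpet =
 fixes Om :: "complex set" and Q :: "nat => complex set" and ver :: version
 assumes car: "relative_sierpinski_carpet Om Q" and standing: "standing_assumptions Om Q"
begin

abbreviation "S == carpet Om Q"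
abbreviation "I == meeting Q"

abbreviation "nI X == ns (I X)"

lemma I_mono: "A <= B ==> I A <= I B" by (auto simp: meeting_def)

lemma I_Un: "I (A Un B) = I A Un I B" by (auto simp: meeting_def)

lemma open_Om [simp]: "open Om" and connected_Om: "connected Om"
 and Q_disjoint: "i ~= j ==> closure (Q i) Int closure (Q j) = {}"
 and interior_S: "interior S = {}"
 using car by (auto simp: relative_sierpinski_carpet_def)

abbreviation "cQ i == closure (Q i)"

text \<open>What is used of the Jordan curve theorem: a disk and the complement of its closure are
  the two sides of one closed curve, so both are connected and have that curve as frontier.\<close>

lemma Q_jordan: "EX c. simple_path c & pathfinish c = pathstart c & Q i = inside (path_image c)
 & frontier (Q i) = path_image c & - cQ i = outside (path_image c)"
proof -
 obtain c where c: "simple_path c" "pathfinish c = pathstart c" "Q i = inside (path_image c)"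
 using car unfolding relative_sierpinski_carpet_def jordan_region_def by meson
 have f: "frontier (inside (path_image c)) = path_image c" using Jordan_inside_outside[OF c(1,2)] by simp
 have "(cQ i) = Q i Un path_image c" using closure_Un_frontier[of "Q i"] f c(3) by simp
 then have "- cQ i = outside (path_image c)" using c(3) by (simp add: union_with_inside Un_commute)
 then show ?thesis using c f by auto
qed

lemma open_Q [simp]: "open (Q i)" and connected_Q: "connected (Q i)" and Q_ne: "Q i ~= {}"
 and bounded_Q [simp]: "bounded (Q i)"
proof -
 obtain c where c: "simple_path c" "pathfinish c = pathstart c" "Q i = inside (path_image c)"
 using Q_jordan by blast
 show "open (Q i)" "connected (Q i)" "Q i ~= {}" "bounded (Q i)"
 using Jordan_inside_outside[OF c(1,2)] c(3) by auto
qed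

lemma cQ_sub: "cQ i <= Om" and compact_cQ [simp]: "compact (cQ i)"
 using car by (auto simp: relative_sierpinski_carpet_def ccontained_def)

lemma connected_compl_closure_Q: "connected (- cQ i)"
 using Q_jordan[of i] Jordan_inside_outside by metis

lemma S_sub: "S <= Om" by (auto simp: carpet_def)

lemma S_Q: "z : S ==> z ~: Q i" by (auto simp: carpet_def)

lemma in_Om: "z : Om ==> z : S | (EX i. z : Q i)" by (auto simp: carpet_def)

lemma fr_Q: "frontier (Q i) = (cQ i) - Q i" by (simp add: frontier_def interior_open)

lemma fr_S: "frontier (Q i) <= S"
proof
 fix z assume z: "z : frontier (Q i)"
 then have "z : Om" using cQ_sub fr_Q by blast
 moreover have "z ~: Q j" for j
 using z Q_disjoint[of i j] closure_subset[of "Q j"] by (cases "i = j") (auto simp: fr_Q)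
 ultimately show "z : S" by (auto simp: carpet_def)
qed

lemma fr_ne: "frontier (Q i) ~= {}"
 using Q_ne[of i] bounded_Q[of i] by (metis frontier_eq_empty not_bounded_UNIV)

lemma compact_fr: "compact (frontier (Q i))"
 by (simp add: compact_frontier_bounded)

lemma cQ_S: "z : S ==> z : cQ i ==> z : frontier (Q i)"
 using S_Q fr_Q by blast

lemma fr_unique: "z : frontier (Q i) ==> z : cQ j ==> i = j"
 using Q_disjoint[of i j] fr_Q by blast

lemma Q_unique: "z : Q i ==> z : cQ j ==> i = j"
 using Q_disjoint[of i j] closure_subset[of "Q i"] by blast

lemma cross: "connected X ==> i : I X ==> X Int S ~= {} ==> X Int frontier (Q i) ~= {}"
 using S_Q by (intro connected_Int_frontier) (auto simp: meeting_def)

lemma open_meets_Q: "open U ==> U ~= {} ==> U <= Om ==> I U ~= {}"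
proof -
 assume U: "open U" "U ~= {}" "U <= Om"
 have "~ U <= S" using interior_maximal[of U S] U interior_S by auto
 then show ?thesis using U(3) by (auto simp: carpet_def meeting_def)
qed

lemma open_I_closure: "open U ==> cQ i Int U ~= {} ==> i : I U"
 unfolding meeting_def using open_Int_closure_eq_empty[of U "Q i"] by blast

section \<open>Diameters and packing of the disks\<close>

abbreviation "dm i == diameter (Q i)"

lemma dm_nonneg: "0 <= dm i" by (simp add: diameter_ge_0)

lemma dm_pos: "0 < dm i"
proof -
 obtain z e where z: "z : Q i" "0 < e" "ball z e <= Q i" using Q_ne open_Q open_contains_ball by blast
 have "dist z (z + of_real (e/2)) <= dm i"
 using z by (intro diameter_bounded_bound) (auto simp: dist_norm subset_iff)
 then show ?thesis using z by (simp add: dist_norm)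
qed

lemma closure_dist: "x : cQ i ==> y : cQ i ==> dist x y <= dm i"
 using diameter_bounded_bound[of "(cQ i)" x y] diameter_closure[of "Q i"] by (simp add: bounded_closure)

text \<open>Packing: fatness gives each of the disjoint sets \<open>A i\<close> an area comparable
  to its summand, and they all lie in a square of half side \<open>3 * s\<close>. Truncation at
  \<open>s\<close> keeps large disks from spoiling the bound.\<close>

lemma sum_min_diam: "EX C>0. ALL x s. 0 < s --> nI (csqr x (2 * s)) (%i. eN ((min (dm i) s)^2)) <= eN (C * s^2)"
proof -
 obtain K where K: "K > 0" "!!i x r. x : Q i ==> 0 < r ==> r < dm i ==> hausdorff 2 (ball x r Int Q i) >= eN (K * r\<^sup>2)"
 using standing unfolding standing_assumptions_def by meson
 have "nI (csqr x (2 * s)) (%i. eN ((min (dm i) s)^2)) <= eN (576 / K * s^2)" if s: "0 < s" for x s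
 proof -
 let ?J = "I (csqr x (2 * s))"
 have "ALL i:?J. EX z. z : Q i Int csqr x (2 * s)" by (auto simp: meeting_def)
 then obtain z where z: "!!i. i : ?J ==> z i : Q i & z i : csqr x (2 * s)" by (metis IntE bchoice)
 \<comment> \<open>Half of the minimum, because fatness is given for radii strictly below the
   diameter.\<close>
 define r where "r i = min (dm i) s / 2" for i
 have r: "0 < r i" "r i < dm i" "r i <= s" for i
 using dm_pos[of i] s by (auto simp: r_def min_def)
 define A where "A i = (if i : ?J then ball (z i) (r i) Int Q i else {})" for i
 let ?M = "hausdorff_measure 2 :: complex measure"
 have sets: "sets ?M = sets borel" by (simp add: hausdorff_measure_def sets.sigma_sets_eq[of borel, simplified] sets_measure_of_conv)
 have Ab: "A i : sets borel" for i by (auto simp: A_def)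
 have "disjoint_family A"
 proof (unfold disjoint_family_on_def, safe)
 fix i j y assume "i ~= j" "y : A i" "y : A j"
 then show "y : {}" using Q_unique[of y i j] closure_subset[of "Q j"] by (auto simp: A_def split: if_splits)
 qed
 then have su: "(\<Sum>i. emeasure ?M (A i)) = emeasure ?M (\<Union>i. A i)"
 using Ab sets by (intro suminf_emeasure) auto
 have sub: "(\<Union>i. A i) <= csqr x (3 * s)"
 proof
 fix y assume "y : (\<Union>i. A i)"
 then obtain i where i: "i : ?J" "y : ball (z i) (r i)" by (auto simp: A_def split: if_splits)
 then show "y : csqr x (3 * s)" using z[OF i(1)] r(3)[of i] ninf_diff_le[of y x "z i"]
 by (auto simp: csqr_def dist_commute)
 qed
 have "ns ?J (%i. ennreal K * eN ((r i)^2)) <= (\<Sum>i. emeasure ?M (A i))"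
 unfolding ns_suminf
 proof (intro suminf_le allI)
 fix i show "ennreal K * eN ((r i)^2) * indicator ?J i <= emeasure ?M (A i)"
 using K(2)[of "z i" i "r i"] z[of i] r[of i] K(1)
 by (auto simp: A_def emeasure_hausdorff_measure ennreal_mult' split: split_indicator)
 qed auto
 also have "... <= hausdorff 2 (csqr x (3 * s))"
 unfolding su using Ab by (subst emeasure_hausdorff_measure) (auto intro!: hausdorff_mono sub[simplified])
 also have "... <= eN (16 * (3 * s)^2)" using s by (intro hausdorff_csqr) auto
 finally have *: "ennreal K * ns ?J (%i. eN ((r i)^2)) <= eN (144 * s^2)"
 by (simp add: ns_cmult power2_eq_square algebra_simps)
 have "ns ?J (%i. eN ((min (dm i) s)^2)) = ns ?J (%i. eN (4/K) * (ennreal K * eN ((r i)^2)))"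
 using K(1) by (intro ns_cong) (auto simp: r_def power2_eq_square simp flip: ennreal_mult')
 also have "... = eN (4/K) * (ennreal K * ns ?J (%i. eN ((r i)^2)))"
 by (simp only: ns_cmult)
 also have "... <= eN (4/K) * eN (144 * s^2)" by (intro mult_left_mono *) auto
 also have "... = eN (576 / K * s^2)" using K(1) by (simp flip: ennreal_mult')
 finally show ?thesis .
 qed
 then show ?thesis using K(1) by (intro exI[of _ "576 / K"]) auto
qed

lemma bounded_csqr: "bounded L ==> EX s>0. ALL t>=s. L <= csqr 0 t"
proof -
 assume "bounded L"
 then obtain B where B: "B > 0" "!!z. z : L ==> norm z <= B" using bounded_pos by blast
 then have "ninf z <= t" if "z : L" "B <= t" for z t using ninf_le_norm[of z] that by force
 then show ?thesis using B by (intro exI[of _ B]) (auto simp: csqr_def)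
qed

text \<open>Each such disk contributes at least \<open>d^2\<close> to the finite sum of
  \<open>sum_min_diam\<close> over a square that covers \<open>L\<close>.\<close>

lemma finite_large:
 assumes "bounded L" "0 < d"
 shows "finite {i : I L. d <= dm i}"
proof (rule ccontr)
 assume inf: "infinite {i : I L. d <= dm i}"
 obtain C where C: "C > 0" "!!x s. 0 < s ==> nI (csqr x (2 * s)) (%i. eN ((min (dm i) s)^2)) <= eN (C * s^2)"
 using sum_min_diam by blast
 obtain s0 where s0: "s0 > 0" "!!t. t >= s0 ==> L <= csqr 0 t" using bounded_csqr assms by blast
 define s where "s = max s0 d"
 have s: "0 < s" "d <= s" "L <= csqr 0 (2 * s)" using s0 assms by (auto simp: s_def)
 have "ns {i : I L. d <= dm i} (%i. eN (d^2)) <= nI (csqr 0 (2 * s)) (%i. eN ((min (dm i) s)^2))"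
 using s assms by (intro ns_mono) (auto simp: meeting_def intro!: power_mono ennreal_leI)
 also have "... < iN" using C(2)[of s 0] s by (auto intro: le_less_trans)
 finally have "ns {i : I L. d <= dm i} (%i. eN (d^2)) < iN" .
 moreover have "ns {i : I L. d <= dm i} (%i. eN (d^2)) = eN (d^2) * iN"
 unfolding ns_def using inf by (simp add: nn_integral_cmult)
 ultimately show False using assms(2) by (simp add: ennreal_mult_top)
qed

lemma bounded_dm: "bounded L ==> EX D>0. ALL i:I L. dm i <= D"
proof -
 assume "bounded L"
 from finite_large[OF this zero_less_one] have f: "finite (dm ` {i : I L. 1 <= dm i})" by simp
 show ?thesis
 proof (intro exI conjI ballI)
 show "0 < 1 + Max (insert 0 (dm ` {i : I L. 1 <= dm i}))" using f by (auto intro!: add_pos_nonneg)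
 fix i assume i: "i : I L"
 have 0: "0 <= Max (insert 0 (dm ` {i : I L. 1 <= dm i}))" using f by auto
 show "dm i <= 1 + Max (insert 0 (dm ` {i : I L. 1 <= dm i}))"
 proof (cases "1 <= dm i")
 case True
 then have "dm i <= Max (insert 0 (dm ` {i : I L. 1 <= dm i}))" using f i by (intro Max_ge) auto
 then show ?thesis by simp
 qed (use 0 in simp)
 qed
qed

text \<open>At a scale above all diameters the truncation in \<open>sum_min_diam\<close>
  disappears.\<close>

lemma sum_diam_sq: "bounded L ==> nI L (%i. eN ((dm i)^2)) < iN"
proof -
 assume L: "bounded L"
 obtain C where C: "C > 0" "!!x s. 0 < s ==> nI (csqr x (2 * s)) (%i. eN ((min (dm i) s)^2)) <= eN (C * s^2)"
 using sum_min_diam by blast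
 obtain s0 where s0: "s0 > 0" "!!t. t >= s0 ==> L <= csqr 0 t" using bounded_csqr L by blast
 obtain D where D: "D > 0" "!!i. i : I L ==> dm i <= D" using bounded_dm[OF L] by blast
 define s where "s = max s0 D"
 have s: "0 < s" "D <= s" "L <= csqr 0 (2 * s)" using s0 D by (auto simp: s_def)
 have "nI L (%i. eN ((dm i)^2)) <= nI (csqr 0 (2 * s)) (%i. eN ((min (dm i) s)^2))"
 using s D by (intro ns_mono I_mono) (auto intro!: ennreal_leI power_mono simp: min_def dm_nonneg dest!: D(2))
 also have "... < iN" using C(2)[of s 0] s by (auto intro: le_less_trans)
 finally show ?thesis .
qed

text \<open>Index sets \<open>I V\<close> are defined by disks while functions live on circles. A
  compact set that contains every closed disk touching \<open>L\<close> reconciles the two.\<close>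

lemma absorb:
 assumes "compact L" "L <= Om"
 shows "EX L'. compact L' & L' <= Om & L <= interior L' & (ALL i. cQ i Int L ~= {} --> cQ i <= interior L')"
proof -
 obtain e where e: "e > 0" "(\<Union>x\<in>L. ball x e) <= Om"
 using compact_subset_open_imp_ball_epsilon_subset[OF assms(1) open_Om assms(2)] by blast
 define E where "E = (\<Union>x\<in>L. ball x (e/2))"
 have Eb: "bounded E" unfolding E_def
 by (rule bounded_subset[OF compact_imp_bounded[OF compact_minkowski_sum_cball[OF assms(1), of "e/2"]]]) auto
 define F where "F = {i : I E. e/2 <= dm i}"
 have F: "finite F" unfolding F_def using Eb e by (intro finite_large) auto
 define L1 where "L1 = (\<Union>x\<in>L. cball x (e/2)) Un (\<Union>i\<in>F. (cQ i))"
 have L1: "compact L1" unfolding L1_def using F assms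
 by (intro compact_Un compact_minkowski_sum_cball compact_UN) auto
 have L1s: "L1 <= Om" unfolding L1_def using e cQ_sub by (fastforce simp: subset_iff)
 obtain d where d: "d > 0" "(\<Union>x\<in>L1. ball x d) <= Om"
 using compact_subset_open_imp_ball_epsilon_subset[OF L1 open_Om L1s] by blast
 define L2 where "L2 = (\<Union>x\<in>L1. cball x (d/2))"
 have op: "open (\<Union>x\<in>L1. ball x (d/2))" by auto
 have sub: "L1 <= interior L2"
 using d by (intro order_trans[OF _ interior_maximal[OF _ op]]) (auto simp: L2_def)
 have "cQ i <= L1" if i: "cQ i Int L ~= {}" for i
 proof -
 obtain z where z: "z : L" "z : cQ i" using i by blast
 have "z : E" using e z by (auto simp: E_def intro!: bexI[of _ z])
 moreover have "open E" unfolding E_def by auto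
 ultimately have iE: "i : I E" using z open_I_closure[of E i] by blast
 show ?thesis
 proof (cases "e/2 <= dm i")
 case True then show ?thesis using iE by (auto simp: L1_def F_def)
 next
 case False
 then show ?thesis using closure_dist[OF z(2)] z(1) by (force simp: L1_def)
 qed
 qed
 moreover have "L <= L1" using e by (auto simp: L1_def)
 moreover have "compact L2" unfolding L2_def by (rule compact_minkowski_sum_cball[OF L1])
 moreover have "L2 <= Om" using d unfolding L2_def by (fastforce simp: subset_iff)
 ultimately show ?thesis using sub by (intro exI[of _ L2]) blast
qed

end

section \<open>Upper gradients and exceptional path families\<close>

definition osci :: "(nat => complex set) => (complex => real) => nat => real" where
 "osci Q f i = (SUP x\<in>frontier (Q i). f x) - (INF x\<in>frontier (Q i). f x)"

context rel_carpet begin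

abbreviation "fr i == frontier (Q i)"
abbreviation "Os == osci Q"

abbreviation "Oe f == %i. eN (Os f i)"
abbreviation "O2 f == %i. (eN (Os f i))^2"

definition fb :: "(complex => real) => bool" where "fb f \<longleftrightarrow> (ALL i. bounded (f ` fr i))"

abbreviation "Ms f i == (SUP x\<in>fr i. f x :: real)"
abbreviation "ms f i == (INF x\<in>fr i. f x :: real)"

lemma fb_bdd: "fb f ==> bdd_above (f ` fr i)" "fb f ==> bdd_below (f ` fr i)"
 by (auto simp: fb_def bounded_imp_bdd_above bounded_imp_bdd_below)

lemma Ms_upper: "fb f ==> x : fr i ==> f x <= Ms f i"
 and ms_lower: "fb f ==> x : fr i ==> ms f i <= f x"
 by (auto intro!: cSUP_upper cINF_lower fb_bdd)

lemma Ms_least: "(!!x. x : fr i ==> f x <= c) ==> Ms f i <= c"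
 and ms_greatest: "(!!x. x : fr i ==> c <= f x) ==> c <= ms f i"
 using fr_ne by (auto intro!: cSUP_least cINF_greatest)

lemma O_ge: "fb f ==> x : fr i ==> y : fr i ==> (abs(f x - f y)) <= Os f i"
 using Ms_upper[of f x i] ms_lower[of f y i] Ms_upper[of f y i] ms_lower[of f x i] unfolding osci_def by linarith

lemma O_nonneg: "fb f ==> 0 <= Os f i"
 using O_ge[of f _ i] fr_ne[of i] by fastforce

lemma Ms_approx: "fb f ==> e > 0 ==> EX x:fr i. Ms f i - e < f x"
 using less_cSUP_iff[of "fr i" f "Ms f i - e"] fr_ne fb_bdd by fastforce

lemma ms_approx: "fb f ==> e > 0 ==> EX x:fr i. f x < ms f i + e"
 using cINF_less_iff[of "fr i" f "ms f i + e"] fr_ne fb_bdd by fastforce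

lemma O_le: assumes "fb f" "!!x y. x : fr i ==> y : fr i ==> f x - f y <= c" shows "Os f i <= c"
proof (rule field_le_epsilon)
 fix e :: real assume "0 < e"
 then obtain x y where "x : fr i" "Ms f i - e/2 < f x" "y : fr i" "f y < ms f i + e/2"
 using Ms_approx[OF assms(1), of "e/2" i] ms_approx[OF assms(1), of "e/2" i] by auto
 then show "Os f i <= c + e" using assms(2)[of x y] by (simp add: osci_def)
qed

lemma fb_const: "fb (%x. c)" unfolding fb_def bounded_iff by (auto intro: exI[of _ "(abs(c))"])

lemma fb_bounded: "(!!x. x : S ==> (abs(f x)) <= C) ==> fb f"
 unfolding fb_def bounded_iff using fr_S by fastforce

lemma fb_add: "fb f ==> fb g ==> fb (%x. f x + g x)"
 unfolding fb_def by (auto intro!: bounded_plus_comp)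

lemma fb_uminus: "fb f ==> fb (%x. - f x)"
 unfolding fb_def by (auto intro!: simp: bounded_iff)

lemma peri_sup_eq: assumes "fb f" shows "peri_sup Q (%x. ereal (f x)) i = ereal (Ms f i)"
 and "peri_inf Q (%x. ereal (f x)) i = ereal (ms f i)"
proof -
 obtain C where C: "!!x. x : fr i ==> (abs(f x)) <= C" using assms unfolding fb_def bounded_iff by fastforce
 have 1: "ALL x:fr i. ereal (-C) <= ereal (f x) & ereal (f x) <= ereal C" using C by force
 show "peri_sup Q (%x. ereal (f x)) i = ereal (Ms f i)" unfolding peri_sup_def
 using fr_ne 1 by (intro ereal_SUP[symmetric] ereal_SUP_not_infty[of _ "ereal (-C)" "ereal C"]) auto
 show "peri_inf Q (%x. ereal (f x)) i = ereal (ms f i)" unfolding peri_inf_def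
 using fr_ne 1 by (intro ereal_INF[symmetric] ereal_INF_not_infty[of _ "ereal (-C)" "ereal C"]) auto
qed

lemma osc_eq: assumes "fb f" shows "osc Q (%x. ereal (f x)) i = Oe f i"
 by (simp add: osc_def peri_sup_eq[OF assms] osci_def e2ennreal_ereal)

text \<open>Finite extremes force finite values on the circles, so \<open>real_of_ereal\<close>
  loses nothing there; elsewhere on the carpet its value may still be a default at this
  stage.\<close>

lemma peri_finite_real:
 assumes "!!i. (abs(peri_sup Q g i)) ~= iN & (abs(peri_inf Q g i)) ~= iN"
 shows "fb (%x. real_of_ereal (g x))" "x : fr i ==> g x = ereal (real_of_ereal (g x))"
 "peri_sup Q g i = ereal (Ms (%x. real_of_ereal (g x)) i)" "osc Q g i = Oe (%x. real_of_ereal (g x)) i"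
 "peri_inf Q g i = ereal (ms (%x. real_of_ereal (g x)) i)"
proof -
 have *: "peri_inf Q g i <= g x & g x <= peri_sup Q g i" if "x : fr i" for x i
 using that by (auto simp: peri_sup_def peri_inf_def intro: SUP_upper INF_lower)
 have fin: "(abs(g x)) ~= iN" if "x : fr i" for x i
 using *[OF that] assms[of i] by auto
 show "x : fr i ==> g x = ereal (real_of_ereal (g x))" using fin[of x i] by (auto simp: ereal_real)
 show f: "fb (%x. real_of_ereal (g x))" unfolding fb_def bounded_iff
 proof (intro allI)
 fix i
 obtain a b where ab: "peri_inf Q g i = ereal a" "peri_sup Q g i = ereal b" using assms[of i] by (cases "peri_inf Q g i"; cases "peri_sup Q g i") auto
 show "EX C. ALL y:(%x. real_of_ereal (g x)) ` fr i. norm y <= C"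
 proof (intro exI ballI, clarify)
 fix x assume x: "x : fr i"
 have "g x = ereal (real_of_ereal (g x))" using fin[OF x] by (auto simp: ereal_real)
 then have "a <= real_of_ereal (g x)" "real_of_ereal (g x) <= b" using *[OF x] ab by (metis ereal_less_eq(3))+
 then show "norm (real_of_ereal (g x)) <= max (abs(a)) (abs(b))" unfolding real_norm_def by linarith
 qed
 qed
 have e: "peri_sup Q g i = peri_sup Q (%x. ereal (real_of_ereal (g x))) i"
 "peri_inf Q g i = peri_inf Q (%x. ereal (real_of_ereal (g x))) i" for i
 using fin[of _ i] by (auto simp: peri_sup_def peri_inf_def ereal_real intro!: SUP_cong INF_cong)
 show "peri_sup Q g i = ereal (Ms (%x. real_of_ereal (g x)) i)" "peri_inf Q g i = ereal (ms (%x. real_of_ereal (g x)) i)"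
 unfolding e using peri_sup_eq[OF f] by auto
 show "osc Q g i = Oe (%x. real_of_ereal (g x)) i"
 using osc_eq[OF f] by (simp add: osc_def e[symmetric])
qed

text \<open>The families that an admissible weight may ignore. With this notion both versions of the
  modulus share all later arguments.\<close>

definition null1 :: "plane_path set => bool" where
 "null1 Gm \<longleftrightarrow> (case ver of Weak => mod2 Gm = 0 | Strong => (ALL gm:Gm. hausdorff 1 (img gm Int S) ~= 0))"

lemma null1_Weak: "ver = Weak ==> null1 Gm \<longleftrightarrow> mod2 Gm = 0"
 and null1_Strong: "ver = Strong ==> null1 Gm \<longleftrightarrow> (ALL gm:Gm. hausdorff 1 (img gm Int S) ~= 0)"
 unfolding null1_def by simp_all

lemma mod2_0_iff: "mod2 Gm = 0 \<longleftrightarrow> (ALL e>0. EX w:borel_measurable borel. (ALL gm:Gm. line_integral w gm >= 1) &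
 (\<integral>\<^sup>+z. (w z)^2 \<partial>hausdorff_measure 2) < eN e)"
proof
 assume "mod2 Gm = 0"
 then show "ALL e>0. EX w:borel_measurable borel. (ALL gm:Gm. line_integral w gm >= 1) &
 (\<integral>\<^sup>+z. (w z)^2 \<partial>hausdorff_measure 2) < eN e"
 proof (intro allI impI)
 fix e :: real assume "e > 0"
 then have "mod2 Gm < eN e" using \<open>mod2 Gm = 0\<close> by simp
 then show "EX w:borel_measurable borel. (ALL gm:Gm. line_integral w gm >= 1) & (\<integral>\<^sup>+z. (w z)^2 \<partial>hausdorff_measure 2) < eN e"
 unfolding mod2_def INF_less_iff by blast
 qed
next
 assume a: "ALL e>0. EX w:borel_measurable borel. (ALL gm:Gm. line_integral w gm >= 1) &
 (\<integral>\<^sup>+z. (w z)^2 \<partial>hausdorff_measure 2) < eN e"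
 have "mod2 Gm <= 0 + eN e" if e: "e > 0" for e
 proof -
 obtain w where "w\<in>borel_measurable borel" "ALL gm:Gm. line_integral w gm >= 1" "(\<integral>\<^sup>+z. (w z)^2 \<partial>hausdorff_measure 2) < eN e"
 using a e by blast
 then show ?thesis unfolding mod2_def by (intro INF_lower2[of w]) auto
 qed
 then have "mod2 Gm <= 0" by (rule ennreal_le_epsilon)
 then show "mod2 Gm = 0" by simp
qed

text \<open>Taking the supremum of countably many weights instead of their sum proves countable
  subadditivity of vanishing moduli without the triangle inequality in L2.\<close>

lemma SUP_square: "(SUP n. f n :: ennreal)^2 <= (\<Sum>n. (f n)^2)"
proof -
 have "(SUP n. f n)^2 = (SUP n. SUP m. f n * f m)"
 by (simp add: power2_eq_square SUP_mult_left_ennreal SUP_mult_right_ennreal) (rule SUP_commute)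
 also have "... <= (\<Sum>n. (f n)^2)"
 proof (intro SUP_least)
 fix n m
 have s: "(f k)^2 <= (\<Sum>n. (f n)^2)" for k
 using sum_le_suminf[of "%n. (f n)^2" "{k}"] by simp
 show "f n * f m <= (\<Sum>n. (f n)^2)"
 proof (cases "f n <= f m")
 case True then have "f n * f m <= (f m)^2" by (simp add: power2_eq_square mult_right_mono)
 then show ?thesis using s order_trans by blast
 next
 case False then have "f n * f m <= (f n)^2" by (simp add: power2_eq_square mult_left_mono)
 then show ?thesis using s order_trans by blast
 qed
 qed
 finally show ?thesis .
qed

lemma eps_sum: "(e::real) > 0 ==> (!!n. a n <= eN (e * (1/2)^Suc n)) ==> (\<Sum>n. a n) <= eN e"
proof -
 assume e: "e > 0" "!!n. a n <= eN (e * (1/2)^Suc n)"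
 have "(\<Sum>n. a n) <= (\<Sum>n. eN (e * (1/2)^Suc n))" by (intro suminf_le e) auto
 also have "... = eN e"
 using e(1) sums_mult[OF power_half_series, of e] by (intro suminf_ennreal_eq) auto
 finally show ?thesis .
qed

lemma line_integral_mono: "(!!z. w z <= w' z) ==> line_integral w gm <= line_integral w' gm"
 unfolding line_integral_def by (auto intro!: SUP_mono' nn_integral_mono mult_right_mono)

lemma mod2_UN: assumes "!!n::nat. mod2 (Gm n) = 0" shows "mod2 (\<Union>n. Gm n) = 0"
 unfolding mod2_0_iff
proof (intro allI impI)
 fix e :: real assume e: "0 < e"
 \<comment> \<open>Half of \<open>e\<close>: summation gives a weak inequality, while the criterion
   asks for a strict one.\<close>
 have "EX w:borel_measurable borel. (ALL gm:Gm n. line_integral w gm >= 1) &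
 (\<integral>\<^sup>+z. (w z)^2 \<partial>hausdorff_measure 2) < eN (e/2 * (1/2)^Suc n)" for n
 using assms[of n] e unfolding mod2_0_iff by (metis half_gt_zero zero_less_power mult_pos_pos zero_less_divide_1_iff zero_less_numeral)
 then obtain w where w: "!!n. w n : borel_measurable borel" "!!n gm. gm : Gm n ==> line_integral (w n) gm >= 1"
 "!!n. (\<integral>\<^sup>+z. (w n z)^2 \<partial>hausdorff_measure 2) < eN (e/2 * (1/2)^Suc n)" by metis
 have sets: "sets (hausdorff_measure 2 :: complex measure) = sets borel"
 by (simp add: hausdorff_measure_def sets.sigma_sets_eq[of borel, simplified] sets_measure_of_conv)
 have wm [measurable]: "w n : borel_measurable (hausdorff_measure 2)" for n
 using w(1)[of n] measurable_cong_sets[OF sets refl] by blast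
 show "EX w:borel_measurable borel. (ALL gm:\<Union>n. Gm n. line_integral w gm >= 1) & (\<integral>\<^sup>+z. (w z)^2 \<partial>hausdorff_measure 2) < eN e"
 proof (intro bexI conjI ballI)
 show "(%z. SUP n. w n z) : borel_measurable borel" using w(1) by measurable
 show "line_integral (%z. SUP n. w n z) gm >= 1" if "gm : (\<Union>n. Gm n)" for gm
 proof -
 obtain n where "gm : Gm n" using \<open>gm : (\<Union>n. Gm n)\<close> by blast
 then have "1 <= line_integral (w n) gm" by (rule w(2))
 also have "... <= line_integral (%z. SUP n. w n z) gm" by (intro line_integral_mono SUP_upper) simp
 finally show ?thesis .
 qed
 have "(\<integral>\<^sup>+z. (SUP n. w n z)^2 \<partial>hausdorff_measure 2) <= (\<integral>\<^sup>+z. (\<Sum>n. (w n z)^2) \<partial>hausdorff_measure 2)"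
 by (intro nn_integral_mono SUP_square)
 also have "... = (\<Sum>n. \<integral>\<^sup>+z. (w n z)^2 \<partial>hausdorff_measure 2)" by (intro nn_integral_suminf) measurable
 also have "... <= eN (e/2)" using e w(3) by (intro eps_sum) (auto intro: less_imp_le)
 also have "... < eN e" using e by (intro ennreal_lessI) auto
 finally show "(\<integral>\<^sup>+z. (SUP n. w n z)^2 \<partial>hausdorff_measure 2) < eN e" .
 qed
qed

lemma null1_UN: "(!!n::nat. null1 (Gm n)) ==> null1 (\<Union>n. Gm n)"
 unfolding null1_def by (cases ver) (auto simp: mod2_UN)

lemma null1_subset: "null1 Gm ==> Gm' <= Gm ==> null1 Gm'"
proof (cases ver)
 case Weak
 assume a: "null1 Gm" "Gm' <= Gm"
 show "null1 Gm'" using a unfolding null1_Weak[OF Weak] mod2_0_iff by (metis subsetD)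
next
 case Strong
 assume a: "null1 Gm" "Gm' <= Gm"
 then show "null1 Gm'" unfolding null1_Strong[OF Strong] by blast
qed

lemma null1_empty: "null1 {}"
 unfolding null1_def by (cases ver) (auto simp: mod2_0_iff intro!: exI[of _ "%_. 0"] bexI[of _ "%_. 0"])

section \<open>Vanishing modulus and almost every path\<close>

abbreviation "cmod0 Gm == carpet_mod ver Om Q Gm = 0"

text \<open>One criterion for both versions: in the strong case the paths of positive length in the
  carpet are collected into the ignored family.\<close>

lemma cmod0_iff: "cmod0 Gm \<longleftrightarrow> (ALL e>0. EX rh Gm0. null1 Gm0 & (ALL gm:Gm - Gm0. nI (img gm) rh >= 1) & ns UNIV (%i. (rh i)^2) < eN e)"
 (is "_ = ?R")
proof -
 let ?P = "%rh. \<exists>Gm0. null1 Gm0 & (ALL gm:Gm - Gm0. nI (img gm) rh >= 1)"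
 have eq: "carpet_mod ver Om Q Gm = (INF rh\<in>{rh. ?P rh}. ns UNIV (%i. (rh i)^2))"
 proof (cases ver)
 case Weak
 have "(\<exists>Gm0\<subseteq>Gm. mod2 Gm0 = 0 & (ALL gm:Gm - Gm0. 1 <= sum_along Q gm rh)) \<longleftrightarrow> ?P rh" for rh
 proof
 assume "?P rh"
 then obtain Gm0 where "null1 Gm0" "ALL gm:Gm - Gm0. nI (img gm) rh >= 1" by blast
 then show "\<exists>Gm0\<subseteq>Gm. mod2 Gm0 = 0 & (ALL gm:Gm - Gm0. 1 <= sum_along Q gm rh)"
 using null1_subset[of Gm0 "Gm0 Int Gm"] null1_Weak[OF Weak]
 by (intro exI[of _ "Gm0 Int Gm"]) (auto simp: sum_along_def ns_infsum)
 qed (use null1_Weak[OF Weak] in \<open>auto simp: sum_along_def ns_infsum\<close>)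
 then show ?thesis using Weak by (simp add: mod_weak_def ns_infsum)
 next
 case Strong
 have "(ALL gm:Gm. hausdorff 1 (img gm Int S) = 0 --> 1 <= sum_along Q gm rh) \<longleftrightarrow> ?P rh" for rh
 unfolding null1_Strong[OF Strong] sum_along_def ns_infsum
 by (rule iffI, rule exI[of _ "{gm. hausdorff 1 (img gm Int S) ~= 0}"]) auto
 then show ?thesis using Strong by (simp add: mod_strong_def ns_infsum)
 qed
 show ?thesis
 proof
 assume "cmod0 Gm"
 then have 0: "(INF rh\<in>{rh. ?P rh}. ns UNIV (%i. (rh i)^2)) = 0" using eq by simp
 show ?R
 proof (intro allI impI)
 fix e :: real assume "e > 0"
 then have "(INF rh\<in>{rh. ?P rh}. ns UNIV (%i. (rh i)^2)) < eN e" using 0 by simp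
 then show "EX rh Gm0. null1 Gm0 & (ALL gm:Gm - Gm0. nI (img gm) rh >= 1) & ns UNIV (%i. (rh i)^2) < eN e"
 unfolding INF_less_iff by blast
 qed
 next
 assume a: ?R
 have "(INF rh\<in>{rh. ?P rh}. ns UNIV (%i. (rh i)^2)) <= 0 + eN e" if e: "e > 0" for e
 proof -
 have "EX rh. ?P rh & ns UNIV (%i. (rh i)^2) < eN e"
 using a[rule_format, OF e] by (elim exE conjE) (intro exI conjI)
 then obtain rh where r: "?P rh" and r2: "ns UNIV (%i. (rh i)^2) < eN e" by (erule_tac exE, erule_tac conjE) (rule that; assumption)
 have "(INF rh\<in>{rh. ?P rh}. ns UNIV (%i. (rh i)^2)) <= ns UNIV (%i. (rh i)^2)"
 by (rule INF_lower) (use r in simp)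
 then show ?thesis using r2 by simp
 qed
 then have "carpet_mod ver Om Q Gm <= 0" unfolding eq by (rule ennreal_le_epsilon)
 then show "cmod0 Gm" by simp
 qed
qed

lemma cmod0E:
 assumes "cmod0 Gm" "e > 0"
 obtains rh Gm0 where "null1 Gm0" "!!gm. gm : Gm ==> gm ~: Gm0 ==> nI (img gm) rh >= 1" "ns UNIV (%i. (rh i)^2) < eN e"
proof -
 obtain rh Gm0 where "null1 Gm0" "ALL gm:Gm - Gm0. nI (img gm) rh >= 1" "ns UNIV (%i. (rh i)^2) < eN e"
 using assms unfolding cmod0_iff by blast
 then show thesis by (intro that) auto
qed

lemma cmod0_subset: "cmod0 Gm ==> Gm' <= Gm ==> cmod0 Gm'"
proof -
 assume a: "cmod0 Gm" "Gm' <= Gm"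
 show "cmod0 Gm'" unfolding cmod0_iff
 proof (intro allI impI)
 fix e :: real assume "e > 0"
 then obtain rh Gm0 where "null1 Gm0" "ALL gm:Gm - Gm0. nI (img gm) rh >= 1" "ns UNIV (%i. (rh i)^2) < eN e"
 using a(1) unfolding cmod0_iff by blast
 then show "EX rh Gm0. null1 Gm0 & (ALL gm:Gm' - Gm0. nI (img gm) rh >= 1) & ns UNIV (%i. (rh i)^2) < eN e"
 using a(2) by (intro exI[of _ rh] exI[of _ Gm0]) auto
 qed
qed

lemma cmod0_UN: assumes "!!n::nat. cmod0 (Gm n)" shows "cmod0 (\<Union>n. Gm n)"
 unfolding cmod0_iff
proof (intro allI impI)
 fix e :: real assume e: "0 < e"
 have "EX rh Gm0. null1 Gm0 & (ALL gm:Gm n - Gm0. nI (img gm) rh >= 1) & ns UNIV (%i. (rh i)^2) < eN (e/2 * (1/2)^Suc n)" for n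
 using assms[of n] e unfolding cmod0_iff by (metis half_gt_zero zero_less_power mult_pos_pos zero_less_divide_1_iff zero_less_numeral)
 then obtain rh G where r: "!!n. null1 (G n)" "!!n gm. gm : Gm n - G n ==> nI (img gm) (rh n) >= 1"
 "!!n. ns UNIV (%i. (rh n i)^2) < eN (e/2 * (1/2)^Suc n)" by metis
 show "EX rh Gm0. null1 Gm0 & (ALL gm:(\<Union>n. Gm n) - Gm0. nI (img gm) rh >= 1) & ns UNIV (%i. (rh i)^2) < eN e"
 proof (intro exI conjI ballI)
 show "null1 (\<Union>n. G n)" using r by (intro null1_UN)
 show "1 <= nI (img gm) (%i. SUP n. rh n i)" if g: "gm : (\<Union>n. Gm n) - (\<Union>n. G n)" for gm
 proof -
 obtain n where "gm : Gm n - G n" using g by blast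
 then have "1 <= nI (img gm) (rh n)" using r by blast
 also have "... <= nI (img gm) (%i. SUP n. rh n i)" by (intro ns_mono) (auto intro: SUP_upper)
 finally show ?thesis .
 qed
 have "ns UNIV (%i. (SUP n. rh n i)^2) <= ns UNIV (%i. \<Sum>n. (rh n i)^2)"
 by (intro ns_mono SUP_square) auto
 also have "... = (\<Sum>n. ns UNIV (%i. (rh n i)^2))" by (rule ns_suminf_swap)
 also have "... <= eN (e/2)" using e r(3) by (intro eps_sum) (auto intro: less_imp_le)
 also have "... < eN e" using e by (intro ennreal_lessI) auto
 finally show "ns UNIV (%i. (SUP n. rh n i)^2) < eN e" .
 qed
qed

text \<open>The analogue of "almost everywhere" for the fixed modulus. It is closed under countable
  conjunction and under passage to all subpaths, and later arguments use it only through such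
  rules.\<close>

definition aep :: "(plane_path => bool) => bool" where
 "aep P \<longleftrightarrow> cmod0 {gm : paths_in Om. ~ P gm}"

lemma aep_mono: "aep P ==> (!!gm. gm : paths_in Om ==> P gm ==> P' gm) ==> aep P'"
 unfolding aep_def by (erule cmod0_subset) blast

lemma aep_all: assumes "!!n::nat. aep (P n)" shows "aep (%gm. ALL n. P n gm)"
proof -
 have "{gm : paths_in Om. ~ (ALL n. P n gm)} = (\<Union>n. {gm : paths_in Om. ~ P n gm})" by blast
 then show ?thesis using assms cmod0_UN unfolding aep_def by simp
qed

lemma aep_conj: assumes "aep P" "aep P'" shows "aep (%gm. P gm & P' gm)"
proof -
 have "aep (%gm. ALL n::nat. (if n = 0 then P gm else P' gm))"
 proof (rule aep_all)
 fix n :: nat show "aep (%gm. if n = 0 then P gm else P' gm)" using assms by (cases "n = 0") auto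
 qed
 then show ?thesis by (rule aep_mono) (metis zero_neq_one)
qed

text \<open>An infinite sum stays infinite when the weight is multiplied by a positive constant,
  while the energy can be made as small as desired.\<close>

lemma aep_l2: assumes "ns UNIV (%i. (rh i)^2) < iN" shows "aep (%gm. nI (img gm) rh < iN)"
 unfolding aep_def cmod0_iff
proof (intro allI impI)
 fix e :: real assume e: "0 < e"
 obtain c where c: "ns UNIV (%i. (rh i)^2) = eN c" "c >= 0"
 using assms by (metis ennreal_cases less_irrefl infinity_ennreal_def)
 define d where "d = sqrt (e / (2 * (c + 1)))"
 have d: "d > 0" "d^2 * c < e" using e c
 by (auto simp: d_def field_simps) (smt (verit) mult_nonneg_nonneg)
 have "ns UNIV (%i. (eN d * rh i)^2) = eN (d^2) * ns UNIV (%i. (rh i)^2)"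
 using d by (simp add: power_mult_distrib ns_cmult ennreal_power)
 also have "... = eN (d^2 * c)" using c by (simp add: ennreal_mult')
 also have "... < eN e" using d e by (intro ennreal_lessI) auto
 finally have 1: "ns UNIV (%i. (eN d * rh i)^2) < eN e" .
 show "EX rh' Gm0. null1 Gm0 & (ALL gm:{gm : paths_in Om. ~ nI (img gm) rh < iN} - Gm0. 1 <= nI (img gm) rh')
 & ns UNIV (%i. (rh' i)^2) < eN e"
 using 1 d null1_empty
 by (intro exI[of _ "%i. eN d * rh i"] exI[of _ "{}"]) (auto simp: ns_cmult ennreal_mult_top not_less top_unique)
qed

lemma subpath_in: "subpath_of gm' gm ==> gm : paths_in Om ==> gm' : paths_in Om"
 unfolding subpath_of_def paths_in_def is_plane_path_def img_def
 using continuous_on_subset[OF _ closure_mono] by (auto intro: bounded_subset) blast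

lemma subpath_img: "subpath_of gm' gm ==> img gm' <= img gm"
 by (auto simp: subpath_of_def img_def)

lemma line_integral_subpath:
 assumes "subpath_of gm' gm" shows "line_integral w gm' <= line_integral w gm"
proof -
 have "locally_rectifiable gm ==> locally_rectifiable gm'"
 using assms unfolding locally_rectifiable_def subpath_of_def by (metis order_trans)
 moreover have "(SUP (a, b)\<in>{(a, b). a <= b & {a..b} <= fst gm'}. F a b) <= (SUP (a, b)\<in>{(a, b). a <= b & {a..b} <= fst gm}. F a b :: ennreal)" for F
 using assms by (intro SUP_subset_mono) (auto simp: subpath_of_def)
 ultimately show ?thesis using assms unfolding line_integral_def subpath_of_def by auto
qed

lemma null1_sub: assumes "null1 Gm" shows "null1 {gm. EX gm':Gm. subpath_of gm' gm}"
proof (cases ver)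
 case Weak
 then have m: "mod2 Gm = 0" using assms null1_Weak by simp
 have "mod2 {gm. EX gm':Gm. subpath_of gm' gm} = 0"
 unfolding mod2_0_iff
 proof (intro allI impI)
 fix e :: real assume "0 < e"
 then obtain w where "w\<in>borel_measurable borel" "ALL gm:Gm. line_integral w gm >= 1"
 "(\<integral>\<^sup>+z. (w z)^2 \<partial>hausdorff_measure 2) < eN e" using m unfolding mod2_0_iff by blast
 then show "EX w:borel_measurable borel. (ALL gm:{gm. EX gm':Gm. subpath_of gm' gm}. 1 <= line_integral w gm) &
 (\<integral>\<^sup>+z. (w z)^2 \<partial>hausdorff_measure 2) < eN e"
 using line_integral_subpath[of _ _ w] by (intro bexI[of _ w]) (auto intro: order_trans)
 qed
 then show ?thesis unfolding null1_Weak[OF Weak] .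
next
 case Strong
 show ?thesis using assms unfolding null1_Strong[OF Strong]
 proof safe
 fix J f J' f' assume a: "ALL gm:Gm. hausdorff 1 (img gm Int S) ~= 0" "(J, f) : Gm" "subpath_of (J, f) (J', f')"
 "hausdorff 1 (img (J', f') Int S) = 0"
 have "hausdorff 1 (img (J,f) Int S) <= hausdorff 1 (img (J',f') Int S)"
 using subpath_img[OF a(3)] by (intro hausdorff_mono) auto
 then show False using a by auto
 qed
qed

text \<open>Sums, line integrals and length in the carpet only grow from a subpath to the path, so
  whatever excludes a bad subpath excludes every path that contains it.\<close>

lemma aep_sub: assumes "aep P" shows "aep (%gm. ALL gm'. subpath_of gm' gm --> P gm')"
 unfolding aep_def cmod0_iff
proof (intro allI impI)
 fix e :: real assume e: "0 < e"
 have c: "cmod0 {gm : paths_in Om. ~ P gm}" using assms by (simp only: aep_def)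
 obtain rh G where r: "null1 G" "!!gm. gm : {gm : paths_in Om. ~ P gm} ==> gm ~: G ==> nI (img gm) rh >= 1" "ns UNIV (%i. (rh i)^2) < eN e"
 by (rule cmod0E[OF c e], rule that)
 show "EX rh Gm0. null1 Gm0 & (ALL gm:{gm : paths_in Om. ~ (ALL gm'. subpath_of gm' gm --> P gm')} - Gm0. 1 <= nI (img gm) rh) &
 ns UNIV (%i. (rh i)^2) < eN e"
 proof (intro exI conjI ballI)
 show "null1 {gm. EX gm':G. subpath_of gm' gm}" using r by (intro null1_sub)
 show "ns UNIV (%i. (rh i)^2) < eN e" by (rule r)
 fix gm assume g: "gm : {gm : paths_in Om. ~ (ALL gm'. subpath_of gm' gm --> P gm')} - {gm. EX gm':G. subpath_of gm' gm}"
 then obtain gm' where "subpath_of gm' gm" "~ P gm'" "gm' ~: G" "gm : paths_in Om" by blast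
 then have "1 <= nI (img gm') rh" using r(2)[of gm'] subpath_in[of gm' gm] by auto
 also have "... <= nI (img gm) rh" using subpath_img[OF \<open>subpath_of gm' gm\<close>] by (intro ns_mono I_mono) auto
 finally show "1 <= nI (img gm) rh" .
 qed
qed

text \<open>The inequality is asked on every parameter interval and not just for the whole image;
  \<open>aep_sub\<close> provides this stronger form for almost every path.\<close>

definition ug :: "(complex => real) => (nat => ennreal) => plane_path => bool" where
 "ug f rh gm \<longleftrightarrow> (ALL s:fst gm. ALL t:fst gm. s <= t --> snd gm s : S --> snd gm t : S -->
 eN (abs(f (snd gm s) - f (snd gm t))) <= nI (snd gm ` {s..t}) rh)"

lemma interval_sub: "is_interval (J::real set) ==> s : J ==> t : J ==> {s..t} <= J"
 by (meson atLeastAtMost_iff is_interval_1 subsetI)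

lemma subpath_Icc: "gm : paths_in Om ==> s : fst gm ==> t : fst gm ==> s <= t ==> subpath_of ({s..t}, snd gm) gm"
 unfolding subpath_of_def paths_in_def is_plane_path_def using interval_sub[of "fst gm" s t] by (simp add: is_interval_cc)

lemma upper_gradient_aep:
 assumes "upper_gradient ver Om Q g sg"
 shows "aep (ug (%x. real_of_ereal (g x)) sg)"
proof -
 obtain G where G: "G <= paths_in Om" "cmod0 G" "ALL gm:paths_in Om - G. ALL x:img gm Int S. ALL y:img gm Int S.
 (abs(g x)) ~= iN & (abs(g y)) ~= iN & (abs(g x - g y)) <= enn2ereal (sum_along Q gm sg)"
 using assms unfolding upper_gradient_def by (elim exE conjE) (rule that; assumption)
 have "aep (%gm. gm ~: G)" unfolding aep_def by (rule cmod0_subset[OF G(2)]) blast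
 then have "aep (%gm. ALL gm'. subpath_of gm' gm --> gm' ~: G)" by (rule aep_sub)
 then show ?thesis
 proof (rule aep_mono)
 fix gm assume a: "gm : paths_in Om" "ALL gm'. subpath_of gm' gm --> gm' ~: G"
 show "ug (%x. real_of_ereal (g x)) sg gm" unfolding ug_def
 proof (intro ballI impI)
 fix s t assume st: "s : fst gm" "t : fst gm" "s <= t" "snd gm s : S" "snd gm t : S"
 let ?c = "({s..t}, snd gm)"
 have sp: "subpath_of ?c gm" using a(1) st by (intro subpath_Icc)
 have c: "?c : paths_in Om - G" using subpath_in[OF sp a(1)] a(2) sp by simp
 have "(abs(g (snd gm s))) ~= iN & (abs(g (snd gm t))) ~= iN & (abs(g (snd gm s) - g (snd gm t))) <= enn2ereal (sum_along Q ?c sg)"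
 using st by (intro G(3)[rule_format, OF c]) (auto simp: img_def)
 moreover obtain p q where "g (snd gm s) = ereal p" "g (snd gm t) = ereal q" using calculation by (cases "g (snd gm s)"; cases "g (snd gm t)") auto
 ultimately have "ereal (abs(p - q)) <= enn2ereal (sum_along Q ?c sg)" "g (snd gm s) = ereal p" "g (snd gm t) = ereal q" by auto
 then show "eN (abs(real_of_ereal (g (snd gm s)) - real_of_ereal (g (snd gm t)))) <= nI (snd gm ` {s..t}) sg"
 by (simp add: sum_along_def ns_infsum img_def less_eq_ennreal.rep_eq enn2ereal_ennreal)
 qed
 qed
qed

lemma aep_upper_gradient:
 assumes "aep (ug f sg)"
 shows "upper_gradient ver Om Q (%x. ereal (f x)) sg"
 unfolding upper_gradient_def
proof (intro exI conjI ballI)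
 show "{gm : paths_in Om. ~ ug f sg gm} <= paths_in Om" by blast
 show "cmod0 {gm : paths_in Om. ~ ug f sg gm}" using assms by (simp add: aep_def)
 fix gm x y assume g: "gm : paths_in Om - {gm : paths_in Om. ~ ug f sg gm}" and x: "x : img gm Int S" and y: "y : img gm Int S"
 have *: "eN (abs(f (snd gm s) - f (snd gm t))) <= nI (img gm) sg" if "s : fst gm" "t : fst gm" "snd gm s : S" "snd gm t : S" "s <= t" for s t
 proof -
 have "eN (abs(f (snd gm s) - f (snd gm t))) <= nI (snd gm ` {s..t}) sg" using g that unfolding ug_def by blast
 also have "... <= nI (img gm) sg"
 using g that interval_sub[of "fst gm" s t]
 by (intro ns_mono I_mono) (auto simp: img_def paths_in_def is_plane_path_def)
 finally show ?thesis .
 qed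
 obtain s t where st: "x = snd gm s" "y = snd gm t" "s : fst gm" "t : fst gm" using x y by (auto simp: img_def)
 have "eN (abs(f x - f y)) <= nI (img gm) sg"
 using *[of s t] *[of t s] st x y by (cases "s <= t") (auto simp: abs_minus_commute)
 then show "(abs(ereal (f x) - ereal (f y))) <= enn2ereal (sum_along Q gm sg)"
 by (simp add: sum_along_def ns_infsum less_eq_ennreal.rep_eq enn2ereal_ennreal)
qed auto

end

section \<open>Generic horizontal and vertical lines\<close>

text \<open>\<open>b\<close> is True for horizontal lines. \<open>phi b\<close> is the coordinate
  that is constant on them and \<open>phi (~ b)\<close> the parameter, so one argument covers both
  directions.\<close>

definition lin :: "bool => real => real => complex" where
 "lin b y t = (if b then Complex t y else Complex y t)"
definition phi :: "bool => complex => real" where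
 "phi b z = (if b then Im z else Re z)"

lemma lin_diff: "lin b y s - lin b y t = (if b then of_real (s - t) else \<i> * of_real (s - t))"
 by (auto simp: lin_def complex_eq_iff)

lemma dist_lin [simp]: "dist (lin b y s) (lin b y t) = (abs(s - t))"
 unfolding dist_norm lin_diff by (auto simp: norm_mult simp del: of_real_diff)

lemma lin_phi [simp]: "lin b (phi b z) (phi (~ b) z) = z" "phi b (lin b y t) = y" "phi (~ b) (lin b y t) = t"
 "phi True (lin False y t) = t" "phi False (lin True y t) = t"
 by (auto simp: lin_def phi_def complex_eq_iff)

lemma phi_dist: "(abs(phi b a - phi b z)) <= dist a z"
 unfolding phi_def dist_norm using abs_Re_le_cmod[of "a - z"] abs_Im_le_cmod[of "a - z"] by auto

lemma cont_lin: "continuous_on A (lin b y)"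
 unfolding continuous_on_iff by (auto simp: dist_real_def)

lemma cont_lin2: "continuous_on A (%(y, t). lin b y t)"
 unfolding lin_def by (cases b) (auto simp: split_beta Complex_eq intro!: continuous_intros)

lemma curve_length_lin: assumes "a <= c" shows "curve_length (lin b y) {a..c} = eN (c - a)"
 unfolding curve_length_def
proof (rule antisym)
 show "(SUP (n, t)\<in>{(n, t). mono_on {..n} t & t ` {..n} <= {a..c}}. \<Sum>k<n. eN (dist (lin b y (t k)) (lin b y (t (Suc k))))) <= eN (c - a)"
 proof (rule SUP_least, clarify)
 fix n and t :: "nat => real" assume m: "mono_on {..n} t" and r: "t ` {..n} <= {a..c}"
 have mm: "t k <= t (Suc k)" if "k < n" for k using mono_onD[OF m, of k "Suc k"] that by auto
 have "(\<Sum>k<n. eN (dist (lin b y (t k)) (lin b y (t (Suc k))))) = (\<Sum>k<n. eN (t (Suc k) - t k))"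
 using mm by (intro sum.cong) (force simp: abs_if)+
 also have "... = eN (\<Sum>k<n. t (Suc k) - t k)" using mm by (intro sum_ennreal) auto
 also have "... = eN (t n - t 0)" by (simp add: sum_lessThan_telescope)
 also have "... <= eN (c - a)" using r by (intro ennreal_leI) (force intro: diff_mono)
 finally show "(\<Sum>k<n. eN (dist (lin b y (t k)) (lin b y (t (Suc k))))) <= eN (c - a)" .
 qed
 have "eN (c - a) = (\<Sum>k<1. eN (dist (lin b y (if k = 0 then a else c)) (lin b y (if Suc k = 0 then a else c))))"
 using assms by simp
 also have "... <= (SUP (n, t)\<in>{(n, t). mono_on {..n} t & t ` {..n} <= {a..c}}. \<Sum>k<n. eN (dist (lin b y (t k)) (lin b y (t (Suc k)))))"
 using assms by (intro SUP_upper2[of "(1, %k. if k = 0 then a else c)"]) (auto simp: mono_on_def)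
 finally show "eN (c - a) <= (SUP (n, t)\<in>{(n, t). mono_on {..n} t & t ` {..n} <= {a..c}}. \<Sum>k<n. eN (dist (lin b y (t k)) (lin b y (t (Suc k)))))" .
qed

lemma arclength_lin: assumes "0 <= s" "s <= c - a" shows "arclength_param (lin b y) a c s = lin b y (a + s)"
proof -
 have "(SOME t. t : {a..c} & curve_length (lin b y) {a..t} = eN s) = a + s"
 proof (rule some_equality)
 show "a + s : {a..c} & curve_length (lin b y) {a..a + s} = eN s"
 using assms curve_length_lin[of a "a+s" b y] by auto
 fix t assume t: "t : {a..c} & curve_length (lin b y) {a..t} = eN s"
 then have "eN (t - a) = eN s" using curve_length_lin[of a t b y] by auto
 then show "t = a + s" using t assms by (simp add: ennreal_inj)
 qed
 then show ?thesis by (simp add: arclength_param_def)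
qed

lemma line_integral_lin:
 assumes w [measurable]: "w : borel_measurable borel" and J: "J <= {-k..k}"
 shows "line_integral w (J, lin b y) <= (\<integral>\<^sup>+t. w (lin b y t) * indicator {-k..k} t \<partial>lborel)"
proof -
 have [measurable]: "lin b y : borel_measurable borel"
 by (rule borel_measurable_continuous_onI[OF cont_lin])
 have lr: "locally_rectifiable (J, lin b y)"
 by (auto simp: locally_rectifiable_def curve_length_lin)
 show ?thesis
 unfolding line_integral_def using lr
 proof (simp, intro SUP_least, clarify)
 fix a c :: real assume ac: "a <= c" "{a..c} <= J"
 have "(\<integral>\<^sup>+s. w (arclength_param (lin b y) a c s) * indicator {0..enn2real (curve_length (lin b y) {a..c})} s \<partial>lborel)
 = (\<integral>\<^sup>+s. w (lin b y (a + 1 * s)) * indicator {a..c} (a + 1 * s) \<partial>lborel)"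
 using ac by (intro nn_integral_cong) (auto simp: curve_length_lin arclength_lin split: split_indicator)
 also have "... = (\<integral>\<^sup>+t. w (lin b y t) * indicator {a..c} t \<partial>lborel)"
 by (subst nn_integral_real_affine[where c=1 and t=a and f="%t. w (lin b y t) * indicator {a..c} t"]) auto
 also have "... <= (\<integral>\<^sup>+t. w (lin b y t) * indicator {-k..k} t \<partial>lborel)"
 using order_trans[OF ac(2) J] by (intro nn_integral_mono) (auto split: split_indicator dest: subsetD)
 finally show "(\<integral>\<^sup>+s. w (arclength_param (lin b y) a c s) * indicator {0..enn2real (curve_length (lin b y) {a..c})} s \<partial>lborel)
 <= (\<integral>\<^sup>+t. w (lin b y t) * indicator {-k..k} t \<partial>lborel)" .
 qed
qed

section \<open>Comparison of Lebesgue and Hausdorff measure\<close>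

lemma emeasure_interval: "0 <= d ==> emeasure lborel {p - d..p + d :: real} = eN (2 * d)"
 by (simp add: )

lemma diam_nn: "bounded U ==> 0 <= diameter U" by (rule diameter_ge_0)

lemma phi_diam: "bounded U ==> z : U ==> a : U ==> phi b a : {phi b z - diameter U..phi b z + diameter U}"
 using phi_dist[of b a z] diameter_bounded_bound[of U a z] by auto

lemma pi_bound: "0 <= d ==> d^2 / 2 <= unit_ball_vol (real 2) * (d / 2)^2"
 using pi_ge_two mult_right_mono[of 2 pi "d^2"] by (simp add: unit_ball_vol_2 power2_eq_square)

text \<open>Any constant will do, so each covering set is put into a rectangle whose sides are twice
  its diameter; the areas compare with factor 8, rounded up to 16.\<close>

lemma lebesgue_le_hausdorff:
 assumes B: "B : sets borel"
 shows "emeasure (lborel \<Otimes>\<^sub>M lborel) {p. lin b (fst p) (snd p) : B} <= 16 * hausdorff 2 B"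
proof -
 let ?E = "{p. lin b (fst p) (snd p) : B}"
 have "emeasure (lborel \<Otimes>\<^sub>M lborel) ?E / 16 <= hausdorff_pre 2 1 B"
 unfolding hausdorff_pre_def
 proof (rule INF_greatest, safe)
 fix U :: "nat => complex set" assume cov: "B <= (\<Union>j. U j)" and U: "ALL j. bounded (U j) & diameter (U j) <= 1"
 define z where "z j = (SOME z. z : U j)" for j
 have z: "U j ~= {} ==> z j : U j" for j unfolding z_def by (meson ex_in_conv someI)
 define d where "d j = diameter (U j)" for j
 have d: "0 <= d j" for j using U by (auto simp: d_def diam_nn)
 define R where "R j = {phi b (z j) - d j..phi b (z j) + d j} \<times> {phi (\<not>b) (z j) - d j..phi (\<not>b) (z j) + d j}" for j
 have Rm: "R j : sets (lborel \<Otimes>\<^sub>M lborel)" for j unfolding R_def by auto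
 have "?E <= (\<Union>j. R j)"
 proof
 fix p assume p: "p : ?E"
 let ?q = "lin b (fst p) (snd p)"
 obtain j where j: "?q : U j" using p cov by blast
 then have "z j : U j" using z by blast
 then have "phi b ?q : {phi b (z j) - d j..phi b (z j) + d j}" "phi (\<not>b) ?q : {phi (\<not>b) (z j) - d j..phi (\<not>b) (z j) + d j}"
 using phi_diam j U unfolding d_def by blast+
 then have "p : R j" by (cases p) (simp add: R_def)
 then show "p : (\<Union>j. R j)" by blast
 qed
 then have "emeasure (lborel \<Otimes>\<^sub>M lborel) ?E <= emeasure (lborel \<Otimes>\<^sub>M lborel) (\<Union>j. R j)"
 using Rm by (intro emeasure_mono) auto
 also have "... <= (\<Sum>j. emeasure (lborel \<Otimes>\<^sub>M lborel) (R j))"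
 using Rm by (intro emeasure_subadditive_countably) auto
 also have "... <= (\<Sum>j. 16 * eN (unit_ball_vol (real 2) * (diameter (U j) / 2) ^ 2))"
 proof (intro suminf_le allI)
 fix j
 have "emeasure (lborel \<Otimes>\<^sub>M lborel) (R j) = eN (2 * d j) * eN (2 * d j)"
 unfolding R_def using d[of j] by (subst lborel.emeasure_pair_measure_Times) (auto simp: emeasure_interval)
 also have "... = eN (8 * ((d j)^2 / 2))" using d[of j] by (simp flip: ennreal_mult' add: power2_eq_square)
 also have "... <= eN (16 * (unit_ball_vol (real 2) * (d j / 2)^2))"
 using pi_bound[OF d[of j]] by (intro ennreal_leI mult_mono) auto
 also have "... = 16 * eN (unit_ball_vol (real 2) * (d j / 2)^2)" by (subst ennreal_mult') auto
 finally show "emeasure (lborel \<Otimes>\<^sub>M lborel) (R j) <= 16 * eN (unit_ball_vol (real 2) * (diameter (U j) / 2) ^ 2)"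
 by (simp add: d_def)
 qed auto
 also have "... = 16 * (\<Sum>j. eN (unit_ball_vol (real 2) * (diameter (U j) / 2) ^ 2))" by simp
 finally show "emeasure (lborel \<Otimes>\<^sub>M lborel) ?E / 16 <= (\<Sum>j. eN (unit_ball_vol (real 2) * (diameter (U j) / 2) ^ 2))"
 by (intro divide_le_posI_ennreal) auto
 qed
 also have "... <= hausdorff 2 B" unfolding hausdorff_def by (intro SUP_upper) auto
 finally have "16 * (emeasure (lborel \<Otimes>\<^sub>M lborel) ?E / 16) <= 16 * hausdorff 2 B" by (intro mult_left_mono) auto
 moreover have "16 * (emeasure (lborel \<Otimes>\<^sub>M lborel) ?E / 16) = emeasure (lborel \<Otimes>\<^sub>M lborel) ?E"
 by (subst mult.commute, rule ennreal_divide_times[THEN trans]) (auto simp: ennreal_mult_divide_eq mult.commute ennreal_times_divide)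
 ultimately show ?thesis by simp
qed

text \<open>The image of planar Lebesgue measure under \<open>lin b\<close> is at most 16 times
  Hausdorff measure; Tonelli then slices a weight of small energy along lines.\<close>

lemma lebesgue_integral_le_hausdorff:
 assumes w [measurable]: "w : borel_measurable borel"
 shows "(\<integral>\<^sup>+y. \<integral>\<^sup>+t. w (lin b y t) \<partial>lborel \<partial>lborel) <= 16 * (\<integral>\<^sup>+z. w z \<partial>hausdorff_measure 2)"
proof -
 let ?f = "%p. lin b (fst p) (snd p)"
 have fm [measurable]: "?f : borel_measurable (lborel \<Otimes>\<^sub>M lborel)"
 proof -
 have "continuous_on UNIV ?f" using cont_lin2[of UNIV b] by (simp add: case_prod_beta)
 then show ?thesis using borel_measurable_continuous_onI[of ?f] by (simp add: lborel_prod)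
 qed
 have sets: "sets (hausdorff_measure 2 :: complex measure) = sets borel"
 by (simp add: hausdorff_measure_def sets.sigma_sets_eq[of borel, simplified] sets_measure_of_conv)
 have "(\<integral>\<^sup>+y. \<integral>\<^sup>+t. w (lin b y t) \<partial>lborel \<partial>lborel) = (\<integral>\<^sup>+p. w (?f p) \<partial>(lborel \<Otimes>\<^sub>M lborel))"
 by (subst lborel.nn_integral_fst[symmetric]) auto
 also have "... = (\<integral>\<^sup>+z. w z \<partial>distr (lborel \<Otimes>\<^sub>M lborel) borel ?f)"
 by (subst nn_integral_distr) auto
 also have "... <= (\<integral>\<^sup>+z. w z \<partial>scale_measure 16 (hausdorff_measure 2))"
 proof (rule nn_integral_mono_measure)
 show "sets (distr (lborel \<Otimes>\<^sub>M lborel) borel ?f) = sets (scale_measure 16 (hausdorff_measure 2 :: complex measure))"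
 by (simp add: sets)
 show "distr (lborel \<Otimes>\<^sub>M lborel) borel ?f <= scale_measure 16 (hausdorff_measure 2)"
 proof (subst le_measure, goal_cases)
 case 1 show "sets (distr (lborel \<Otimes>\<^sub>M lborel) borel ?f) = sets (scale_measure 16 (hausdorff_measure 2))" by (simp add: sets)
 next
 case 2 show ?case
 proof
 fix A assume "A : sets (distr (lborel \<Otimes>\<^sub>M lborel) borel ?f)"
 then have A: "A : sets borel" by simp
 have "emeasure (distr (lborel \<Otimes>\<^sub>M lborel) borel ?f) A = emeasure (lborel \<Otimes>\<^sub>M lborel) {p. lin b (fst p) (snd p) : A}"
 using A by (subst emeasure_distr) (auto simp: vimage_def space_pair_measure)
 also have "... <= 16 * hausdorff 2 A" using A by (rule lebesgue_le_hausdorff)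
 finally show "emeasure (distr (lborel \<Otimes>\<^sub>M lborel) borel ?f) A <= emeasure (scale_measure 16 (hausdorff_measure 2)) A"
 using A by (simp add: emeasure_hausdorff_measure)
 qed
 qed
 qed
 also have "... = 16 * (\<integral>\<^sup>+z. w z \<partial>hausdorff_measure 2)"
 proof (rule nn_integral_scale_measure)
 show "w : borel_measurable (hausdorff_measure 2)" unfolding measurable_cong_sets[OF sets refl] by (rule w)
 qed
 finally show ?thesis .
qed

text \<open>\<open>E\<close> need not be measurable, and each covering may fail on a null set, which
  is where exceptional lines of other kinds are absorbed.\<close>

lemma AE_small:
 assumes "!!e::real. 0 < e ==> EX A:sets lborel. emeasure lborel A <= eN e & (AE y::real in lborel. y : E --> y : A)"
 shows "AE y in lborel. y ~: E"
proof -
 have "EX A. A\<in>sets lborel & emeasure lborel A <= eN (1 / Suc n) & (AE y::real in lborel. y : E --> y : A)" for n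
 using assms[of "1 / Suc n"] by auto
 then obtain A where A: "!!n. A n : sets lborel" "!!n. emeasure lborel (A n) <= eN (1 / Suc n)"
 "!!n. AE y::real in lborel. y : E --> y : A n" by metis
 have B: "(\<Inter>n. A n) : sets lborel" using A by auto
 have "emeasure lborel (\<Inter>n. A n) <= ennreal 0"
 proof (rule LIMSEQ_le_const)
 show "(%n. eN (1 / Suc n)) \<longlonglongrightarrow> ennreal 0" by (intro tendsto_ennrealI LIMSEQ_Suc[OF lim_1_over_n])
 have "emeasure lborel (\<Inter>n. A n) <= emeasure lborel (A n)" for n using A by (intro emeasure_mono) auto
 then show "EX N. ALL n>=N. emeasure lborel (\<Inter>n. A n) <= eN (1 / Suc n)" using A(2) order_trans by blast
 qed
 then have "(\<Inter>n. A n) : null_sets lborel" using B by (auto simp: null_sets_def)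
 then have "AE y in lborel. y ~: (\<Inter>n. A n)" by (rule AE_not_in)
 moreover have "AE y in lborel. ALL n. y : E --> y : A n" unfolding AE_all_countable using A(3) by blast
 ultimately show ?thesis by eventually_elim auto
qed

lemma ennreal_mult3: "0 <= a ==> 0 <= x ==> eN a * (numeral n * eN x) = eN (a * (numeral n * x))"
 by (simp add: ennreal_mult')

text \<open>Stands in for the Cauchy-Schwarz inequality when a square integral has to control an
  integral over a bounded interval.\<close>

lemma finite_tau: "(tu::real) > 0 ==> w <= ennreal tu + eN (1/tu) * (w::ennreal)^2"
proof (cases w)
 case (real r)
 assume t: "tu > 0"
 have "r <= tu + 1/tu * r^2"
 proof (cases "r <= tu")
 case False
 then have "r * tu <= r * r" using real t by (intro mult_left_mono) auto
 then have "r <= 1/tu * r^2" using t by (simp add: field_simps power2_eq_square)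
 then show ?thesis using t by simp
 qed (use t real in \<open>simp add: add_increasing2\<close>)
 then have "eN r <= eN (tu + 1/tu * r^2)" by (rule ennreal_leI)
 also have "... = ennreal tu + eN (1/tu * r^2)" using t real by (intro ennreal_plus) auto
 also have "eN (1/tu * r^2) = eN (1/tu) * (eN r)^2" using t real by (subst ennreal_mult) (auto simp: ennreal_power)
 finally show ?thesis using real by simp
qed (simp add: ennreal_mult_top ennreal_top_mult power2_eq_square)

lemma bounded_nat_interval: "bounded (J::real set) ==> EX k::nat. J <= {- real k..real k}"
proof -
 assume "bounded J"
 then obtain B where B: "!!x. x : J ==> (abs(x)) <= B" by (auto simp: bounded_iff)
 obtain k :: nat where "B <= real k" using real_arch_simple by blast
 then show ?thesis using B by (intro exI[of _ k]) fastforce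
qed

lemma AE_all_nat: "(!!k::nat. AE y in M. P k y) ==> AE y in M. ALL k. P k y"
 by (subst AE_all_countable) auto

section \<open>Null families on generic lines\<close>

context rel_carpet begin

text \<open>A weight of small energy has, by Tonelli and Markov, small energy on most lines, too
  small for the integral 1 that admissibility demands on a bounded piece.\<close>

lemma mod2_lines:
 assumes "mod2 Gm = 0"
 shows "AE y in lborel. ALL J. bounded J --> (J, lin b y) ~: Gm"
proof -
 have 1: "AE y in lborel. y ~: {y. EX J. J <= {- real k..real k} & (J, lin b y) : Gm}" for k :: nat
 proof (rule AE_small)
 fix e :: real assume e: "0 < e"
 define c where "c = real k + 1"
 have c: "c >= 1" "real k <= c" by (auto simp: c_def)
 \<comment> \<open>128 is the Markov factor 8 times the 16 of
   \<open>lebesgue_integral_le_hausdorff\<close>.\<close>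
 have e': "e / (128 * c) > 0" using c e by simp
 obtain w where w [measurable]: "w : borel_measurable borel" and w1: "ALL gm:Gm. line_integral w gm >= 1"
 and w2: "(\<integral>\<^sup>+z. (w z)^2 \<partial>hausdorff_measure 2) < eN (e / (128 * c))"
 using assms e' unfolding mod2_0_iff by blast
 have lm [measurable]: "(%p. lin b (fst p) (snd p)) : borel_measurable (borel \<Otimes>\<^sub>M borel)"
 proof -
 have "continuous_on UNIV (%p. lin b (fst p) (snd p))" using cont_lin2[of UNIV b] by (simp add: case_prod_beta)
 then show ?thesis using borel_measurable_continuous_onI by (simp add: borel_prod)
 qed
 define F where "F y = (\<integral>\<^sup>+t. (w (lin b y t))^2 \<partial>lborel)" for y
 have [measurable]: "F : borel_measurable lborel"
 proof -
 have "(%p. (w (lin b (fst p) (snd p)))^2) : borel_measurable (borel \<Otimes>\<^sub>M borel)" by measurable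
 then show ?thesis unfolding F_def using lborel.borel_measurable_nn_integral_fst[of "%p. (w (lin b (fst p) (snd p)))^2" borel] by simp
 qed
 define A where "A = {y. eN (8 * c) * F y >= 1}"
 show "EX A:sets lborel. emeasure lborel A <= eN e & (AE y in lborel. y : {y. EX J. J <= {- real k..real k} & (J, lin b y) : Gm} --> y : A)"
 proof (intro bexI conjI AE_I2 impI)
 show A: "A : sets lborel" unfolding A_def by measurable
 have "emeasure lborel A <= eN (8 * c) * (\<integral>\<^sup>+y. F y \<partial>lborel)"
 unfolding A_def using nn_integral_Markov_inequality[of F UNIV lborel "eN (8*c)"] by simp
 also have "... <= eN (8 * c) * (16 * eN (e / (128 * c)))"
 unfolding F_def
 by (intro mult_left_mono order_trans[OF lebesgue_integral_le_hausdorff[where w="%z. (w z)^2"]] less_imp_le[OF w2]) auto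
 also have "... = eN (8 * c * (16 * (e / (128 * c))))" using c e by (intro ennreal_mult3) auto
 also have "8 * c * (16 * (e / (128 * c))) = e" using c by simp
 finally show "emeasure lborel A <= eN e" .
 fix y assume "y : {y. EX J. J <= {- real k..real k} & (J, lin b y) : Gm}"
 then obtain J where J: "J <= {- real k..real k}" "(J, lin b y) : Gm" by blast
 have [measurable]: "lin b y : borel_measurable borel"
 by (rule borel_measurable_continuous_onI[OF cont_lin])
 have "1 <= line_integral w (J, lin b y)" using w1 J by blast
 also have "... <= (\<integral>\<^sup>+t. w (lin b y t) * indicator {-c..c} t \<partial>lborel)"
 using J c by (intro line_integral_lin[OF w]) auto
 \<comment> \<open>With parameter \<open>1/(4*c)\<close> the constant part integrates to 1/2 over
   \<open>{-c..c}\<close>, so \<open>F y\<close> has to supply the other half.\<close>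
 also have "... <= (\<integral>\<^sup>+t. eN (1/(4*c)) * indicator {-c..c} t + eN (4*c) * (w (lin b y t))^2 \<partial>lborel)"
 using finite_tau[of "1/(4*c)"] c by (intro nn_integral_mono) (auto split: split_indicator)
 also have "... = (\<integral>\<^sup>+t. eN (1/(4*c)) * indicator {-c..c} t \<partial>lborel) + eN (4*c) * F y"
 unfolding F_def by (subst nn_integral_add) (auto simp: nn_integral_cmult)
 also have "(\<integral>\<^sup>+t. eN (1/(4*c)) * indicator {-c..c} t \<partial>lborel) = eN (1/2)"
 using c by (subst nn_integral_cmult_indicator) (auto simp flip: ennreal_mult' simp: divide_simps)
 finally have *: "1 <= eN (1/2) + eN (4*c) * F y" .
 show "y : A"
 proof (cases "F y")
 case (real f)
 have "eN (1/2 + 4*c*f) = eN (1/2) + eN (4*c*f)" using c real by (intro ennreal_plus) auto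
 moreover have "eN (4*c*f) = eN (4*c) * eN f" using c real by (intro ennreal_mult) auto
 ultimately have "ennreal 1 <= eN (1/2 + 4*c*f)" using * real by (simp only: ennreal_1)
 then have "1 <= 1/2 + 4*c*f" using c real by (subst (asm) ennreal_le_iff) auto
 then have "ennreal 1 <= eN (8*c*f)" by (intro ennreal_leI) simp
 then show ?thesis using real c by (simp add: A_def ennreal_mult')
 next
 case top
 then show ?thesis using c by (simp add: A_def ennreal_mult_top)
 qed
 qed
 qed
 have "AE y in lborel. ALL k::nat. y ~: {y. EX J. J <= {- real k..real k} & (J, lin b y) : Gm}"
 by (rule AE_all_nat) (rule 1)
 then show ?thesis by eventually_elim (use bounded_nat_interval in blast)
qed

lemma hausdorff2_S: "hausdorff 2 S = 0"
 using standing by (auto simp: standing_assumptions_def)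

text \<open>Slicing inequality: a cover of \<open>S\<close> by sets of diameter \<open>d\<^sub>j\<close> costs \<open>\<Sum> d\<^sub>j\<^sup>2\<close>, and each set is seen by a set
 of lines of measure \<open>O(d\<^sub>j)\<close>.\<close>
lemma hausdorff1_lines: "AE y in lborel. hausdorff 1 (range (lin b y) Int S) = 0"
proof -
 have 1: "AE y in lborel. y ~: {y. hausdorff_pre 1 (1 / Suc n) (range (lin b y) Int S) >= eN (1 / Suc m)}" for n m :: nat
 proof (rule AE_small)
 fix e :: real assume e: "0 < e"
 \<comment> \<open>The 4 is lost in comparing \<open>d j * (2 * d j)\<close> with the area of a
   disc, the factor \<open>Suc m\<close> in Markov's inequality.\<close>
 define e' where "e' = e / 4 / Suc m"
 have e': "0 < e'" using e by (simp add: e'_def)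
 have "hausdorff_pre 2 (1 / Suc n) S <= hausdorff 2 S"
 unfolding hausdorff_def by (intro SUP_upper) auto
 then have "hausdorff_pre 2 (1 / Suc n) S < eN e'" using e' by (simp add: hausdorff2_S)
 then obtain U :: "nat => complex set" where U: "S <= (\<Union>j. U j)" "!!j. bounded (U j)" "!!j. diameter (U j) <= 1 / Suc n"
 and U2: "(\<Sum>j. eN (unit_ball_vol (real 2) * (diameter (U j) / 2) ^ 2)) < eN e'"
 unfolding hausdorff_pre_def INF_less_iff by blast
 define d where "d j = diameter (U j)" for j
 have d: "0 <= d j" for j using U by (auto simp: d_def diam_nn)
 define z where "z j = (SOME z. z : U j)" for j
 have z: "U j ~= {} ==> z j : U j" for j unfolding z_def by (meson ex_in_conv someI)
 define F where "F y = (\<Sum>j. eN (d j) * indicator {phi b (z j) - d j..phi b (z j) + d j} y)" for y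
 have [measurable]: "F : borel_measurable lborel" unfolding F_def by measurable
 have "(\<integral>\<^sup>+y. F y \<partial>lborel) = (\<Sum>j. eN (d j) * eN (2 * d j))"
 unfolding F_def using d
 by (subst nn_integral_suminf) (auto simp: nn_integral_cmult_indicator emeasure_interval intro!: suminf_cong)
 also have "... <= (\<Sum>j. 4 * eN (unit_ball_vol (real 2) * (diameter (U j) / 2) ^ 2))"
 proof (intro suminf_le allI)
 fix j
 have "eN (d j) * eN (2 * d j) = eN (4 * ((d j)^2 / 2))"
 using d[of j] by (simp flip: ennreal_mult' add: power2_eq_square)
 also have "... <= eN (4 * (unit_ball_vol (real 2) * (d j / 2)^2))"
 using pi_bound[OF d[of j]] by (intro ennreal_leI mult_mono) auto
 also have "... = 4 * eN (unit_ball_vol (real 2) * (d j / 2)^2)" by (subst ennreal_mult') auto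
 finally show "eN (d j) * eN (2 * d j) <= 4 * eN (unit_ball_vol (real 2) * (diameter (U j) / 2) ^ 2)"
 by (simp add: d_def)
 qed auto
 also have "... = 4 * (\<Sum>j. eN (unit_ball_vol (real 2) * (diameter (U j) / 2) ^ 2))" by simp
 also have "... <= 4 * eN e'" using U2 by (intro mult_left_mono) auto
 finally have IF: "(\<integral>\<^sup>+y. F y \<partial>lborel) <= 4 * eN e'" .
 define A where "A = {y. eN (Suc m) * F y >= 1}"
 show "EX A:sets lborel. emeasure lborel A <= eN e &
 (AE y in lborel. y : {y. hausdorff_pre 1 (1 / Suc n) (range (lin b y) Int S) >= eN (1 / Suc m)} --> y : A)"
 proof (intro bexI conjI AE_I2 impI)
 show A: "A : sets lborel" unfolding A_def by measurable
 have "emeasure lborel A <= eN (Suc m) * (\<integral>\<^sup>+y. F y \<partial>lborel)"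
 unfolding A_def using nn_integral_Markov_inequality[of F UNIV lborel "eN (Suc m)"] by simp
 also have "... <= eN (Suc m) * (4 * eN e')" by (intro mult_left_mono IF) auto
 also have "... = eN (Suc m * (4 * e'))" using e' by (intro ennreal_mult3) auto
 also have "Suc m * (4 * e') = e" by (simp add: e'_def del: of_nat_Suc)
 finally show "emeasure lborel A <= eN e" .
 fix y assume y: "y : {y. hausdorff_pre 1 (1 / Suc n) (range (lin b y) Int S) >= eN (1 / Suc m)}"
 let ?V = "%j. U j Int range (lin b y)"
 have "eN (1 / Suc m) <= hausdorff_pre 1 (1 / Suc n) (range (lin b y) Int S)" using y by simp
 also have "... <= (\<Sum>j. eN (unit_ball_vol (real 1) * (diameter (?V j) / 2) ^ 1))"
 unfolding hausdorff_pre_def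
 proof (rule INF_lower, safe)
 fix t assume "lin b y t : S"
 then show "lin b y t : (\<Union>j. ?V j)" using U(1) by blast
 next
 fix j show "bounded (?V j)" using U(2) by (auto intro: bounded_subset)
 have "diameter (?V j) <= diameter (U j)" using U(2) by (intro diameter_subset) auto
 then show "diameter (?V j) <= 1 / Suc n" using U(3)[of j] by linarith
 qed
 also have "... <= F y" unfolding F_def
 proof (intro suminf_le allI)
 fix j
 have "diameter (?V j) <= d j" unfolding d_def using U(2) by (intro diameter_subset) auto
 moreover have "y : {phi b (z j) - d j..phi b (z j) + d j}" if V: "?V j ~= {}"
 proof -
 obtain t where t: "lin b y t : U j" using V by blast
 then have "z j : U j" using z by blast
 then show ?thesis using phi_diam[of "U j" "z j" "lin b y t" b] t U(2) by (simp add: d_def)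
 qed
 ultimately show "eN (unit_ball_vol (real 1) * (diameter (?V j) / 2) ^ 1) <= eN (d j) * indicator {phi b (z j) - d j..phi b (z j) + d j} y"
 by (cases "?V j = {}") (auto simp: unit_ball_vol_1 intro!: ennreal_leI simp del: atLeastAtMost_iff)
 qed auto
 finally have "eN (Suc m) * eN (1 / Suc m) <= eN (Suc m) * F y" by (intro mult_left_mono) auto
 moreover have "eN (Suc m) * eN (1 / Suc m) = 1" by (simp flip: ennreal_mult' del: of_nat_Suc)
 ultimately show "y : A" by (simp add: A_def del: of_nat_Suc)
 qed
 qed
 have "AE y in lborel. ALL n m::nat. y ~: {y. hausdorff_pre 1 (1 / Suc n) (range (lin b y) Int S) >= eN (1 / Suc m)}"
 by (intro AE_all_nat 1)
 then show ?thesis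
 proof eventually_elim
 fix y assume y: "ALL n m::nat. y ~: {y. hausdorff_pre 1 (1 / Suc n) (range (lin b y) Int S) >= eN (1 / Suc m)}"
 have "hausdorff 1 (range (lin b y) Int S) <= 0" unfolding hausdorff_def
 proof (rule SUP_least)
 fix dl :: real assume "dl : {0<..}"
 then obtain n where n: "1 / Suc n < dl" using nat_approx_posE by (metis greaterThan_iff)
 have "hausdorff_pre 1 dl (range (lin b y) Int S) <= hausdorff_pre 1 (1 / Suc n) (range (lin b y) Int S)"
 using n by (intro hausdorff_pre_antimono) simp
 also have "... <= 0"
 proof (rule ennreal_le_epsilon)
 fix e :: real assume "0 < e"
 then obtain m where m: "1 / Suc m < e" using nat_approx_posE by metis
 have "hausdorff_pre 1 (1 / Suc n) (range (lin b y) Int S) <= eN (1 / Suc m)" using y by (auto simp: not_le less_imp_le)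
 also have "... <= eN e" using m by (intro ennreal_leI) simp
 finally show "hausdorff_pre 1 (1 / Suc n) (range (lin b y) Int S) <= 0 + eN e" by simp
 qed
 finally show "hausdorff_pre 1 dl (range (lin b y) Int S) <= 0" .
 qed
 then show "hausdorff 1 (range (lin b y) Int S) = 0" by simp
 qed
qed

lemma null1_lines:
 assumes "null1 Gm"
 shows "AE y in lborel. ALL J. bounded J --> (J, lin b y) ~: Gm"
proof (cases ver)
 case Weak
 then show ?thesis using assms mod2_lines null1_Weak by blast
next
 case Strong
 have g: "ALL gm:Gm. hausdorff 1 (img gm Int S) ~= 0" using assms null1_Strong[OF Strong] by blast
 show ?thesis using hausdorff1_lines[of b]
 proof eventually_elim
 fix y assume y: "hausdorff 1 (range (lin b y) Int S) = 0"
 show "ALL J. bounded J --> (J, lin b y) ~: Gm"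
 proof (intro allI impI notI)
 fix J assume "(J, lin b y) : Gm"
 then have "hausdorff 1 (img (J, lin b y) Int S) ~= 0" using g by blast
 moreover have "hausdorff 1 (img (J, lin b y) Int S) <= hausdorff 1 (range (lin b y) Int S)"
 by (intro hausdorff_mono) (auto simp: img_def)
 ultimately show False using y by simp
 qed
 qed
qed

text \<open>Disk i is met only by lines from a set of measure at most \<open>2 * dm i\<close>.
  Young's inequality against the summable squared diameters then makes the sums of a weight of small
  energy small on most lines.\<close>

lemma aep_lines:
 assumes "aep P"
 shows "AE y in lborel. ALL J. bounded J --> is_interval J --> J ~= {} --> lin b y ` J <= Om --> P (J, lin b y)"
proof -
 \<comment> \<open>The offset \<open>y\<close> is confined as well, so that all these segments lie
   in \<open>csqr 0 k\<close>, over which squared diameters are summable.\<close>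
 define E where "E k = {y. y : {-real k..real k} & (EX J. J <= {- real k..real k} & is_interval J & J ~= {} & lin b y ` J <= Om & ~ P (J, lin b y))}" for k :: nat
 have 1: "AE y in lborel. y ~: E k" for k :: nat
 proof (rule AE_small)
 fix e :: real assume e: "0 < e"
 let ?B = "csqr 0 (real k)"
 obtain Pr where Pr: "ns (I ?B) (%i. eN ((dm i)^2)) = ennreal Pr" "0 <= Pr"
 using sum_diam_sq[OF compact_imp_bounded[OF compact_csqr], of 0 "real k"] by (metis ennreal_cases less_irrefl infinity_ennreal_def)
 \<comment> \<open>With this parameter the energy of the weight and the squared diameters contribute
   at most \<open>e / 2\<close> each; adding 1 avoids division by zero.\<close>
 define tu where "tu = e / (2 * (Pr + 1))"
 have tu: "tu > 0" "tu * Pr <= e / 2" using e Pr by (auto simp: tu_def field_simps)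
 have c: "cmod0 {gm : paths_in Om. ~ P gm}" using assms by (simp only: aep_def)
 have te: "tu * e / 2 > 0" using e tu by simp
 obtain rh G where r: "null1 G" "!!gm. gm : {gm : paths_in Om. ~ P gm} ==> gm ~: G ==> nI (img gm) rh >= 1" "ns UNIV (%i. (rh i)^2) < eN (tu * e / 2)"
 by (rule cmod0E[OF c te], rule that)
 define z where "z j = (SOME z. z : Q j)" for j
 have z: "z j : Q j" for j unfolding z_def using Q_ne by (meson ex_in_conv someI)
 define F where "F y = ns (I ?B) (%i. rh i * indicator {phi b (z i) - dm i..phi b (z i) + dm i} y)" for y
 have [measurable]: "F : borel_measurable lborel" unfolding F_def ns_suminf by measurable
 have "(\<integral>\<^sup>+y. F y \<partial>lborel) = ns (I ?B) (%i. rh i * eN (2 * dm i))"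
 unfolding F_def ns_suminf
 proof (subst nn_integral_suminf)
 show "(\<Sum>i. \<integral>\<^sup>+y. rh i * indicator {phi b (z i) - dm i..phi b (z i) + dm i} y * indicator (I ?B) i \<partial>lborel)
 = (\<Sum>i. rh i * eN (2 * dm i) * indicator (I ?B) i)"
 by (intro suminf_cong) (simp add: nn_integral_multc nn_integral_cmult_indicator emeasure_interval dm_nonneg)
 qed auto
 also have "... <= ns (I ?B) (%i. eN (1/tu) * (rh i)^2 + ennreal tu * eN ((dm i)^2))"
 proof (intro ns_mono order_refl)
 fix i
 show "rh i * eN (2 * dm i) <= eN (1/tu) * (rh i)^2 + ennreal tu * eN ((dm i)^2)"
 proof (cases "rh i")
 case (real a)
 have "0 <= (a / sqrt tu - sqrt tu * dm i)^2" by simp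
 also have "... = 1/tu * a^2 + tu * (dm i)^2 - a * (2 * dm i)"
 using tu by (simp add: power2_diff power_mult_distrib power_divide field_simps)
 finally have "eN (a * (2 * dm i)) <= eN (1/tu * a^2 + tu * (dm i)^2)" by (intro ennreal_leI) simp
 then show ?thesis using real tu dm_nonneg by (simp add: ennreal_mult' ennreal_power flip: ennreal_mult')
 next
 case top
 then show ?thesis using tu by (simp add: ennreal_mult_top ennreal_top_mult power2_eq_square)
 qed
 qed
 also have "... = eN (1/tu) * ns (I ?B) (%i. (rh i)^2) + ennreal tu * ennreal Pr"
 by (simp add: ns_add ns_cmult Pr)
 also have "... <= eN (1/tu) * eN (tu * e / 2) + ennreal tu * ennreal Pr"
 proof (intro add_right_mono mult_left_mono)
 have "ns (I ?B) (%i. (rh i)^2) <= ns UNIV (%i. (rh i)^2)" by (rule ns_mono) auto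
 then show "ns (I ?B) (%i. (rh i)^2) <= eN (tu * e / 2)" using r(3) by simp
 qed simp
 also have "... = eN (e / 2 + tu * Pr)"
 proof -
 have "eN (1/tu) * eN (tu * e / 2) = eN (e / 2)" using tu e by (subst ennreal_mult[symmetric]) auto
 moreover have "ennreal tu * ennreal Pr = eN (tu * Pr)" using tu Pr by (subst ennreal_mult) auto
 ultimately show ?thesis using tu e Pr by (simp add: ennreal_plus)
 qed
 also have "... <= eN e" using tu by (intro ennreal_leI) simp
 finally have IF: "(\<integral>\<^sup>+y. F y \<partial>lborel) <= eN e" .
 define A where "A = {y. 1 * F y >= 1}"
 show "EX A:sets lborel. emeasure lborel A <= eN e & (AE y in lborel. y : E k --> y : A)"
 proof (intro bexI conjI)
 show A: "A : sets lborel" unfolding A_def by measurable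
 have "emeasure lborel A <= 1 * (\<integral>\<^sup>+y. F y \<partial>lborel)"
 unfolding A_def using nn_integral_Markov_inequality[of F UNIV lborel 1] by simp
 then show "emeasure lborel A <= eN e" using IF by simp
 show "AE y in lborel. y : E k --> y : A" using null1_lines[OF r(1), of b]
 proof eventually_elim
 fix y assume y: "ALL J. bounded J --> (J, lin b y) ~: G"
 show "y : E k --> y : A"
 proof
 assume "y : E k"
 then obtain J where J: "y : {-real k..real k}" "J <= {- real k..real k}" "is_interval J" "J ~= {}" "lin b y ` J <= Om" "~ P (J, lin b y)"
 by (auto simp: E_def)
 have bJ: "bounded J" using J(2) by (rule bounded_subset[OF bounded_closed_interval])
 have "1 <= nI (img (J, lin b y)) rh"
 using y J bJ cont_lin by (intro r(2)) (auto simp: paths_in_def is_plane_path_def img_def)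
 also have "... = nI (img (J, lin b y)) (%i. rh i * indicator {phi b (z i) - dm i..phi b (z i) + dm i} y)"
 proof (intro ns_cong refl)
 fix i assume "i : I (img (J, lin b y))"
 then obtain t where t: "lin b y t : Q i" by (auto simp: meeting_def img_def)
 have "y : {phi b (z i) - dm i..phi b (z i) + dm i}" using phi_diam[OF bounded_Q z t, of b] by simp
 then show "rh i = rh i * indicator {phi b (z i) - dm i..phi b (z i) + dm i} y" by simp
 qed
 also have "... <= F y" unfolding F_def
 proof (intro ns_mono I_mono order_refl)
 show "img (J, lin b y) <= ?B" using J(1,2) by (fastforce simp: img_def csqr_def ninf_def lin_def abs_le_iff)
 qed
 finally show "y : A" by (simp add: A_def)
 qed
 qed
 qed
 qed
 have "AE y in lborel. ALL k::nat. y ~: E k" by (rule AE_all_nat) (rule 1)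
 then show ?thesis
 proof eventually_elim
 fix y assume y: "ALL k::nat. y ~: E k"
 show "ALL J. bounded J --> is_interval J --> J ~= {} --> lin b y ` J <= Om --> P (J, lin b y)"
 proof (intro allI impI)
 fix J assume J: "bounded J" "is_interval J" "J ~= {}" "lin b y ` J <= Om"
 then obtain k :: nat where "insert y J <= {- real k..real k}" using bounded_nat_interval[of "insert y J"] by auto
 then show "P (J, lin b y)" using y J unfolding E_def by blast
 qed
 qed
qed

end

section \<open>The chain lemma\<close>

context rel_carpet begin

definition l2loc :: "(nat => ennreal) => bool" where
 "l2loc rh \<longleftrightarrow> (ALL L. compact L --> L <= Om --> nI L (%i. (rh i)^2) < iN)"

lemma l2locD: "l2loc rh ==> compact L ==> L <= Om ==> nI L (%i. (rh i)^2) < iN"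
 by (auto simp: l2loc_def)

lemma sq_add_le: "((a::ennreal) + b)^2 <= 2 * a\<^sup>2 + 2 * b\<^sup>2"
proof (cases a; cases b)
 fix r s assume a: "a = eN r" "0 <= r" "b = eN s" "0 <= s"
 have "0 <= (r - s)^2" by simp
 then have "(r + s)^2 <= 2 * r^2 + 2 * s^2" by (simp add: power2_diff power2_sum)
 then have "eN ((r + s)^2) <= eN (2 * r^2 + 2 * s^2)" by (rule ennreal_leI)
 also have "eN (2 * r^2 + 2 * s^2) = 2 * eN (r^2) + 2 * eN (s^2)" by (simp add: ennreal_plus ennreal_mult')
 finally show ?thesis using a by (simp add: ennreal_power flip: ennreal_plus)
qed (auto simp: power2_eq_square ennreal_mult_top ennreal_top_mult)

lemma l2_add: "ns A (%i. (rh i)^2) < iN ==> ns A (%i. (sg i)^2) < iN ==> ns A (%i. (rh i + sg i)^2) < iN"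
proof -
 assume a: "ns A (%i. (rh i)^2) < iN" "ns A (%i. (sg i)^2) < iN"
 have "ns A (%i. (rh i + sg i)^2) <= ns A (%i. 2 * (rh i)^2 + 2 * (sg i)^2)"
 by (intro ns_mono sq_add_le) auto
 also have "... = 2 * ns A (%i. (rh i)^2) + 2 * ns A (%i. (sg i)^2)" by (simp add: ns_add ns_cmult)
 also have "... < iN" using a by (simp add: ennreal_mult_less_top)
 finally show ?thesis .
qed

lemma l2loc_add: "l2loc rh ==> l2loc sg ==> l2loc (%i. rh i + sg i)"
 unfolding l2loc_def using l2_add by blast

lemma l2loc_cmult: "l2loc rh ==> c < iN ==> l2loc (%i. c * rh i)"
 unfolding l2loc_def
 by (auto simp: power_mult_distrib ns_cmult ennreal_mult_less_top power_less_top_ennreal)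

lemma l2loc_mono: "l2loc rh ==> (!!i. sg i <= rh i) ==> l2loc sg"
proof -
 assume a: "l2loc rh" "!!i. sg i <= rh i"
 have "ns A (%i. (sg i)^2) <= ns A (%i. (rh i)^2)" for A
 using a(2) by (intro ns_mono power_mono) auto
 then show ?thesis using a(1) unfolding l2loc_def by (meson order_le_less_trans)
qed

lemma l2loc_dm: "l2loc (%i. eN (dm i))"
 unfolding l2loc_def using sum_diam_sq[OF compact_imp_bounded] by (simp add: ennreal_power dm_nonneg)

lemma exhaust:
 "EX C. (ALL n::nat. compact (C n)) & (ALL n. C n <= Om) & (ALL K. compact K --> K <= Om --> (EX N. ALL n>=N. K <= C n))"
proof (rule open_Union_compact_subsets[OF open_Om])
 fix C :: "nat => complex set"
 assume "!!n. compact (C n)" "!!n. C n <= Om" "!!K. compact K ==> K <= Om ==> EX N. ALL n>=N. K <= C n"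
 then show ?thesis by (intro exI[of _ C]) simp
qed

text \<open>The weight is restricted to each member of a countable compact exhaustion, where
  \<open>aep_l2\<close> applies.\<close>

lemma aep_l2loc:
 assumes "l2loc rh"
 shows "aep (%gm. ALL X L. X <= img gm --> compact L --> L <= Om --> X <= L --> nI X rh < iN)"
proof -
 obtain C where C0: "ALL n::nat. compact (C n)" "ALL n. C n <= Om" "ALL K. compact K --> K <= Om --> (EX N. ALL n>=N. K <= C n)"
 using exhaust by blast
 then have C: "!!n. compact (C n)" "!!n. C n <= Om" "!!K. compact K ==> K <= Om ==> EX N. ALL n>=N. K <= C n" by auto
 have "aep (%gm. ALL n. nI (img gm) (%i. rh i * indicator (I (C n)) i) < iN)"
 proof (rule aep_all, rule aep_l2)
 fix n
 have "ns UNIV (%i. (rh i * indicator (I (C n)) i)^2) = nI (C n) (%i. (rh i)^2)"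
 unfolding ns_def by (intro nn_integral_cong) (auto split: split_indicator)
 then show "ns UNIV (%i. (rh i * indicator (I (C n)) i)^2) < iN"
 using l2locD[OF assms C(1,2)] by simp
 qed
 then show ?thesis
 proof (rule aep_mono, intro allI impI)
 fix gm X L assume a: "ALL n. nI (img gm) (%i. rh i * indicator (I (C n)) i) < iN"
 and X: "X <= img gm" "compact L" "L <= Om" "X <= L"
 obtain n where n: "L <= C n" using C(3)[OF X(2,3)] by blast
 have "nI X rh <= nI (img gm) (%i. rh i * indicator (I (C n)) i)"
 using I_mono[of X "C n"] X n by (intro ns_mono I_mono) (auto split: split_indicator)
 then show "nI X rh < iN" using a order_le_less_trans by blast
 qed
qed

lemma path_cont: "gm : paths_in Om ==> {s..t} <= fst gm ==> continuous_on {s..t} (snd gm)"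
 unfolding paths_in_def is_plane_path_def
 using continuous_on_subset[OF _ order_trans[OF _ closure_subset]] by blast

lemma first_hit:
 fixes h :: "real => complex"
 assumes h: "continuous_on {a..b} h" and S: "h a : S" and t: "t : {a..b}" "h t : cQ i"
 shows "EX a1:{a..b}. a1 <= t & h a1 : fr i & (ALL tu:{a..<a1}. h tu ~: cQ i) & (ALL tu:{a..a1}. h tu ~: Q i)"
proof -
 let ?C = "{a..b} Int h -` (cQ i)"
 have "closed ?C" using continuous_closed_preimage[OF h closed_atLeastAtMost closed_closure] .
 then have "compact ?C" by (meson bounded_closed_interval bounded_subset compact_eq_bounded_closed inf_le1)
 moreover have "?C ~= {}" using t by blast
 ultimately obtain a1 where a1: "a1 : ?C" "!!tu. tu : ?C ==> a1 <= tu" using compact_attains_inf by metis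
 have "h a1 : fr i"
 proof (rule ccontr)
 assume n: "h a1 ~: fr i"
 then have q: "h a1 : Q i" using a1(1) fr_Q by auto
 have "a : {a..a1}" "a1 : {a..a1}" using a1(1) by auto
 then have ne: "h ` {a..a1} Int S ~= {}" and iI: "i : I (h ` {a..a1})" using S q unfolding meeting_def by blast+
 have "connected (h ` {a..a1})" using a1(1) h
 by (intro connected_continuous_image) (auto intro: continuous_on_subset)
 then have "h ` {a..a1} Int fr i ~= {}" using ne iI by (intro cross)
 then obtain tu where tu: "tu : {a..a1}" "h tu : fr i" by blast
 then have "tu : ?C" using a1(1) fr_Q by auto
 then have "tu = a1" using a1(2)[of tu] tu by auto
 then show False using tu n by simp
 qed
 moreover have "h tu ~: cQ i" if "tu : {a..<a1}" for tu using a1(1) a1(2)[of tu] that by auto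
 moreover have "h tu ~: Q i" if "tu : {a..a1}" for tu
 using calculation that closure_subset[of "Q i"] fr_Q[of i] by (cases "tu = a1") auto
 ultimately show ?thesis using a1(1) a1(2)[of t] t by (intro bexI[of _ a1]) auto
qed

lemma last_hit:
 fixes h :: "real => complex"
 assumes h: "continuous_on {a..b} h" and S: "h b : S" and t: "t : {a..b}" "h t : cQ i"
 shows "EX b1:{a..b}. t <= b1 & h b1 : fr i & (ALL tu:{b1<..b}. h tu ~: cQ i) & (ALL tu:{b1..b}. h tu ~: Q i)"
proof -
 have "EX a1:{-b..-a}. a1 <= -t & (%tu. h (-tu)) a1 : fr i & (ALL tu:{-b..<a1}. (%tu. h (-tu)) tu ~: cQ i) & (ALL tu:{-b..a1}. (%tu. h (-tu)) tu ~: Q i)"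
 using assms by (intro first_hit) (auto intro!: continuous_on_compose2[OF h] continuous_intros)
 then obtain a1 where a1: "a1\<in>{-b..-a}" "a1 <= -t" "h (- a1) : fr i" "ALL tu:{-b..<a1}. h (-tu) ~: cQ i" "ALL tu:{-b..a1}. h (-tu) ~: Q i"
 by auto
 show ?thesis
 proof (intro bexI[of _ "- a1"] conjI ballI)
 fix tu assume "tu : {- a1<..b}" then show "h tu ~: cQ i" using a1(4)[rule_format, of "-tu"] by auto
 next
 fix tu assume "tu : {- a1..b}" then show "h tu ~: Q i" using a1(5)[rule_format, of "-tu"] by auto
 qed (use a1 in auto)
qed

text \<open>A path is replaced by a chain of parameter intervals that avoid finitely many given
  disks. Linked intervals touch a common circle, and the jump between them costs at most the
  oscillation on that circle.\<close>

definition touch :: "(real => complex) => nat => real \<times> real => bool" where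
 "touch h j p \<longleftrightarrow> (EX tu:{fst p..snd p}. h tu : fr j)"
definition link :: "(real => complex) => nat set => real \<times> real => real \<times> real => bool" where
 "link h J p q \<longleftrightarrow> (EX j:J. touch h j p & touch h j q)"
definition piece :: "(real => complex) => nat set => real => real => real \<times> real => bool" where
 "piece h F a b p \<longleftrightarrow> a <= fst p & fst p <= snd p & snd p <= b & h (fst p) : S & h (snd p) : S & (ALL i:F. h ` {fst p..snd p} Int Q i = {})"

text \<open>Induction on the disks to be avoided: the stretch between the first and the last visit
  to \<open>cQ i\<close> is cut out, and the circle of disk i links what is left on either
  side.\<close>

lemma chain_exists:
 fixes h :: "real => complex"
 assumes h: "continuous_on {s..t} h" and F: "finite F"
 shows "!!a b. s <= a ==> a <= b ==> b <= t ==> h a : S ==> h b : S ==>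
 EX ps. ps ~= [] & (ALL p:set ps. piece h F a b p) & fst (hd ps) = a & snd (last ps) = b & successively (link h (I (h ` {s..t}))) ps"
 using F
proof (induction F)
 case empty
 then show ?case by (intro exI[of _ "[(a,b)]"]) (auto simp: piece_def)
next
 case (insert i F)
 have hab: "continuous_on {a..b} h" using h insert.prems by (auto intro: continuous_on_subset)
 show ?case
 proof (cases "h ` {a..b} Int Q i = {}")
 case True
 obtain ps where ps: "ps ~= []" "ALL p:set ps. piece h F a b p" "fst (hd ps) = a" "snd (last ps) = b" "successively (link h (I (h ` {s..t}))) ps"
 using insert.IH[OF insert.prems] by blast
 have "ALL p:set ps. piece h (insert i F) a b p"
 proof
 fix p assume "p : set ps"
 then have p: "piece h F a b p" using ps by blast
 then have "{fst p..snd p} <= {a..b}" by (auto simp: piece_def)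
 then have "h ` {fst p..snd p} Int Q i = {}" using True by blast
 then show "piece h (insert i F) a b p" using p by (simp add: piece_def)
 qed
 then show ?thesis using ps by (intro exI[of _ ps]) simp
 next
 case False
 then obtain tu where tu: "tu : {a..b}" "h tu : Q i" by blast
 then have tu': "h tu : cQ i" using closure_subset by blast
 obtain a1 where a1: "a1 : {a..b}" "a1 <= tu" "h a1 : fr i" "ALL tu:{a..a1}. h tu ~: Q i"
 using first_hit[OF hab insert.prems(4) tu(1) tu'] by blast
 obtain b1 where b1: "b1 : {a..b}" "tu <= b1" "h b1 : fr i" "ALL tu:{b1..b}. h tu ~: Q i"
 using last_hit[OF hab insert.prems(5) tu(1) tu'] by blast
 have S1: "h a1 : S" "h b1 : S" using a1 b1 fr_S by auto
 obtain ps where ps: "ps ~= []" "ALL p:set ps. piece h F a a1 p" "fst (hd ps) = a" "snd (last ps) = a1" "successively (link h (I (h ` {s..t}))) ps"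
 using insert.IH[of a a1] insert.prems a1 S1 by auto
 obtain qs where qs: "qs ~= []" "ALL p:set qs. piece h F b1 b p" "fst (hd qs) = b1" "snd (last qs) = b" "successively (link h (I (h ` {s..t}))) qs"
 using insert.IH[of b1 b] insert.prems b1 S1 by auto
 have "i : I (h ` {s..t})" using tu insert.prems by (auto simp: meeting_def)
 moreover have "touch h i (last ps)" using ps a1 by (auto simp: touch_def piece_def intro!: bexI[of _ a1])
 moreover have "touch h i (hd qs)" using qs b1 by (auto simp: touch_def piece_def intro!: bexI[of _ b1])
 ultimately have "successively (link h (I (h ` {s..t}))) (ps @ qs)"
 using ps qs by (auto simp: successively_append_iff link_def)
 moreover have "ALL p:set (ps @ qs). piece h (insert i F) a b p"
 proof
 fix p assume "p : set (ps @ qs)"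
 then consider "piece h F a a1 p" | "piece h F b1 b p" using ps qs by auto
 then show "piece h (insert i F) a b p" using a1 b1 by cases (auto simp: piece_def)
 qed
 ultimately show ?thesis using ps qs by (intro exI[of _ "ps @ qs"]) auto
 qed
qed

lemma card_adjacent: assumes "finite (K :: nat set)" "!!k l. k : K ==> l : K ==> k + 2 <= l ==> False" shows "card K <= 2"
proof (cases "K = {}")
 case False
 have "K <= {Min K, Suc (Min K)}"
 proof
 fix k assume k: "k : K"
 then have "Min K <= k" "~ Min K + 2 <= k" using assms False by (auto simp: Min_in dest: assms(2)[OF Min_in[OF assms(1) False]])
 then show "k : {Min K, Suc (Min K)}" by auto
 qed
 then have "card K <= card {Min K, Suc (Min K)}" by (intro card_mono) auto
 then show ?thesis by simp
qed simp

text \<open>In a chain of least length no circle touches two pieces that are not neighbours. Hence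
  the linking circles are distinct, which gives the first sum without a factor, and every disk met
  by the pieces is counted at most twice.\<close>

lemma chain_bound:
 assumes g: "gm : paths_in Om" and u: "ug f rh gm" and f: "fb f"
 and st: "s : fst gm" "t : fst gm" "s <= t" "snd gm s : S" "snd gm t : S" and F: "finite F"
 defines "J == I (snd gm ` {s..t})"
 shows "eN (abs(f (snd gm s) - f (snd gm t))) <= ns J (Oe f) + 2 * ns (J - F) rh"
proof -
 define h where "h = snd gm"
 have sub: "{s..t} <= fst gm" using g st interval_sub by (auto simp: paths_in_def is_plane_path_def)
 have h: "continuous_on {s..t} h" unfolding h_def by (rule path_cont[OF g sub])
 define Ch where "Ch ps \<longleftrightarrow> ps ~= [] & (ALL p:set ps. piece h F s t p) & s : {fst (hd ps)..snd (hd ps)} & t : {fst (last ps)..snd (last ps)}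
 & successively (link h J) ps" for ps
 have "EX ps. Ch ps"
 proof -
 obtain ps where "ps ~= []" "ALL p:set ps. piece h F s t p" "fst (hd ps) = s" "snd (last ps) = t" "successively (link h J) ps"
 using chain_exists[OF h F, of s t] st unfolding h_def J_def by auto
 moreover then have "piece h F s t (hd ps)" "piece h F s t (last ps)" by auto
 ultimately have "Ch ps" unfolding Ch_def by (auto simp: piece_def)
 then show ?thesis by blast
 qed
 then obtain ps where ps: "Ch ps" "!!qs. Ch qs ==> length ps <= length qs"
 using ex_has_least_nat[of Ch _ length] by blast
 define n where "n = length ps"
 have n0: "n > 0" using ps(1) by (auto simp: Ch_def n_def)
 have pk: "piece h F s t (ps ! k)" if "k < n" for k using ps(1) that by (auto simp: Ch_def n_def)
 \<comment> \<open>A disk touching both pieces would link them directly and shorten the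
   chain.\<close>
 have nolink: False if "k + 2 <= l" "l < n" "i : J" "touch h i (ps ! k)" "touch h i (ps ! l)" for k l i
 proof -
 let ?qs = "take (Suc k) ps @ drop l ps"
 have e: "last (take (Suc k) ps) = ps ! k" "hd (drop l ps) = ps ! l" "take (Suc k) ps ~= []" "drop l ps ~= []"
 using that n0 by (auto simp: n_def last_conv_nth hd_drop_conv_nth min_def)
 have s1: "successively (link h J) (take (Suc k) ps)" "successively (link h J) (drop l ps)"
 using ps(1) successively_append_iff[of "link h J" "take (Suc k) ps" "drop (Suc k) ps"]
 successively_append_iff[of "link h J" "take l ps" "drop l ps"] by (auto simp: Ch_def)
 have "Ch ?qs" unfolding Ch_def
 proof (intro conjI)
 show "successively (link h J) ?qs" using s1 e that by (auto simp: successively_append_iff link_def)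
 show "ALL p:set ?qs. piece h F s t p" using ps(1) by (auto simp: Ch_def dest: in_set_takeD in_set_dropD)
 have "hd ?qs = hd ps" using n0 by (cases ps) (auto simp: n_def)
 then show "s : {fst (hd ?qs)..snd (hd ?qs)}" using ps(1) by (simp add: Ch_def)
 have "last ?qs = last ps" using that by (simp add: n_def last_drop)
 then show "t : {fst (last ?qs)..snd (last ?qs)}" using ps(1) by (simp add: Ch_def)
 qed (use e in simp)
 then have "n <= length ?qs" using ps(2)[of ?qs] by (simp only: n_def)
 then show False using that by (simp add: n_def)
 qed
 have "EX j tu sg. j : J & tu : {fst (ps!k)..snd (ps!k)} & h tu : fr j & sg : {fst (ps!Suc k)..snd (ps!Suc k)} & h sg : fr j" if "Suc k < n" for k
 proof -
 have "link h J (ps ! k) (ps ! Suc k)" using ps(1) that by (auto simp: Ch_def n_def successively_conv_nth)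
 then show ?thesis unfolding link_def touch_def by blast
 qed
 then obtain j tu sg where jts: "!!k. Suc k < n ==> j k : J & tu k : {fst (ps!k)..snd (ps!k)} & h (tu k) : fr (j k)
 & sg k : {fst (ps!Suc k)..snd (ps!Suc k)} & h (sg k) : fr (j k)" by metis
 \<comment> \<open>Piece k is entered at \<open>en k\<close> and left at \<open>ex k\<close>; from
   \<open>ex k\<close> to \<open>en (Suc k)\<close> the jump takes place on the circle of
   \<open>j k\<close>.\<close>
 define en where "en k = (if k = 0 then s else sg (k - 1))" for k
 define ex where "ex k = (if Suc k = n then t else tu k)" for k
 have en: "en k : {fst (ps!k)..snd (ps!k)}" "h (en k) : S" if "k < n" for k
 using that jts[of "k - 1"] ps(1) n0 st by (auto simp: en_def Ch_def hd_conv_nth h_def intro: subsetD[OF fr_S])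
 have ex: "ex k : {fst (ps!k)..snd (ps!k)}" "h (ex k) : S" if "k < n" for k
 proof -
 have kn: "k < n" by (rule that)
 show "ex k : {fst (ps!k)..snd (ps!k)}" "h (ex k) : S"
 proof (atomize (full), cases "Suc k = n")
 case True
 have "ps ~= []" using n0 by (auto simp: n_def)
 then have "last ps = ps ! (n - 1)" by (simp add: last_conv_nth n_def)
 then have "last ps = ps ! k" using True by auto
 then show "ex k : {fst (ps!k)..snd (ps!k)} & h (ex k) : S" using True ps(1) st by (simp add: ex_def Ch_def h_def)
 next
 case False
 then have "Suc k < n" using kn by simp
 from jts[OF this] show "ex k : {fst (ps!k)..snd (ps!k)} & h (ex k) : S"
 using False by (auto simp: ex_def intro: subsetD[OF fr_S])
 qed
 qed
 define Ik where "Ik k = I (h ` {fst (ps!k)..snd (ps!k)})" for k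
 have IkJ: "Ik k <= J - F" if "k < n" for k
 proof
 fix i assume "i : Ik k"
 then obtain tu where "tu : {fst (ps!k)..snd (ps!k)}" "h tu : Q i" unfolding Ik_def meeting_def by blast
 moreover have "ALL i:F. h ` {fst (ps!k)..snd (ps!k)} Int Q i = {}" "{fst (ps!k)..snd (ps!k)} <= {s..t}"
 using pk[OF that] by (auto simp: piece_def)
 ultimately show "i : J - F" unfolding J_def meeting_def h_def by blast
 qed
 have Iktouch: "touch h i (ps ! k)" if "k < n" "i : Ik k" for i k
 proof -
 have "connected (h ` {fst (ps!k)..snd (ps!k)})"
 using h pk[OF that(1)] by (intro connected_continuous_image) (auto simp: piece_def intro: continuous_on_subset)
 moreover have "fst (ps!k) : {fst (ps!k)..snd (ps!k)}" "h (fst (ps!k)) : S" using pk[OF that(1)] by (auto simp: piece_def)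
 then have "h ` {fst (ps!k)..snd (ps!k)} Int S ~= {}" by blast
 ultimately have "h ` {fst (ps!k)..snd (ps!k)} Int fr i ~= {}" using that(2) unfolding Ik_def by (intro cross)
 then show ?thesis by (auto simp: touch_def)
 qed
 have A: "eN (abs(f (h (en k)) - f (h (ex k)))) <= ns (Ik k) rh" if k: "k < n" for k
 proof -
 have *: "eN (abs(f (h a) - f (h b))) <= ns (Ik k) rh" if "a : {fst (ps!k)..snd (ps!k)}" "b : {fst (ps!k)..snd (ps!k)}" "a <= b" "h a : S" "h b : S" for a b
 proof -
 have "a : {s..t}" "b : {s..t}" using that pk[OF k] by (auto simp: piece_def)
 then have "a : fst gm" "b : fst gm" using sub by auto
 then have "eN (abs(f (h a) - f (h b))) <= nI (h ` {a..b}) rh"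
 using u that unfolding ug_def h_def by blast
 also have "... <= ns (Ik k) rh" unfolding Ik_def using that by (intro ns_mono I_mono image_mono) auto
 finally show ?thesis .
 qed
 show ?thesis using *[of "en k" "ex k"] *[of "ex k" "en k"] en[OF k] ex[OF k]
 by (cases "en k <= ex k") (auto simp: abs_minus_commute)
 qed
 have B: "(abs(f (h (ex k)) - f (h (en (Suc k))))) <= Os f (j k)" if "Suc k < n" for k
 using jts[OF that] that O_ge[OF f] by (simp add: ex_def en_def)
 have "eN (abs(f (h (en 0)) - f (h (ex m)))) <= (\<Sum>k\<le>m. ns (Ik k) rh) + (\<Sum>k<m. eN (Os f (j k)))" if "m < n" for m
 using that
 proof (induction m)
 case 0
 then show ?case using A[of 0] by simp
 next
 case (Suc m)
 let ?a = "f (h (en 0))" and ?b = "f (h (ex m))" and ?c = "f (h (en (Suc m)))" and ?d = "f (h (ex (Suc m)))"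
 have "eN (abs(?a - ?d)) <= eN ((abs(?a - ?b)) + Os f (j m) + (abs(?c - ?d)))"
 using B[OF Suc.prems] by (intro ennreal_leI) linarith
 also have "... = eN (abs(?a - ?b)) + eN (Os f (j m)) + eN (abs(?c - ?d))"
 using O_nonneg[OF f] by (simp add: ennreal_plus)
 also have "... <= ((\<Sum>k\<le>m. ns (Ik k) rh) + (\<Sum>k<m. eN (Os f (j k)))) + eN (Os f (j m)) + ns (Ik (Suc m)) rh"
 using Suc by (intro add_mono A order_refl) auto
 finally show ?case by (simp add: ac_simps)
 qed
 from this[of "n - 1"] have "eN (abs(f (h s) - f (h t))) <= (\<Sum>k\<le>n-1. ns (Ik k) rh) + (\<Sum>k<n-1. eN (Os f (j k)))"
 using n0 by (simp add: en_def ex_def)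
 also have "(\<Sum>k\<le>n-1. ns (Ik k) rh) = (\<Sum>k<n. ns (Ik k) rh)" using n0 by (intro sum.cong) auto
 also have "... <= 2 * ns (J - F) rh"
 proof -
 have "(\<Sum>k<n. ns (Ik k) rh) = ns UNIV (%i. \<Sum>k<n. rh i * indicator (Ik k) i)"
 unfolding ns_def by (subst nn_integral_sum[symmetric]) auto
 also have "... <= ns UNIV (%i. 2 * (rh i * indicator (J - F) i))"
 proof (intro ns_mono order_refl)
 fix i
 \<comment> \<open>A disk met by a piece also touches it by \<open>cross\<close>, so the pieces that
   meet disk i are neighbours.\<close>
 have c: "card {k\<in>{..<n}. i : Ik k} <= 2"
 proof (rule card_adjacent)
 fix k l assume "k : {k\<in>{..<n}. i : Ik k}" "l : {k\<in>{..<n}. i : Ik k}" "k + 2 <= l"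
 then have kl: "k < n" "l < n" "i : Ik k" "i : Ik l" "k + 2 <= l" by auto
 have "i : J" using IkJ[OF kl(1)] kl(3) by blast
 then show False using nolink[OF kl(5) kl(2)] Iktouch kl by blast
 qed simp
 have "(\<Sum>k<n. rh i * indicator (Ik k) i) = (\<Sum>k\<in>{..<n}. if i : Ik k then rh i else 0)"
 by (intro sum.cong) auto
 also have "... = (\<Sum>k\<in>{k\<in>{..<n}. i : Ik k}. rh i)" by (rule sum.inter_filter[symmetric]) simp
 also have "... = of_nat (card {k\<in>{..<n}. i : Ik k}) * rh i" by simp
 also have "... <= 2 * (rh i * indicator (J - F) i)"
 proof (cases "i : J - F")
 case True
 have "(of_nat (card {k\<in>{..<n}. i : Ik k}) :: ennreal) <= of_nat 2" using c by (simp only: of_nat_le_iff)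
 then show ?thesis using True by (simp add: mult_right_mono)
 next
 case False
 then have "{k\<in>{..<n}. i : Ik k} = {}" using IkJ by blast
 then have c0: "card {k\<in>{..<n}. i : Ik k} = 0" by (simp only: card.empty)
 show ?thesis unfolding c0 by simp
 qed
 finally show "(\<Sum>k<n. rh i * indicator (Ik k) i) <= 2 * (rh i * indicator (J - F) i)" .
 qed
 also have "... = 2 * ns (J - F) rh" by (subst ns_cmult) (simp add: ns_def)
 finally show ?thesis .
 qed
 also have "(\<Sum>k<n-1. eN (Os f (j k))) <= ns J (Oe f)"
 proof -
 \<comment> \<open>The same circle at two links would again be a shortcut.\<close>
 have inj: "inj_on j {..<n-1}"
 proof (rule inj_onI)
 have *: "~ (k < l & Suc l < n & j k = j l)" for k l
 proof
 assume a: "k < l & Suc l < n & j k = j l"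
 then have "touch h (j k) (ps ! k)" "touch h (j k) (ps ! Suc l)" "j k : J"
 using jts[of k] jts[of l] by (auto simp: touch_def)
 then show False using nolink[of k "Suc l" "j k"] a by auto
 qed
 fix k l assume "k : {..<n-1}" "l : {..<n-1}" "j k = j l"
 then show "k = l" using *[of k l] *[of l k] by (cases k l rule: linorder_cases) auto
 qed
 have "(\<Sum>k<n-1. eN (Os f (j k))) = (\<Sum>i\<in>j ` {..<n-1}. Oe f i)"
 by (subst sum.reindex[OF inj]) simp
 also have "... = ns (j ` {..<n-1}) (Oe f)" by (simp add: ns_finite)
 also have "... <= ns J (Oe f)" using jts by (intro ns_mono) auto
 finally show ?thesis .
 qed
 finally show ?thesis by (simp add: h_def ac_simps add_mono)
qed

text \<open>In \<open>chain_bound\<close> only the tail of \<open>rh\<close> outside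
  \<open>F\<close> is left, and \<open>F\<close> is arbitrary. So any locally square summable upper
  gradient may be replaced by the oscillation.\<close>

lemma ug_osc:
 assumes g: "gm : paths_in Om" and u: "ug f rh gm" and f: "fb f"
 and fin: "!!X L. X <= img gm ==> compact L ==> L <= Om ==> X <= L ==> nI X rh < iN"
 shows "ug f (Oe f) gm"
 unfolding ug_def
proof (intro ballI impI)
 fix s t assume st: "s : fst gm" "t : fst gm" "s <= t" "snd gm s : S" "snd gm t : S"
 let ?J = "I (snd gm ` {s..t})"
 have sub: "{s..t} <= fst gm" using g st interval_sub by (auto simp: paths_in_def is_plane_path_def)
 have h: "continuous_on {s..t} (snd gm)" by (rule path_cont[OF g sub])
 have im: "snd gm ` {s..t} <= img gm" using sub by (auto simp: img_def)
 have "ns ?J rh < iN"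
 using im g by (intro fin[of _ "snd gm ` {s..t}"] compact_continuous_image h) (auto simp: paths_in_def)
 show "eN (abs(f (snd gm s) - f (snd gm t))) <= ns ?J (Oe f)"
 proof (rule ennreal_le_epsilon)
 fix e :: real assume "0 < e"
 then obtain F where F: "finite F" "ns (?J - F) rh < eN (e/2)" using ns_tail[OF \<open>ns ?J rh < iN\<close>, of "e/2"] by auto
 have "eN (abs(f (snd gm s) - f (snd gm t))) <= ns ?J (Oe f) + 2 * ns (?J - F) rh"
 by (rule chain_bound[OF g u f st F(1)])
 also have "... <= ns ?J (Oe f) + 2 * eN (e/2)"
 using F by (intro add_mono mult_left_mono) auto
 also have "2 * eN (e/2) = eN e" using \<open>0 < e\<close> ennreal_mult'[of 2 "e/2"] by simp
 finally show "eN (abs(f (snd gm s) - f (snd gm t))) <= ns ?J (Oe f) + eN e" .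
 qed
qed

lemma aep_ug_osc:
 assumes "aep (ug f rh)" "l2loc rh" "fb f"
 shows "aep (ug f (Oe f))"
 using aep_conj[OF assms(1) aep_l2loc[OF assms(2)]]
 by (rule aep_mono) (use ug_osc[OF _ _ assms(3)] in blast)

end

section \<open>Sobolev functions and test functions\<close>

context rel_carpet begin

text \<open>Real-valued local Sobolev functions, stated over compact sets in place of balls. The
  sums with \<open>M\<close> are handled separately: \<open>sob_W12_loc\<close> derives them from
  local boundedness.\<close>

definition sob :: "(complex => real) => bool" where
 "sob f \<longleftrightarrow> fb f & l2loc (Oe f) & aep (ug f (Oe f))"

lemma ns_ball_compact:
 assumes "!!x r. ball x r \<subset>\<subset> Om ==> nI (ball x r) w < iN" "compact L" "L <= Om"
 shows "nI L w < iN"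
proof -
 have "ALL x:L. EX r>0. ball x r \<subset>\<subset> Om"
 proof
 fix x assume "x : L"
 then obtain r where r: "r > 0" "cball x r <= Om" using assms(3) open_Om open_contains_cball by blast
 have "closure (ball x r) <= cball x r" by (rule closure_minimal) auto
 then have "ball x r \<subset>\<subset> Om" using r bounded_subset[of "cball x r"] unfolding ccontained_def by (auto simp: compact_eq_bounded_closed)
 then show "EX r>0. ball x r \<subset>\<subset> Om" using r by blast
 qed
 then obtain r where r: "!!x. x : L ==> r x > 0 & ball x (r x) \<subset>\<subset> Om" by metis
 have "L <= (\<Union>x\<in>L. ball x (r x))" using r by force
 then obtain D where D: "D <= L" "finite D" "L <= (\<Union>x\<in>D. ball x (r x))"
 using compactE_image[OF assms(2), of L "%x. ball x (r x)"] by auto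
 have "nI (\<Union>x\<in>D. ball x (r x)) w < iN" using D(2,1)
 proof (induction D)
 case empty then show ?case by (simp add: meeting_def)
 next
 case (insert x D)
 have "nI (\<Union>x\<in>insert x D. ball x (r x)) w <= nI (ball x (r x)) w + nI (\<Union>x\<in>D. ball x (r x)) w"
 using ns_Un_le by (simp add: I_Un)
 also have "... < iN" using insert assms(1) r by (auto simp: ennreal_add_less_top)
 finally show ?case .
 qed
 then show ?thesis using ns_mono[OF I_mono[OF D(3)] order_refl, of w] by (rule order_le_less_trans[rotated])
qed

lemma W12_locD:
 assumes g: "g : W12_loc ver Om Q"
 defines "g' == %x. real_of_ereal (g x)"
 shows "sob g'" "!!i. peri_sup Q g i = ereal (Ms g' i)" "!!i. peri_inf Q g i = ereal (ms g' i)" "!!i. osc Q g i = Oe g' i"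
 "!!i x. x : fr i ==> g x = ereal (g' x)"
proof -
 have fin: "!!i. (abs(peri_sup Q g i)) ~= iN & (abs(peri_inf Q g i)) ~= iN" using g unfolding W12_loc_def by simp
 note pf = peri_finite_real[OF fin, folded g'_def]
 show "!!i. peri_sup Q g i = ereal (Ms g' i)" by (rule pf(3))
 show "!!i. peri_inf Q g i = ereal (ms g' i)" by (rule pf(5))
 show "!!i x. x : fr i ==> g x = ereal (g' x)" unfolding g'_def by (rule pf(2))
 show o: "!!i. osc Q g i = Oe g' i" by (rule pf(4))
 have oe: "osc Q g = (Oe g')" by (rule ext) (rule o)
 have "upper_gradient ver Om Q g (osc Q g)" using g by (simp add: W12_loc_def)
 then have a: "aep (ug g' (Oe g'))" unfolding oe g'_def by (rule upper_gradient_aep)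
 have "l2loc (Oe g')" unfolding l2loc_def
 proof (intro allI impI)
 fix L assume L: "compact L" "L <= Om"
 show "nI L (O2 g') < iN"
 proof (rule ns_ball_compact[OF _ L])
 fix x r assume "ball x r \<subset>\<subset> Om"
 then have "(\<Sum>\<^sub>\<infinity>i\<in>I (ball x r). (osc Q g i)^2) < iN" using g unfolding W12_loc_def by simp
 then show "nI (ball x r) (O2 g') < iN" by (simp add: ns_infsum oe)
 qed
 qed
 then show "sob g'" using a pf(1) by (simp add: sob_def)
qed

lemma sob_real: "(%x. ereal (f x)) : W12_loc ver Om Q ==> sob f"
 using W12_locD(1)[of "%x. ereal (f x)"] by simp

lemma e2_sq: "e2ennreal ((ereal a)^2 * ereal b) = eN (a^2 * b)"
 by (simp add: power2_eq_square e2ennreal_ereal)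

lemma Ms_bound: "(!!x. x : fr i ==> (abs(f x)) <= C) ==> (abs(Ms f i)) <= C"
proof -
 assume a: "!!x. x : fr i ==> (abs(f x)) <= C"
 obtain y where y: "y : fr i" using fr_ne by blast
 have "bdd_above (f ` fr i)" using a by (intro bdd_aboveI[of _ C]) (auto simp: abs_le_iff)
 then have "f y <= Ms f i" using y by (intro cSUP_upper)
 moreover have "Ms f i <= C" using a by (intro Ms_least) (simp add: abs_le_iff)
 ultimately show ?thesis using a[OF y] by linarith
qed

lemma meets_fr: "x : fr i ==> x : L ==> cQ i Int L ~= {}"
 using fr_Q by blast

text \<open>The weight \<open>rh\<close> need not be the oscillation: the chain lemma upgrades it.\<close>
definition tst :: "(complex => real) => bool" where
 "tst f \<longleftrightarrow> (EX C. ALL x:S. (abs(f x)) <= C) & (EX L. compact L & L <= Om & (ALL x:S - L. f x = 0)) &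
 (EX rh. l2loc rh & (ALL i. Oe f i <= rh i) & aep (ug f rh))"

lemma tst_fb: "tst f ==> fb f"
 by (auto simp: tst_def intro: fb_bounded)

lemma supp_I:
 assumes "compact L" "L <= Om" "ALL x:S - L. f x = 0"
 shows "EX L'. compact L' & L' <= Om & (ALL i. i ~: I L' --> (ALL x:fr i. f x = (0::real)))"
proof -
 obtain L' where L': "compact L'" "L' <= Om" "ALL i. cQ i Int L ~= {} --> cQ i <= interior L'"
 using absorb[OF assms(1,2)] by blast
 have "f x = 0" if "i ~: I L'" "x : fr i" for i x
 proof (rule ccontr)
 assume "f x ~= 0"
 then have "x : L" using assms(3) fr_S that by blast
 then have "cQ i <= interior L'" using L'(3) meets_fr that by blast
 then have "Q i <= L'" using closure_subset interior_subset by blast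
 then show False using that Q_ne[of i] by (auto simp: meeting_def)
 qed
 then show ?thesis using L' by blast
qed

lemma O_add: "fb f ==> fb g ==> Os (%x. f x + g x) i <= Os f i + Os g i"
proof (rule O_le)
 assume a: "fb f" "fb g"
 show "fb (%x. f x + g x)" by (rule fb_add[OF a])
 fix x y assume "x : fr i" "y : fr i"
 then show "f x + g x - (f y + g y) <= Os f i + Os g i" using O_ge[OF a(1), of x i y] O_ge[OF a(2), of x i y] by linarith
qed

lemma O_cong: "(!!x. x : fr i ==> f x = g x) ==> Os f i = Os g i"
proof -
 assume a: "!!x. x : fr i ==> f x = g x"
 then have "f ` fr i = g ` fr i" by (intro image_cong) auto
 then show ?thesis by (simp add: osci_def)
qed

lemma ug_add: "ug f rh gm ==> ug g sg gm ==> ug (%x. f x + g x) (%i. rh i + sg i) gm"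
 unfolding ug_def
proof (intro ballI impI, goal_cases)
 case (1 s t)
 let ?x = "snd gm s" and ?y = "snd gm t" and ?J = "I (snd gm ` {s..t})"
 have f: "eN (abs(f ?x - f ?y)) <= ns ?J rh" and g: "eN (abs(g ?x - g ?y)) <= ns ?J sg" using 1 by blast+
 have "eN (abs(f ?x + g ?x - (f ?y + g ?y))) <= eN ((abs(f ?x - f ?y)) + (abs(g ?x - g ?y)))" by (intro ennreal_leI) linarith
 also have "... = eN (abs(f ?x - f ?y)) + eN (abs(g ?x - g ?y))" by (simp add: ennreal_plus)
 also have "... <= ns ?J rh + ns ?J sg" by (intro add_mono f g)
 finally show ?case by (simp add: ns_add)
qed

lemma sob_add_tst: "sob f ==> tst g ==> sob (%x. f x + g x)"
proof -
 assume f: "sob f" and g: "tst g"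
 obtain rh where rh: "l2loc rh" "!!i. Oe g i <= rh i" "aep (ug g rh)" using g by (auto simp: tst_def)
 let ?F = "%x. f x + g x" and ?sg = "%i. Oe f i + rh i"
 have fb: "fb f" "fb g" "fb ?F" using f g tst_fb fb_add by (auto simp: sob_def)
 have l: "l2loc ?sg" using f rh by (intro l2loc_add) (auto simp: sob_def)
 have "aep (%gm. ug f (Oe f) gm & ug g rh gm)" using f rh by (intro aep_conj) (auto simp: sob_def)
 then have a: "aep (ug ?F ?sg)" by (rule aep_mono) (simp add: ug_add)
 have "eN (Os ?F i) <= ?sg i" for i
 proof -
 have "eN (Os ?F i) <= eN (Os f i + Os g i)" by (intro ennreal_leI O_add fb)
 also have "... = Oe f i + Oe g i" using O_nonneg fb by (simp add: ennreal_plus)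
 finally show ?thesis using rh(2)[of i] by (meson add_left_mono order_trans)
 qed
 then show ?thesis using aep_ug_osc[OF a l fb(3)] l2loc_mono[OF l] fb by (auto simp: sob_def)
qed

text \<open>A test function changes the suprema by at most its bound \<open>C\<close>, and only at
  disks meeting a compact set, where the squared diameters are summable.\<close>

lemma W12_add:
 assumes z: "ze : W12 ver Om Q" and f: "tst f"
 shows "(%x. ereal (real_of_ereal (ze x) + f x)) : W12 ver Om Q"
proof -
 define z' where "z' x = real_of_ereal (ze x)" for x
 have zl: "ze : W12_loc ver Om Q" using z by (simp add: W12_def)
 note zz = W12_locD[OF zl, folded z'_def]
 let ?F = "%x. z' x + f x"
 have s: "sob ?F" by (rule sob_add_tst[OF zz(1) f])
 then have fbF: "fb ?F" by (simp add: sob_def)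
 have fbz: "fb z'" using zz(1) by (simp add: sob_def)
 have fbf: "fb f" by (rule tst_fb[OF f])
 obtain C where C: "!!x. x : S ==> (abs(f x)) <= C" using f by (auto simp: tst_def)
 obtain L0 where "compact L0" "L0 <= Om" "ALL x:S - L0. f x = 0" using f by (auto simp: tst_def)
 from supp_I[OF this] obtain L where L: "compact L" "L <= Om" "!!i x. i ~: I L ==> x : fr i ==> f x = 0" by blast
 obtain rh where rh: "l2loc rh" "!!i. Oe f i <= rh i" using f by (auto simp: tst_def)
 have "ns UNIV (O2 f) <= nI L (%i. (rh i)^2)"
 unfolding ns_def
 proof (intro nn_integral_mono)
 fix i
 have "Os f i = 0" if "i ~: I L" using O_cong[of i f "%_. 0"] L(3)[OF that] fr_ne[of i] by (simp add: osci_def)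
 then show "(Oe f i)^2 * indicator UNIV i <= (rh i)^2 * indicator (I L) i"
 using power_mono[OF rh(2)[of i], of 2] by (auto split: split_indicator)
 qed
 then have of: "ns UNIV (O2 f) < iN" using l2locD[OF rh(1) L(1,2)] by (rule order_le_less_trans)
 have oz: "ns UNIV (O2 z') < iN" using z zz by (simp add: W12_def ns_infsum)
 have "ns UNIV (%i. (eN (Os ?F i))^2) <= ns UNIV (%i. (Oe z' i + Oe f i)^2)"
 using O_nonneg[OF fbz] O_nonneg[OF fbf] O_add[OF fbz fbf]
 by (intro ns_mono power_mono) (auto simp flip: ennreal_plus intro!: ennreal_leI)
 also have "... < iN" by (rule l2_add[OF oz of])
 finally have E: "ns UNIV (%i. (eN (Os ?F i))^2) < iN" .
 have mz: "ns UNIV (%i. eN ((Ms z' i)^2 * (dm i)^2)) < iN"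
 using z zz by (simp add: W12_def ns_infsum e2_sq)
 have "ns UNIV (%i. eN ((Ms ?F i)^2 * (dm i)^2)) <=
 ns UNIV (%i. 2 * eN ((Ms z' i)^2 * (dm i)^2) + eN (2 * C^2) * (eN ((dm i)^2) * indicator (I L) i))"
 proof (intro ns_mono order_refl)
 fix i
 show "eN ((Ms ?F i)^2 * (dm i)^2) <= 2 * eN ((Ms z' i)^2 * (dm i)^2) + eN (2 * C^2) * (eN ((dm i)^2) * indicator (I L) i)"
 proof (cases "i : I L")
 case True
 have "(abs(Ms ?F i - Ms z' i)) <= C"
 proof -
 have "Ms ?F i <= Ms z' i + C"
 using Ms_upper[OF fbz] C fr_S by (intro Ms_least) (fastforce intro: add_mono simp: abs_le_iff)
 moreover have "Ms z' i <= Ms ?F i + C"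
 proof (intro Ms_least)
 fix x assume x: "x : fr i"
 then have "(abs(f x)) <= C" using C fr_S by blast
 then show "z' x <= Ms ?F i + C" using Ms_upper[OF fbF x] by linarith
 qed
 ultimately show ?thesis by linarith
 qed
 then have "(Ms ?F i)^2 <= 2 * (Ms z' i)^2 + 2 * C^2"
 proof -
 assume a: "(abs(Ms ?F i - Ms z' i)) <= C"
 have "(Ms ?F i - Ms z' i)^2 <= C^2" using power_mono[OF a, of 2] by simp
 moreover have "0 <= (Ms ?F i - 2 * Ms z' i)^2" by simp
 ultimately show ?thesis by (simp add: power2_diff)
 qed
 then have "(Ms ?F i)^2 * (dm i)^2 <= (2 * (Ms z' i)^2 + 2 * C^2) * (dm i)^2" by (intro mult_right_mono) auto
 then have "eN ((Ms ?F i)^2 * (dm i)^2) <= eN (2 * ((Ms z' i)^2 * (dm i)^2) + (2 * C^2) * (dm i)^2)"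
 by (intro ennreal_leI) (simp add: algebra_simps)
 also have "... = 2 * eN ((Ms z' i)^2 * (dm i)^2) + eN (2 * C^2) * eN ((dm i)^2)"
 using ennreal_mult'[of 2 "(Ms z' i)^2 * (dm i)^2"] ennreal_mult'[of "2 * C^2" "(dm i)^2"] by (simp add: ennreal_plus)
 finally show ?thesis using True by simp
 next
 case False
 then have "(%x. z' x + f x) ` fr i = z' ` fr i" using L(3) by (intro image_cong) auto
 then have "Ms ?F i = Ms z' i" by simp
 then have "eN ((Ms ?F i)^2 * (dm i)^2) = 1 * eN ((Ms z' i)^2 * (dm i)^2)" by simp
 also have "... <= 2 * eN ((Ms z' i)^2 * (dm i)^2)" by (intro mult_right_mono) auto
 finally show ?thesis by (simp add: add_increasing2)
 qed
 qed
 also have "... = 2 * ns UNIV (%i. eN ((Ms z' i)^2 * (dm i)^2)) + eN (2 * C^2) * nI L (%i. eN ((dm i)^2))"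
 by (simp add: ns_add ns_cmult) (simp add: ns_def)
 also have "... < iN" using mz sum_diam_sq[OF compact_imp_bounded[OF L(1)]] by (simp add: ennreal_mult_less_top)
 finally have M: "ns UNIV (%i. eN ((Ms ?F i)^2 * (dm i)^2)) < iN" .
 have sub: "ns A w < iN" if "ns UNIV w < iN" for A w
 using ns_mono[OF subset_UNIV order_refl, of A w] that by (rule order_le_less_trans)
 have "(%x. ereal (?F x)) : W12 ver Om Q"
 unfolding W12_def W12_loc_def
 using M E sub[OF M] sub[OF E] s aep_upper_gradient
 by (auto simp: peri_sup_eq[OF fbF] peri_sup_eq(2)[OF fbF] osc_eq[OF fbF, abs_def] ns_infsum e2_sq sob_def)
 then show ?thesis by (simp add: z'_def)
qed

lemma zero_W12: "(%x. 0) : W12 ver Om Q"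
proof -
 have f: "fb (%x. 0)" by (rule fb_const)
 have o: "Os (%x. 0) i = 0" and m: "Ms (%x. 0) i = 0" "ms (%x. 0) i = 0" for i
 using fr_ne[of i] by (auto simp: osci_def)
 have "cmod0 {}" unfolding cmod0_iff
 by (intro allI impI exI[of _ "%_. 0"] exI[of _ "{}"]) (simp add: null1_empty)
 then have "aep (ug (%x. 0) (%i. 0))" unfolding aep_def ug_def by simp
 then have "upper_gradient ver Om Q (%x. ereal 0) (%i. 0)" by (rule aep_upper_gradient)
 then have u: "upper_gradient ver Om Q (%x. 0) (%i. 0)" by (simp add: zero_ereal_def)
 have oo: "osc Q (%x. 0) = (%i. 0)" using osc_eq[OF f] by (auto simp: o zero_ereal_def[symmetric])
 have z: "e2ennreal (0\<^sup>2 * ereal b) = 0" for b using e2_sq[of 0 b] by (simp add: zero_ereal_def)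
 show ?thesis
 unfolding W12_def W12_loc_def
 using u oo z peri_sup_eq[OF f] by (simp add: m zero_ereal_def[symmetric] ns_infsum)
qed

lemma tst_W12: "tst f ==> (%x. ereal (f x)) : W12 ver Om Q"
 using W12_add[OF zero_W12, of f] by simp

lemma sob_W12_loc:
 assumes "sob f" and bd: "!!L. compact L ==> L <= Om ==> EX C. ALL x:S Int L. (abs(f x)) <= C"
 shows "(%x. ereal (f x)) : W12_loc ver Om Q"
proof -
 have fbF: "fb f" using assms by (simp add: sob_def)
 have 1: "nI (ball x r) (%i. eN ((Ms f i)^2 * (dm i)^2)) < iN & nI (ball x r) (O2 f) < iN" if b: "ball x r \<subset>\<subset> Om" for x r
 proof
 define L where "L = closure (ball x r)"
 have L: "compact L" "L <= Om" "ball x r <= L" using b closure_subset by (auto simp: L_def ccontained_def)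
 have "nI L (O2 f) < iN" using assms L by (intro l2locD) (auto simp: sob_def)
 then show "nI (ball x r) (O2 f) < iN"
 using ns_mono[OF I_mono[OF L(3)] order_refl] by (rule order_le_less_trans[rotated])
 obtain L' where L': "compact L'" "L' <= Om" "ALL i. cQ i Int L ~= {} --> cQ i <= interior L'"
 using absorb[OF L(1,2)] by blast
 obtain C where C: "!!x. x : S Int L' ==> (abs(f x)) <= C" using bd[OF L'(1,2)] by blast
 have "nI (ball x r) (%i. eN ((Ms f i)^2 * (dm i)^2)) <= nI L (%i. eN (C^2) * eN ((dm i)^2))"
 proof (intro ns_mono I_mono L(3))
 fix i assume "i : I (ball x r)"
 then have "cQ i Int L ~= {}" using L(3) closure_subset[of "Q i"] by (auto simp: meeting_def)
 then have "cQ i <= L'" using L' interior_subset by blast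
 then have "(abs(Ms f i)) <= C" using fr_Q[of i] fr_S[of i] by (intro Ms_bound C) auto
 then have "(Ms f i)^2 <= C^2" using power_mono[of "(abs(Ms f i))" C 2] by simp
 then show "eN ((Ms f i)^2 * (dm i)^2) <= eN (C^2) * eN ((dm i)^2)"
 by (simp add: ennreal_leI mult_right_mono flip: ennreal_mult')
 qed
 also have "... < iN" using sum_diam_sq[OF compact_imp_bounded[OF L(1)]] by (simp add: ns_cmult ennreal_mult_less_top)
 finally show "nI (ball x r) (%i. eN ((Ms f i)^2 * (dm i)^2)) < iN" .
 qed
 show ?thesis
 unfolding W12_loc_def
 using 1 assms(1) aep_upper_gradient
 by (auto simp: peri_sup_eq[OF fbF] peri_sup_eq(2)[OF fbF] osc_eq[OF fbF, abs_def] ns_infsum e2_sq sob_def)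
qed

text \<open>Minimality against bounded, compactly supported variations, the form in which the
  Caccioppoli inequality and the maximum principle use it. The limit is tested against all of
  \<open>W12\<close> in \<open>v_harmonic\<close>.\<close>

definition harm :: "(complex => real) => bool" where
 "harm u \<longleftrightarrow> sob u & (ALL V f. open V --> V \<subset>\<subset> Om --> tst f --> (ALL x:S - V. f x = 0) -->
 nI V (O2 u) <= nI V (O2 (%x. u x + f x)))"

lemma carpet_harmonic_harm: "carpet_harmonic ver Om Q (%x. ereal (u x)) ==> harm u"
 unfolding harm_def
proof (intro conjI allI impI)
 assume h: "carpet_harmonic ver Om Q (%x. ereal (u x))"
 show s: "sob u" using h sob_real by (simp add: carpet_harmonic_def)
 then have fu: "fb u" by (simp add: sob_def)
 fix V f assume V: "open V" "V \<subset>\<subset> Om" and f: "tst f" "ALL x:S - V. f x = 0"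
 have hh: "!!V ze. open V ==> V \<subset>\<subset> Om ==> ze : W12 ver Om Q ==> ALL x:S - V. ze x = 0 ==>
 energy Q V (%x. ereal (u x)) <= energy Q V (%x. ereal (u x) + ze x)"
 using h unfolding carpet_harmonic_def by blast
 have "energy Q V (%x. ereal (u x)) <= energy Q V (%x. ereal (u x) + ereal (f x))"
 by (rule hh[OF V tst_W12[OF f(1)]]) (use f(2) in \<open>simp add: zero_ereal_def\<close>)
 then show "nI V (O2 u) <= nI V (O2 (%x. u x + f x))"
 using osc_eq[OF fu] osc_eq[OF fb_add[OF fu tst_fb[OF f(1)]]] by (simp add: energy_def ns_infsum)
qed

end

section \<open>Length of paths\<close>

definition psum :: "(real => complex) => nat => (nat => real) => real" where
 "psum h n t = (\<Sum>k<n. dist (h (t k)) (h (t (Suc k))))"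

lemma curve_length_psum:
 "curve_length h J = (SUP (n, t)\<in>{(n, t). mono_on {..n} t & t ` {..n} <= J}. eN (psum h n t))"
 unfolding curve_length_def psum_def by (intro SUP_cong refl) (auto simp: sum_ennreal)

lemma curve_length_upper: "mono_on {..n} t ==> t ` {..n} <= J ==> eN (psum h n t) <= curve_length h J"
 unfolding curve_length_psum by (rule SUP_upper2[of "(n, t)"]) auto

lemma curve_length_least: "(!!n t. mono_on {..n} t ==> t ` {..n} <= J ==> eN (psum h n t) <= c) ==> curve_length h J <= c"
 unfolding curve_length_psum by (rule SUP_least) auto

lemma curve_length_mono: "J <= J' ==> curve_length h J <= curve_length h J'"
 by (rule curve_length_least) (auto intro: curve_length_upper)

lemma psum_nonneg: "0 <= psum h n t" unfolding psum_def by (intro sum_nonneg) auto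

lemma sum_shift_split: "(\<Sum>k<n1 + m. f k) = (\<Sum>k<n1. f k) + (\<Sum>k<m. f (n1 + k) :: real)" for m n1 :: nat
 by (induction m) auto

lemma curve_length_superadd:
 assumes "a <= b" "b <= c"
 shows "curve_length h {a..b} + curve_length h {b..c} <= curve_length h {a..c}"
proof -
 have *: "eN (psum h n1 t1) + eN (psum h n2 t2) <= curve_length h {a..c}"
 if 1: "mono_on {..n1} t1" "t1 ` {..n1} <= {a..b}" and 2: "mono_on {..n2} t2" "t2 ` {..n2} <= {b..c}" for n1 t1 n2 t2
 proof -
 \<comment> \<open>The two partitions are concatenated; the extra step from \<open>t1 n1\<close> to
   \<open>t2 0\<close> has nonnegative length and is dropped.\<close>
 define t where "t k = (if k <= n1 then t1 k else t2 (k - Suc n1))" for k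
 have m: "mono_on {..n1 + Suc n2} t"
 proof (rule mono_onI)
 fix r s assume rs: "r : {..n1 + Suc n2}" "s : {..n1 + Suc n2}" "r <= s"
 consider "s <= n1" | "r <= n1" "n1 < s" | "n1 < r" using rs by linarith
 then show "t r <= t s"
 proof cases
 case 1 then show ?thesis using rs mono_onD[OF that(1), of r s] by (simp add: t_def)
 next
 case 2
 then have "s - Suc n1 : {..n2}" "r : {..n1}" using rs by auto
 then have "t1 r : {a..b}" "t2 (s - Suc n1) : {b..c}" using that(2,4) by blast+
 then show ?thesis using 2 by (simp add: t_def)
 next
 case 3 then show ?thesis using rs mono_onD[OF that(3), of "r - Suc n1" "s - Suc n1"] by (simp add: t_def)
 qed
 qed
 have i: "t ` {..n1 + Suc n2} <= {a..c}"
 proof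
 fix x assume "x : t ` {..n1 + Suc n2}"
 then obtain k where k: "k <= n1 + Suc n2" "x = t k" by auto
 show "x : {a..c}"
 proof (cases "k <= n1")
 case True then have "t1 k : {a..b}" using 1 by auto
 then show ?thesis using True k assms by (simp add: t_def)
 next
 case False
 then have "k - Suc n1 : {..n2}" using k by auto
 then have "t2 (k - Suc n1) : {b..c}" using 2(2) by blast
 then show ?thesis using False k assms by (simp add: t_def)
 qed
 qed
 have "psum h (n1 + Suc n2) t = (\<Sum>k<n1. dist (h (t k)) (h (t (Suc k)))) + (\<Sum>k<Suc n2. dist (h (t (n1 + k))) (h (t (Suc (n1 + k)))))"
 unfolding psum_def by (rule sum_shift_split)
 also have "(\<Sum>k<n1. dist (h (t k)) (h (t (Suc k)))) = psum h n1 t1" unfolding psum_def by (intro sum.cong) (auto simp: t_def)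
 also have "(\<Sum>k<Suc n2. dist (h (t (n1 + k))) (h (t (Suc (n1 + k))))) = dist (h (t n1)) (h (t (Suc n1))) + psum h n2 t2"
 unfolding psum_def sum.lessThan_Suc_shift by (auto simp: t_def intro!: sum.cong)
 finally have "psum h n1 t1 + psum h n2 t2 <= psum h (n1 + Suc n2) t" by simp
 then have "eN (psum h n1 t1 + psum h n2 t2) <= eN (psum h (n1 + Suc n2) t)" by (rule ennreal_leI)
 also have "... <= curve_length h {a..c}" by (rule curve_length_upper[OF m i])
 finally show ?thesis by (simp add: psum_nonneg ennreal_plus)
 qed
 have ne: "{(n::nat, t). mono_on {..n} t & t ` {..n} <= {x..y}} ~= {}" if "x <= y" for x y :: real
 using that by (auto simp: mono_on_def intro!: exI[of _ "%_. x"])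
 have **: "eN (psum h n1 t1) + curve_length h {b..c} <= curve_length h {a..c}" if "mono_on {..n1} t1" "t1 ` {..n1} <= {a..b}" for n1 t1
 unfolding curve_length_psum[of h "{b..c}"]
 by (subst ennreal_SUP_add_right) (use ne[OF assms(2)] in \<open>auto intro!: SUP_least *[OF that]\<close>)
 show ?thesis
 unfolding curve_length_psum[of h "{a..b}"]
 by (subst ennreal_SUP_add_left[symmetric]) (use ne[OF assms(1)] in \<open>auto intro!: SUP_least **\<close>)
qed

lemma curve_length_subadd:
 assumes "a <= b" "b <= c"
 shows "curve_length h {a..c} <= curve_length h {a..b} + curve_length h {b..c}"
proof (rule curve_length_least)
 fix n and t :: "nat => real" assume t: "mono_on {..n} t" "t ` {..n} <= {a..c}"
 \<comment> \<open>Clipping at \<open>b\<close> from both sides: a step across \<open>b\<close> is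
   split by the triangle inequality through \<open>h b\<close>.\<close>
 have "psum h n t <= psum h n (%k. min (t k) b) + psum h n (%k. max (t k) b)"
 unfolding psum_def sum.distrib[symmetric]
 proof (intro sum_mono)
 fix k assume "k : {..<n}"
 then have "t k <= t (Suc k)" using mono_onD[OF t(1), of k "Suc k"] by auto
 then show "dist (h (t k)) (h (t (Suc k))) <= dist (h (min (t k) b)) (h (min (t (Suc k)) b)) + dist (h (max (t k) b)) (h (max (t (Suc k)) b))"
 using dist_triangle[of "h (t k)" "h (t (Suc k))" "h b"] by (auto simp: min_def max_def)
 qed
 then have "eN (psum h n t) <= eN (psum h n (%k. min (t k) b) + psum h n (%k. max (t k) b))" by (rule ennreal_leI)
 also have "... = eN (psum h n (%k. min (t k) b)) + eN (psum h n (%k. max (t k) b))"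
 by (rule ennreal_plus; rule psum_nonneg)
 also have "... <= curve_length h {a..b} + curve_length h {b..c}"
 proof (intro add_mono curve_length_upper)
 show "mono_on {..n} (%k. min (t k) b)" "mono_on {..n} (%k. max (t k) b)"
 using t(1) unfolding mono_on_def by (meson min.mono max.mono order_refl)+
 show "(%k. min (t k) b) ` {..n} <= {a..b}" "(%k. max (t k) b) ` {..n} <= {b..c}"
 using t(2) assms by (auto simp: image_subset_iff)
 qed
 finally show "eN (psum h n t) <= curve_length h {a..b} + curve_length h {b..c}" .
qed

lemma curve_length_add: "a <= b ==> b <= c ==> curve_length h {a..c} = curve_length h {a..b} + curve_length h {b..c}"
 by (intro antisym curve_length_subadd curve_length_superadd)

lemma dist_le_curve_length: "a <= b ==> eN (dist (h a) (h b)) <= curve_length h {a..b}"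
proof -
 assume ab: "a <= b"
 let ?t = "%k::nat. if k = 0 then a else b"
 have 1: "mono_on {..1} ?t" using ab by (auto simp: mono_on_def)
 have 2: "?t ` {..1} <= {a..b}" using ab by auto
 show ?thesis using curve_length_upper[OF 1 2, of h] by (simp add: psum_def)
qed

lemma curve_length_reflect: "curve_length (%x. h (- x)) {-b..-a} = curve_length h {a..b}"
proof -
 have *: "curve_length (%x. h (- x)) {-b..-a} <= curve_length h {a..b}" for h and a b :: real
 proof (rule curve_length_least)
 fix n and t :: "nat => real" assume t: "mono_on {..n} t" "t ` {..n} <= {-b..-a}"
 have "psum (%x. h (- x)) n t = psum h n (%k. - t (n - k))"
 unfolding psum_def
 by (subst sum.nat_diff_reindex[symmetric]) (auto intro!: sum.cong simp: dist_commute Suc_diff_Suc)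
 also have "ennreal ... <= curve_length h {a..b}"
 using t mono_onD[OF t(1)] by (intro curve_length_upper) (auto simp: mono_on_def image_subset_iff minus_le_iff le_minus_iff)
 finally show "eN (psum (%x. h (- x)) n t) <= curve_length h {a..b}" .
 qed
 show ?thesis using *[of h b a] *[of "%x. h (- x)" "-a" "-b"] by (intro antisym) auto
qed

text \<open>If the end point of an almost optimal partition is moved from \<open>b\<close> back to
  \<open>tu\<close>, beyond all other partition points, the sum drops by at most
  \<open>dist (h tu) (h b)\<close>. So nearly all the length lies before \<open>tu\<close>.\<close>

lemma curve_length_left_cont:
 assumes ab: "a < b" and h: "continuous_on {a..b} h" and fin: "curve_length h {a..b} < iN" and e: "0 < e"
 shows "EX d. a <= d & d < b & (ALL tu. d < tu --> tu <= b --> curve_length h {tu..b} <= eN e)"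
proof -
 define L where "L = enn2real (curve_length h {a..b})"
 have L: "curve_length h {a..b} = ennreal L" "0 <= L" using fin by (auto simp: L_def)
 have "EX n t. mono_on {..n} t & t ` {..n} <= {a..b} & L - e/2 < psum h n t"
 proof (rule ccontr)
 assume nt: "~ ?thesis"
 then have "curve_length h {a..b} <= eN (L - e/2)"
 by (intro curve_length_least ennreal_leI) (auto simp: not_less)
 \<comment> \<open>\<open>eN\<close> truncates at 0, so the sign has to be settled before comparing;
   the partition without steps has sum 0.\<close>
 moreover have "L - e/2 >= 0"
 proof -
 have "~ (L - e/2 < psum h 0 (%_. a))"
 proof
 assume "L - e/2 < psum h 0 (%_. a)"
 then have "EX n t. mono_on {..n} t & t ` {..n} <= {a..b} & L - e/2 < psum h n t"
 using ab by (intro exI[of _ 0] exI[of _ "%_. a"]) (auto simp: mono_on_def)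
 then show False using nt by blast
 qed
 then show ?thesis by (simp add: psum_def)
 qed
 ultimately show False using L e by (simp add: ennreal_le_iff)
 qed
 then obtain n t where t: "mono_on {..n} t" "t ` {..n} <= {a..b}" "L - e/2 < psum h n t" by blast
 define m where "m = Max (insert a {t k | k. k <= n & t k < b})"
 have finm: "finite (insert a {t k | k. k <= n & t k < b})" by simp
 have m: "a <= m" "m < b" "!!k. k <= n ==> t k < b ==> t k <= m" using finm ab by (auto simp: m_def intro!: Max_ge)
 have "continuous (at b within {a..b}) h" using h ab by (auto simp: continuous_on_eq_continuous_within)
 then obtain d where d: "d > 0" "!!x. x : {a..b} ==> dist x b < d ==> dist (h x) (h b) < e/2"
 using e unfolding continuous_within_eps_delta by (metis half_gt_zero)
 show ?thesis
 proof (intro exI conjI allI impI)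
 show "a <= max m (b - d)" "max m (b - d) < b" using m d by auto
 fix tu assume tu: "max m (b - d) < tu" "tu <= b"
 then have dh: "dist (h tu) (h b) < e/2" using m d(2)[of tu] d(1) by (auto simp: dist_real_def)
 \<comment> \<open>The increments of \<open>g\<close> telescope, so the cost of moving
   \<open>b\<close> is paid once even if \<open>b\<close> occurs several times in the
   partition.\<close>
 define g where "g x = (if x = b then dist (h tu) (h b) else 0)" for x
 have bb: "t k <= m | t k = b" if "k <= n" for k using m(3)[OF that] t(2) that by (fastforce simp: image_subset_iff)
 have "psum h n t <= psum h n (%k. min (t k) tu) + (\<Sum>k<n. g (t (Suc k)) - g (t k))"
 unfolding psum_def sum.distrib[symmetric]
 proof (intro sum_mono)
 fix k assume "k : {..<n}"
 then have k: "t k <= t (Suc k)" "t k <= m | t k = b" "t (Suc k) <= m | t (Suc k) = b"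
 using mono_onD[OF t(1), of k "Suc k"] bb by auto
 then show "dist (h (t k)) (h (t (Suc k))) <= dist (h (min (t k) tu)) (h (min (t (Suc k)) tu)) + (g (t (Suc k)) - g (t k))"
 using tu m(2) dist_triangle[of "h (t k)" "h b" "h tu"] by (auto simp: g_def min_def)
 qed
 also have "(\<Sum>k<n. g (t (Suc k)) - g (t k)) = g (t n) - g (t 0)" by (rule sum_lessThan_telescope)
 also have "... <= dist (h tu) (h b)" by (auto simp: g_def)
 finally have "L - e < psum h n (%k. min (t k) tu)" using t(3) dh by linarith
 then have "eN (L - e) <= eN (psum h n (%k. min (t k) tu))" by (intro ennreal_leI) simp
 also have "... <= curve_length h {a..tu}"
 proof (rule curve_length_upper)
 show "mono_on {..n} (%k. min (t k) tu)" using t(1) unfolding mono_on_def by (meson min.mono order_refl)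
 show "(%k. min (t k) tu) ` {..n} <= {a..tu}" using t(2) tu m by (auto simp: image_subset_iff)
 qed
 finally have 1: "eN (L - e) <= curve_length h {a..tu}" .
 have 2: "curve_length h {a..tu} + curve_length h {tu..b} = ennreal L"
 using curve_length_add[of a tu b h] tu m L by simp
 obtain p where p: "curve_length h {a..tu} = eN p" "0 <= p"
 using 2 by (cases "curve_length h {a..tu}") auto
 obtain q where q: "curve_length h {tu..b} = eN q" "0 <= q"
 using 2 by (cases "curve_length h {tu..b}") auto
 have "p + q = L" using 2 p q L by (simp flip: ennreal_plus)
 moreover have "L - e <= p" using 1 p by (simp add: ennreal_le_iff)
 ultimately show "curve_length h {tu..b} <= eN e" using q by (simp add: ennreal_leI)
 qed
qed

lemma curve_length_right_cont:
 assumes ab: "a < b" and h: "continuous_on {a..b} h" and fin: "curve_length h {a..b} < iN" and e: "0 < e"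
 shows "EX d. a < d & d <= b & (ALL tu. a <= tu --> tu < d --> curve_length h {a..tu} <= eN e)"
proof -
 have "EX d. - b <= d & d < - a & (ALL tu. d < tu --> tu <= - a --> curve_length (%x. h (- x)) {tu..- a} <= eN e)"
 using ab fin e by (intro curve_length_left_cont)
 (auto simp: curve_length_reflect intro!: continuous_on_compose2[OF h] continuous_intros)
 then obtain d where d: "- b <= d" "d < - a" "!!tu. d < tu ==> tu <= - a ==> curve_length (%x. h (- x)) {tu..- a} <= eN e" by blast
 show ?thesis
 proof (intro exI[of _ "-d"] conjI allI impI)
 fix tu assume "a <= tu" "tu < - d"
 then show "curve_length h {a..tu} <= eN e" using d(3)[of "-tu"] curve_length_reflect[of h tu a] by simp
 qed (use d in auto)
qed

text \<open>Arc length is continuous, so the arc length parametrization is defined and 1-Lipschitz on the whole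
 interval.\<close>
lemma arclength_lipschitz:
 assumes ab: "a <= b" and h: "continuous_on {a..b} h" and fin: "curve_length h {a..b} < iN"
 defines "L == enn2real (curve_length h {a..b})"
 shows "!!s s'. s : {0..L} ==> s' : {0..L} ==> dist (arclength_param h a b s) (arclength_param h a b s') <= (abs(s - s'))"
 and "h ` {a..b} <= arclength_param h a b ` {0..L}"
proof -
 define l where "l t = enn2real (curve_length h {a..t})" for t
 have fint: "curve_length h {a..t} < iN" if "t <= b" for t
 using curve_length_mono[of "{a..t}" "{a..b}" h] that fin by (auto intro: order_le_less_trans)
 have l: "curve_length h {a..t} = eN (l t)" "0 <= l t" if "t <= b" for t
 using fint[OF that] by (auto simp: l_def)
 have fint2: "curve_length h {t..t'} < iN" if "a <= t" "t' <= b" for t t'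
 using curve_length_mono[of "{t..t'}" "{a..b}" h] that fin by (auto intro: order_le_less_trans)
 have ladd: "l t' = l t + enn2real (curve_length h {t..t'})" if "a <= t" "t <= t'" "t' <= b" for t t'
 unfolding l_def using curve_length_add[OF that(1,2), of h] fint[of t] fint2[of t t'] that by (simp add: enn2real_plus)
 have lmono: "l t <= l t'" if "a <= t" "t <= t'" "t' <= b" for t t' using ladd[OF that] by simp
 have ldist: "dist (h t) (h t') <= (abs(l t - l t'))" if "t : {a..b}" "t' : {a..b}" for t t'
 proof -
 have *: "dist (h t) (h t') <= l t' - l t" if "t <= t'" "t : {a..b}" "t' : {a..b}" for t t'
 proof -
 have "eN (dist (h t) (h t')) <= curve_length h {t..t'}" using that by (intro dist_le_curve_length)
 also have "... = eN (enn2real (curve_length h {t..t'}))" using fint2[of t t'] that by simp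
 finally have "dist (h t) (h t') <= enn2real (curve_length h {t..t'})" by (simp add: ennreal_le_iff)
 then show ?thesis using ladd[of t t'] that by simp
 qed
 show ?thesis using *[of t t'] *[of t' t] that by (cases "t <= t'") (auto simp: dist_commute)
 qed
 have l0: "l a = 0"
 proof -
 have "curve_length h {a..a} <= 0"
 proof (rule curve_length_least)
 fix n and t :: "nat => real" assume "t ` {..n} <= {a..a}"
 then have "!!k. k <= n ==> t k = a" by (auto simp: image_subset_iff)
 then show "eN (psum h n t) <= 0" by (simp add: psum_def)
 qed
 then show ?thesis by (simp add: l_def)
 qed
 have lL: "l b = L" by (simp add: l_def L_def)
 have lcont: "continuous_on {a..b} l"
 unfolding continuous_on_iff
 proof (intro ballI allI impI)
 fix x and e :: real assume x: "x : {a..b}" and e: "0 < e"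
 have "EX d1>0. ALL y. y : {a..b} --> x <= y --> y < x + d1 --> l y - l x <= e/2"
 proof (cases "x < b")
 case True
 have "continuous_on {x..b} h" using h x by (auto intro: continuous_on_subset)
 then obtain d where d: "x < d" "d <= b" "!!tu. x <= tu ==> tu < d ==> curve_length h {x..tu} <= eN (e/2)"
 using curve_length_right_cont[OF True _ fint2[of x b], of "e/2"] x e by auto
 have "l y - l x <= e/2" if "y : {a..b}" "x <= y" "y < x + (d - x)" for y
 using d(3)[of y] ladd[of x y] that x e enn2real_mono[of "curve_length h {x..y}" "eN (e/2)"] by (auto simp: less_top[symmetric])
 then show ?thesis using d by (intro exI[of _ "d - x"]) auto
 next
 case False then show ?thesis using x e by (intro exI[of _ 1]) auto
 qed
 then obtain d1 where d1: "d1 > 0" "!!y. y : {a..b} ==> x <= y ==> y < x + d1 ==> l y - l x <= e/2" by blast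
 have "EX d2>0. ALL y. y : {a..b} --> y <= x --> x - d2 < y --> l x - l y <= e/2"
 proof (cases "a < x")
 case True
 have "continuous_on {a..x} h" using h x by (auto intro: continuous_on_subset)
 then obtain d where d: "a <= d" "d < x" "!!tu. d < tu ==> tu <= x ==> curve_length h {tu..x} <= eN (e/2)"
 using curve_length_left_cont[OF True _ fint2[of a x], of "e/2"] x e by auto
 have "l x - l y <= e/2" if "y : {a..b}" "y <= x" "x - (x - d) < y" for y
 using d(3)[of y] ladd[of y x] that x e enn2real_mono[of "curve_length h {y..x}" "eN (e/2)"] by (auto simp: less_top[symmetric])
 then show ?thesis using d by (intro exI[of _ "x - d"]) auto
 next
 case False then show ?thesis using x e by (intro exI[of _ 1]) auto
 qed
 then obtain d2 where d2: "d2 > 0" "!!y. y : {a..b} ==> y <= x ==> x - d2 < y ==> l x - l y <= e/2" by blast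
 show "EX d>0. ALL x':{a..b}. dist x' x < d --> dist (l x') (l x) < e"
 proof (intro exI conjI ballI impI)
 show "min d1 d2 > 0" using d1 d2 by simp
 fix y assume y: "y : {a..b}" "dist y x < min d1 d2"
 show "dist (l y) (l x) < e"
 proof (cases "x <= y")
 case True
 then show ?thesis using d1(2)[of y] lmono[of x y] x y e by (auto simp: dist_real_def)
 next
 case False
 then show ?thesis using d2(2)[of y] lmono[of y x] x y e by (auto simp: dist_real_def)
 qed
 qed
 qed
 define T where "T s = (SOME t. t : {a..b} & curve_length h {a..t} = eN s)" for s
 have T: "T s : {a..b}" "l (T s) = s" if "s : {0..L}" for s
 proof -
 have "EX t. a <= t & t <= b & l t = s" using that l0 lL ab lcont by (intro IVT') auto
 then have "EX t. t : {a..b} & curve_length h {a..t} = eN s" using l by auto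
 from someI_ex[OF this] have *: "T s : {a..b}" "curve_length h {a..T s} = eN s" by (auto simp: T_def)
 then show "T s : {a..b}" "l (T s) = s" using that by (auto simp: l_def)
 qed
 have al: "arclength_param h a b s = h (T s)" for s by (simp add: arclength_param_def T_def)
 show "dist (arclength_param h a b s) (arclength_param h a b s') <= (abs(s - s'))" if "s : {0..L}" "s' : {0..L}" for s s'
 unfolding al using ldist[of "T s" "T s'"] T that by simp
 show "h ` {a..b} <= arclength_param h a b ` {0..L}"
 proof
 fix x assume "x : h ` {a..b}"
 then obtain t where t: "t : {a..b}" "x = h t" by blast
 have lt: "l t : {0..L}" using t lmono[of t b] l(2)[of t] lL by auto
 have "dist (h (T (l t))) (h t) <= 0" using ldist[of "T (l t)" t] T[OF lt] t by simp
 then have "x = arclength_param h a b (l t)" using t by (simp add: al)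
 then show "x : arclength_param h a b ` {0..L}" using lt by blast
 qed
qed

section \<open>Length of paths inside the carpet\<close>

context rel_carpet begin

lemma S_borel: "S : sets borel"
proof -
 have "open (\<Union>i. Q i)" by auto
 then show ?thesis unfolding carpet_def by auto
qed

lemma negligible_lip1:
 fixes p :: "real => real"
 assumes "negligible N" "!!x y. x : N ==> y : N ==> (abs(p x - p y)) <= (abs(x - y))"
 shows "negligible (p ` N)"
proof (rule negligible_locally_Lipschitz_image[OF order_refl assms(1)])
 fix x assume "x : N"
 then have "open (UNIV::real set) & x : UNIV & (ALL y:N Int UNIV. norm (p y - p x) <= 1 * norm (y - x))" using assms(2) by auto
 then show "EX T B. open T & x : T & (ALL y:N Int T. norm (p y - p x) <= B * norm (y - x))" by blast
qed

text \<open>The distance from the starting point maps the path onto an interval as long as the left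
  side. The part on the carpet has null image by assumption, and each disk covers at most its
  diameter.\<close>

lemma dist_le_dm:
 assumes g: "gm : paths_in Om" and st: "s : fst gm" "t : fst gm" "s <= t"
 and neg: "!!p::complex => real. (!!x y. (abs(p x - p y)) <= dist x y) ==> negligible (p ` (snd gm ` {s..t} Int S))"
 shows "eN (dist (snd gm s) (snd gm t)) <= nI (snd gm ` {s..t}) (%i. eN (dm i))"
proof -
 let ?J = "I (snd gm ` {s..t})" and ?X = "snd gm ` {s..t}"
 define p where "p x = dist (snd gm s) x" for x
 have plip: "(abs(p x - p y)) <= dist x y" for x y
 unfolding p_def using dist_triangle[of "snd gm s" x y] dist_triangle[of "snd gm s" y x] by (auto simp: dist_commute)
 have sub: "{s..t} <= fst gm" using g st interval_sub by (auto simp: paths_in_def is_plane_path_def)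
 have XO: "?X <= Om" using g sub by (auto simp: paths_in_def img_def)
 have cont: "continuous_on {s..t} (%x. p (snd gm x))" unfolding p_def
 using path_cont[OF g sub] by (intro continuous_intros)
 have "{0..dist (snd gm s) (snd gm t)} <= p ` ?X"
 proof
 fix y assume y: "y : {0..dist (snd gm s) (snd gm t)}"
 have "EX x. s <= x & x <= t & p (snd gm x) = y" using y cont st by (intro IVT') (auto simp: p_def)
 then show "y : p ` ?X" by auto
 qed
 define z where "z j = (SOME z. z : Q j)" for j
 have z: "z j : Q j" for j unfolding z_def using Q_ne by (meson ex_in_conv someI)
 define N where "N = p ` (?X Int S)"
 have N: "N : null_sets lebesgue" unfolding N_def using neg[OF plip] by (simp add: negligible_iff_null_sets)
 have q: "p x : cbox (p (z i) - dm i) (p (z i) + dm i)" if "x : Q i" for i x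
 proof -
 have "dist x (z i) <= dm i" using that z by (intro diameter_bounded_bound) auto
 then show ?thesis using plip[of x "z i"] by (simp add: abs_le_iff)
 qed
 define R where "R i = (if i : ?J then {Inf (p ` Q i)..Sup (p ` Q i)} else {})" for i
 have bp: "bdd_above (p ` Q i)" "bdd_below (p ` Q i)" for i
 using q by (auto simp: bdd_above_def bdd_below_def intro: exI[of _ "p (z i) + dm i"] exI[of _ "p (z i) - dm i"])
 have Rlen: "Sup (p ` Q i) - Inf (p ` Q i) <= dm i" for i
 proof -
 have "Sup (p ` Q i) <= Inf (p ` Q i) + dm i"
 proof (rule cSUP_least[OF Q_ne])
 fix x assume x: "x : Q i"
 have "p x - dm i <= Inf (p ` Q i)"
 proof (rule cINF_greatest[OF Q_ne])
 fix y assume "y : Q i"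
 then have "dist x y <= dm i" using x by (intro diameter_bounded_bound) auto
 then show "p x - dm i <= p y" using plip[of x y] by (simp add: abs_le_iff)
 qed
 then show "p x <= Inf (p ` Q i) + dm i" by simp
 qed
 then show ?thesis by simp
 qed
 have cov: "{0..dist (snd gm s) (snd gm t)} <= N Un (\<Union>i. R i)"
 proof
 fix y assume "y : {0..dist (snd gm s) (snd gm t)}"
 then obtain x where x: "x : ?X" "y = p x" using \<open>{0..dist (snd gm s) (snd gm t)} <= p ` ?X\<close> by blast
 show "y : N Un (\<Union>i. R i)"
 proof (cases "x : S")
 case True then show ?thesis using x by (auto simp: N_def)
 next
 case False
 then obtain i where i: "x : Q i" using in_Om x XO by blast
 then have "i : ?J" using x by (auto simp: meeting_def)
 moreover have "Inf (p ` Q i) <= p x" "p x <= Sup (p ` Q i)" using i bp by (auto intro: cINF_lower cSUP_upper)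
 ultimately have "y : R i" using x by (simp add: R_def)
 then show ?thesis by blast
 qed
 qed
 have Rm: "R i : sets lebesgue" for i by (auto simp: R_def)
 have "eN (dist (snd gm s) (snd gm t)) = emeasure lebesgue {0..dist (snd gm s) (snd gm t)}" by simp
 also have "... <= emeasure lebesgue (N Un (\<Union>i. R i))" using N Rm cov by (intro emeasure_mono) auto
 also have "... = emeasure lebesgue (\<Union>i. R i)" using emeasure_Un_null_set[of "\<Union>i. R i" lebesgue N] N Rm by (simp add: Un_commute sets.countable_UN)
 also have "... <= (\<Sum>i. emeasure lebesgue (R i))" using Rm by (intro emeasure_subadditive_countably) auto
 also have "... <= ns ?J (%i. eN (dm i))" unfolding ns_suminf
 using Rlen dm_nonneg by (intro suminf_le) (auto simp: R_def emeasure_lborel_Icc_eq intro!: ennreal_leI)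
 finally show ?thesis .
qed

text \<open>As the carpet has measure zero, the weight that is infinite on it has energy
  zero.\<close>

lemma mod2_length_S: "mod2 {gm : paths_in Om. line_integral (%z. iN * indicator S z) gm >= 1} = 0"
proof -
 have "(\<integral>\<^sup>+z. (iN * indicator S z :: ennreal)^2 \<partial>hausdorff_measure 2) = (\<integral>\<^sup>+z. iN * indicator S z \<partial>hausdorff_measure 2)"
 by (intro nn_integral_cong) (auto split: split_indicator simp: power2_eq_square)
 also have "... = iN * emeasure (hausdorff_measure 2) S"
 using S_borel by (intro nn_integral_cmult_indicator) (simp add: hausdorff_measure_def sets.sigma_sets_eq[of borel, simplified] sets_measure_of_conv)
 also have "... = 0" using S_borel hausdorff2_S by (simp add: emeasure_hausdorff_measure)
 finally have "(\<integral>\<^sup>+z. (iN * indicator S z :: ennreal)^2 \<partial>hausdorff_measure 2) = 0" .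
 then show ?thesis unfolding mod2_0_iff
 using S_borel by (intro allI impI bexI[of _ "%z. iN * indicator S z"]) auto
qed

lemma h1_negligible:
 fixes p :: "complex => real"
 assumes h: "hausdorff 1 X = 0" and p: "!!x y. (abs(p x - p y)) <= dist x y"
 shows "negligible (p ` X)"
 unfolding negligible_outer_le
proof (intro allI impI)
 fix e :: real assume e: "0 < e"
 have "hausdorff_pre 1 1 (X) <= hausdorff 1 (X)" unfolding hausdorff_def by (intro SUP_upper) auto
 then have "hausdorff_pre 1 1 (X) < eN (e/2)" using h e by simp
 then obtain U :: "nat => complex set" where U: "X <= (\<Union>j. U j)" "!!j. bounded (U j)"
 and U2: "(\<Sum>j. eN (unit_ball_vol (real 1) * (diameter (U j) / 2) ^ 1)) < eN (e/2)"
 unfolding hausdorff_pre_def INF_less_iff by blast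
 define z where "z j = (SOME z. z : U j)" for j
 have z: "U j ~= {} ==> z j : U j" for j unfolding z_def by (meson ex_in_conv someI)
 define R where "R j = cbox (p (z j) - diameter (U j)) (p (z j) + diameter (U j))" for j
 have "p ` X <= (\<Union>j. R j)"
 proof
 fix y assume "y : p ` X"
 then obtain x where x: "x : X" "y = p x" by auto
 then obtain j where j: "x : U j" using U by blast
 then have "dist x (z j) <= diameter (U j)" using z[of j] U by (intro diameter_bounded_bound) auto
 then have "y : R j" using p[of x "z j"] x by (simp add: R_def abs_le_iff)
 then show "y : (\<Union>j. R j)" by blast
 qed
 moreover have "emeasure lebesgue (\<Union>j. R j) <= eN e"
 proof -
 have "emeasure lebesgue (\<Union>j. R j) <= (\<Sum>j. emeasure lebesgue (R j))"
 by (intro emeasure_subadditive_countably) (auto simp: R_def)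
 also have "... = (\<Sum>j. 2 * eN (unit_ball_vol (real 1) * (diameter (U j) / 2) ^ 1))"
 proof (intro suminf_cong)
 fix j
 have "emeasure lebesgue (R j) = eN (2 * diameter (U j))" using diam_nn[OF U(2)] by (simp add: R_def)
 also have "... = 2 * eN (diameter (U j))" using ennreal_mult'[of 2 "diameter (U j)"] by simp
 finally show "emeasure lebesgue (R j) = 2 * eN (unit_ball_vol (real 1) * (diameter (U j) / 2) ^ 1)" by (simp add: unit_ball_vol_1)
 qed
 also have "... = 2 * (\<Sum>j. eN (unit_ball_vol (real 1) * (diameter (U j) / 2) ^ 1))" by simp
 also have "... <= 2 * eN (e/2)" using U2 by (intro mult_left_mono) auto
 also have "... = eN e" using e ennreal_mult'[of 2 "e/2"] by simp
 finally show ?thesis .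
 qed
 moreover have "(\<Union>j. R j) : sets lebesgue" by (auto simp: R_def)
 ultimately show "EX T. p ` X <= T & T : lmeasurable & measure lebesgue T <= e"
 using e by (intro exI[of _ "\<Union>j. R j"])
 (auto simp: fmeasurable_def measure_def enn2real_leI intro: order_le_less_trans)
 qed

text \<open>In the weak version the weight infinite on \<open>S\<close> is not admissible for the
  remaining paths, so almost every arc length parameter lies off the carpet, and the 1-Lipschitz
  parametrization transports this to images. In the strong version length zero in the carpet is the
  definition.\<close>

lemma null1_length: "\<exists>Gm. null1 Gm & (ALL gm:paths_in Om - Gm. ALL s:fst gm. ALL t:fst gm. s <= t -->
 (ALL p::complex => real. (ALL x y. (abs(p x - p y)) <= dist x y) --> negligible (p ` (snd gm ` {s..t} Int S))))"
proof (cases ver)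
 case Weak
 let ?w = "%z. iN * indicator S z :: ennreal"
 let ?G = "{gm : paths_in Om. line_integral ?w gm >= 1}"
 have "null1 ?G" using mod2_length_S null1_Weak[OF Weak] by simp
 moreover have "negligible (p ` (snd gm ` {s..t} Int S))"
 if g: "gm : paths_in Om - ?G" and st: "s : fst gm" "t : fst gm" "s <= t" and p: "!!x y. (abs(p x - p y)) <= dist x y" for gm s t and p :: "complex => real"
 proof -
 have sub: "{s..t} <= fst gm" using g st interval_sub by (auto simp: paths_in_def is_plane_path_def)
 have li: "line_integral ?w gm < 1" using g by (auto simp: not_le)
 then have lr: "locally_rectifiable gm" by (auto simp: line_integral_def split: if_splits)
 let ?h = "snd gm"
 have fin: "curve_length ?h {s..t} < iN" using lr sub st by (auto simp: locally_rectifiable_def)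
 have h: "continuous_on {s..t} ?h" using path_cont g sub by auto
 define L where "L = enn2real (curve_length ?h {s..t})"
 define al where "al = arclength_param ?h s t"
 have al: "!!x y. x : {0..L} ==> y : {0..L} ==> dist (al x) (al y) <= (abs(x - y))" and im: "?h ` {s..t} <= al ` {0..L}"
 using arclength_lipschitz[OF st(3) h fin] by (auto simp: al_def L_def)
 have alc: "continuous_on {0..L} al"
 unfolding continuous_on_iff using al by (metis dist_real_def order_le_less_trans)
 define N where "N = {x : {0..L}. al x : S}"
 have Nm: "N : sets borel"
 proof -
 have "al : borel_measurable (restrict_space borel {0..L})" by (rule borel_measurable_continuous_on_restrict[OF alc])
 from measurable_sets[OF this S_borel] have "al -` S Int {0..L} : sets (restrict_space borel {0..L})" by (simp add: space_restrict_space)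
 moreover have "al -` S Int {0..L} = N" by (auto simp: N_def)
 ultimately show ?thesis by (subst (asm) sets_restrict_space_iff) auto
 qed
 have "(\<integral>\<^sup>+x\<in>{0..L}. ?w (al x) \<partial>lborel) <= line_integral ?w gm"
 unfolding line_integral_def using lr sub st
 by (auto simp: al_def L_def intro!: SUP_upper2[of "(s, t)"])
 then have "(\<integral>\<^sup>+x\<in>{0..L}. ?w (al x) \<partial>lborel) < 1" using li by simp
 moreover have "(\<integral>\<^sup>+x\<in>{0..L}. ?w (al x) \<partial>lborel) = (\<integral>\<^sup>+x. iN * indicator N x \<partial>lborel)"
 by (intro nn_integral_cong) (auto simp: N_def split: split_indicator)
 moreover have "... = iN * emeasure lborel N" using Nm by (intro nn_integral_cmult_indicator) auto
 ultimately have "emeasure lborel N = 0" by (cases "emeasure lborel N = 0") (auto simp: ennreal_top_mult)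
 then have "N : null_sets lborel" using Nm by (auto simp: null_sets_def)
 then have "negligible N" by (simp add: negligible_iff_null_sets null_sets_completionI)
 then have "negligible ((%x. p (al x)) ` N)"
 proof (rule negligible_lip1)
 fix x y assume "x : N" "y : N"
 then show "(abs(p (al x) - p (al y))) <= (abs(x - y))" using p[of "al x" "al y"] al[of x y] by (simp add: N_def)
 qed
 then show ?thesis by (rule negligible_subset) (use im in \<open>auto simp: N_def\<close>)
 qed
 ultimately show ?thesis by (intro exI[of _ ?G]) blast
next
 case Strong
 let ?G = "{gm. hausdorff 1 (img gm Int S) ~= 0}"
 have "null1 ?G" using null1_Strong[OF Strong] by simp
 moreover have "negligible (p ` (snd gm ` {s..t} Int S))"
 if g: "gm : paths_in Om - ?G" and st: "s : fst gm" "t : fst gm" "s <= t" and p: "!!x y. (abs(p x - p y)) <= dist x y" for gm s t and p :: "complex => real"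
 proof -
 have "{s..t} <= fst gm" using g st interval_sub by (auto simp: paths_in_def is_plane_path_def)
 then have "snd gm ` {s..t} Int S <= img gm Int S" by (auto simp: img_def)
 then have "hausdorff 1 (snd gm ` {s..t} Int S) <= hausdorff 1 (img gm Int S)" by (rule hausdorff_mono)
 then have "hausdorff 1 (snd gm ` {s..t} Int S) = 0" using g by simp
 then show ?thesis using p by (rule h1_negligible)
 qed
 ultimately show ?thesis by (intro exI[of _ ?G]) blast
qed

text \<open>Lipschitz functions thus have a multiple of the diameters as upper gradient, and these
  are locally square summable. This is what admits cutoffs.\<close>

lemma aep_dist: "aep (%gm. ALL s:fst gm. ALL t:fst gm. s <= t -->
 eN (dist (snd gm s) (snd gm t)) <= nI (snd gm ` {s..t}) (%i. eN (dm i)))"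
proof -
 obtain G where G: "null1 G" "ALL gm:paths_in Om - G. ALL s:fst gm. ALL t:fst gm. s <= t -->
 (ALL p::complex => real. (ALL x y. (abs(p x - p y)) <= dist x y) --> negligible (p ` (snd gm ` {s..t} Int S)))"
 using null1_length by (elim exE conjE) (rule that)
 have "cmod0 G" unfolding cmod0_iff using G(1)
 by (intro allI impI exI[of _ "%_. 0"] exI[of _ G]) auto
 then have "aep (%gm. gm ~: G)" unfolding aep_def by (rule cmod0_subset) blast
 then show ?thesis
 proof (rule aep_mono, intro ballI impI)
 fix gm s t assume g: "gm : paths_in Om" "gm ~: G" and st: "s : fst gm" "t : fst gm" "s <= t"
 have "gm : paths_in Om - G" using g by simp
 from G(2)[rule_format, OF this st]
 show "eN (dist (snd gm s) (snd gm t)) <= nI (snd gm ` {s..t}) (%i. eN (dm i))"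
 by (intro dist_le_dm[OF g(1) st]) blast
 qed
qed

end

section \<open>Cutoffs and the Caccioppoli inequality\<close>

context rel_carpet begin

lemma encl:
 assumes "compact L" "L <= Om"
 shows "EX V. open V & V \<subset>\<subset> Om & L <= V & (ALL i. cQ i Int L ~= {} --> cQ i <= V)"
proof -
 obtain L' where L': "compact L'" "L' <= Om" "L <= interior L'" "ALL i. cQ i Int L ~= {} --> cQ i <= interior L'"
 using absorb[OF assms] by blast
 have "closure (interior L') <= L'" using L'(1) by (simp add: closure_minimal compact_imp_closed interior_subset)
 then have "interior L' \<subset>\<subset> Om" using L' bounded_subset[of L'] unfolding ccontained_def
 by (auto simp: compact_eq_bounded_closed)
 then show ?thesis using L' by (intro exI[of _ "interior L'"]) auto
qed

lemma cutoff:
 assumes "compact L" "L <= Om"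
 shows "\<exists>(et :: complex => real) K c. compact K & K <= Om & c >= 0 & (ALL x. 0 <= et x & et x <= 1) & (ALL x:L. et x = 1) &
 (ALL x. x ~: K --> et x = 0) & (ALL x y. (abs(et x - et y)) <= c * dist x y)"
proof (cases "L = {}")
 case True
 then show ?thesis by (intro exI[of _ "%_. 0"] exI[of _ "{}"] exI[of _ 0]) auto
next
 case False
 obtain e where e: "e > 0" "(\<Union>x\<in>L. ball x e) <= Om"
 using compact_subset_open_imp_ball_epsilon_subset[OF assms(1) open_Om assms(2)] by blast
 let ?K = "\<Union>x\<in>L. cball x (e/2)" and ?et = "%x. max 0 (1 - infdist x L / (e/2))"
 have "?K <= (\<Union>x\<in>L. ball x e)" using e by (intro UN_mono) (auto simp: subset_iff)
 then have K: "compact ?K" "?K <= Om" using compact_minkowski_sum_cball[OF assms(1)] e by auto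
 have "?et x = 0" if "x ~: ?K" for x
 proof -
 obtain a where a: "a : L" "infdist x L = dist x a"
 using infdist_attains_inf[of L x] assms(1) False compact_imp_closed by auto
 then have "dist x a > e/2" using that by (auto simp: dist_commute not_le)
 then show ?thesis using a e by (auto simp: field_simps)
 qed
 moreover have "(abs(?et x - ?et y)) <= (2/e) * dist x y" for x y
 proof -
 have "infdist x L <= infdist y L + dist x y" "infdist y L <= infdist x L + dist y x" by (rule infdist_triangle)+
 then have "(abs(infdist x L - infdist y L)) <= dist x y" by (simp add: dist_commute)
 have "(abs(?et x - ?et y)) <= (abs(infdist x L / (e/2) - infdist y L / (e/2)))" by linarith
 also have "infdist x L / (e/2) - infdist y L / (e/2) = (2/e) * (infdist x L - infdist y L)"
 by (simp add: algebra_simps)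
 also have "(abs((2/e) * (infdist x L - infdist y L))) = (2/e) * (abs(infdist x L - infdist y L))" unfolding abs_mult using e by simp
 also have "... <= (2/e) * dist x y" using \<open>(abs(infdist x L - infdist y L)) <= dist x y\<close> e by (intro mult_left_mono) auto
 finally show ?thesis .
 qed
 moreover have "0 <= ?et x & ?et x <= 1" for x using e infdist_nonneg[of x L] by auto
 moreover have "?et x = 1" if "x : L" for x using that by simp
 ultimately show ?thesis using K e by (intro exI[of _ ?et] exI[of _ ?K] exI[of _ "2/e"]) auto
qed

text \<open>Product rule: the cutoff adds \<open>C * c\<close> times the diameters to the upper
  gradient of \<open>w\<close>, where \<open>C\<close> bounds \<open>w\<close> on
  \<open>K\<close>.\<close>

lemma tst_cutoff:
 assumes K: "compact K" "K <= Om" and c: "c >= 0" and et: "!!x. 0 <= et x & et x <= 1" "!!x. x ~: K ==> et x = 0" "!!x y. (abs(et x - et y)) <= c * dist x y"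
 and w: "aep (ug w sg)" "l2loc sg" "!!i. Oe w i <= sg i" "fb w" and C: "C >= 0" "!!x. x : S Int K ==> (abs(w x)) <= C"
 shows "tst (%x. et x * w x)"
proof -
 have main: "(abs(et x * w x - et y * w y)) <= (abs(w x - w y)) + C * c * dist x y" if "x : S" "y : S" for x y
 proof (cases "y : K")
 case True
 have "et x * w x - et y * w y = et x * (w x - w y) + (et x - et y) * w y" by (simp add: algebra_simps)
 also have "(abs(...)) <= (abs(et x * (w x - w y))) + (abs((et x - et y) * w y))" by (rule abs_triangle_ineq)
 also have "(abs(et x * (w x - w y))) <= (abs(w x - w y))" using et(1)[of x] by (simp add: abs_mult mult_left_le_one_le)
 also have "(abs((et x - et y) * w y)) <= (c * dist x y) * C" unfolding abs_mult using et(3) C True that c by (intro mult_mono) auto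
 finally show ?thesis by (simp add: mult_ac)
 next
 case False
 show ?thesis
 proof (cases "x : K")
 case True
 have "(abs(et x * w x - et y * w y)) = (abs(et x - et y)) * (abs(w x))" using et(2)[OF False] by (simp add: abs_mult)
 also have "... <= (c * dist x y) * C" using et(3) C True that c by (intro mult_mono) auto
 finally show ?thesis by (simp add: mult_ac)
 qed (use False et(2) C c in auto)
 qed
 let ?f = "%x. et x * w x" and ?rh = "%i. sg i + eN (C * c) * eN (dm i)"
 have Cc: "0 <= C * c" using C c by simp
 have bd: "EX C. ALL x:S. (abs(?f x)) <= C"
 proof (intro exI ballI)
 fix x assume x: "x : S"
 show "(abs(?f x)) <= C"
 proof (cases "x : K")
 case True then show ?thesis using et(1)[of x] C(2)[of x] x by (simp add: abs_mult) (meson C(1) abs_ge_zero mult_left_le_one_le order_trans)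
 qed (use et(2) C in simp)
 qed
 then obtain B where "ALL x:S. (abs(?f x)) <= B" by blast
 then have fbf: "fb ?f" by (intro fb_bounded[of _ B]) auto
 have "eN (Os ?f i) <= ?rh i" for i
 proof -
 have "Os ?f i <= Os w i + C * c * dm i"
 proof (rule O_le[OF fbf])
 fix x y assume xy: "x : fr i" "y : fr i"
 then have "(abs(w x - w y)) <= Os w i" "dist x y <= dm i" using O_ge[OF w(4)] closure_dist fr_Q by auto
 moreover have "C * c * dist x y <= C * c * dm i" using calculation Cc by (intro mult_left_mono) auto
 moreover have "(abs(?f x - ?f y)) <= (abs(w x - w y)) + C * c * dist x y" using xy fr_S by (intro main) auto
 ultimately show "?f x - ?f y <= Os w i + C * c * dm i" by linarith
 qed
 then have "eN (Os ?f i) <= eN (Os w i + C * c * dm i)" by (rule ennreal_leI)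
 also have "... = Oe w i + eN (C * c) * eN (dm i)"
 using O_nonneg[OF w(4)] Cc dm_nonneg by (simp add: ennreal_plus ennreal_mult')
 also have "... <= ?rh i" by (intro add_right_mono w)
 finally show ?thesis .
 qed
 moreover have "l2loc ?rh" using w l2loc_cmult[OF l2loc_dm, of "eN (C * c)"] by (intro l2loc_add) auto
 moreover have "aep (ug ?f ?rh)"
 using aep_conj[OF w(1) aep_dist]
 proof (rule aep_mono)
 fix gm assume a: "ug w sg gm & (ALL s:fst gm. ALL t:fst gm. s <= t -->
 eN (dist (snd gm s) (snd gm t)) <= nI (snd gm ` {s..t}) (%i. eN (dm i)))"
 show "ug ?f ?rh gm" unfolding ug_def
 proof (intro ballI impI)
 fix s t assume st: "s : fst gm" "t : fst gm" "s <= t" "snd gm s : S" "snd gm t : S"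
 let ?x = "snd gm s" and ?y = "snd gm t" and ?J = "I (snd gm ` {s..t})"
 have 1: "eN (abs(w ?x - w ?y)) <= ns ?J sg" using a st unfolding ug_def by simp
 have 2: "eN (dist ?x ?y) <= ns ?J (%i. eN (dm i))" using a st by simp
 have "eN (abs(?f ?x - ?f ?y)) <= eN ((abs(w ?x - w ?y)) + C * c * dist ?x ?y)" by (intro ennreal_leI main st)
 also have "... = eN (abs(w ?x - w ?y)) + eN (C * c) * eN (dist ?x ?y)" using Cc by (simp add: ennreal_plus ennreal_mult')
 also have "... <= ns ?J sg + eN (C * c) * ns ?J (%i. eN (dm i))" by (intro add_mono mult_left_mono 1 2) auto
 finally show "eN (abs(?f ?x - ?f ?y)) <= ns ?J ?rh" by (simp add: ns_add ns_cmult)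
 qed
 qed
 ultimately show ?thesis unfolding tst_def using bd K et(2) by auto
qed

section \<open>Change of sign and the Caccioppoli estimate\<close>

lemma O_uminus: "fb f ==> Os (%x. - f x) i = Os f i"
proof (rule antisym)
 assume f: "fb f"
 show "Os (%x. - f x) i <= Os f i" using O_ge[OF f] by (intro O_le fb_uminus f) (smt (verit))
 show "Os f i <= Os (%x. - f x) i" using O_ge[OF fb_uminus[OF f]] by (intro O_le f) (smt (verit))
qed

lemma ug_uminus: "ug (%x. - f x) rh = ug f rh"
 by (rule ext) (simp add: ug_def abs_minus_commute)

lemma harmD: "harm u ==> open V ==> V \<subset>\<subset> Om ==> tst f ==> ALL x:S - V. f x = 0 ==>
 nI V (O2 u) <= nI V (O2 (%x. u x + f x))"
 unfolding harm_def by blast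

lemma sob_uminus: "sob f ==> sob (%x. - f x)"
 unfolding sob_def by (simp add: O_uminus ug_uminus fb_uminus cong: conj_cong)

lemma tst_uminus: "tst f ==> tst (%x. - f x)"
 using tst_fb[of f] unfolding tst_def by (simp add: O_uminus ug_uminus)

lemma harm_uminus: assumes "harm u" shows "harm (%x. - u x)"
 unfolding harm_def
proof (intro conjI allI impI)
 have s: "sob u" using assms by (simp add: harm_def)
 then show "sob (%x. - u x)" by (rule sob_uminus)
 have fu: "fb u" using s by (simp add: sob_def)
 fix V f assume V: "open V" "V \<subset>\<subset> Om" and f: "tst f" "ALL x:S - V. f x = 0"
 have "nI V (O2 u) <= nI V (O2 (%x. u x + - f x))"
 by (rule harmD[OF assms V tst_uminus[OF f(1)]]) (use f(2) in simp)
 also have "... = nI V (O2 (%x. - u x + f x))"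
 using O_uminus[OF fb_add[OF fb_uminus[OF fu] tst_fb[OF f(1)]]] by simp
 finally show "nI V (O2 (%x. - u x)) <= nI V (O2 (%x. - u x + f x))"
 by (simp add: O_uminus[OF fu])
qed

text \<open>The estimate for a single disk: \<open>a\<close> is the oscillation of u,
  \<open>s\<close> the least value of the cutoff on the circle, \<open>r\<close> a bound for the
  variation of the cutoff and \<open>x\<close> the oscillation of the competitor. If
  \<open>r <= s\<close> the cross term is absorbed, otherwise everything is of order
  \<open>C * r\<close>, apart from \<open>a^2\<close>.\<close>

lemma cacc_ineq:
 fixes a s r C x :: real
 assumes "0 <= a" "a <= 2 * C" "0 <= s" "s <= 1" "0 <= r" "r <= 1" "0 <= x" "x <= (1 - s^2) * a + 2 * C * (s + r) * r"
 shows "x^2 + s^2 * a^2 <= a^2 + 36 * C^2 * r^2"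
proof -
 have C: "0 <= C" and s2: "s^2 <= 1" using assms by (auto simp: power_le_one)
 define b where "b = 2 * C * (s + r) * r"
 have b0: "0 <= b" using assms C by (simp add: b_def)
 have x2: "x^2 <= ((1 - s^2) * a + b)^2" using assms by (intro power_mono) (auto simp: b_def)
 show ?thesis
 proof (cases "r <= s")
 case True
 define be where "be = 4 * C * r"
 have be: "0 <= be" using C assms by (simp add: be_def)
 have "2 * C * r * (s + r) <= 2 * C * r * (2 * s)" using True C assms by (intro mult_left_mono) auto
 then have "b <= s * be" by (simp add: b_def be_def algebra_simps)
 then have "((1 - s^2) * a + b)^2 <= ((1 - s^2) * a + s * be)^2" using b0 s2 assms by (intro power_mono) auto
 \<comment> \<open>Cauchy-Schwarz for a sum of two products with weights \<open>1 - s^2\<close> and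
   \<open>s^2\<close>, written with its exact defect.\<close>
 moreover have "(1 - s^2) * a^2 + be^2 - ((1 - s^2) * a + s * be)^2 = (1 - s^2) * (s * a - be)^2"
 by (simp add: power2_eq_square algebra_simps)
 moreover have "0 <= (1 - s^2) * (s * a - be)^2" using s2 by simp
 moreover have "be^2 = 16 * C^2 * r^2" by (simp add: be_def power_mult_distrib)
 moreover have "0 <= C^2 * r^2" by simp
 ultimately have "x^2 <= (1 - s^2) * a^2 + 16 * C^2 * r^2" "0 <= C^2 * r^2" using x2 by linarith+
 moreover have "(1 - s^2) * a^2 = a^2 - s^2 * a^2" by (simp add: algebra_simps)
 ultimately show ?thesis by linarith
 next
 case False
 have "(1 - s^2) * a <= a" using s2 assms by (simp add: mult_left_le_one_le)
 then have "((1 - s^2) * a + b)^2 <= (a + b)^2" using b0 s2 assms by (intro power_mono) auto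
 also have "... = a^2 + 2 * a * b + b^2" by (simp add: power2_sum)
 finally have 1: "x^2 <= a^2 + 2 * a * b + b^2" using x2 by simp
 have "2 * C * r * (s + r) <= 2 * C * r * (2 * r)" using False C assms by (intro mult_left_mono) auto
 then have b: "b <= 4 * C * r^2" by (simp add: b_def power2_eq_square algebra_simps)
 have "a * b <= (2 * C) * (4 * C * r^2)" using b b0 assms C by (intro mult_mono) auto
 then have 2: "a * b <= 8 * C^2 * r^2" by (simp add: power2_eq_square algebra_simps)
 have "r^2 <= r" using assms by (simp add: power2_eq_square mult_left_le)
 then have "b <= 4 * C * r" using b C by (meson mult_left_mono order_trans zero_le_numeral mult_nonneg_nonneg)
 then have "b^2 <= (4 * C * r)^2" using b0 by (intro power_mono)
 then have 3: "b^2 <= 16 * C^2 * r^2" by (simp add: power_mult_distrib)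
 have "s^2 * a^2 <= r^2 * (2 * C)^2" using False assms by (intro mult_mono power_mono) auto
 then have 4: "s^2 * a^2 <= 4 * C^2 * r^2" by (simp add: power_mult_distrib mult_ac)
 \<comment> \<open>The constants add up as 16 + 16 + 4.\<close>
 show ?thesis using 1 2 3 4 by linarith
 qed
qed

text \<open>The competitor subtracts the square of a cutoff times u. Squaring the cutoff puts its
  values into the cross term, which \<open>cacc_ineq\<close> needs; the energy of u over
  \<open>V\<close> cancels and squared diameters remain.\<close>

lemma caccioppoli:
 assumes L: "compact L" "L <= Om"
 shows "EX L'. compact L' & L' <= Om & (ALL C>=0. EX E. ALL u. harm u --> (ALL x:S Int L'. (abs(u x)) <= C) -->
 nI L (O2 u) <= ennreal E)"
proof -
 obtain L1 where L1: "compact L1" "L1 <= Om" "ALL i. cQ i Int L ~= {} --> cQ i <= interior L1"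
 using absorb[OF L] by blast
 obtain et :: "complex => real" and K c where K: "compact K" "K <= Om" "c >= 0" and et: "!!x. 0 <= et x & et x <= 1" "!!x. x : L1 ==> et x = 1"
 "!!x. x ~: K ==> et x = 0" "!!x y. (abs(et x - et y)) <= c * dist x y"
 using cutoff[OF L1(1,2)] by metis
 obtain V where V: "open V" "V \<subset>\<subset> Om" "K <= V" "ALL i. cQ i Int K ~= {} --> cQ i <= V"
 using encl[OF K(1,2)] by blast
 have cV: "compact (closure V)" "closure V <= Om" using V(2) by (auto simp: ccontained_def)
 have "EX E. ALL u. harm u --> (ALL x:S Int closure V. (abs(u x)) <= C) --> nI L (O2 u) <= ennreal E" if C: "C >= 0" for C
 proof -
 obtain P where P: "nI V (%i. eN ((dm i)^2)) = ennreal P" "0 <= P"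
 using sum_diam_sq[of V] cV bounded_subset[OF compact_imp_bounded closure_subset] by (metis ennreal_cases less_irrefl infinity_ennreal_def)
 have "nI L (O2 u) <= eN (36 * C^2 * c^2 * P)" if u: "harm u" and uC: "ALL x:S Int closure V. (abs(u x)) <= C" for u
 proof -
 have su: "sob u" using u by (simp add: harm_def)
 then have fu: "fb u" by (simp add: sob_def)
 have e2: "(abs((et x)^2 - (et y)^2)) <= (2 * c) * dist x y" for x y
 proof -
 have "(abs((et x)^2 - (et y)^2)) = (abs(et x - et y)) * (abs(et x + et y))" by (simp add: power2_eq_square square_diff_square_factored abs_mult[symmetric] mult.commute)
 also have "... <= (c * dist x y) * 2" using et(1)[of x] et(1)[of y] et(4)[of x y] K(3) by (intro mult_mono) auto
 finally show ?thesis by simp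
 qed
 have t: "tst (%x. (et x)^2 * - u x)"
 proof (rule tst_cutoff[OF K(1,2), of "2 * c" "%x. (et x)^2" "%x. - u x" "%i. Oe u i" C])
 show "0 <= (et x)^2 & (et x)^2 <= 1" for x using et(1)[of x] by (simp add: power_le_one)
 show "(abs(- u x)) <= C" if "x : S Int K" for x using uC that V(3) closure_subset by auto
 qed (use K et e2 C su O_uminus[OF fu] fb_uminus[OF fu] in \<open>auto simp: sob_def ug_uminus\<close>)
 let ?u' = "%x. u x + (et x)^2 * - u x"
 have le: "nI V (O2 u) <= nI V (%i. (eN (Os ?u' i))^2)"
 by (rule harmD[OF u V(1,2) t]) (use et(3) V(3) in auto)
 have fu': "fb ?u'" by (rule fb_add[OF fu tst_fb[OF t]])
 \<comment> \<open>The least value of the cutoff on the circle; it is 1 for disks that meet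
   \<open>L\<close>.\<close>
 define s where "s i = ms et i" for i
 have bet: "bdd_below (et ` fr i)" for i using et(1) by (intro bdd_belowI[of _ 0]) auto
 have s: "0 <= s i" "!!x. x : fr i ==> s i <= et x" for i
 using et(1) bet by (auto simp: s_def intro!: ms_greatest cINF_lower)
 have s1: "s i <= 1" for i using s(2)[of _ i] et(1) fr_ne[of i] by (meson ex_in_conv order_trans)
 have trm: "(eN (Os ?u' i))^2 + eN ((s i)^2) * (Oe u i)^2 <= (Oe u i)^2 + eN (36 * C^2 * c^2) * eN ((dm i)^2)" for i
 proof -
 define r where "r = min (c * dm i) 1"
 have r: "0 <= r" "r <= 1" "r <= c * dm i" using K(3) dm_nonneg by (auto simp: r_def)
 have etr: "(abs(et x - et y)) <= r" if "x : fr i" "y : fr i" for x y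
 proof -
 have "dist x y <= dm i" using that closure_dist fr_Q by auto
 then have "c * dist x y <= c * dm i" using K(3) by (intro mult_left_mono)
 then show ?thesis using et(4)[of x y] et(1)[of x] et(1)[of y] by (auto simp: r_def)
 qed
 have "(Os ?u' i)^2 + (s i)^2 * (Os u i)^2 <= (Os u i)^2 + 36 * C^2 * r^2"
 proof (cases "fr i Int K = {}")
 case True
 then have z: "et x = 0" if "x : fr i" for x using et(3) that by blast
 then have "Os ?u' i = Os u i" by (intro O_cong) simp
 moreover have "s i = 0" using s z fr_ne[of i] by (metis all_not_in_conv order_antisym)
 ultimately show ?thesis by simp
 next
 case False
 then have "cQ i Int K ~= {}" using fr_Q by blast
 then have uf: "(abs(u x)) <= C" if "x : fr i" for x
 using that V(4) uC fr_S[of i] fr_Q[of i] closure_subset[of V] by blast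
 have "Os u i <= 2 * C" using uf by (intro O_le[OF fu]) (smt (verit))
 moreover have "Os ?u' i <= (1 - (s i)^2) * Os u i + 2 * C * (s i + r) * r"
 proof (rule O_le[OF fu'])
 fix x y assume xy: "x : fr i" "y : fr i"
 have "(u x + (et x)^2 * - u x) - (u y + (et y)^2 * - u y) = (1 - (et x)^2) * (u x - u y) + ((et y)^2 - (et x)^2) * u y"
 by (simp add: algebra_simps)
 also have "(1 - (et x)^2) * (u x - u y) <= (1 - (s i)^2) * Os u i"
 proof -
 have "(1 - (et x)^2) * (u x - u y) <= (1 - (et x)^2) * Os u i"
 using O_ge[OF fu xy] et(1)[of x] by (intro mult_left_mono) (auto simp: power_le_one)
 also have "... <= (1 - (s i)^2) * Os u i"
 using s(2)[OF xy(1)] s(1) O_nonneg[OF fu] by (intro mult_right_mono) (auto intro: power_mono)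
 finally show ?thesis .
 qed
 \<comment> \<open>A difference of squares: one factor is at most \<open>r\<close>, the other at
   most \<open>2 * (s i + r)\<close>, since the cutoff varies by at most \<open>r\<close> on the
   circle.\<close>
 also have "((et y)^2 - (et x)^2) * u y <= (r * (2 * (s i + r))) * C"
 proof -
 have up: "et z <= s i + r" if z: "z : fr i" for z
 proof -
 have "et z - r <= s i" unfolding s_def using etr[OF z] by (intro ms_greatest) (smt (verit))
 then show ?thesis by simp
 qed
 have "((et y)^2 - (et x)^2) * u y <= (abs((et y)^2 - (et x)^2)) * (abs(u y))" by (metis abs_ge_self abs_mult)
 also have "(abs((et y)^2 - (et x)^2)) = (abs(et y - et x)) * (abs(et y + et x))" by (simp add: power2_eq_square square_diff_square_factored abs_mult[symmetric] mult.commute)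
 also have "(abs(et y - et x)) * (abs(et y + et x)) * (abs(u y)) <= (r * (2 * (s i + r))) * C"
 using etr[OF xy(2,1)] up[OF xy(1)] up[OF xy(2)] uf[OF xy(2)] et(1)[of x] et(1)[of y] r s(1)
 by (intro mult_mono) auto
 finally show ?thesis .
 qed
 finally show "(u x + (et x)^2 * - u x) - (u y + (et y)^2 * - u y) <= (1 - (s i)^2) * Os u i + 2 * C * (s i + r) * r"
 by (simp add: mult_ac)
 qed
 ultimately show ?thesis using O_nonneg[OF fu] O_nonneg[OF fu'] s(1) s1 r by (intro cacc_ineq) auto
 qed
 also have "36 * C^2 * r^2 <= 36 * C^2 * c^2 * (dm i)^2"
 using power_mono[OF r(3) r(1), of 2] by (simp add: power_mult_distrib mult_left_mono mult.assoc)
 finally have "eN ((Os ?u' i)^2 + (s i)^2 * (Os u i)^2) <= eN ((Os u i)^2 + 36 * C^2 * c^2 * (dm i)^2)" by (intro ennreal_leI) simp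
 then show ?thesis using O_nonneg[OF fu] O_nonneg[OF fu'] by (simp add: ennreal_plus ennreal_mult' ennreal_power)
 qed
 let ?a = "nI V (O2 u)"
 have fin: "?a < iN"
 proof -
 have "nI (closure V) (O2 u) < iN" using su cV by (intro l2locD) (auto simp: sob_def)
 then show ?thesis using ns_mono[OF I_mono[OF closure_subset] order_refl] by (rule order_le_less_trans[rotated])
 qed
 have "?a + nI V (%i. eN ((s i)^2) * (Oe u i)^2) <= nI V (%i. (eN (Os ?u' i))^2 + eN ((s i)^2) * (Oe u i)^2)"
 unfolding ns_add by (intro add_right_mono le)
 also have "... <= nI V (%i. (Oe u i)^2 + eN (36 * C^2 * c^2) * eN ((dm i)^2))"
 by (intro ns_mono trm) auto
 also have "... = ?a + eN (36 * C^2 * c^2 * P)" using P by (simp add: ns_add ns_cmult ennreal_mult)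
 \<comment> \<open>The energy of u over \<open>V\<close> is finite and may be cancelled on both
   sides.\<close>
 finally have "nI V (%i. eN ((s i)^2) * (Oe u i)^2) <= eN (36 * C^2 * c^2 * P)"
 using fin by (subst (asm) ennreal_add_left_cancel_le) auto
 moreover have "nI L (O2 u) <= nI V (%i. eN ((s i)^2) * (Oe u i)^2)"
 unfolding ns_def
 proof (intro nn_integral_mono)
 fix i
 have "i : I V & s i = 1" if i: "i : I L"
 proof -
 have "cQ i Int L ~= {}" using i closure_subset[of "Q i"] by (auto simp: meeting_def)
 then have c1: "cQ i <= L1" using L1(3) interior_subset by blast
 then have "et x = 1" if "x : cQ i" for x using et(2) that by blast
 moreover have "s i >= 1" unfolding s_def using calculation fr_Q[of i] by (intro ms_greatest) auto
 moreover have "Q i <= V"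
 proof
 fix x assume "x : Q i"
 then have "et x = 1" using calculation(1) closure_subset by blast
 then show "x : V" using et(3) V(3) by force
 qed
 ultimately show ?thesis using s1[of i] Q_ne[of i] by (auto simp: meeting_def)
 qed
 then show "(Oe u i)^2 * indicator (I L) i <= eN ((s i)^2) * (Oe u i)^2 * indicator (I V) i"
 by (auto split: split_indicator)
 qed
 ultimately show ?thesis by simp
 qed
 then show ?thesis by blast
 qed
 then show ?thesis using cV by blast
qed

end

section \<open>The maximum principle\<close>

lemma ns_eq_termwise:
 assumes "ns A g <= ns A f" "ns A g < iN" "!!i. f i <= g i" "i : A"
 shows "f i = g i"
proof -
 have e: "g i = f i + (g i - f i)" for i using assms(3)[of i] by (simp add: ennreal_add_diff_cancel_right add_diff_inverse_ennreal)
 have "ns A g = ns A (%i. f i + (g i - f i))" using e by simp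
 also have "... = ns A f + ns A (%i. g i - f i)" by (rule ns_add)
 finally have g: "ns A g = ns A f + ns A (%i. g i - f i)" .
 have ff: "ns A f < iN" using ns_mono[OF order_refl assms(3), of A] assms(2) by (rule order_le_less_trans)
 have "ns A f + ns A (%i. g i - f i) <= ns A f + 0" using assms(1) g by simp
 then have "ns A (%i. g i - f i) <= 0" using ff by (subst (asm) ennreal_add_left_cancel_le) auto
 then have "g i - f i = 0" using ns_single[OF assms(4), of "%i. g i - f i"] by simp
 then show ?thesis using e[of i] by simp
qed

lemma sqr_cross: "z1 : sqr x e ==> z2 : sqr x e ==> Complex (Re z2) (Im z1) : sqr x e"
 by (auto simp: sqr_def ninf_def)

lemma lin_in_sqr:
 assumes "lin b y s : sqr x e" "lin b y t : sqr x e" "tu : {s..t}" shows "lin b y tu : sqr x e"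
 using assms by (cases b) (auto simp: sqr_def ninf_def lin_def)

context rel_carpet begin

text \<open>\<open>vals f e\<close>: the values of \<open>f\<close> attached to a point of \<open>Om\<close>, which may lie in a peripheral disk.\<close>
definition vals :: "(complex => real) => complex => real set" where
 "vals f e = {f x | x. (e : S & x = e) | (EX l. e : Q l & x : fr l)}"

lemma vals_S: "e : S ==> vals f e = {f e}"
 using S_Q unfolding vals_def by blast

lemma vals_Q: assumes "e : Q l" shows "vals f e = f ` fr l"
proof -
 have "e ~: S" using assms S_Q by blast
 moreover have "l' = l" if "e : Q l'" for l'
 using Q_unique[OF that, of l] assms closure_subset[of "Q l"] by blast
 ultimately have "vals f e = {f x | x. x : fr l}" using assms unfolding vals_def by blast
 then show ?thesis by blast
qed

lemma vals_ne: "e : Om ==> vals f e ~= {}"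
 using in_Om[of e] fr_ne unfolding vals_def by blast

text \<open>What a generic segment of small total oscillation provides, detached from lines so that
  it also makes sense for points inside disks.\<close>

definition okset :: "(complex => real) => complex set => real => bool" where
 "okset f X W \<longleftrightarrow> fb f & connected X & X <= Om & nI X (Oe f) <= ennreal W & 0 <= W &
 (ALL x:X Int S. ALL y:X Int S. (abs(f x - f y)) <= W)"

lemma okset_O: "okset f X W ==> l : I X ==> Os f l <= W"
 using ns_single[of l "I X" "%i. Oe f i"] unfolding okset_def
 by (meson ennreal_le_iff order_trans)

text \<open>An end point inside a disk is moved, at cost \<open>W\<close>, to a point where
  \<open>X\<close> crosses the circle; two moves and the way between them give \<open>3 * W\<close>.
  If \<open>X\<close> lies in one disk there is no crossing, but then both values belong to the same
  circle.\<close>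

lemma okset_vals:
 assumes X: "okset f X W" and e: "e1 : X" "e2 : X" and v: "a : vals f e1" "b : vals f e2"
 shows "(abs(a - b)) <= 3 * W"
proof -
 have f: "fb f" and con: "connected X" and W: "0 <= W" and d: "!!x y. x : X Int S ==> y : X Int S ==> (abs(f x - f y)) <= W"
 using X by (auto simp: okset_def)
 have key: "EX y:X Int S. (abs(a - f y)) <= W" if kh: "e : X" "a : vals f e" "~ X <= Q l" "e : Q l" for e a l
 proof -
 obtain x where x: "a = f x" "x : fr l" using kh(2) vals_Q[OF kh(4), of f] by blast
 have "X Int fr l ~= {}" using con kh by (intro connected_Int_frontier) auto
 then obtain y where y: "y : X" "y : fr l" by blast
 have "l : I X" using kh by (auto simp: meeting_def)
 then have "(abs(f x - f y)) <= W" using okset_O[OF X] O_ge[OF f x(2) y(2)] by force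
 then show ?thesis using x y fr_S by blast
 qed
 have key': "EX y:X Int S. (abs(a - f y)) <= W" if kh: "e : X" "a : vals f e" "ALL l. ~ X <= Q l" for e a
 proof (cases "e : S")
 case True
 then have "a = f e" using kh vals_S[of e f] by blast
 then show ?thesis using True kh W by (intro bexI[of _ e]) auto
 next
 case False
 then obtain l where l: "e : Q l" using kh in_Om[of e] X unfolding okset_def by blast
 show ?thesis using key[OF kh(1,2) _ l] kh(3) by simp
 qed
 show ?thesis
 proof (cases "EX l. X <= Q l")
 case True
 then obtain l where l: "X <= Q l" by blast
 then obtain x y where "a = f x" "x : fr l" "b = f y" "y : fr l"
 using e v vals_Q[of e1 l f] vals_Q[of e2 l f] by blast
 moreover have "l : I X" using l e by (auto simp: meeting_def)
 ultimately have "(abs(a - b)) <= W" using okset_O[OF X] O_ge[OF f, of x l y] by force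
 then show ?thesis using W by simp
 next
 case False
 then obtain x y where "x : X Int S" "(abs(a - f x)) <= W" "y : X Int S" "(abs(b - f y)) <= W"
 using key'[OF e(1) v(1)] key'[OF e(2) v(2)] by blast
 then show ?thesis using d[of x y] by linarith
 qed
qed

definition gline :: "(complex => real) => bool => real => bool" where
 "gline f b y \<longleftrightarrow> (ALL J. bounded J --> is_interval J --> J ~= {} --> lin b y ` J <= Om --> ug f (Oe f) (J, lin b y))"

lemma AE_gline: "sob f ==> AE y in lborel. gline f b y"
 unfolding gline_def sob_def by (intro aep_lines) simp

lemma gline_okset:
 assumes g: "gline f b y" and f: "fb f" and st: "s <= t" and sub: "lin b y ` {s..t} <= Om"
 and W: "nI (lin b y ` {s..t}) (Oe f) <= ennreal W" "0 <= W"
 shows "okset f (lin b y ` {s..t}) W"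
 unfolding okset_def
proof (intro conjI f sub W ballI)
 show "connected (lin b y ` {s..t})" by (intro connected_continuous_image cont_lin) auto
 have u: "ug f (Oe f) ({s..t}, lin b y)"
 using g st sub unfolding gline_def by (auto simp: is_interval_cc)
 have *: "(abs(f (lin b y p) - f (lin b y q))) <= W" if "p : {s..t}" "q : {s..t}" "p <= q" "lin b y p : S" "lin b y q : S" for p q
 proof -
 have "eN (abs(f (lin b y p) - f (lin b y q))) <= nI (lin b y ` {p..q}) (Oe f)"
 using u that unfolding ug_def by simp
 also have "... <= nI (lin b y ` {s..t}) (Oe f)"
 using that by (intro ns_mono I_mono image_mono) auto
 also have "... <= ennreal W" by (rule W)
 finally show ?thesis using W(2) by (simp add: ennreal_le_iff)
 qed
 fix x z assume "x : lin b y ` {s..t} Int S" "z : lin b y ` {s..t} Int S"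
 then obtain p q where pq: "p : {s..t}" "q : {s..t}" "x = lin b y p" "z = lin b y q" "x : S" "z : S" by auto
 show "(abs(f x - f z)) <= W"
 using *[of p q] *[of q p] pq by (cases "p <= q") (auto simp: abs_minus_commute)
qed

lemma AE_interval: "AE y in lborel. P y ==> a < (b::real) ==> EX y. a < y & y < b & P y"
proof (rule ccontr)
 assume a: "AE y in lborel. P y" "a < b" "~ (EX y. a < y & y < b & P y)"
 have "AE y in lborel. y ~: {a<..<b}" using a(1) by eventually_elim (use a(3) in auto)
 then have "{a<..<b} : null_sets lborel" by (subst AE_iff_null_sets) auto
 then show False using a(2) by (auto simp: null_sets_def)
qed

lemma sqr_in_open: "open U ==> x : U ==> EX e>0. sqr x e <= U"
proof -
 assume "open U" "x : U"
 then obtain e where e: "e > 0" "cball x e <= U" using open_contains_cball by blast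
 have "sqr x (e/2) <= cball x e" using sqr_subset_csqr csqr_subset_cball[of x "e/2"] by auto
 then show ?thesis using e by (intro exI[of _ "e/2"]) auto
qed

lemma sqr_center: "e > 0 ==> x : sqr x e" by (simp add: sqr_def ninf_def)

lemma sqr_mono: "e <= e' ==> sqr x e <= sqr x e'" by (auto simp: sqr_def)

lemma perturb:
 assumes "open U" "z : U" "AE y in lborel. P y"
 shows "EX z':U. P (phi b z') "
proof -
 obtain e where e: "e > 0" "ball z e <= U" using assms open_contains_ball by blast
 obtain y where y: "phi b z - e < y" "y < phi b z + e" "P y" using AE_interval[OF assms(3), of "phi b z - e" "phi b z + e"] e by auto
 let ?z = "lin b y (phi (~ b) z)"
 have "dist z ?z = dist (lin (~ b) (phi (~ b) z) (phi b z)) (lin (~ b) (phi (~ b) z) y)"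
 by (cases b) (auto simp: lin_def phi_def)
 also have "... < e" using y by (simp add: abs_less_iff)
 finally have "?z : U" using e by auto
 then show ?thesis using y by (intro bexI[of _ ?z]) auto
qed

text \<open>An L-shaped connection inside the square. Its ends lie in open disks and can be moved
  until both lines are generic, and squares are products, so they contain the corner.\<close>

lemma sqr_two_lines:
 assumes h: "AE y in lborel. P y" and v: "AE y in lborel. P' y"
 and j: "Q j Int sqr w e ~= {}" and k: "Q k Int sqr w e ~= {}"
 shows "EX y x s t s' t'. P y & P' x & s <= t & s' <= t' & lin True y ` {s..t} <= sqr w e & lin False x ` {s'..t'} <= sqr w e &
 lin True y ` {s..t} Int Q j ~= {} & lin False x ` {s'..t'} Int Q k ~= {} & lin True y ` {s..t} Int lin False x ` {s'..t'} ~= {}"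
proof -
 have op: "open (Q i Int sqr w e)" for i by (intro open_Int) auto
 obtain z10 z20 where z0: "z10 : Q j Int sqr w e" "z20 : Q k Int sqr w e" using j k by blast
 obtain z1 where z1: "z1 : Q j Int sqr w e" "P (phi True z1)"
 using perturb[OF op z0(1) h, of True] by (elim bexE)
 obtain z2 where z2: "z2 : Q k Int sqr w e" "P' (phi False z2)"
 using perturb[OF op z0(2) v, of False] by (elim bexE)
 let ?c = "Complex (Re z2) (Im z1)"
 have c: "?c : sqr w e" using sqr_cross z1 z2 by blast
 have l1: "z1 = lin True (Im z1) (Re z1)" "?c = lin True (Im z1) (Re z2)" by (auto simp: lin_def)
 have l2: "z2 = lin False (Re z2) (Im z2)" "?c = lin False (Re z2) (Im z1)" by (auto simp: lin_def)
 let ?s = "min (Re z1) (Re z2)" and ?t = "max (Re z1) (Re z2)"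
 let ?s' = "min (Im z1) (Im z2)" and ?t' = "max (Im z1) (Im z2)"
 have i1: "z1 : lin True (Im z1) ` {?s..?t}" "?c : lin True (Im z1) ` {?s..?t}" using l1 by (auto intro!: image_eqI)
 have i2: "z2 : lin False (Re z2) ` {?s'..?t'}" "?c : lin False (Re z2) ` {?s'..?t'}" using l2 by (auto intro!: image_eqI)
 have e1: "lin True (Im z1) ?s : sqr w e" "lin True (Im z1) ?t : sqr w e" using l1 c z1 by (auto simp: min_def max_def)
 have e2: "lin False (Re z2) ?s' : sqr w e" "lin False (Re z2) ?t' : sqr w e" using l2 c z2 by (auto simp: min_def max_def)
 show ?thesis
 proof (intro exI conjI)
 show "P (Im z1)" "P' (Re z2)" using z1 z2 by (auto simp: phi_def)
 show "?s <= ?t" "?s' <= ?t'" by auto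
 show "lin True (Im z1) ` {?s..?t} <= sqr w e" using lin_in_sqr[OF e1] by blast
 show "lin False (Re z2) ` {?s'..?t'} <= sqr w e" using lin_in_sqr[OF e2] by blast
 show "lin True (Im z1) ` {?s..?t} Int Q j ~= {}" "lin False (Re z2) ` {?s'..?t'} Int Q k ~= {}"
 "lin True (Im z1) ` {?s..?t} Int lin False (Re z2) ` {?s'..?t'} ~= {}" using i1 i2 z1 z2 by blast+
 qed
qed

lemma locally_const:
 assumes f: "sob f" and sub: "sqr w e <= Om" and z: "!!i. i : I (sqr w e) ==> Os f i = 0"
 and j: "Q j Int sqr w e ~= {}" "x : fr j" and k: "Q k Int sqr w e ~= {}" "y : fr k"
 shows "f x = f y"
proof -
 have fb: "fb f" using f by (simp add: sob_def)
 obtain p q s t s' t' where L: "gline f True p" "gline f False q" "s <= t" "s' <= t'" "lin True p ` {s..t} <= sqr w e" "lin False q ` {s'..t'} <= sqr w e"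
 "lin True p ` {s..t} Int Q j ~= {}" "lin False q ` {s'..t'} Int Q k ~= {}" "lin True p ` {s..t} Int lin False q ` {s'..t'} ~= {}"
 using sqr_two_lines[OF AE_gline[OF f, of True] AE_gline[OF f, of False] j(1) k(1)]
 by (elim exE conjE) (rule that)
 have 0: "nI X (Oe f) <= ennreal 0" if sX: "X <= sqr w e" for X
 proof -
 have "nI X (Oe f) <= nI X (%i. 0)"
 using z subsetD[OF I_mono[OF sX]] by (intro ns_mono) auto
 then show ?thesis by simp
 qed
 have ok: "okset f (lin True p ` {s..t}) 0" "okset f (lin False q ` {s'..t'}) 0"
 proof -
 have "lin True p ` {s..t} <= Om" "lin False q ` {s'..t'} <= Om" using L(5,6) sub by blast+
 then show "okset f (lin True p ` {s..t}) 0" "okset f (lin False q ` {s'..t'}) 0"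
 using gline_okset[OF L(1) fb L(3) _ 0[OF L(5)]] gline_okset[OF L(2) fb L(4) _ 0[OF L(6)]] by simp_all
 qed
 obtain e1 e2 c where e: "e1 : lin True p ` {s..t}" "e1 : Q j" "e2 : lin False q ` {s'..t'}" "e2 : Q k" "c : lin True p ` {s..t}" "c : lin False q ` {s'..t'}"
 using L(7-9) by blast
 obtain a where a: "a : vals f c" using vals_ne[of c f] e(5) L(5) sub by blast
 have v: "f x : vals f e1" "f y : vals f e2" using e j k vals_Q[of e1 j f] vals_Q[of e2 k f] by auto
 show ?thesis using okset_vals[OF ok(1) e(1,5) v(1) a] okset_vals[OF ok(2) e(3,6) v(2) a] by simp
qed

text \<open>A trap: \<open>V\<close> can be left only through \<open>A\<close> or across the disks in \<open>B\<close>.\<close>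
definition trap :: "nat set => complex set => complex set => bool" where
 "trap B A V \<longleftrightarrow> finite B & open V & connected V & compact (closure V) & closure V <= Om & V Int A = {} &
 (ALL i:B. A Int Q i = {} & V Int Q i = {}) &
 (ALL z:frontier V - A. EX i:B. z : fr i & (EX e>0. ball z e <= Q i Un closure V)) &
 (EX a:A Int frontier V. (ALL i:B. a ~: cQ i) & (ALL e>0. I (A Int ball a e) ~= {}))"

text \<open>Removing from u its part \<open>v\<close> above \<open>M\<close> inside the trap
  increases no oscillation, so by minimality it preserves all of them. That makes \<open>v\<close>
  constant on every circle off \<open>B\<close>, hence locally constant across disks, and the
  contact point of the trap fixes the constant as 0.\<close>

lemma max_principle:
 assumes u: "harm u" and tr: "trap B A V" and C: "!!x. x : S Int closure V ==> (abs(u x)) <= C"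
 and MB: "!!i. i : B ==> ms u i <= M" and MA: "!!x. x : S Int A ==> u x <= M" "!!i. i : I A ==> Ms u i <= M"
 and j: "j : I V"
 shows "Ms u j <= M"
proof -
 have B: "finite B" and V: "open V" "connected V" "compact (closure V)" "closure V <= Om" "V Int A = {}"
 and BA: "!!i. i : B ==> A Int Q i = {}" and BV: "!!i. i : B ==> V Int Q i = {}"
 and exit: "!!z. z : frontier V ==> z ~: A ==> EX i:B. z : fr i & (EX e>0. ball z e <= Q i Un closure V)"
 and contact: "EX a:A Int frontier V. (ALL i:B. a ~: cQ i) & (ALL e>0. I (A Int ball a e) ~= {})"
 using tr unfolding trap_def by auto
 have su: "sob u" using u by (simp add: harm_def)
 then have fu: "fb u" by (simp add: sob_def)
 have frV: "frontier V = closure V - V" using V(1) by (simp add: frontier_def interior_open)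
 \<comment> \<open>The excess over \<open>M\<close> inside the trap. It vanishes on
   \<open>A\<close>, and only the disks of \<open>B\<close> allow it to jump when the trap is
   left.\<close>
 define v where "v x = (if x : closure V then max 0 (u x - M) else 0)" for x
 define D where "D = (abs(C)) + (abs(M))"
 have D0: "0 <= D" by (simp add: D_def)
 have vD: "0 <= v x" "x : S ==> v x <= D" for x using C[of x] by (auto simp: v_def D_def)
 have fv: "fb v" using vD by (intro fb_bounded[of _ D]) auto
 have caseA: "v x = 0" if "i : I A" "x : fr i" for i x
 using MA(2)[OF that(1)] Ms_upper[OF fu that(2)] by (auto simp: v_def)
 have caseV: "Q i <= V" if "i ~: I A" "i : I V" "i ~: B" for i
 proof -
 have "Q i Int frontier V = {}"
 proof (rule ccontr)
 assume "Q i Int frontier V ~= {}"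
 then obtain z where z: "z : Q i" "z : frontier V" by blast
 then have "z ~: A" using that by (auto simp: meeting_def)
 then obtain i' where "i' : B" "z : fr i'" using exit z by blast
 then show False using Q_unique[OF z(1), of i'] fr_Q that by auto
 qed
 then show ?thesis using connected_Int_frontier[OF connected_Q, of i V] that by (auto simp: meeting_def)
 qed
 have caseO: "v x = 0" if "i ~: I A" "i ~: I V" "i ~: B" "x : fr i" for i x
 proof (cases "x : closure V")
 case True
 have "x ~: V" using open_I_closure[OF V(1), of i] that fr_Q by blast
 then have xf: "x : frontier V" using True frV by blast
 have "x : A"
 proof (rule ccontr)
 assume "x ~: A"
 then obtain i' where "i' : B" "x : fr i'" using exit xf by blast
 then show False using fr_unique[OF that(4), of i'] fr_Q that by auto
 qed
 then have "u x <= M" using MA(1) fr_S that by blast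
 then show ?thesis by (simp add: v_def)
 qed (simp add: v_def)
 have vcases: "(ALL x:fr i. v x = 0) | (Q i <= V & (ALL x:fr i. v x = max 0 (u x - M)))" if "i ~: B" for i
 proof (cases "i : I A")
 case True then show ?thesis using caseA by blast
 next
 case nA: False
 show ?thesis
 proof (cases "i : I V")
 case True
 then have s: "Q i <= V" using caseV nA that by blast
 then have "fr i <= closure V" using closure_mono fr_Q by blast
 then show ?thesis using s by (auto simp: v_def)
 next
 case False then show ?thesis using caseO nA that by blast
 qed
 qed
 \<comment> \<open>A path through a disk of \<open>B\<close> may see a jump of \<open>v\<close> by
   up to \<open>D\<close>; finitely many constant weights pay for it and keep the weight locally
   square summable.\<close>
 define rh where "rh i = Oe u i + ennreal D * indicator B i" for i
 have lB: "l2loc (%i. ennreal D * indicator B i)" unfolding l2loc_def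
 proof (intro allI impI)
 fix L
 have "nI L (%i. (ennreal D * indicator B i)^2) <= ns B (%i. (ennreal D)^2)"
 unfolding ns_def by (intro nn_integral_mono) (auto split: split_indicator)
 also have "... < iN" using B by (simp add: ns_finite ennreal_mult_less_top of_nat_less_top power_less_top_ennreal)
 finally show "nI L (%i. (ennreal D * indicator B i)^2) < iN" .
 qed
 have lrh: "l2loc rh" unfolding rh_def using su by (intro l2loc_add lB) (auto simp: sob_def)
 have Orh: "Oe v i <= rh i" for i
 proof (cases "i : B")
 case True
 have "Os v i <= D" using vD fr_S by (intro O_le[OF fv]) (smt (verit) subsetD)
 then show ?thesis using True by (simp add: rh_def add_increasing ennreal_leI)
 next
 case False
 have "Os v i <= Os u i"
 proof (rule O_le[OF fv])
 fix x y assume xy: "x : fr i" "y : fr i"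
 then show "v x - v y <= Os u i" using vcases[OF False] O_ge[OF fu xy] O_nonneg[OF fu, of i] by (auto simp: max_def)
 qed
 then show ?thesis using False by (simp add: rh_def ennreal_leI)
 qed
 have av: "aep (ug v rh)"
 proof (rule aep_mono)
 show "aep (ug u (Oe u))" using su by (simp add: sob_def)
 fix gm assume g: "gm : paths_in Om" and ugu: "ug u (Oe u) gm"
 show "ug v rh gm" unfolding ug_def
 proof (intro ballI impI)
 fix s t assume st: "s : fst gm" "t : fst gm" "s <= t" "snd gm s : S" "snd gm t : S"
 let ?h = "snd gm" let ?X = "?h ` {s..t}"
 have sub: "{s..t} <= fst gm" using g st interval_sub by (auto simp: paths_in_def is_plane_path_def)
 have hc: "continuous_on {s..t} ?h" by (rule path_cont[OF g sub])
 have XO: "?X <= Om" using g sub by (auto simp: paths_in_def img_def)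
 have mem: "?h s : ?X" "?h t : ?X" using st by auto
 have conX: "connected ?X" using hc by (intro connected_continuous_image) auto
 have le: "nI (?h ` {p..q}) (Oe u) <= ns (I ?X) rh" if "s <= p" "q <= t" for p q
 using that by (intro ns_mono I_mono image_mono) (auto simp: rh_def)
 have uu: "eN (abs(u (?h p) - u (?h q))) <= ns (I ?X) rh" if "s <= p" "p <= q" "q <= t" "?h p : S" "?h q : S" for p q
 proof -
 have "p : fst gm" "q : fst gm" using that sub by auto
 then have "eN (abs(u (?h p) - u (?h q))) <= nI (?h ` {p..q}) (Oe u)"
 using ugu that unfolding ug_def by blast
 then show ?thesis using le[of p q] that order_trans by blast
 qed
 show "eN (abs(v (?h s) - v (?h t))) <= ns (I ?X) rh"
 proof (cases "EX i:B. i : I ?X")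
 case True
 then obtain i where i: "i : B" "i : I ?X" by blast
 have "eN (abs(v (?h s) - v (?h t))) <= ennreal D" using vD st by (intro ennreal_leI) (smt (verit))
 also have "... <= rh i" using i by (simp add: rh_def)
 also have "... <= ns (I ?X) rh" by (rule ns_single[OF i(2)])
 finally show ?thesis .
 next
 case nB: False
 \<comment> \<open>Without meeting \<open>A\<close> or a disk of \<open>B\<close>, the path would
   find \<open>closure V\<close> relatively open as well as closed, and could not leave it.\<close>
 have hitA: "?X Int A ~= {}" if "?X Int closure V ~= {}" "~ ?X <= closure V"
 proof
 assume nA: "?X Int A = {}"
 have "openin (top_of_set ?X) (?X Int closure V)"
 unfolding openin_contains_ball
 proof (intro conjI ballI)
 fix z assume z: "z : ?X Int closure V"
 show "EX e>0. ball z e Int ?X <= ?X Int closure V"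
 proof (cases "z : V")
 case True
 then obtain e where "e > 0" "ball z e <= V" using V(1) open_contains_ball by blast
 then show ?thesis using closure_subset by blast
 next
 case False
 then have "z : frontier V" "z ~: A" using z frV nA by auto
 then obtain i e where ie: "i : B" "e > 0" "ball z e <= Q i Un closure V" using exit by blast
 have "?X Int Q i = {}" using nB ie by (auto simp: meeting_def)
 then show ?thesis using ie by blast
 qed
 qed simp
 moreover have "closedin (top_of_set ?X) (?X Int closure V)" by (simp add: closedin_closed_Int)
 ultimately have "?X Int closure V = {} | ?X Int closure V = ?X" using conX connected_clopen by blast
 then show False using that by blast
 qed
 have bound: "eN (max 0 (u (?h p) - M)) <= ns (I ?X) rh" if p: "p = s | p = t" and A: "?X Int A ~= {}" for p
 proof -
 obtain tu where tu: "tu : {s..t}" "?h tu : A" using A by blast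
 \<comment> \<open>A point of \<open>A\<close> inside a disk is traded for a point of the path on
   the circle of that disk, where u is also at most \<open>M\<close>.\<close>
 have "EX tu':{s..t}. ?h tu' : S & u (?h tu') <= M"
 proof (cases "?h tu : S")
 case True then show ?thesis using tu MA(1) by blast
 next
 case False
 then obtain k where k: "?h tu : Q k" using in_Om XO tu by blast
 then have kA: "k : I A" using tu by (auto simp: meeting_def)
 have "?h s : ?X Int S" using st by auto
 moreover have "k : I ?X" using k tu by (auto simp: meeting_def)
 ultimately have "?X Int fr k ~= {}" using conX by (intro cross) auto
 then obtain tu' where "tu' : {s..t}" "?h tu' : fr k" by blast
 then show ?thesis using Ms_upper[OF fu, of "?h tu'" k] MA(2)[OF kA] fr_S by (intro bexI[of _ tu']) force+
 qed
 then obtain tu' where tu': "tu' : {s..t}" "?h tu' : S" "u (?h tu') <= M" by blast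
 have "eN (max 0 (u (?h p) - M)) <= eN (abs(u (?h p) - u (?h tu')))" using tu' by (intro ennreal_leI) auto
 also have "... <= ns (I ?X) rh"
 using p uu[of s tu'] uu[of tu' t] tu' st by (auto simp: abs_minus_commute)
 finally show ?thesis .
 qed
 show ?thesis
 proof (cases "?h s : closure V")
 case s: True
 show ?thesis
 proof (cases "?h t : closure V")
 case True
 then have "eN (abs(v (?h s) - v (?h t))) <= eN (abs(u (?h s) - u (?h t)))" using s by (intro ennreal_leI) (auto simp: v_def)
 also have "... <= ns (I ?X) rh" using uu[of s t] st by simp
 finally show ?thesis .
 next
 case False
 then have "?X Int A ~= {}" using s mem hitA by blast
 then show ?thesis using bound[of s] s False vD(1)[of "?h s"] by (simp add: v_def)
 qed
 next
 case s: False
 show ?thesis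
 proof (cases "?h t : closure V")
 case True
 then have "?X Int A ~= {}" using s mem hitA by blast
 then show ?thesis using bound[of t] s True vD(1)[of "?h t"] by (simp add: v_def)
 next
 case False then show ?thesis using s by (simp add: v_def)
 qed
 qed
 qed
 qed
 qed
 have tv: "tst v" unfolding tst_def
 using vD V(3,4) lrh Orh av by (intro conjI exI[of _ D] exI[of _ "closure V"] exI[of _ rh]) (auto simp: v_def)
 have sv: "sob v" unfolding sob_def using aep_ug_osc[OF av lrh fv] l2loc_mono[OF lrh Orh] fv by auto
 obtain W where W: "open W" "W \<subset>\<subset> Om" "closure V <= W" using encl[OF V(3,4)] by blast
 let ?u' = "%x. u x + - v x"
 have fu': "fb ?u'" by (rule fb_add[OF fu tst_fb[OF tst_uminus[OF tv]]])
 have leu: "nI W (O2 u) <= nI W (%i. (eN (Os ?u' i))^2)"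
 by (rule harmD[OF u W(1,2) tst_uminus[OF tv]]) (use W(3) in \<open>auto simp: v_def\<close>)
 have finu: "nI W (O2 u) < iN"
 proof -
 have "nI (closure W) (O2 u) < iN" using su W(2) by (intro l2locD) (auto simp: sob_def ccontained_def)
 then show ?thesis using ns_mono[OF I_mono[OF closure_subset] order_refl] by (rule order_le_less_trans[rotated])
 qed
 \<comment> \<open>Off \<open>B\<close> this is truncation at \<open>M\<close> or no change. On a
   disk of \<open>B\<close> the truncated values stay within the range of u, because its infimum is
   at most \<open>M\<close>.\<close>
 have Ole: "Os ?u' i <= Os u i" for i
 proof (rule O_le[OF fu'])
 fix x y assume xy: "x : fr i" "y : fr i"
 show "(u x + - v x) - (u y + - v y) <= Os u i"
 proof (cases "i : B")
 case True
 have "u x + - v x <= Ms u i" using Ms_upper[OF fu xy(1)] vD(1)[of x] by linarith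
 moreover have "ms u i <= u y + - v y" using ms_lower[OF fu xy(2)] MB[OF True] by (auto simp: v_def)
 ultimately show ?thesis by (simp add: osci_def)
 next
 case False
 then show ?thesis using vcases[OF False] xy O_ge[OF fu xy] O_nonneg[OF fu, of i] by (auto simp: max_def)
 qed
 qed
 have Oeq: "Os ?u' i = Os u i" if "i : I W" for i
 proof -
 have "(eN (Os ?u' i))^2 = (Oe u i)^2"
 using Ole by (intro ns_eq_termwise[OF leu finu _ that] power_mono ennreal_leI) auto
 then have "(Os ?u' i)^2 = (Os u i)^2" using O_nonneg[OF fu] O_nonneg[OF fu'] by (simp add: ennreal_power)
 then show ?thesis using O_nonneg[OF fu] O_nonneg[OF fu'] by (simp add: power2_eq_iff_nonneg)
 qed
 \<comment> \<open>Truncation at \<open>M\<close> preserves the oscillation on a circle only if u is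
   constant there or does not exceed \<open>M\<close>.\<close>
 have Ov0: "Os v i = 0" if nB: "i ~: B" for i
 proof -
 have "v x - v y <= 0" if xy: "x : fr i" "y : fr i" for x y
 proof (cases "ALL x:fr i. v x = 0")
 case True then show ?thesis using xy by simp
 next
 case False
 then have QV: "Q i <= V" and vm: "!!x. x : fr i ==> v x = max 0 (u x - M)" using vcases[OF nB] by auto
 have iW: "i : I W" using QV W(3) closure_subset[of V] Q_ne[of i] by (auto simp: meeting_def)
 show ?thesis
 proof (cases "ms u i >= M")
 case True
 have "?u' x = M" if "x : fr i" for x using ms_lower[OF fu that] True vm[OF that] by simp
 then have "Os ?u' i = Os (%_. M) i" by (intro O_cong) auto
 also have "... = 0" using fr_ne[of i] by (simp add: osci_def)
 finally have "Os u i = 0" using Oeq[OF iW] by simp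
 then show ?thesis using O_ge[OF fu xy] vm xy by simp
 next
 case ml: False
 show ?thesis
 proof (cases "Ms u i <= M")
 case True
 then show ?thesis using vm[OF xy(1)] vm[OF xy(2)] Ms_upper[OF fu xy(1)] by auto
 next
 case MM: False
 have "Os ?u' i <= M - ms u i"
 proof (rule O_le[OF fu'])
 fix x y assume "x : fr i" "y : fr i"
 then show "(u x + - v x) - (u y + - v y) <= M - ms u i"
 using ms_lower[OF fu, of y i] ml vm[of x] vm[of y] by auto
 qed
 then have "Os u i <= M - ms u i" using Oeq[OF iW] by simp
 then show ?thesis using MM by (simp add: osci_def)
 qed
 qed
 qed
 then have "Os v i <= 0" by (intro O_le[OF fv])
 then show ?thesis using O_nonneg[OF fv, of i] by simp
 qed
 have lc: "EX e>0. ALL i x k y. i : I (sqr w e) --> x : fr i --> k : I (sqr w e) --> y : fr k --> v x = v y"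
 if w: "w : Om" "!!i. i : B ==> w ~: cQ i" for w
 proof -
 have "closed (\<Union>i\<in>B. (cQ i))" using B by auto
 then have "open (Om - (\<Union>i\<in>B. (cQ i)))" by auto
 then obtain e where e: "e > 0" "sqr w e <= Om - (\<Union>i\<in>B. (cQ i))" using sqr_in_open[of _ w] w by blast
 have "i ~: B" if "i : I (sqr w e)" for i using that e(2) closure_subset[of "Q i"] by (auto simp: meeting_def)
 then have "v x = v y" if "i : I (sqr w e)" "x : fr i" "k : I (sqr w e)" "y : fr k" for i x k y
 using locally_const[OF sv, of w e i x k y] e(2) that Ov0 by (auto simp: meeting_def)
 then show ?thesis using e(1) by blast
 qed
 have VB: "w ~: cQ i" if "w : V" "i : B" for w i
 using BV[OF that(2)] open_I_closure[OF V(1), of i] that(1) by (auto simp: meeting_def)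
 have VO: "V <= Om" using V(4) closure_subset by blast
 \<comment> \<open>By \<open>lc\<close> all circles near a point of \<open>V\<close> carry one value
   of \<open>v\<close>, so being zero or nonzero splits \<open>V\<close> into two open sets.\<close>
 define T0 where "T0 = {w : V. EX e>0. ALL i:I (sqr w e). ALL x:fr i. v x = 0}"
 define T1 where "T1 = {w : V. EX e>0. ALL i:I (sqr w e). ALL x:fr i. v x ~= 0}"
 have sub2: "sqr z (e - d) <= sqr w e" if "ninf (z - w) <= d" for z w e d
 proof
 fix x assume "x : sqr z (e - d)"
 then show "x : sqr w e" using that ninf_triangle[of "x - z" "z - w"] by (auto simp: sqr_def)
 qed
 have opT: "open {w : V. EX e>0. ALL i:I (sqr w e). ALL x:fr i. R (v x)}" for R
 unfolding open_contains_ball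
 proof (clarify)
 fix w e assume w: "w : V" "0 < e" "ALL i:I (sqr w e). ALL x:fr i. R (v x)"
 obtain d where d: "d > 0" "ball w d <= V" using w V(1) open_contains_ball by blast
 show "EX e>0. ball w e <= {w : V. EX e>0. ALL i:I (sqr w e). ALL x:fr i. R (v x)}"
 proof (intro exI conjI subsetI)
 show "min d (e/2) > 0" using d w by simp
 fix z assume z: "z : ball w (min d (e/2))"
 have "ninf (z - w) <= e/2" using z ninf_le_norm[of "z - w"] by (auto simp: dist_norm norm_minus_commute)
 then have "sqr z (e - e/2) <= sqr w e" by (rule sub2)
 then have "ALL i:I (sqr z (e/2)). ALL x:fr i. R (v x)" using w(3) I_mono[of "sqr z (e/2)" "sqr w e"] by auto
 then show "z : {w : V. EX e>0. ALL i:I (sqr w e). ALL x:fr i. R (v x)}" using z d w(2) by (auto intro!: exI[of _ "e/2"])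
 qed
 qed
 have "open T0" "open T1" unfolding T0_def T1_def using opT[of "%r. r = 0"] opT[of "%r. r ~= 0"] by auto
 moreover have "V <= T0 Un T1"
 proof
 fix w assume w: "w : V"
 obtain e where e: "e > 0" "ALL i x k y. i : I (sqr w e) --> x : fr i --> k : I (sqr w e) --> y : fr k --> v x = v y"
 using lc[of w] w VO VB by blast
 show "w : T0 Un T1"
 proof (cases "EX i:I (sqr w e). EX x:fr i. v x = 0")
 case True
 then have "ALL i:I (sqr w e). ALL x:fr i. v x = 0" using e(2) by metis
 then show ?thesis using w e(1) by (auto simp: T0_def)
 next
 case False then show ?thesis using w e(1) by (auto simp: T1_def)
 qed
 qed
 moreover have "T0 Int T1 = {}"
 proof (rule ccontr)
 assume "T0 Int T1 ~= {}"
 then obtain w e e' where w: "w : V" "0 < e" "0 < e'" "ALL i:I (sqr w e). ALL x:fr i. v x = 0" "ALL i:I (sqr w e'). ALL x:fr i. v x ~= 0"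
 by (auto simp: T0_def T1_def)
 have "sqr w (min e e') Int V ~= {}" using w sqr_center[of "min e e'" w] by auto
 then have "I (sqr w (min e e') Int V) ~= {}" using V(1) VO by (intro open_meets_Q) auto
 then obtain i where "i : I (sqr w (min e e'))" by (auto simp: meeting_def)
 then have "i : I (sqr w e)" "i : I (sqr w e')" using I_mono[OF sqr_mono] by (meson min.cobounded1 min.cobounded2 subsetD)+
 then show False using w fr_ne[of i] by blast
 qed
 \<comment> \<open>At the contact point \<open>lc\<close> applies although the point is not in
   \<open>V\<close>; disks meeting \<open>A\<close> near it force the common value 0, and points of
   \<open>V\<close> are close by.\<close>
 moreover have "T0 Int V ~= {}"
 proof -
 obtain a where a: "a : A" "a : frontier V" "!!i. i : B ==> a ~: cQ i" "!!e. e > 0 ==> I (A Int ball a e) ~= {}" using contact by blast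
 have "a : Om" using a(2) V(4) frV by blast
 then obtain e where e: "e > 0" "ALL i x k y. i : I (sqr a e) --> x : fr i --> k : I (sqr a e) --> y : fr k --> v x = v y"
 using lc[of a] a(3) by blast
 obtain k where k: "k : I (A Int ball a e)" using a(4)[OF e(1)] by blast
 have kA: "k : I A" "k : I (sqr a e)" using k I_mono[of "A Int ball a e"] ball_subset_sqr by blast+
 have v0: "v x = 0" if "i : I (sqr a e)" "x : fr i" for i x
 proof -
 obtain y where y: "y : fr k" using fr_ne by blast
 then have "v y = 0" using caseA kA by blast
 then show ?thesis using e(2) that kA y by metis
 qed
 have "a : closure V" using a(2) frV by blast
 then have "sqr a e Int V ~= {}" using sqr_center[OF e(1), of a] open_Int_closure_eq_empty[of "sqr a e" V] by auto
 then obtain w where w: "w : sqr a e" "w : V" by blast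
 obtain d where d: "d > 0" "sqr w d <= sqr a e" using sqr_in_open[OF open_sqr w(1)] by blast
 have "ALL i:I (sqr w d). ALL x:fr i. v x = 0" using v0 I_mono[OF d(2)] by blast
 then have "w : T0" using w d(1) unfolding T0_def by blast
 then show ?thesis using w by blast
 qed
 ultimately have T1: "T1 Int V = {}" using V(2) connectedD[OF V(2), of T0 T1] by blast
 obtain z where z: "z : Q j" "z : V" using j by (auto simp: meeting_def)
 have "z : T0" using T1 \<open>V <= T0 Un T1\<close> z by blast
 then obtain e where e: "e > 0" "ALL i:I (sqr z e). ALL x:fr i. v x = 0" by (auto simp: T0_def)
 have vj: "v x = 0" if "x : fr j" for x using e(2) z(1) sqr_center[OF e(1), of z] that by (auto simp: meeting_def)
 show ?thesis
 proof (cases "j : I A")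
 case True then show ?thesis by (rule MA)
 next
 case False
 have "j ~: B" using BV j by (auto simp: meeting_def)
 then have "Q j <= V" using caseV False j by blast
 then have "fr j <= closure V" using closure_mono fr_Q by blast
 then show ?thesis using vj by (intro Ms_least) (force simp: v_def)
 qed
qed

end

section \<open>Small squares about a point\<close>

text \<open>The boundary of a square parametrized by the angle on the whole real line, with period
  \<open>2 * pi\<close>, so that an arc starting anywhere is the image of an interval.\<close>

definition hq :: "complex => real => real => complex" where
 "hq x r t = x + of_real (r / ninf (cis t)) * cis t"

definition Tq :: "complex => real => complex set" where "Tq x r = {z. ninf (z - x) = r}"

lemma ninf_cis_pos: "0 < ninf (cis t)"
 using norm_le_ninf[of "cis t"] by simp

lemma hq_Tq: "0 <= r ==> hq x r t : Tq x r"
 using ninf_cis_pos[of t] by (simp add: Tq_def hq_def ninf_scale del: of_real_divide)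

lemma continuous_hq: "continuous_on A (hq x r)"
 unfolding hq_def using ninf_cis_pos
 by (intro continuous_intros) (auto simp: less_imp_neq[THEN not_sym])

lemma hq_periodic: "hq x r (t + 2 * pi * of_int n) = hq x r t"
proof -
 have "cis (t + 2 * pi * of_int n) = cis t"
 using sin_cos_eq_iff[of "t + 2 * pi * of_int n" t] by (auto simp: complex_eq_iff mult.assoc)
 then show ?thesis by (simp add: hq_def)
qed

lemma hq_inj: assumes "0 < r" "hq x r s = hq x r t" shows "EX n::int. s = t + 2 * pi * of_int n"
proof -
 have e: "of_real (r / ninf (cis s)) * cis s = of_real (r / ninf (cis t)) * cis t" using assms by (simp add: hq_def)
 then have "norm (of_real (r / ninf (cis s)) * cis s) = norm (of_real (r / ninf (cis t)) * cis t)" by simp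
 then have "r / ninf (cis s) = r / ninf (cis t)"
 unfolding norm_mult norm_of_real using assms ninf_cis_pos[of s] ninf_cis_pos[of t] by simp
 moreover have "r / ninf (cis t) ~= 0" using assms ninf_cis_pos[of t] by simp
 ultimately have "cis s = cis t" using e by (metis mult_cancel_left of_real_eq_0_iff)
 then have "sin s = sin t & cos s = cos t" by (simp add: complex_eq_iff)
 then show ?thesis using sin_cos_eq_iff[of s t] by (auto simp: mult.assoc)
qed

lemma hq_surj: assumes "0 < r" "z : Tq x r" shows "EX t. 0 <= t & t < 2 * pi & z = hq x r t"
proof -
 have nz: "z - x ~= 0" and n: "ninf (z - x) = r" using assms by (auto simp: Tq_def ninf_def)
 define t where "t = Arg2pi (z - x)"
 have t: "z - x = of_real (norm (z - x)) * cis t" unfolding t_def using Arg2pi_eq[of "z - x"] by (simp add: cis_conv_exp)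
 have "r = norm (z - x) * ninf (cis t)" using n t ninf_scale[of "norm (z - x)" "cis t"] by (metis abs_norm_cancel)
 then have "r / ninf (cis t) = norm (z - x)" using ninf_cis_pos[of t] by (simp add: field_simps)
 then have "z = hq x r t" using t by (simp add: hq_def algebra_simps)
 then show ?thesis using Arg2pi_ge_0 Arg2pi_lt_2pi unfolding t_def by blast
qed

lemma Tq_image: "0 < r ==> Tq x r = hq x r ` {c..c + 2 * pi}"
proof
 assume r: "0 < r"
 show "Tq x r <= hq x r ` {c..c + 2 * pi}"
 proof
 fix z assume "z : Tq x r"
 then obtain t where t: "z = hq x r t" using hq_surj[OF r] by blast
 define n where "n = \<lfloor>(t - c) / (2 * pi)\<rfloor>"
 have "of_int n <= (t - c) / (2 * pi)" "(t - c) / (2 * pi) < of_int n + 1" unfolding n_def by linarith+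
 then have "2 * pi * of_int n <= t - c" "t - c < 2 * pi * of_int n + 2 * pi" by (auto simp: field_simps)
 then have "t + 2 * pi * of_int (- n) : {c..c + 2 * pi}" by auto
 then show "z : hq x r ` {c..c + 2 * pi}" using t hq_periodic[of x r t "-n"] by (metis imageI)
 qed
qed (use hq_Tq in auto)

text \<open>The angles of the corners.\<close>

definition brk :: "nat => real" where "brk k = pi / 4 + real k * (pi / 2)"

text \<open>On the first side sine dominates the absolute value of cosine, so the height is
  constant; the rotation by \<open>pi/2\<close> carries this from side to side and exchanges the
  coordinates.\<close>

lemma hq_piece:
 assumes "0 <= r"
 shows "EX b c. (c = r | c = - r) & (ALL t:{brk k..brk (Suc k)}. phi b (hq x r t) = phi b x + c)"
proof -
 have base: "(abs(cos th)) <= sin th" if "pi/4 <= th" "th <= 3 * pi/4" for th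
 proof -
 have 1: "cos th <= sin th"
 proof -
 have "0 <= sin (th - pi/4)" using that by (intro sin_ge_zero) auto
 then have "0 <= (sin th - cos th) * (sqrt 2 / 2)" by (simp add: sin_diff cos_45 sin_45 algebra_simps)
 then show ?thesis by (simp add: zero_le_mult_iff)
 qed
 have 2: "- cos th <= sin th"
 proof -
 have "0 <= sin (th + pi/4)" using that by (intro sin_ge_zero) auto
 then have "0 <= (sin th + cos th) * (sqrt 2 / 2)" by (simp add: sin_add cos_45 sin_45 algebra_simps)
 then show ?thesis by (simp add: zero_le_mult_iff)
 qed
 show ?thesis using 1 2 by linarith
 qed
 have sinpos: "0 < sin th" if "pi/4 <= th" "th <= 3 * pi/4" for th
 using that pi_gt_zero by (intro sin_gt_zero) linarith+
 have main: "EX b c. (c = r | c = - r) & (ALL th. pi/4 <= th --> th <= 3 * pi/4 --> phi b (hq x r (th + real k * (pi/2))) = phi b x + c)"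
 proof (induction k)
 case 0
 show ?case
 proof (intro exI[of _ True] exI[of _ r] conjI allI impI)
 fix th assume t: "pi/4 <= th" "th <= 3 * pi/4"
 have "ninf (cis th) = sin th" using base[OF t] sinpos[OF t] by (simp add: ninf_def)
 then show "phi True (hq x r (th + real 0 * (pi/2))) = phi True x + r" using sinpos[OF t] by (simp add: phi_def hq_def)
 qed simp
 next
 case (Suc k)
 then obtain b c where bc: "c = r | c = - r" "!!th. pi/4 <= th ==> th <= 3 * pi/4 ==> phi b (hq x r (th + real k * (pi/2))) = phi b x + c" by blast
 have rot: "hq x r (t + pi/2) - x = \<i> * (hq x r t - x)" for t
 proof -
 have c: "cis (t + pi/2) = \<i> * cis t" by (simp add: complex_eq_iff cos_add sin_add)
 have "ninf (cis (t + pi/2)) = ninf (cis t)" by (simp add: ninf_def cos_add sin_add max.commute)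
 then show ?thesis using c by (simp add: hq_def)
 qed
 have *: "phi (~ b) (hq x r (t + pi/2)) - phi (~ b) x = (if b then - 1 else 1) * (phi b (hq x r t) - phi b x)" for t
 proof -
 have "Re (hq x r (t + pi/2) - x) = - Im (hq x r t - x)" "Im (hq x r (t + pi/2) - x) = Re (hq x r t - x)"
 unfolding rot by auto
 then show ?thesis by (auto simp: phi_def)
 qed
 show ?case
 proof (intro exI[of _ "~ b"] exI[of _ "(if b then - 1 else 1) * c"] conjI allI impI)
 fix th assume "pi/4 <= th" "th <= 3 * pi/4"
 then have "phi b (hq x r (th + real k * (pi/2))) - phi b x = c" using bc(2) by simp
 then have "phi (~ b) (hq x r (th + real k * (pi/2) + pi/2)) - phi (~ b) x = (if b then - 1 else 1) * c" using * by simp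
 moreover have "th + real k * (pi/2) + pi/2 = th + real (Suc k) * (pi/2)" by (simp add: algebra_simps)
 ultimately show "phi (~ b) (hq x r (th + real (Suc k) * (pi/2))) = phi (~ b) x + (if b then - 1 else 1) * c" by (metis add.commute diff_add_cancel)
 qed (use bc(1) in auto)
 qed
 then obtain b c where bc: "c = r | c = - r" "!!th. pi/4 <= th ==> th <= 3 * pi/4 ==> phi b (hq x r (th + real k * (pi/2))) = phi b x + c" by blast
 have "phi b (hq x r t) = phi b x + c" if "t : {brk k..brk (Suc k)}" for t
 proof -
 have a: "pi/4 <= t - real k * (pi/2)" "t - real k * (pi/2) <= 3 * pi/4" using that by (auto simp: brk_def field_simps)
 show ?thesis using bc(2)[OF a] by simp
 qed
 then show ?thesis using bc(1) by blast
qed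

text \<open>Used for translations and reflections of the real line: their inverses are 1-Lipschitz
  and therefore preserve null sets.\<close>

lemma AE_lip:
 fixes g :: "real => real"
 assumes "AE y in lborel. P y" and g: "!!x y. (abs(g x - g y)) <= (abs(x - y))" and inv: "!!x. g (h x) = x"
 shows "AE y in lborel. P (h y)"
proof -
 obtain N where N: "{y. ~ P y} <= N" "N : null_sets lborel" using assms(1) by (auto simp: eventually_ae_filter)
 then have "negligible N" by (simp add: negligible_iff_null_sets null_sets_completionI)
 then have "negligible (g ` N)"
 proof (intro negligible_locally_Lipschitz_image[OF order_refl])
 fix x show "EX T B. open T & x : T & (ALL y:N Int T. norm (g y - g x) <= B * norm (y - x))"
 using g by (intro exI[of _ UNIV] exI[of _ "1::real"]) auto
 qed
 then have gN: "g ` N : null_sets lebesgue" by (simp add: negligible_iff_null_sets)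
 have "AE y in lebesgue. P (h y)"
 proof (rule AE_I'[OF gN])
 show "{y : space lebesgue. ~ P (h y)} <= g ` N"
 proof
 fix y assume "y : {y : space lebesgue. ~ P (h y)}"
 then have "h y : N" using N by auto
 then show "y : g ` N" using inv[of y] by (metis imageI)
 qed
 qed
 then show ?thesis by (simp add: AE_completion_iff)
qed

section \<open>Oscillation along square boundaries and choice of radii\<close>

context rel_carpet begin

definition goodr :: "(complex => real) => complex => real => bool" where
 "goodr f x r \<longleftrightarrow> (ALL b. gline f b (phi b x + r) & gline f b (phi b x - r))"

lemma AE_goodr: assumes "sob f" shows "AE r in lborel. goodr f x r"
proof -
 have "AE r in lborel. gline f b (phi b x + r)" for b
 by (rule AE_lip[OF AE_gline[OF assms, of b], of "%y. y - phi b x"]) auto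
 moreover have "AE r in lborel. gline f b (phi b x - r)" for b
 by (rule AE_lip[OF AE_gline[OF assms, of b], of "%y. phi b x - y"]) auto
 ultimately have "AE r in lborel. (gline f True (phi True x + r) & gline f False (phi False x + r))
 & (gline f True (phi True x - r) & gline f False (phi False x - r))" by (intro AE_conjI) auto
 then show ?thesis by eventually_elim (auto simp: goodr_def all_bool_eq)
qed

text \<open>Shifted by full periods, an arc of at most one turn lies between \<open>brk 0\<close>
  and \<open>brk 8\<close>. It consists of at most eight pieces on sides of the square, each costing
  \<open>3 * W\<close> by \<open>okset_vals\<close>.\<close>

lemma arc_vals:
 assumes f: "fb f" and g: "goodr f x r" and r: "0 < r" and sub: "hq x r ` {c..d} <= Om" and cd: "c <= d" "d <= c + 2 * pi"
 and W: "nI (hq x r ` {c..d}) (Oe f) <= ennreal W" "0 <= W"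
 and e: "e1 : hq x r ` {c..d}" "e2 : hq x r ` {c..d}" and v: "a : vals f e1" "a' : vals f e2"
 shows "(abs(a - a')) <= 24 * W"
proof -
 define n where "n = \<lfloor>(c - pi/4) / (2 * pi)\<rfloor>"
 have "of_int n <= (c - pi/4) / (2 * pi)" "(c - pi/4) / (2 * pi) < of_int n + 1" unfolding n_def by linarith+
 then have n: "2 * pi * of_int n <= c - pi/4" "c - pi/4 < 2 * pi * of_int n + 2 * pi" by (auto simp: field_simps)
 define c' d' where "c' = c - 2 * pi * of_int n" and "d' = d - 2 * pi * of_int n"
 have cd': "brk 0 <= c'" "d' <= brk 8" using n cd by (auto simp: c'_def d'_def brk_def)
 have im: "hq x r ` {c'..d'} = hq x r ` {c..d}"
 proof (intro equalityI subsetI)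
 fix z assume "z : hq x r ` {c'..d'}"
 then obtain t where "t : {c'..d'}" "z = hq x r t" by blast
 then show "z : hq x r ` {c..d}" using hq_periodic[of x r t n] by (intro image_eqI[of _ _ "t + 2 * pi * of_int n"]) (auto simp: c'_def d'_def)
 next
 fix z assume "z : hq x r ` {c..d}"
 then obtain t where "t : {c..d}" "z = hq x r t" by blast
 then show "z : hq x r ` {c'..d'}" using hq_periodic[of x r t "-n"] by (intro image_eqI[of _ _ "t + 2 * pi * of_int (-n)"]) (auto simp: c'_def d'_def)
 qed
 have piece: "(abs(a - a')) <= 3 * W" if st: "s : {c'..d'}" "t : {c'..d'}" "s <= t" "brk k <= s" "t <= brk (Suc k)" and v: "a : vals f (hq x r s)" "a' : vals f (hq x r t)" for s t k a a'
 proof -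
 obtain b y where y: "y = phi b x + r | y = phi b x - r" "!!t. t : {brk k..brk (Suc k)} ==> phi b (hq x r t) = y"
 using hq_piece[of r k x] r by (metis diff_conv_add_uminus less_imp_le)
 define \<psi> where "\<psi> t = phi (~ b) (hq x r t)" for t
 have l: "hq x r t = lin b y (\<psi> t)" if "t : {brk k..brk (Suc k)}" for t
 using lin_phi(1)[of b "hq x r t"] y(2)[OF that] by (simp add: \<psi>_def)
 have \<psi>c: "continuous_on {s..t} \<psi>" unfolding \<psi>_def phi_def
 by (cases b) (auto intro!: continuous_intros continuous_hq)
 let ?p = "min (\<psi> s) (\<psi> t)" and ?q = "max (\<psi> s) (\<psi> t)"
 \<comment> \<open>By the intermediate value theorem the arc covers the segment between its end
   points, so the segment meets no further disks.\<close>
 have seg: "lin b y ` {?p..?q} <= hq x r ` {s..t}"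
 proof
 fix z assume "z : lin b y ` {?p..?q}"
 then obtain tu where tu: "?p <= tu" "tu <= ?q" "z = lin b y tu" by auto
 have "EX t'. s <= t' & t' <= t & \<psi> t' = tu"
 proof (cases "\<psi> s <= \<psi> t")
 case True then show ?thesis using tu st \<psi>c by (intro IVT') auto
 next
 case False then show ?thesis using tu st \<psi>c by (intro IVT2') auto
 qed
 then obtain t' where "t' : {s..t}" "\<psi> t' = tu" by auto
 moreover have "hq x r t' = lin b y (\<psi> t')" using calculation st by (intro l) auto
 ultimately show "z : hq x r ` {s..t}" using tu by (metis imageI)
 qed
 also have "... <= hq x r ` {c'..d'}" using st by (intro image_mono) auto
 finally have seg2: "lin b y ` {?p..?q} <= hq x r ` {c..d}" by (simp add: im)
 have gl: "gline f b y" using g y(1) by (auto simp: goodr_def)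
 have "nI (lin b y ` {?p..?q}) (Oe f) <= ennreal W"
 using ns_mono[OF I_mono[OF seg2] order_refl] W(1) by (rule order_trans)
 then have ok: "okset f (lin b y ` {?p..?q}) W"
 using gl f seg2 sub W(2) by (intro gline_okset) auto
 have "hq x r s : lin b y ` {?p..?q}" "hq x r t : lin b y ` {?p..?q}"
 using l[of s] l[of t] st by auto
 then show ?thesis by (rule okset_vals[OF ok _ _ v])
 qed
 have "ALL s t a a'. s : {c'..d'} --> t : {c'..d'} --> s <= t --> t <= brk (Suc k) --> a : vals f (hq x r s) --> a' : vals f (hq x r t) --> (abs(a - a')) <= 3 * real (Suc k) * W" for k
 proof (induction k)
 case 0
 then show ?case using piece[of _ _ 0] cd' by auto
 next
 case (Suc k)
 show ?case
 proof (intro allI impI)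
 fix s t a a' assume st: "s : {c'..d'}" "t : {c'..d'}" "s <= t" "t <= brk (Suc (Suc k))" and v: "a : vals f (hq x r s)" "a' : vals f (hq x r t)"
 consider "t <= brk (Suc k)" | "brk (Suc k) <= s" | "s < brk (Suc k)" "brk (Suc k) < t" by linarith
 then show "(abs(a - a')) <= 3 * real (Suc (Suc k)) * W"
 proof cases
 case 1
 then have "(abs(a - a')) <= 3 * real (Suc k) * W" using Suc st v by blast
 also have "... <= 3 * real (Suc (Suc k)) * W" using W(2) by (intro mult_right_mono) auto
 finally show ?thesis .
 next
 case 2
 then have "(abs(a - a')) <= 3 * W" using piece st v by blast
 also have "... <= 3 * real (Suc (Suc k)) * W" using W(2) by (intro mult_right_mono) auto
 finally show ?thesis .
 next
 case 3
 let ?m = "brk (Suc k)"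
 have m: "?m : {c'..d'}" using 3 st by auto
 then have "hq x r ?m : Om" using sub im by blast
 then obtain w where w: "w : vals f (hq x r ?m)" using vals_ne by blast
 have "(abs(a - w)) <= 3 * real (Suc k) * W" using Suc st(1) m 3 v(1) w by (meson less_imp_le order_refl)
 moreover have "(abs(w - a')) <= 3 * W" using piece[OF m st(2) _ order_refl st(4) w v(2)] 3 by simp
 ultimately have "(abs(a - a')) <= 3 * real (Suc k) * W + 3 * W" by linarith
 then show ?thesis by (simp add: algebra_simps)
 qed
 qed
 qed
 note B0 = this[of 7]
 have B: "(abs(a - a')) <= 24 * W" if "s : {c'..d'}" "t : {c'..d'}" "s <= t" "a : vals f (hq x r s)" "a' : vals f (hq x r t)" for s t a a'
 proof -
 have "t <= brk (Suc 7)" using that(2) cd'(2) by simp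
 then have "(abs(a - a')) <= 3 * real (Suc 7) * W" using B0 that by blast
 then show ?thesis by simp
 qed
 obtain s t where st: "s : {c'..d'}" "e1 = hq x r s" "t : {c'..d'}" "e2 = hq x r t" using e im by blast
 show ?thesis
 using B[of s t a a'] B[of t s a' a] st v by (cases "s <= t") (auto simp: abs_minus_commute)
qed

definition ann :: "complex => real => complex set" where "ann x s = {z. s < ninf (z - x) & ninf (z - x) < 2 * s}"

text \<open>Length-area estimate: a disk is met only for radii in a set of measure at most
  \<open>2 * min (dm i) s\<close>. Young's inequality and \<open>sum_min_diam\<close> bound the mean
  over the radii, and \<open>C\<close> is twice the resulting constant, which makes the
  contradiction strict. Disks in \<open>B\<close> are disregarded.\<close>

lemma courant_leb:
 "EX C>0. ALL x s e B rh P. 0 < s --> 0 < e --> (AE r in lborel. P r) --> (ALL i. 0 <= rh i) -->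
 ns (I (ann x s) - B) (%i. eN ((rh i)^2)) <= eN (e^2) -->
 (EX r. s < r & r < 2 * s & P r & ns (I (Tq x r) - B) (%i. eN (rh i)) <= eN (C * e))"
proof -
 obtain C0 where C0: "C0 > 0" "!!x s. 0 < s ==> nI (csqr x (2 * s)) (%i. eN ((min (dm i) s)^2)) <= eN (C0 * s^2)"
 using sum_min_diam by blast
 define C where "C = 2 * (1 + C0)"
 have "EX r. s < r & r < 2 * s & P r & ns (I (Tq x r) - B) (%i. eN (rh i)) <= eN (C * e)"
 if s: "0 < s" and e: "0 < e" and P: "AE r in lborel. P r" and rh: "ALL i. 0 <= rh i"
 and E: "ns (I (ann x s) - B) (%i. eN ((rh i)^2)) <= eN (e^2)" for x s e B rh P
 proof (rule ccontr)
 assume no: "~ ?thesis"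
 let ?J = "I (ann x s) - B"
 define z where "z j = (SOME z. z : Q j)" for j
 have z: "z j : Q j" for j unfolding z_def using Q_ne by (meson ex_in_conv someI)
 define c where "c i = ninf (z i - x)" for i
 \<comment> \<open>The radii at which the square boundary can meet disk i; intersecting with
   \<open>{s..2 * s}\<close> truncates the length of this set at \<open>s\<close>.\<close>
 define R where "R i = {c i - dm i..c i + dm i} Int {s..2 * s}" for i
 have Rm [measurable]: "R i : sets borel" for i unfolding R_def by auto
 have mR: "emeasure lborel (R i) <= eN (2 * min (dm i) s)" for i
 proof -
 have "emeasure lborel (R i) <= emeasure lborel {c i - dm i..c i + dm i}" "emeasure lborel (R i) <= emeasure lborel {s..2 * s}"
 unfolding R_def by (intro emeasure_mono; auto)+
 then have "emeasure lborel (R i) <= eN (2 * dm i)" "emeasure lborel (R i) <= eN s"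
 using emeasure_interval[OF dm_nonneg, of "c i" i] s by auto
 moreover have "eN s <= eN (2 * s)" using s by (intro ennreal_leI) auto
 ultimately show ?thesis by (auto simp: min_def)
 qed
 define F where "F r = ns ?J (%i. eN (rh i) * indicator (R i) r)" for r
 have [measurable]: "F : borel_measurable lborel" unfolding F_def ns_suminf by measurable
 have "(\<integral>\<^sup>+r. F r \<partial>lborel) = ns ?J (%i. eN (rh i) * emeasure lborel (R i))"
 unfolding F_def ns_suminf
 proof (subst nn_integral_suminf)
 show "(\<Sum>i. \<integral>\<^sup>+r. eN (rh i) * indicator (R i) r * indicator ?J i \<partial>lborel) = (\<Sum>i. eN (rh i) * emeasure lborel (R i) * indicator ?J i)"
 by (intro suminf_cong) (simp add: nn_integral_multc nn_integral_cmult_indicator)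
 qed auto
 also have "... <= ns ?J (%i. eN (s/e) * eN ((rh i)^2) + eN (e/s) * eN ((min (dm i) s)^2))"
 proof (intro ns_mono order_refl)
 fix i
 let ?m = "min (dm i) s"
 have m: "0 <= ?m" using s dm_nonneg by auto
 have "eN (rh i) * emeasure lborel (R i) <= eN (rh i) * eN (2 * ?m)" by (intro mult_left_mono mR) auto
 also have "... = eN (rh i * (2 * ?m))" using rh by (simp add: ennreal_mult')
 also have "rh i * (2 * ?m) <= s/e * (rh i)^2 + e/s * ?m^2"
 proof -
 have "0 <= (e/s) * (s/e * rh i - ?m)^2" using s e by simp
 also have "... = s/e * (rh i)^2 + e/s * ?m^2 - rh i * (2 * ?m)"
 using s e by (simp add: power2_diff power_mult_distrib power_divide field_simps power2_eq_square)
 finally show ?thesis by simp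
 qed
 also have "eN (s/e * (rh i)^2 + e/s * ?m^2) = eN (s/e) * eN ((rh i)^2) + eN (e/s) * eN (?m^2)"
 proof -
 have "eN (s/e * (rh i)^2 + e/s * ?m^2) = eN (s/e * (rh i)^2) + eN (e/s * ?m^2)" using s e by (intro ennreal_plus) auto
 moreover have "eN (s/e * (rh i)^2) = eN (s/e) * eN ((rh i)^2)" "eN (e/s * ?m^2) = eN (e/s) * eN (?m^2)"
 using s e by (intro ennreal_mult; simp)+
 ultimately show ?thesis by simp
 qed
 finally show "eN (rh i) * emeasure lborel (R i) <= eN (s/e) * eN ((rh i)^2) + eN (e/s) * eN (?m^2)"
 by (simp add: ennreal_leI)
 qed
 also have "... = eN (s/e) * ns ?J (%i. eN ((rh i)^2)) + eN (e/s) * ns ?J (%i. eN ((min (dm i) s)^2))"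
 by (simp add: ns_add ns_cmult)
 also have "... <= eN (s/e) * eN (e^2) + eN (e/s) * eN (C0 * s^2)"
 proof (intro add_mono mult_left_mono E)
 have "ann x s <= csqr x (2 * s)" by (auto simp: ann_def csqr_def)
 from I_mono[OF this] have "?J <= I (csqr x (2 * s))" by blast
 then have "ns ?J (%i. eN ((min (dm i) s)^2)) <= nI (csqr x (2 * s)) (%i. eN ((min (dm i) s)^2))" by (intro ns_mono) auto
 also have "... <= eN (C0 * s^2)" by (rule C0(2)[OF s])
 finally show "ns ?J (%i. eN ((min (dm i) s)^2)) <= eN (C0 * s^2)" .
 qed auto
 also have "... = eN (s * e * (1 + C0))"
 proof -
 have "eN (s/e) * eN (e^2) = eN (s * e)" using s e by (subst ennreal_mult[symmetric]) (auto simp: power2_eq_square)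
 moreover have "eN (e/s) * eN (C0 * s^2) = eN (s * e * C0)" using s e C0 by (subst ennreal_mult[symmetric]) (auto simp: power2_eq_square mult_ac)
 moreover have "eN (s * e) + eN (s * e * C0) = eN (s * e + s * e * C0)" using s e C0 by (intro ennreal_plus[symmetric]) auto
 ultimately show ?thesis by (simp add: distrib_left)
 qed
 finally have IF: "(\<integral>\<^sup>+r. F r \<partial>lborel) <= eN (s * e * (1 + C0))" .
 have "(\<integral>\<^sup>+r. eN (C * e) * indicator {s<..<2 * s} r \<partial>lborel) <= (\<integral>\<^sup>+r. F r \<partial>lborel)"
 proof (rule nn_integral_mono_AE)
 show "AE r in lborel. eN (C * e) * indicator {s<..<2 * s} r <= F r" using P
 proof eventually_elim
 fix r assume Pr: "P r"
 show "eN (C * e) * indicator {s<..<2 * s} r <= F r"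
 proof (cases "r : {s<..<2 * s}")
 case True
 then have "eN (C * e) <= ns (I (Tq x r) - B) (%i. eN (rh i))" using no Pr by (auto simp: not_le less_imp_le)
 also have "... <= F r" unfolding F_def
 proof (rule ns_mono)
 show "I (Tq x r) - B <= ?J" using True I_mono[of "Tq x r" "ann x s"] by (auto simp: Tq_def ann_def)
 fix i assume "i : I (Tq x r) - B"
 then obtain y where y: "y : Q i" "ninf (y - x) = r" by (auto simp: meeting_def Tq_def)
 have "(abs(r - c i)) <= dist y (z i)" using ninf_diff_le[of y x "z i"] y by (simp add: c_def)
 also have "... <= dm i" using y z by (intro diameter_bounded_bound) auto
 finally have "r : R i" using True by (auto simp: R_def)
 then show "eN (rh i) <= eN (rh i) * indicator (R i) r" by simp
 qed
 finally show ?thesis using True by simp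
 qed simp
 qed
 qed
 also have "(\<integral>\<^sup>+r. eN (C * e) * indicator {s<..<2 * s} r \<partial>lborel) = eN (C * e * s)"
 using s e C0 by (subst nn_integral_cmult_indicator) (auto simp: C_def ennreal_mult[symmetric])
 finally have "eN (C * e * s) <= eN (s * e * (1 + C0))" using IF by (rule order_trans)
 then have "C * e * s <= s * e * (1 + C0)" using s e C0 by (subst (asm) ennreal_le_iff) auto
 then have "(s * e * (1 + C0)) * 2 <= (s * e * (1 + C0)) * 1" by (simp add: C_def mult_ac)
 moreover have "0 < s * e * (1 + C0)" using s e C0 by simp
 ultimately show False by linarith
 qed
 then show ?thesis using C0 by (intro exI[of _ C]) (auto simp: C_def)
qed

text \<open>A disk whose closure misses x keeps a distance from x. The next scale is taken below the
  distances of all disks that could reach it from the present annulus, so no such disk meets two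
  annuli.\<close>

lemma sparse_scales:
 fixes x :: complex
 assumes R0: "0 < R0"
 defines "B == {i. x : cQ i}"
 shows "EX s::nat => real. (ALL k. 0 < s k & 4 * s k <= R0 & s (Suc k) <= s k) &
 (ALL i k l. i ~: B --> i : I (ann x (s k)) --> i : I (ann x (s l)) --> k = l)"
proof -
 have step: "EX s'. 0 < s' & s' <= sg & (ALL i. i ~: B --> i : I (ann x sg) --> i ~: I (csqr x (2 * s')))" if sg: "0 < sg" for sg
 proof -
 \<comment> \<open>The next square will have half side at most \<open>sg / 2\<close>; only disks of
   diameter at least \<open>sg / 2\<close> reach it from the annulus, and there are finitely
   many.\<close>
 define F where "F = {i : I (csqr x (2 * sg)). sg / 2 <= dm i} - B"
 have F: "finite F" unfolding F_def using sg by (intro finite_Diff finite_large compact_imp_bounded compact_csqr) auto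
 have "EX d>0. sqr x d Int Q i = {}" if "i : F" for i
 proof -
 have "x : - cQ i" using that by (auto simp: F_def B_def)
 then obtain d where "d > 0" "sqr x d <= - cQ i" using sqr_in_open[of "- cQ i" x] by auto
 then show ?thesis using closure_subset[of "Q i"] by blast
 qed
 then obtain d where d: "!!i. i : F ==> d i > 0 & sqr x (d i) Int Q i = {}" by metis
 define s' where "s' = Min (insert (sg / 4) ((%i. d i / 4) ` F))"
 have fin: "finite (insert (sg / 4) ((%i. d i / 4) ` F))" using F by simp
 have s': "0 < s'" "s' <= sg / 4" "!!i. i : F ==> s' <= d i / 4"
 proof -
 have mn: "!!y. y : insert (sg / 4) ((%i. d i / 4) ` F) ==> s' <= y" unfolding s'_def by (rule Min_le[OF fin])
 show "s' <= sg / 4" by (rule mn) simp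
 show "s' <= d i / 4" if "i : F" for i by (rule mn) (use that in blast)
 show "0 < s'" unfolding s'_def using fin d sg by (subst Min_gr_iff) auto
 qed
 have "i ~: I (csqr x (2 * s'))" if i: "i ~: B" "i : I (ann x sg)" for i
 proof
 assume "i : I (csqr x (2 * s'))"
 then obtain y where y: "y : Q i" "ninf (y - x) <= 2 * s'" by (auto simp: meeting_def csqr_def)
 obtain w where w: "w : Q i" "sg < ninf (w - x)" "ninf (w - x) < 2 * sg" using i by (auto simp: meeting_def ann_def)
 have "sg / 2 <= dist w y" using y w s' ninf_diff_le[of w x y] by linarith
 also have "... <= dm i" using y w by (intro diameter_bounded_bound) auto
 finally have iF: "i : F" using w i by (auto simp: F_def meeting_def csqr_def)
 have "y : sqr x (d i)" using y s'(3)[OF iF] d[OF iF] by (auto simp: sqr_def)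
 then show False using d[OF iF] y by blast
 qed
 then show ?thesis using s' sg by (intro exI[of _ s']) auto
 qed
 then obtain nx where nx: "!!sg. 0 < sg ==> 0 < nx sg & nx sg <= sg & (ALL i. i ~: B --> i : I (ann x sg) --> i ~: I (csqr x (2 * nx sg)))" by metis
 define s where "s = rec_nat (R0 / 4) (%_. nx)"
 have s0: "s 0 = R0 / 4" and sS: "s (Suc k) = nx (s k)" for k by (auto simp: s_def)
 have pos: "0 < s k" for k by (induction k) (use R0 nx in \<open>auto simp: s0 sS\<close>)
 have dec: "s (Suc k) <= s k" for k using nx[OF pos] by (simp add: sS)
 have anti: "l <= k ==> s k <= s l" for k l using decseqD[of s] dec by (simp add: decseq_Suc_iff)
 have key: False if "i ~: B" "i : I (ann x (s k))" "i : I (ann x (s l))" "k < l" for i k l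
 proof -
 have "s l <= nx (s k)" using anti[of "Suc k" l] that by (simp add: sS)
 then have "ann x (s l) <= csqr x (2 * nx (s k))" by (auto simp: ann_def csqr_def)
 then have "i : I (csqr x (2 * nx (s k)))" using that(3) I_mono by blast
 then show False using nx[OF pos, of k] that by blast
 qed
 have one: "k = l" if "i ~: B" "i : I (ann x (s k))" "i : I (ann x (s l))" for i k l
 using key[OF that] key[OF that(1,3,2)] by (cases k l rule: linorder_cases) auto
 have two: "4 * s k <= R0" for k using anti[of 0 k] s0 by simp
 show ?thesis by (intro exI[of _ s] conjI allI impI pos two dec) (rule one)
qed

text \<open>Pigeonhole: off \<open>B\<close> the index sets at different scales are disjoint and
  share the total \<open>E\<close>.\<close>

lemma scale_pick:
 assumes "!!i k l. i ~: B ==> i : I (A k) ==> i : I (A l) ==> k = (l::nat)" "!!k. A k <= L"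
 and E: "nI L w <= ennreal E" "0 <= E" and N: "0 < N"
 shows "EX k<N. ns (I (A k) - B) w <= eN (E / real N)"
proof (rule ccontr)
 assume no: "~ ?thesis"
 have "eN (E / real N) < ns (I (A k) - B) w" if "k < N" for k using no that by (auto simp: not_le)
 moreover have dis: "ns (\<Union>k<m. I (A k) - B) w = (\<Sum>k<m. ns (I (A k) - B) w)" for m
 proof (induction m)
 case (Suc m)
 have "(\<Union>k<m. I (A k) - B) Int (I (A m) - B) = {}"
 proof (rule ccontr)
 assume "(\<Union>k<m. I (A k) - B) Int (I (A m) - B) ~= {}"
 then obtain i k where ik: "k < m" "i : I (A k)" "i : I (A m)" "i ~: B" by blast
 have "k = m" by (rule assms(1)[OF ik(4) ik(2) ik(3)])
 then show False using ik(1) by simp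
 qed
 then show ?case using Suc ns_Un_disj[of "\<Union>k<m. I (A k) - B" "I (A m) - B" w]
 by (simp add: lessThan_Suc Un_commute add.commute)
 qed simp
 ultimately have gt: "!!k. k < N ==> eN (E / real N) < ns (I (A k) - B) w" by blast
 have "(\<Sum>k<N. ns (I (A k) - B) w) = ns (\<Union>k<N. I (A k) - B) w" by (rule dis[symmetric])
 also have "... <= nI L w" using I_mono[OF assms(2)] by (intro ns_mono) auto
 also have "... <= ennreal E" by (rule E)
 finally have le: "(\<Sum>k<N. ns (I (A k) - B) w) <= ennreal E" .
 define a where "a k = enn2real (ns (I (A k) - B) w)" for k
 have a: "ns (I (A k) - B) w = eN (a k)" "0 <= a k" if "k < N" for k
 proof -
 have "ns (I (A k) - B) w <= (\<Sum>k<N. ns (I (A k) - B) w)" using that by (intro member_le_sum) auto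
 then have "ns (I (A k) - B) w <= ennreal E" using le by (rule order_trans)
 then have "ns (I (A k) - B) w < iN" by (rule order_le_less_trans) simp
 then show "ns (I (A k) - B) w = eN (a k)" "0 <= a k" by (auto simp: a_def)
 qed
 have "(\<Sum>k<N. ns (I (A k) - B) w) = (\<Sum>k<N. eN (a k))" using a(1) by (intro sum.cong) auto
 also have "... = eN (\<Sum>k<N. a k)" by (rule sum_ennreal) (auto simp: a_def)
 finally have "eN (\<Sum>k<N. a k) <= ennreal E" using le by simp
 then have "(\<Sum>k<N. a k) <= E" using E by (simp add: ennreal_le_iff)
 moreover have "(\<Sum>k<N. E / real N) < (\<Sum>k<N. a k)"
 proof (rule sum_strict_mono)
 fix k assume "k : {..<N}"
 then have k: "k < N" by simp
 have "eN (E / real N) < eN (a k)" using gt[OF k] a[OF k] by simp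
 then show "E / real N < a k" using E by (simp add: ennreal_less_iff)
 qed (use N in auto)
 moreover have "(\<Sum>k<N. E / real N) = E" using N by simp
 ultimately show False by simp
qed

end

section \<open>Crosscuts at a boundary point\<close>

context rel_carpet begin

lemma negligible_interval: "negligible X ==> connected X ==> a : X ==> b : X ==> a = (b::real)"
proof (rule ccontr)
 assume X: "negligible X" "connected X" and ab: "a : X" "b : X" "a ~= b"
 then have "{min a b..max a b} <= X" using connected_contains_Icc[OF X(2), of "min a b" "max a b"] by (auto simp: min_def max_def)
 then have n: "negligible {min a b..max a b}" using X(1) negligible_subset by blast
 have "min a b < max a b" using ab by auto
 then show False using n negligible_interval(1)[of "min a b" "max a b"] by (simp add: box_eq_empty)
qed

text \<open>A connected set that meets no disk lies in the carpet and so has length zero. Both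
  coordinate projections are then null intervals, and the set is a single point.\<close>

lemma contact:
 assumes "connected X" "X <= Om" "hausdorff 1 (X Int S) = 0" "a : X" "b : X" "a ~= b"
 shows "I X ~= {}"
proof
 assume "I X = {}"
 then have "X <= S" using assms(2) by (auto simp: carpet_def meeting_def)
 then have h: "hausdorff 1 X = 0" using assms(3) by (simp add: Int_absorb2)
 have 1: "negligible (Re ` X)" by (rule h1_negligible[OF h]) (metis abs_Re_le_cmod dist_norm minus_complex.simps(1))
 have 2: "negligible (Im ` X)" by (rule h1_negligible[OF h]) (metis abs_Im_le_cmod dist_norm minus_complex.simps(2))
 have "Re a = Re b" using assms by (intro negligible_interval[OF 1]) (auto intro!: connected_continuous_image continuous_intros)
 moreover have "Im a = Im b" using assms by (intro negligible_interval[OF 2]) (auto intro!: connected_continuous_image continuous_intros)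
 ultimately show False using assms by (simp add: complex_eq_iff)
qed

definition Hr :: "complex => real => bool" where "Hr x r \<longleftrightarrow> hausdorff 1 (Tq x r Int S) = 0"

lemma AE_Hr: "AE r in lborel. Hr x r"
proof -
 have 1: "AE r in lborel. hausdorff 1 (range (lin b (phi b x + r)) Int S) = 0" for b
 by (rule AE_lip[OF hausdorff1_lines[of b], where g="%y. y - phi b x"]) auto
 have 2: "AE r in lborel. hausdorff 1 (range (lin b (phi b x - r)) Int S) = 0" for b
 by (rule AE_lip[OF hausdorff1_lines[of b], where g="%y. phi b x - y"]) auto
 show ?thesis using 1[of True] 1[of False] 2[of True] 2[of False]
 proof eventually_elim
 case (elim r)
 let ?L = "%b c. range (lin b (phi b x + c)) Int S"
 have "Tq x r Int S <= (?L True r Un ?L True (-r)) Un (?L False r Un ?L False (-r))"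
 proof
 fix z assume z: "z : Tq x r Int S"
 then have "(Im z = Im x + r | Im z = Im x - r) | (Re z = Re x + r | Re z = Re x - r)"
 by (auto simp: Tq_def ninf_def max_def abs_real_def split: if_splits)
 moreover have "z : range (lin True (Im z))" "z : range (lin False (Re z))"
 using lin_phi(1)[of True z] lin_phi(1)[of False z] by (auto simp: phi_def intro: range_eqI[OF sym])
 ultimately show "z : (?L True r Un ?L True (-r)) Un (?L False r Un ?L False (-r))" using z by (auto simp: phi_def)
 qed
 then have "hausdorff 1 (Tq x r Int S) <= hausdorff 1 ((?L True r Un ?L True (-r)) Un (?L False r Un ?L False (-r)))" by (rule hausdorff_mono)
 also have "... <= hausdorff 1 (?L True r Un ?L True (-r)) + hausdorff 1 (?L False r Un ?L False (-r))" by (rule hausdorff_subadd2) simp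
 also have "... <= (hausdorff 1 (?L True r) + hausdorff 1 (?L True (-r))) + (hausdorff 1 (?L False r) + hausdorff 1 (?L False (-r)))"
 by (intro add_mono hausdorff_subadd2) simp_all
 also have "... = 0" using elim by simp
 finally show ?case by (simp add: Hr_def)
 qed
qed

lemma arc_contact:
 assumes r: "0 < r" "Hr x r" and cd: "c < d" and sub: "hq x r ` {c..d} <= Om" and a: "a : hq x r ` {c..d}" and e: "0 < e"
 shows "I (hq x r ` {c..d} Int ball a e) ~= {}"
proof -
 let ?h = "hq x r"
 obtain t where t: "t : {c..d}" "a = ?h t" using a by blast
 obtain et where et: "et > 0" "!!s. (abs(s - t)) < et ==> dist (?h s) (?h t) < e"
 using continuous_hq[of UNIV x r] e unfolding continuous_on_iff by (metis UNIV_I dist_real_def)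
 define p q where "p = max c (t - min (et/2) 1)" and "q = min d (t + min (et/2) 1)"
 have pq: "p < q" "c <= p" "q <= d" "q - p <= 2" "!!s. s : {p..q} ==> (abs(s - t)) < et"
 using t cd et(1) by (auto simp: p_def q_def min_def max_def abs_real_def split: if_splits)
 let ?X = "?h ` {p..q}"
 have X: "?X <= ?h ` {c..d} Int ball a e" using pq et(2) t by (auto simp: dist_commute)
 have TX: "?X <= Tq x r" using hq_Tq r by auto
 have "hausdorff 1 (?X Int S) <= hausdorff 1 (Tq x r Int S)" using TX by (intro hausdorff_mono) auto
 then have h: "hausdorff 1 (?X Int S) = 0" using r by (simp add: Hr_def)
 have ne: "?h p ~= ?h q"
 proof
 assume "?h p = ?h q"
 then obtain n :: int where n: "p = q + 2 * pi * of_int n" using hq_inj[OF r(1)] by blast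
 have "n ~= 0" using n pq by auto
 then have "2 * pi * 1 <= (abs(2 * pi * of_int n :: real))" unfolding abs_mult by (intro mult_mono) auto
 then show False using n pq pi_gt3 by auto
 qed
 have "I ?X ~= {}" by (rule contact[OF _ _ h, of "?h p" "?h q"])
 (use X sub pq ne in \<open>auto intro: connected_continuous_image continuous_hq\<close>)
 then show ?thesis using I_mono[OF X] by blast
qed

text \<open>Starting the loop at x, the small arc \<open>al\<close> about x consists of the
  beginning and the end of the parametrization, and \<open>be\<close> is the middle part.\<close>

lemma loop_split:
 fixes x :: complex
 assumes c: "simple_path c" "pathfinish c = pathstart c" and x: "x : path_image c" and R: "0 < R"
 shows "EX al be. path_image c = al Un be & compact al & connected al & compact be & connected be & al <= ball x R & x ~: be"
proof -
 obtain tu where tu: "tu : {0..1}" "c tu = x" using x by (auto simp: path_image_def)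
 define k where "k = shiftpath tu c"
 have k: "simple_path k" "path_image k = path_image c" "k 0 = x" "k 1 = x"
 using simple_path_shiftpath[OF c] path_image_shiftpath[OF tu(1) c(2)] pathstart_shiftpath[of tu c] pathfinish_shiftpath[OF _ c(2), of tu] tu
 by (auto simp: k_def pathstart_def pathfinish_def)
 have ck: "continuous_on {0..1} k" using k(1) by (simp add: simple_path_def path_def)
 obtain a where a: "a > 0" "!!s. s : {0..1} ==> (abs(s)) < a ==> dist (k s) x < R"
 using ck R k(3) unfolding continuous_on_iff by (metis atLeastAtMost_iff diff_zero dist_real_def order_refl zero_le_one)
 obtain b where b: "b > 0" "!!s. s : {0..1} ==> (abs(s - 1)) < b ==> dist (k s) x < R"
 using ck R k(4) unfolding continuous_on_iff by (metis atLeastAtMost_iff dist_real_def order_refl zero_le_one)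
 define a' b' where "a' = min (a/2) (1/2)" and "b' = 1 - min (b/2) (1/2)"
 have ab: "0 < a'" "a' <= b'" "b' < 1" "a' < a" "1 - b' < b" using a b by (auto simp: a'_def b'_def)
 define al be where "al = k ` {0..a'} Un k ` {b'..1}" and "be = k ` {a'..b'}"
 have cc: "compact (k ` {s..t}) & connected (k ` {s..t})" if "0 <= s" "t <= 1" for s t
 proof -
 have "continuous_on {s..t} k" by (rule continuous_on_subset[OF ck]) (use that in auto)
 then show ?thesis by (auto intro: compact_continuous_image connected_continuous_image)
 qed
 have "{0..1} = ({0..a'} Un {b'..1}) Un {a'..b'}" using ab by auto
 then have "path_image k = al Un be" unfolding path_image_def al_def be_def by (metis image_Un)
 then have "path_image c = al Un be" using k(2) by simp
 moreover have "compact al" "compact be" "connected be" using cc ab by (auto simp: al_def be_def intro!: compact_Un)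
 moreover have "connected al" unfolding al_def
 proof (rule connected_Un)
 have "k 0 : k ` {0..a'}" "k 1 : k ` {b'..1}" using ab by auto
 then show "k ` {0..a'} Int k ` {b'..1} ~= {}" using k by auto
 qed (use cc ab in auto)
 moreover have "al <= ball x R" using a(2) b(2) ab by (auto simp: al_def dist_commute)
 moreover have "x ~: be"
 proof
 assume "x : be"
 then obtain s where s: "s : {a'..b'}" "k s = k 0" using k by (auto simp: be_def)
 then show False using k(1) ab unfolding simple_path_def loop_free_def by force
 qed
 ultimately show ?thesis by blast
qed

lemma fr_split:
 assumes "x : fr i" "0 < R"
 shows "EX al be. fr i = al Un be & compact al & connected al & compact be & connected be & al <= ball x R & x ~: be"
proof -
 obtain c where "simple_path c" "pathfinish c = pathstart c" "fr i = path_image c" using Q_jordan[of i] by metis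
 then show ?thesis using loop_split[of c x R] assms by metis
qed

lemma fr_outer: "fr i <= closure (- cQ i)"
proof -
 obtain c where c: "simple_path c" "pathfinish c = pathstart c" "fr i = path_image c" "- cQ i = outside (path_image c)"
 using Q_jordan[of i] by metis
 then have "frontier (outside (path_image c)) = path_image c" using Jordan_inside_outside by blast
 then show ?thesis using c by (auto simp: frontier_def)
qed

section \<open>Janiszewski arguments at a Jordan curve\<close>

lemma cc_compl: "y ~: cQ i ==> z ~: cQ i ==> connected_component (- fr i) y z"
 using connected_compl_closure_Q[of i] unfolding connected_component_def
 by (intro exI[of _ "- cQ i"]) (auto simp: fr_Q)

lemma cc_upgrade:
 assumes y: "y ~: cQ i" and c: "connected_component (- (fr i Un T)) y z"
 shows "connected_component (- (cQ i Un T)) y z"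
proof -
 obtain X where X: "connected X" "X <= - (fr i Un T)" "y : X" "z : X" using c unfolding connected_component_def by blast
 have "X Int cQ i = {}"
 proof (rule ccontr)
 assume "X Int cQ i ~= {}"
 then have "X Int Q i ~= {}" using X(2) fr_Q by blast
 moreover have "X - Q i ~= {}" using X(3) y closure_subset by blast
 ultimately have "X Int fr i ~= {}" using X(1) by (intro connected_Int_frontier)
 then show False using X(2) by blast
 qed
 then show ?thesis unfolding connected_component_def using X by (intro exI[of _ X]) auto
qed

text \<open>Local connectedness of the exterior at a boundary point. Janiszewski's theorem is
  applied to the circle and to \<open>T\<close>, the outside of the ball together with the far arc;
  they intersect in that arc, which is connected.\<close>

lemma ulc:
 assumes x: "x : fr i" and r: "0 < r"
 shows "EX dl>0. ALL y z. y : ball x dl - cQ i --> z : ball x dl - cQ i -->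
 connected_component (- (cQ i Un - ball x r)) y z"
proof -
 obtain al be where ab: "fr i = al Un be" "compact be" "connected be" "al <= ball x r" "x ~: be" using fr_split[OF x r] by blast
 define T where "T = - ball x r Un be"
 have T: "closed T" "x ~: T" using ab r by (auto simp: T_def compact_imp_closed intro!: closed_Un)
 obtain dl where dl: "dl > 0" "ball x dl <= - T" using T open_contains_ball[of "- T"] by auto
 have "connected_component (- (cQ i Un - ball x r)) y z"
 if y: "y : ball x dl - cQ i" and z: "z : ball x dl - cQ i" for y z
 proof -
 have "connected_component (- (fr i Un T)) y z"
 proof (rule Janiszewski[OF compact_fr T(1)])
 have "fr i Int T = be" using ab by (auto simp: T_def)
 then show "connected (fr i Int T)" using ab by simp
 show "connected_component (- fr i) y z" using y z by (intro cc_compl) auto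
 show "connected_component (- T) y z" unfolding connected_component_def
 using y z dl by (intro exI[of _ "ball x dl"]) auto
 qed
 then have "connected_component (- (cQ i Un T)) y z" using y by (intro cc_upgrade) auto
 then show ?thesis by (rule connected_component_of_subset) (auto simp: T_def)
 qed
 then show ?thesis using dl by blast
qed

text \<open>The counterpart of \<open>ulc\<close>: \<open>T\<close> is now a small ball together
  with the near arc, and that arc is the connected intersection with the circle.\<close>

lemma far:
 assumes x: "x : fr i" and R: "0 < R"
 shows "EX r>0. r < R & (ALL y z. y ~: ball x R Un cQ i --> z ~: ball x R Un cQ i -->
 connected_component (- (cQ i Un cball x r)) y z)"
proof -
 obtain al be where ab: "fr i = al Un be" "compact al" "connected al" "compact be" "al <= ball x R" "x ~: be" using fr_split[OF x R] by blast
 have "open (- be)" "x : - be" using ab by (auto simp: compact_imp_closed)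
 then obtain r0 where r0: "r0 > 0" "cball x r0 <= - be" using open_contains_cball by blast
 define r where "r = min r0 (R/2)"
 have r: "0 < r" "r < R" "cball x r <= - be" using r0 R by (auto simp: r_def)
 define T where "T = cball x r Un al"
 have "connected_component (- (cQ i Un cball x r)) y z"
 if y: "y ~: ball x R Un cQ i" and z: "z ~: ball x R Un cQ i" for y z
 proof -
 have "connected_component (- (fr i Un T)) y z"
 proof (rule Janiszewski[OF compact_fr])
 show "closed T" using ab by (auto simp: T_def compact_imp_closed intro!: closed_Un)
 have "fr i Int T = al" using ab r by (auto simp: T_def)
 then show "connected (fr i Int T)" using ab by simp
 show "connected_component (- fr i) y z" using y z by (intro cc_compl) auto
 have "connected (- ball x R)" by (rule connected_complement_bounded_convex) auto
 moreover have "- ball x R <= - T" using ab r by (auto simp: T_def)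
 ultimately show "connected_component (- T) y z" unfolding connected_component_def
 using y z by (intro exI[of _ "- ball x R"]) auto
 qed
 then have "connected_component (- (cQ i Un T)) y z" using y by (intro cc_upgrade) auto
 then show ?thesis by (rule connected_component_of_subset) (auto simp: T_def)
 qed
 then show ?thesis using r by blast
qed

lemma Tq_separates: "ninf (y - x) < r ==> r < ninf (p - x) ==> Tq x r <= X ==> ~ connected_component (- X) y p"
proof
 assume yp: "ninf (y - x) < r" "r < ninf (p - x)" and X: "Tq x r <= X" and "connected_component (- X) y p"
 then obtain T where T: "connected T" "T <= - X" "y : T" "p : T" unfolding connected_component_def by blast
 have "connected ((%z. ninf (z - x)) ` T)" using T(1) by (intro connected_continuous_image continuous_intros)
 then have "r : (%z. ninf (z - x)) ` T"
 using T yp connected_contains_Icc[of "(%z. ninf (z - x)) ` T" "ninf (y - x)" "ninf (p - x)"] by force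
 then show False using T(2) X by (auto simp: Tq_def)
qed

text \<open>If no single crosscut separated y from p, Janiszewski's theorem would allow adding them
  to \<open>K\<close> one after the other, as any two of the sets involved meet exactly in the
  connected \<open>K\<close>. In the end the whole square boundary would fail to separate inside
  from outside.\<close>

lemma single_arc:
 assumes K: "compact K" "connected K" and D: "open D" "connected D" "D = - K" and r: "0 < r"
 and y: "y : D" "ninf (y - x) < r" and p: "p : D" "r < ninf (p - x)" and t0: "hq x r t0 : K"
 shows "EX c d. t0 <= c & c < d & d <= t0 + 2 * pi & hq x r c : K & hq x r d : K & (ALL t:{c<..<d}. hq x r t ~: K) &
 ~ connected_component (- (K Un hq x r ` {c..d})) y p"
proof (rule ccontr)
 assume no: "~ ?thesis"
 let ?h = "hq x r" and ?E = "t0 + 2 * pi"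
 have hE: "?h ?E : K" using t0 hq_periodic[of x r t0 1] by simp
 have ch: "continuous_on A ?h" for A by (rule continuous_hq)
 \<comment> \<open>The gaps of \<open>K\<close> on one period. The period starts and ends at
   parameters mapped into \<open>K\<close>, so every gap is an interval with both ends
   there.\<close>
 define GG where "GG = {{c<..<d} | c d. t0 <= c & c < d & d <= ?E & ?h c : K & ?h d : K & (ALL t:{c<..<d}. ?h t ~: K)}"
 have ex: "EX J:GG. t : J" if t: "t : {t0..?E}" "?h t ~: K" for t
 proof -
 define A where "A = {s : {t0..t}. ?h s : K}"
 define B where "B = {s : {t..?E}. ?h s : K}"
 have cl: "closed K" using K compact_imp_closed by blast
 have A: "compact A" unfolding A_def
 using continuous_closed_preimage[OF ch[of "{t0..t}"] closed_atLeastAtMost cl]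
 by (auto simp: compact_eq_bounded_closed vimage_def Int_def conj_commute intro: bounded_subset[OF bounded_closed_interval])
 have B: "compact B" unfolding B_def
 using continuous_closed_preimage[OF ch[of "{t..?E}"] closed_atLeastAtMost cl]
 by (auto simp: compact_eq_bounded_closed vimage_def Int_def conj_commute intro: bounded_subset[OF bounded_closed_interval])
 have ne: "A ~= {}" "B ~= {}" using t t0 hE by (auto simp: A_def B_def)
 obtain c where c: "c : A" "!!s. s : A ==> s <= c" using compact_attains_sup[OF A ne(1)] by blast
 obtain d where d: "d : B" "!!s. s : B ==> d <= s" using compact_attains_inf[OF B ne(2)] by blast
 have cd: "t0 <= c" "c <= t" "?h c : K" "t <= d" "d <= ?E" "?h d : K" using c(1) d(1) by (auto simp: A_def B_def)
 have "c ~= t" "d ~= t" using cd t by auto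
 then have lt: "c < t" "t < d" using cd by auto
 have nK: "?h s ~: K" if s: "s : {c<..<d}" for s
 proof
 assume "?h s : K"
 then have "s : A | s : B" using s cd t by (auto simp: A_def B_def)
 then show False using c(2)[of s] d(2)[of s] s by auto
 qed
 have "{c<..<d} : GG" unfolding GG_def using cd lt nK by fastforce
 then show ?thesis using lt by (intro bexI[of _ "{c<..<d}"]) auto
 qed
 have dis: "J Int J' = {}" if J: "J : GG" and J': "J' : GG" and ne: "J ~= J'" for J J'
 proof (rule ccontr)
 assume "J Int J' ~= {}"
 then obtain t where t: "t : J" "t : J'" by blast
 obtain c d where c: "J = {c<..<d}" "?h c : K" "?h d : K" "ALL t:{c<..<d}. ?h t ~: K" using J unfolding GG_def by blast
 obtain c' d' where c': "J' = {c'<..<d'}" "?h c' : K" "?h d' : K" "ALL t:{c'<..<d'}. ?h t ~: K" using J' unfolding GG_def by blast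
 have "c ~: {c'<..<d'}" "d ~: {c'<..<d'}" "c' ~: {c<..<d}" "d' ~: {c<..<d}" using c c' by blast+
 then have "c = c'" "d = d'" using t c(1) c'(1) by auto
 then show False using ne c c' by simp
 qed
 have "path_connected D" using D by (simp add: connected_open_path_connected)
 then obtain P where P: "path P" "path_image P <= D" "pathstart P = y" "pathfinish P = p"
 using y(1) p(1) unfolding path_connected_def by blast
 have cP: "compact (path_image P)" "connected (path_image P)" using P(1) by (auto simp: compact_path_image connected_path_image)
 define Z where "Z = {t : {t0..?E}. ?h t : path_image P}"
 have "compact Z" unfolding Z_def
 using continuous_closed_preimage[OF ch[of "{t0..?E}"] closed_atLeastAtMost compact_imp_closed[OF cP(1)]]
 by (auto simp: compact_eq_bounded_closed vimage_def Int_def conj_commute intro: bounded_subset[OF bounded_closed_interval])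
 moreover have "Z <= \<Union>GG"
 proof
 fix t assume "t : Z"
 then have "t : {t0..?E}" "?h t ~: K" using P(2) D(3) by (auto simp: Z_def)
 then show "t : \<Union>GG" using ex by blast
 qed
 moreover have "!!J. J : GG ==> open J" unfolding GG_def by auto
 ultimately obtain FF where FF: "FF <= GG" "finite FF" "Z <= \<Union>FF" using compactE[of Z GG] by metis
 \<comment> \<open>There may be infinitely many gaps, but by compactness the path \<open>P\<close>
   meets finitely many. All others are added at once, those in \<open>FF\<close> one at a
   time.\<close>
 have main: "connected_component (- (K Un ?h ` ({t0..?E} - \<Union>(FF - HH)))) y p" if "HH <= FF" for HH
 proof -
 have "finite HH" using that FF finite_subset by blast
 then show ?thesis using that
 proof (induction HH)
 case empty
 have "path_image P Int ?h ` ({t0..?E} - \<Union>FF) = {}"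
 proof (rule ccontr)
 assume "~ ?thesis"
 then obtain t where t: "t : {t0..?E} - \<Union>FF" "?h t : path_image P" by blast
 then have "t : Z" by (simp add: Z_def)
 then show False using FF(3) t(1) by blast
 qed
 then have "path_image P <= - (K Un ?h ` ({t0..?E} - \<Union>(FF - {})))" using P(2) D(3) by auto
 then show ?case unfolding connected_component_def using cP P by (intro exI[of _ "path_image P"]) (auto simp: pathstart_in_path_image pathfinish_in_path_image)
 next
 case (insert J HH)
 have JG: "J : GG" using insert FF by blast
 obtain c d where cd: "J = {c<..<d}" "t0 <= c" "c < d" "d <= ?E" "?h c : K" "?h d : K" "ALL t:{c<..<d}. ?h t ~: K"
 using JG unfolding GG_def by blast
 define U where "U = {t0..?E} - \<Union>(FF - HH)"
 have "open (\<Union>(FF - HH))" using FF by (intro open_Union) (auto simp: GG_def)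
 then have "compact U" unfolding U_def by (intro compact_diff) auto
 then have S: "compact (K Un ?h ` U)" using K(1) by (intro compact_Un compact_continuous_image ch)
 have T: "closed (K Un ?h ` {c..d})" using K(1) by (intro compact_imp_closed compact_Un compact_continuous_image ch) auto
 \<comment> \<open>Off \<open>K\<close> equal points would have parameters less than a period apart,
   hence equal parameters, which would put \<open>s\<close> into the gap just excluded from
   \<open>U\<close>.\<close>
 have "?h s : K" if s: "s : U" "t : {c..d}" "?h s = ?h t" for s t
 proof (rule ccontr)
 assume nK: "?h s ~: K"
 then have t: "t : {c<..<d}" using s cd by (cases "t = c"; cases "t = d") auto
 obtain n :: int where n: "s = t + 2 * pi * of_int n" using hq_inj[OF r s(3)] by blast
 have "(abs(s - t)) < 2 * pi" using s(1) t cd by (auto simp: U_def)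
 then have lt: "(abs(2 * pi * of_int n :: real)) < 2 * pi" by (simp add: n)
 have "n = 0"
 proof (rule ccontr)
 assume "n ~= 0"
 then have "2 * pi * 1 <= (abs(2 * pi * of_int n :: real))" unfolding abs_mult by (intro mult_mono) auto
 then show False using lt by simp
 qed
 then have "s = t" using n by simp
 then have "s : J" using t cd(1) by simp
 then show False using s(1) insert by (auto simp: U_def)
 qed
 then have int: "(K Un ?h ` U) Int (K Un ?h ` {c..d}) = K" by auto
 have "connected_component (- ((K Un ?h ` U) Un (K Un ?h ` {c..d}))) y p"
 proof (rule Janiszewski[OF S T])
 show "connected ((K Un ?h ` U) Int (K Un ?h ` {c..d}))" using int K by simp
 show "connected_component (- (K Un ?h ` U)) y p" using insert by (simp add: U_def)
 show "connected_component (- (K Un ?h ` {c..d})) y p" using no cd by blast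
 qed
 then show ?case
 proof (rule connected_component_of_subset)
 have "{t0..?E} - \<Union>(FF - insert J HH) <= U Un {c..d}" using cd by (auto simp: U_def)
 then have "?h ` ({t0..?E} - \<Union>(FF - insert J HH)) <= ?h ` U Un ?h ` {c..d}" by blast
 then show "- ((K Un ?h ` U) Un (K Un ?h ` {c..d})) <= - (K Un ?h ` ({t0..?E} - \<Union>(FF - insert J HH)))" by blast
 qed
 qed
 qed
 have "connected_component (- (K Un ?h ` {t0..?E})) y p" using main[of FF] by simp
 moreover have "Tq x r <= K Un ?h ` {t0..?E}" using Tq_image[OF r, of x t0] by simp
 ultimately show False using Tq_separates y(2) p(2) by blast
qed

section \<open>Construction of the traps\<close>

lemma csqr_ninf: "z : ball x r ==> ninf (z - x) < r" "r <= ninf (z - x) ==> r <= dist x z" "dist x z <= 2 * ninf (z - x)"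
 using ninf_le_norm[of "z - x"] norm_le_ninf[of "z - x"] by (auto simp: dist_norm norm_minus_commute)

text \<open>At a point on no circle the whole square with its full boundary is the trap, and there
  are no exit disks.\<close>

lemma trap_core:
 assumes x: "x : S" "!!i. x ~: cQ i" and R: "0 < R"
 shows "EX r2>0. ALL r1>0. EX dl>0. ALL r. r1 <= r --> r <= r2 --> Hr x r -->
 (EX c d V. c < d & d <= c + 2 * pi & trap {} (hq x r ` {c..d}) V & V <= ball x R &
 (ALL i. Q i Int ball x dl ~= {} --> i : I V) & hq x r ` {c..d} <= Om)"
proof -
 have "x : Om" using x S_sub by blast
 then obtain R0 where R0: "R0 > 0" "cball x R0 <= Om" using open_Om open_contains_cball by blast
 define r2 where "r2 = min R R0 / 4"
 have r2: "0 < r2" "4 * r2 <= R" "4 * r2 <= R0" using R R0 by (auto simp: r2_def)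
 have main: "EX c d V. c < d & d <= c + 2 * pi & trap {} (hq x r ` {c..d}) V & V <= ball x R &
 (ALL i. Q i Int ball x r1 ~= {} --> i : I V) & hq x r ` {c..d} <= Om"
 if r1: "0 < r1" "r1 <= r" and r: "r <= r2" "Hr x r" for r1 r
 proof -
 have r0: "0 < r" using r1 by simp
 let ?A = "hq x r ` {0..0 + 2 * pi}" and ?V = "sqr x r"
 have A: "?A = Tq x r" using Tq_image[OF r0, of x 0] by simp
 have c2: "csqr x r <= cball x (2 * r)" by (rule csqr_subset_cball)
 have "cball x (2 * r) <= cball x R0" using r r2 by (intro subset_cball) auto
 then have cO: "csqr x r <= Om" using c2 R0(2) by blast
 have clV: "closure ?V <= csqr x r" using sqr_subset_csqr compact_csqr by (intro closure_minimal) (auto simp: compact_imp_closed)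
 have TO: "Tq x r <= csqr x r" by (auto simp: Tq_def csqr_def)
 have "frontier ?V = closure ?V - ?V" by (simp add: frontier_def interior_open)
 then have fV: "frontier ?V <= Tq x r" using clV by (auto simp: csqr_def sqr_def Tq_def)
 have cV: "connected ?V"
 proof (rule convex_connected, rule convexI)
 fix a b u v assume ab: "a : ?V" "b : ?V" and uv: "0 <= u" "0 <= v" "u + v = (1::real)"
 have "u *\<^sub>R a + v *\<^sub>R b - x = of_real u * (a - x) + of_real v * (b - x)"
 unfolding eq_diff_eq[THEN iffD2, OF uv(3)[unfolded add.commute[of u]]] by (simp add: scaleR_conv_of_real algebra_simps)
 then have "ninf (u *\<^sub>R a + v *\<^sub>R b - x) <= u * ninf (a - x) + v * ninf (b - x)"
 using ninf_triangle[of "of_real u * (a - x)" "of_real v * (b - x)"] uv by (simp add: ninf_scale)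
 also have "... < r" using ab uv convex_bound_lt[of "ninf (a - x)" r "ninf (b - x)" u v] by (simp add: sqr_def)
 finally show "u *\<^sub>R a + v *\<^sub>R b : ?V" by (simp add: sqr_def)
 qed
 have "UNIV Int frontier ?V ~= {}"
 proof (rule connected_Int_frontier)
 show "UNIV Int ?V ~= {}" using sqr_center[OF r0] by blast
 have "hq x r 0 ~: ?V" using hq_Tq[of r x 0] r0 by (simp add: sqr_def Tq_def)
 then show "UNIV - ?V ~= {}" by blast
 qed (rule connected_UNIV)
 then obtain a where a: "a : frontier ?V" by blast
 then have aA: "a : ?A" using fV A by blast
 have "trap {} ?A ?V" unfolding trap_def
 proof (intro conjI)
 show "compact (closure ?V)" using clV compact_csqr by (meson bounded_subset closed_closure compact_eq_bounded_closed)
 show "closure ?V <= Om" using clV cO by blast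
 show "?V Int ?A = {}" unfolding A by (auto simp: sqr_def Tq_def)
 show "ALL z:frontier ?V - ?A. EX i:{}. z : fr i & (EX e>0. ball z e <= Q i Un closure ?V)" using fV A by blast
 have "I (?A Int ball a e) ~= {}" if "0 < e" for e
 by (rule arc_contact[OF r0 r(2) _ _ aA that]) (use A TO cO in auto)
 then show "EX a:?A Int frontier ?V. (ALL i:{}. a ~: cQ i) & (ALL e>0. I (?A Int ball a e) ~= {})" using a aA by blast
 qed (use cV in auto)
 moreover have "?V <= ball x R"
 proof
 fix z assume "z : ?V"
 then have "dist x z < 2 * r" using csqr_ninf(3)[of x z] by (simp add: sqr_def)
 then show "z : ball x R" using r r2 by simp
 qed
 moreover have "i : I ?V" if "Q i Int ball x r1 ~= {}" for i
 proof -
 have "ball x r1 <= ?V" using csqr_ninf(1)[of _ x r1] r1 by (force simp: sqr_def)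
 then show ?thesis using that by (auto simp: meeting_def)
 qed
 moreover have "?A <= Om" using A TO cO by blast
 ultimately show ?thesis using pi_gt_zero by (intro exI[of _ 0] exI[of _ "0 + 2 * pi"] exI[of _ ?V]) auto
 qed
 show ?thesis
 proof (rule exI[of _ r2], rule conjI[OF r2(1)], rule allI, rule impI)
 fix r1 :: real assume r1: "0 < r1"
 show "EX dl>0. ALL r. r1 <= r --> r <= r2 --> Hr x r -->
 (EX c d V. c < d & d <= c + 2 * pi & trap {} (hq x r ` {c..d}) V & V <= ball x R &
 (ALL i. Q i Int ball x dl ~= {} --> i : I V) & hq x r ` {c..d} <= Om)"
 by (rule exI[of _ r1], rule conjI[OF r1], intro allI impI, rule main[OF r1])
 qed
qed

text \<open>The trap is the component behind one crosscut, as seen from a point of the exterior near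
  x. \<open>ulc\<close> shows that it contains the exterior near x, \<open>far\<close> that it stays
  near x.\<close>

lemma trap_fr:
 assumes x: "x : fr i" and R: "0 < R"
 shows "EX r2>0. ALL r1>0. EX dl>0. ALL r. r1 <= r --> r <= r2 --> Hr x r -->
 (EX c d V. c < d & d <= c + 2 * pi & trap {i} (hq x r ` {c..d}) V & V <= ball x R &
 (ALL j. j ~= i --> Q j Int ball x dl ~= {} --> j : I V) & hq x r ` {c..d} <= Om & hq x r ` {c..d} Int fr i ~= {})"
proof -
 define K where "K = (cQ i)"
 define D where "D = - K"
 have K: "compact K" "connected K" "closed K" using connected_Q connected_imp_connected_closure by (auto simp: K_def)
 have D: "open D" "connected D" "D = - K" using connected_compl_closure_Q by (auto simp: D_def K_def)
 have JK: "fr i = K - Q i" "Q i <= K" using fr_Q closure_subset by (auto simp: K_def)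
 have "x : Om" using x fr_S S_sub by blast
 then obtain R0 where R0: "R0 > 0" "cball x R0 <= Om" using open_Om open_contains_cball by blast
 define R' where "R' = min R R0"
 have R': "0 < R'" "R' <= R" "R' <= R0" using R R0 by (auto simp: R'_def)
 obtain rf where rf: "0 < rf" "rf < R'" "!!y z. y ~: ball x R' Un K ==> z ~: ball x R' Un K ==> connected_component (- (K Un cball x rf)) y z"
 using far[OF x R'(1)] unfolding K_def by blast
 obtain w where w: "w : K" "w ~= x"
 proof -
 obtain w where "w : Q i" using Q_ne by blast
 moreover have "x ~: Q i" using x JK by blast
 ultimately show ?thesis using that[of w] JK by blast
 qed
 \<comment> \<open>The first bound keeps the square boundary inside \<open>cball x rf\<close>; the
   second makes the connected set \<open>K\<close>, which contains x and w, meet it.\<close>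
 define r2 where "r2 = min (rf/2) (ninf (w - x))"
 have "ninf (w - x) ~= 0" using w by simp
 then have "0 < ninf (w - x)" using ninf_nonneg[of "w - x"] by linarith
 then have r2: "0 < r2" "2 * r2 <= rf" "r2 <= ninf (w - x)" using rf by (auto simp: r2_def)
 have "bounded (ball x R' Un K)" using K by (simp add: compact_imp_bounded)
 then obtain p where p: "p ~: ball x R' Un K" using not_bounded_UNIV by (metis UNIV_eq_I)
 show ?thesis
 proof (rule exI[of _ r2], rule conjI[OF r2(1)], rule allI, rule impI)
 fix r1 :: real assume r1: "0 < r1"
 obtain dl0 where dl0: "dl0 > 0" "!!y z. y : ball x dl0 - K ==> z : ball x dl0 - K ==> connected_component (- (K Un - ball x r1)) y z"
 using ulc[OF x r1] unfolding K_def by blast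
 define dl where "dl = min dl0 r1"
 have dl: "0 < dl" "dl <= dl0" "dl <= r1" using dl0 r1 by (auto simp: dl_def)
 have "x : closure D" using fr_outer x unfolding D_def K_def by blast
 then obtain y where y: "y : D" "y : ball x dl" using dl(1) by (metis centre_in_ball closure_iff_nhds_not_empty[THEN iffD1] closure_approachable dist_commute mem_ball)
 have main: "EX c d V. c < d & d <= c + 2 * pi & trap {i} (hq x r ` {c..d}) V & V <= ball x R &
 (ALL j. j ~= i --> Q j Int ball x dl ~= {} --> j : I V) & hq x r ` {c..d} <= Om & hq x r ` {c..d} Int fr i ~= {}"
 if r: "r1 <= r" "r <= r2" "Hr x r" for r
 proof -
 let ?h = "hq x r"
 have r0: "0 < r" using r r1 by simp
 have "EX t0. ?h t0 : K"
 proof -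
 have "connected ((%z. ninf (z - x)) ` K)" using K by (intro connected_continuous_image continuous_intros)
 moreover have "ninf (x - x) : (%z. ninf (z - x)) ` K" "ninf (w - x) : (%z. ninf (z - x)) ` K" using x JK w by blast+
 ultimately have "{ninf (x - x)..ninf (w - x)} <= (%z. ninf (z - x)) ` K" by (rule connected_contains_Icc)
 moreover have "ninf (x - x) = 0" by simp
 then have "r : {ninf (x - x)..ninf (w - x)}" using r r0 r2 unfolding atLeastAtMost_iff by linarith
 ultimately obtain z where z: "z : K" "z : Tq x r" by (auto simp: Tq_def)
 then show ?thesis using hq_surj[OF r0 z(2)] by blast
 qed
 then obtain t0 where t0: "?h t0 : K" by blast
 have yr: "ninf (y - x) < r" using csqr_ninf(1)[OF y(2)] dl r by simp
 have pr: "r < ninf (p - x)"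
 proof -
 have "R' <= dist x p" using p by auto
 then show ?thesis using csqr_ninf(3)[of x p] rf r r2 by linarith
 qed
 have pD: "p : D" using p D by auto
 obtain c d where cd: "c < d" "d <= t0 + 2 * pi" "t0 <= c" "?h c : K" "?h d : K" "!!t. t : {c<..<d} ==> ?h t ~: K"
 and sep: "~ connected_component (- (K Un ?h ` {c..d})) y p"
 using single_arc[OF K(1,2) D r0 y(1) yr pD pr t0] by blast
 define A where "A = ?h ` {c..d}"
 have cA: "compact A" unfolding A_def by (intro compact_continuous_image continuous_hq) auto
 have AT: "A <= Tq x r" using hq_Tq r0 by (auto simp: A_def)
 have AB: "A Int ball x r1 = {}" using AT csqr_ninf(1)[of _ x r1] r(1) by (force simp: Tq_def)
 have AC: "A <= cball x rf"
 proof
 fix z assume "z : A"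
 then have "ninf (z - x) = r" using AT by (auto simp: Tq_def)
 then show "z : cball x rf" using csqr_ninf(3)[of x z] r r2 by simp
 qed
 have AO: "A <= Om"
 proof -
 have "cball x rf <= cball x R0" using rf R' by (intro subset_cball) auto
 then show ?thesis using AC R0 by blast
 qed
 \<comment> \<open>An end point inside the open disk would have parameters of the open arc nearby
   that are also mapped into \<open>K\<close>.\<close>
 have ends: "?h t : fr i" if t: "t = c | t = d" for t
 proof (rule ccontr)
 assume "?h t ~: fr i"
 then have "?h t : Q i" using t cd JK by blast
 then have "t : ?h -` Q i" by simp
 moreover have "open (?h -` Q i)" using continuous_hq[of UNIV x r] open_Q by (rule open_vimage[rotated])
 ultimately obtain e where e: "e > 0" "ball t e <= ?h -` Q i" using open_contains_ball by blast
 define m where "m = min (e/2) ((d - c)/2)"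
 have m: "0 < m" "m < e" "m < d - c" using e(1) cd(1) by (auto simp: m_def min_def)
 define s where "s = (if t = c then c + m else d - m)"
 have s: "s : {c<..<d}" "s : ball t e" using m t by (auto simp: s_def dist_real_def)
 then show False using e cd(6)[of s] JK by blast
 qed
 have AQ: "A Int Q i = {}"
 proof -
 have "?h t ~: Q i" if "t : {c..d}" for t
 proof (cases "t = c | t = d")
 case True
 then show ?thesis using ends JK by blast
 next
 case False
 then have "t : {c<..<d}" using that by auto
 then show ?thesis using cd(6) JK by blast
 qed
 then show ?thesis by (auto simp: A_def)
 qed
 have op: "open (- (K Un A))" using K(1) cA by (intro open_Compl closed_Un compact_imp_closed)
 define V where "V = connected_component_set (- (K Un A)) y"
 have V: "open V" "connected V" "V <= - (K Un A)" "p ~: V"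
 proof -
 show "open V" unfolding V_def by (rule open_connected_component[OF op])
 show "connected V" unfolding V_def by simp
 show "V <= - (K Un A)" unfolding V_def by (rule connected_component_subset)
 show "p ~: V" unfolding V_def A_def mem_Collect_eq by (rule sep)
 qed
 have Vcc: "z : V" if "v : V" "connected_component (- (K Un A)) v z" for v z
 using that unfolding V_def by (metis connected_component_trans mem_Collect_eq)
 have DV: "D Int ball x dl <= V"
 proof
 fix z assume z: "z : D Int ball x dl"
 have "connected_component (- (K Un - ball x r1)) y z" using z y dl D by (intro dl0(2)) auto
 then have "connected_component (- (K Un A)) y z" by (rule connected_component_of_subset) (use AB in auto)
 then show "z : V" by (simp add: V_def)
 qed
 \<comment> \<open>Points outside this ball are joined to p by \<open>far\<close> without meeting
   the crosscut, whereas p is not in \<open>V\<close>.\<close>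
 have VR: "V <= ball x R'"
 proof
 fix z assume z: "z : V"
 show "z : ball x R'"
 proof (rule ccontr)
 assume "z ~: ball x R'"
 then have "z ~: ball x R' Un K" using z V(3) by auto
 then have "connected_component (- (K Un cball x rf)) z p" using p by (intro rf(3))
 then have "connected_component (- (K Un A)) z p" by (rule connected_component_of_subset) (use AC in auto)
 then show False using Vcc z V(4) by blast
 qed
 qed
 have clV: "closure V <= cball x R'" using VR by (intro closure_minimal) (auto simp: less_imp_le)
 have "cball x R' <= cball x R0" using R' by (intro subset_cball) auto
 then have clO: "closure V <= Om" using clV R0 by blast
 have fV: "frontier V <= K Un A"
 proof -
 have "frontier V <= frontier (- (K Un A))" unfolding V_def by (rule frontier_of_connected_component_subset)
 also have "... = frontier (K Un A)" by (rule frontier_complement)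
 also have "... <= K Un A" using K cA by (intro frontier_subset_closed closed_Un) (auto simp: compact_imp_closed)
 finally show ?thesis .
 qed
 \<comment> \<open>By \<open>ulc\<close> at z, all exterior points near z lie in the component
   \<open>V\<close>; hence a full neighbourhood lies in the disk and the closure of
   \<open>V\<close>.\<close>
 have leave: "z : fr i & (EX e>0. ball z e <= Q i Un closure V)" if z: "z : frontier V - A" for z
 proof -
 have zc: "z : closure V" using z by (auto simp: frontier_def)
 have "z ~: Q i"
 proof
 assume "z : Q i"
 then have "V Int Q i ~= {}" using zc open_Q[of i] by (metis IntI Int_commute empty_iff open_Int_closure_eq_empty)
 then show False using V(3) JK by blast
 qed
 then have zf: "z : fr i" using z fV JK by blast
 have "z : - A" "open (- A)" using z cA by (auto simp: compact_imp_closed)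
 then obtain rh where rh: "rh > 0" "ball z rh <= - A" using open_contains_ball by blast
 obtain \<epsilon> where \<epsilon>: "\<epsilon> > 0" "!!y w. y : ball z \<epsilon> - K ==> w : ball z \<epsilon> - K ==> connected_component (- (K Un - ball z rh)) y w"
 using ulc[OF zf rh(1)] unfolding K_def by blast
 obtain v where v: "v : V" "dist v z < \<epsilon>" using zc \<epsilon>(1) unfolding closure_approachable by blast
 have in_V: "w : V" if w: "w : ball z \<epsilon> - K" for w
 proof -
 have "v : ball z \<epsilon> - K" using v V(3) by (auto simp: dist_commute)
 then have "connected_component (- (K Un - ball z rh)) v w" using w by (rule \<epsilon>(2))
 then have "connected_component (- (K Un A)) v w" by (rule connected_component_of_subset) (use rh in auto)
 then show ?thesis using Vcc v(1) by blast
 qed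
 have "ball z \<epsilon> <= Q i Un closure V"
 proof
 fix w assume w: "w : ball z \<epsilon>"
 show "w : Q i Un closure V"
 proof (cases "w : fr i")
 case True
 then have "w : ball z \<epsilon> Int closure D" using w fr_outer unfolding D_def K_def by blast
 also have "... <= closure (ball z \<epsilon> Int D)" by (rule open_Int_closure_subset) simp
 also have "... <= closure V" using in_V D by (intro closure_mono) auto
 finally show ?thesis by simp
 next
 case False
 then show ?thesis using w in_V JK closure_subset[of V] by blast
 qed
 qed
 then show ?thesis using zf \<epsilon>(1) by blast
 qed
 \<comment> \<open>The connected exterior contains points of \<open>V\<close> and the point p
   outside it. A frontier point found there is on the crosscut and away from the closed disk, as the
   contact clause of \<open>trap\<close> requires.\<close>
 have "D Int frontier V ~= {}"
 proof (rule connected_Int_frontier[OF D(2)])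
 show "D Int V ~= {}" using DV y by blast
 show "D - V ~= {}" using pD V(4) by blast
 qed
 then obtain a where a: "a : frontier V" "a ~: K" using D by blast
 have aA: "a : A" using a fV by blast
 have t1: "trap {i} A V" unfolding trap_def
 proof (intro conjI)
 show "compact (closure V)" using clV by (meson bounded_cball bounded_subset closed_closure compact_eq_bounded_closed)
 show "V Int A = {}" using V(3) by blast
 show "ALL j:{i}. A Int Q j = {} & V Int Q j = {}" using AQ V(3) JK by blast
 show "ALL z:frontier V - A. EX j:{i}. z : fr j & (EX e>0. ball z e <= Q j Un closure V)" using leave by blast
 have "I (A Int ball a e) ~= {}" if "0 < e" for e
 unfolding A_def by (rule arc_contact[OF r0 r(3) cd(1) _ _ that]) (use AO aA in \<open>auto simp: A_def\<close>)
 then show "EX a:A Int frontier V. (ALL i:{i}. a ~: cQ i) & (ALL e>0. I (A Int ball a e) ~= {})" using a aA K_def by blast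
 qed (use V clO in auto)
 have t2: "V <= ball x R" using VR R' by (auto simp: subset_iff)
 have t3: "j : I V" if j: "j ~= i" "Q j Int ball x dl ~= {}" for j
 proof -
 obtain z where z: "z : Q j" "z : ball x dl" using j by blast
 then have "z : D" using Q_unique[of z j i] j by (auto simp: D_def K_def)
 then show ?thesis using DV z by (auto simp: meeting_def)
 qed
 have "?h c : fr i" by (rule ends) simp
 moreover have "?h c : A" using cd(1) by (auto simp: A_def)
 ultimately have t4: "A Int fr i ~= {}" by blast
 have t5: "d <= c + 2 * pi" using cd(2,3) by simp
 show ?thesis unfolding A_def[symmetric]
 by (rule exI[of _ c], rule exI[of _ d], rule exI[of _ V], fold A_def, intro conjI cd(1) t5 t1 t2 AO t4 allI impI t3)
 qed
 show "EX dl>0. ALL r. r1 <= r --> r <= r2 --> Hr x r -->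
 (EX c d V. c < d & d <= c + 2 * pi & trap {i} (hq x r ` {c..d}) V & V <= ball x R &
 (ALL j. j ~= i --> Q j Int ball x dl ~= {} --> j : I V) & hq x r ` {c..d} <= Om & hq x r ` {c..d} Int fr i ~= {})"
 by (rule exI[of _ dl], rule conjI[OF dl(1)], intro allI impI, rule main)
 qed
qed

text \<open>The order of quantifiers is essential: \<open>dl\<close> depends on the lower bound
  \<open>r1\<close> of the radii alone, since the radius itself will depend on the function.\<close>

lemma trap_exists:
 assumes x: "x : S" and R: "0 < R"
 defines "B == {i. x : cQ i}"
 shows "EX r2>0. ALL r1>0. EX dl>0. ALL r. r1 <= r --> r <= r2 --> Hr x r -->
 (EX c d V. c < d & d <= c + 2 * pi & trap B (hq x r ` {c..d}) V & V <= ball x R &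
 (ALL j. j ~: B --> Q j Int ball x dl ~= {} --> j : I V) & hq x r ` {c..d} <= Om & (ALL i:B. hq x r ` {c..d} Int fr i ~= {}))"
proof (cases "EX i. x : cQ i")
 case True
 then obtain i where i: "x : cQ i" by blast
 have xf: "x : fr i" using cQ_S[OF x i] .
 have "j = i" if "j : B" for j using fr_unique[OF xf, of j] that by (simp add: B_def)
 moreover have "i : B" using i by (simp add: B_def)
 ultimately have B: "B = {i}" by blast
 show ?thesis using trap_fr[OF xf R] unfolding B by (simp only: ball_simps singleton_iff simp_thms)
next
 case False
 then have B: "B = {}" by (auto simp: B_def)
 have "!!i. x ~: cQ i" using False by simp
 from trap_core[OF x this R] show ?thesis unfolding B by (simp only: ball_simps empty_iff simp_thms)
qed

end

section \<open>Equicontinuity on disks\<close>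

context rel_carpet begin

lemma vals_uminus: "vals (%x. - f x) e = uminus ` vals f e"
 unfolding vals_def by (auto simp: image_iff)

text \<open>All bounds asked by \<open>max_principle\<close> are read off from values along
  \<open>A\<close>; an exit disk is covered because its circle meets \<open>A\<close>, which bounds
  its infimum.\<close>

lemma trap_bound:
 assumes u: "harm u" and tr: "trap B A V" and AO: "A <= Om" and C: "!!x. x : S Int closure V ==> (abs(u x)) <= C"
 and v: "!!e a. e : A ==> a : vals u e ==> a <= M" and B: "!!i. i : B ==> A Int fr i ~= {}" and j: "j : I V"
 shows "Ms u j <= M"
proof (rule max_principle[OF u tr C _ _ _ j])
 have fb: "fb u" using u by (simp add: harm_def sob_def)
 show "ms u i <= M" if iB: "i : B" for i
 proof -
 obtain e where e: "e : A" "e : fr i" using B[OF iB] by blast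
 then have "e : S" using fr_S by blast
 then have "u e <= M" using v[OF e(1)] vals_S by simp
 then show ?thesis using ms_lower[OF fb e(2)] by linarith
 qed
 show "u x <= M" if "x : S Int A" for x using that v[of x "u x"] vals_S[of x u] by simp
 show "Ms u i <= M" if i: "i : I A" for i
 proof -
 obtain e where e: "e : A" "e : Q i" using i by (auto simp: meeting_def)
 show ?thesis using v[OF e(1)] vals_Q[OF e(2), of u] by (intro Ms_least) auto
 qed
qed

text \<open>Caccioppoli gives one energy bound for the family, hence one number \<open>N\<close> of
  scales that works for all its members. The good scale and radius vary with u, but a single
  \<open>dl\<close> serves them all.\<close>

lemma equi_osc:
 fixes U :: "(complex => real) set"
 assumes U: "!!u. u : U ==> harm u" and bd: "!!L. compact L ==> L <= Om ==> EX C. ALL u:U. ALL x:S Int L. (abs(u x)) <= C"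
 and x: "x : S" and e: "0 < e"
 defines "B == {i. x : cQ i}"
 shows "EX dl>0. ball x dl <= Om & (ALL u:U. EX m M. M - m <= e & (ALL j. j ~: B --> Q j Int ball x dl ~= {} --> (ALL z:fr j. m <= u z & u z <= M)))"
proof -
 have "x : Om" using x S_sub by blast
 then obtain R0 where R0: "R0 > 0" "cball x R0 <= Om" using open_Om open_contains_cball by blast
 let ?L = "cball x R0"
 obtain L' where L': "compact L'" "L' <= Om" "!!C. C >= 0 ==> EX E. ALL u. harm u --> (ALL x:S Int L'. (abs(u x)) <= C) -->
 ns (I ?L) (O2 u) <= ennreal E"
 using caccioppoli[OF compact_cball R0(2)] by (elim exE conjE) (rule that, blast+)
 have "compact (L' Un ?L)" "L' Un ?L <= Om" using L'(1,2) R0(2) by auto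
 then obtain C0 where C0: "ALL u:U. ALL x:S Int (L' Un ?L). (abs(u x)) <= C0" using bd by metis
 define C where "C = max C0 0"
 have C: "C >= 0" "!!u x. u : U ==> x : S Int (L' Un ?L) ==> (abs(u x)) <= C" using C0 by (auto simp: C_def le_max_iff_disj)
 obtain E0 where E0: "!!u. harm u ==> (ALL x:S Int L'. (abs(u x)) <= C) ==> ns (I ?L) (O2 u) <= ennreal E0"
 using L'(3)[OF C(1)] by blast
 define E where "E = max E0 1"
 have E1: "E >= 1" "E0 <= E" by (auto simp: E_def)
 have E: "ns (I ?L) (%i. eN ((Os u i)^2)) <= ennreal E" if "u : U" for u
 proof -
 have h: "harm u" using U that .
 have fb: "fb u" using h by (simp add: harm_def sob_def)
 have "ns (I ?L) (%i. eN ((Os u i)^2)) = ns (I ?L) (O2 u)"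
 using O_nonneg[OF fb] by (intro ns_cong) (auto simp: ennreal_power)
 also have "... <= ennreal E0" using C(2)[OF that] by (intro E0 h) auto
 also have "... <= ennreal E" using E1 by (intro ennreal_leI)
 finally show ?thesis .
 qed
 obtain r2 where r2: "r2 > 0" and trap: "!!r1. r1 > 0 ==> EX dl>0. ALL r. r1 <= r --> r <= r2 --> Hr x r -->
 (EX c d V. c < d & d <= c + 2 * pi & trap B (hq x r ` {c..d}) V & V <= ball x R0 &
 (ALL j. j ~: B --> Q j Int ball x dl ~= {} --> j : I V) & hq x r ` {c..d} <= Om & (ALL i:B. hq x r ` {c..d} Int fr i ~= {}))"
 using trap_exists[OF x R0(1), folded B_def] by (elim exE conjE) (rule that, assumption, simp)
 define R1 where "R1 = min R0 r2"
 have R1: "R1 > 0" "R1 <= R0" "R1 <= r2" using R0 r2 by (auto simp: R1_def)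
 obtain s where s0: "ALL k. 0 < s k & 4 * s k <= R1 & s (Suc k) <= s k"
 and sp0: "ALL i k l. i ~: B --> i : I (ann x (s k)) --> i : I (ann x (s l)) --> k = (l::nat)"
 using sparse_scales[OF R1(1), of x, folded B_def] by (elim exE conjE) (rule that)
 have s: "!!k. 0 < s k" "!!k. 4 * s k <= R1" "!!k. s (Suc k) <= s k" using s0 by auto
 have sp: "!!i k l. i ~: B ==> i : I (ann x (s k)) ==> i : I (ann x (s l)) ==> k = (l::nat)" using sp0 by blast
 obtain C1 where C1: "C1 > 0" and CL: "!!x s e B rh P. 0 < s ==> 0 < e ==> (AE r in lborel. P r) ==> (ALL i. 0 <= rh i) ==>
 ns (I (ann x s) - B) (%i. eN ((rh i)^2)) <= eN (e^2) ==>
 (EX r. s < r & r < 2 * s & P r & ns (I (Tq x r) - B) (%i. eN (rh i)) <= eN (C1 * e))"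
 using courant_leb by (elim exE conjE) (rule that, assumption, simp)
 \<comment> \<open>The bounds above and below \<open>a0\<close> are off by
   \<open>24 * (C1 * e')\<close> each, so 48 makes their distance \<open>e\<close>.\<close>
 define e' where "e' = e / (48 * C1)"
 have e': "e' > 0" using e C1 by (simp add: e'_def)
 obtain N :: nat where N: "E / e'^2 < real N" using reals_Archimedean2 by blast
 have "0 < E / e'^2" using E1 e' by simp
 then have N0: "0 < N" using N by (cases N) auto
 have EN: "E / real N <= e'^2" using N N0 e' by (simp add: field_simps)
 have dec: "s N <= s k" if "k <= N" for k using lift_Suc_antimono_le[of s, OF s(3) that] .
 \<comment> \<open>Taken for the smallest scale in use, so that it is valid for every radius that
   may be picked.\<close>
 obtain dl0 where dl0: "dl0 > 0" and tr: "!!r. s N <= r ==> r <= r2 ==> Hr x r ==>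
 (EX c d V. c < d & d <= c + 2 * pi & trap B (hq x r ` {c..d}) V & V <= ball x R0 &
 (ALL j. j ~: B --> Q j Int ball x dl0 ~= {} --> j : I V) & hq x r ` {c..d} <= Om & (ALL i:B. hq x r ` {c..d} Int fr i ~= {}))"
 using trap[OF s(1)[of N]] by (elim exE conjE) (rule that, assumption, simp)
 define dl where "dl = min dl0 R0"
 have dl: "dl > 0" "ball x dl <= ball x dl0" "ball x dl <= ?L" using dl0 R0 by (auto simp: dl_def)
 have "EX m M. M - m <= e & (ALL j. j ~: B --> Q j Int ball x dl ~= {} --> (ALL z:fr j. m <= u z & u z <= M))" if u: "u : U" for u
 proof -
 have h: "harm u" using U u .
 have sb: "sob u" and fb: "fb u" using h by (auto simp: harm_def sob_def)
 have annL: "ann x (s k) <= ?L" for k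
 proof
 fix z assume "z : ann x (s k)"
 then have "dist x z < 4 * s k" using csqr_ninf(3)[of x z] by (simp add: ann_def)
 then show "z : ?L" using s(2)[of k] R1 by simp
 qed
 have "0 <= E" using E1 by simp
 obtain k where k: "k < N" "ns (I (ann x (s k)) - B) (%i. eN ((Os u i)^2)) <= eN (E / real N)"
 proof -
 have "EX k<N. ns (I (ann x (s k)) - B) (%i. eN ((Os u i)^2)) <= eN (E / real N)"
 by (rule scale_pick[OF _ annL E[OF u] \<open>0 <= E\<close> N0]) (rule sp)
 then show ?thesis by (elim exE conjE) (rule that)
 qed
 have k2: "ns (I (ann x (s k)) - B) (%i. eN ((Os u i)^2)) <= eN (e'^2)"
 using k(2) EN by (meson ennreal_leI order_trans)
 have AE: "AE r in lborel. goodr u x r & Hr x r" using AE_goodr[OF sb, of x] AE_Hr[of x] by eventually_elim simp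
 have On: "ALL i. 0 <= Os u i" using O_nonneg[OF fb] by simp
 obtain r where r: "s k < r" "r < 2 * s k" "goodr u x r" "Hr x r" and
 W: "ns (I (Tq x r) - B) (Oe u) <= eN (C1 * e')"
 using CL[OF s(1) e' AE On k2] by blast
 have rr: "s N <= r" "r <= r2" "0 < r" using r dec[of k] k(1) s(1)[of k] s(2)[of k] R1 by auto
 obtain c d V where cd: "c < d" "d <= c + 2 * pi" and T: "trap B (hq x r ` {c..d}) V" and V: "V <= ball x R0"
 and jV: "!!j. j ~: B ==> Q j Int ball x dl0 ~= {} ==> j : I V" and AO: "hq x r ` {c..d} <= Om"
 and AB: "!!i. i : B ==> hq x r ` {c..d} Int fr i ~= {}"
 using tr[OF rr(1,2) r(4)] by (elim exE conjE) (rule that, auto)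
 define A where "A = hq x r ` {c..d}"
 \<comment> \<open>The crosscut avoids the disks touching x, so disregarding them in the energy
   loses nothing along it.\<close>
 have "ALL i:B. A Int Q i = {}" using T unfolding trap_def A_def by blast
 then have "B Int I A = {}" unfolding meeting_def by blast
 moreover have "A <= Tq x r" using hq_Tq rr(3) by (auto simp: A_def)
 then have "I A <= I (Tq x r)" by (rule I_mono)
 ultimately have "I A <= I (Tq x r) - B" by blast
 then have "nI A (Oe u) <= ns (I (Tq x r) - B) (Oe u)" by (intro ns_mono) auto
 also have "... <= eN (C1 * e')" by (rule W)
 finally have WA: "nI (hq x r ` {c..d}) (Oe u) <= eN (C1 * e')" by (simp add: A_def)
 have W0: "0 <= C1 * e'" using C1 e' by simp
 have osc: "(abs(a - a')) <= 24 * (C1 * e')" if "e1 : A" "e2 : A" "a : vals u e1" "a' : vals u e2" for e1 e2 a a'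
 by (rule arc_vals[OF fb r(3) rr(3) AO less_imp_le[OF cd(1)] cd(2) WA W0 that[unfolded A_def]])
 have e0: "hq x r c : A" using cd by (auto simp: A_def)
 then have "hq x r c : Om" using AO by (auto simp: A_def)
 then obtain a0 where a0: "a0 : vals u (hq x r c)" using vals_ne by blast
 have clV: "closure V <= ?L" using V by (intro closure_minimal) (auto simp: less_imp_le)
 have cV: "(abs(u y)) <= C" if "y : S Int closure V" for y using C(2)[OF u] that clV by blast
 have up: "Ms u j <= a0 + 24 * (C1 * e')" if "j : I V" for j
 proof (rule trap_bound[OF h T AO cV _ AB that])
 fix e1 a assume "e1 : hq x r ` {c..d}" "a : vals u e1"
 then show "a <= a0 + 24 * (C1 * e')" using osc[OF _ e0 _ a0, of e1 a] by (simp add: A_def abs_le_iff)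
 qed
 have lo: "Ms (%x. - u x) j <= - a0 + 24 * (C1 * e')" if "j : I V" for j
 proof (rule trap_bound[OF harm_uminus[OF h] T AO _ _ AB that])
 fix y assume "y : S Int closure V" then show "(abs(- u y)) <= C" using cV by simp
 next
 fix e1 a assume "e1 : hq x r ` {c..d}" "a : vals (%x. - u x) e1"
 then obtain a' where "e1 : A" "a' : vals u e1" "a = - a'" by (auto simp: vals_uminus A_def)
 then show "a <= - a0 + 24 * (C1 * e')" using osc[OF _ e0 _ a0, of e1 a'] by (simp add: abs_le_iff)
 qed
 show ?thesis
 proof (intro exI conjI allI impI ballI)
 show "(a0 + 24 * (C1 * e')) - (a0 - 24 * (C1 * e')) <= e" using C1 by (simp add: e'_def)
 fix j z assume j: "j ~: B" "Q j Int ball x dl ~= {}" and z: "z : fr j"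
 then have "j : I V" using dl by (intro jV) auto
 then show "u z <= a0 + 24 * (C1 * e')" "a0 - 24 * (C1 * e') <= u z"
 using up[of j] lo[of j] Ms_upper[OF fb z] Ms_upper[OF fb_uminus[OF fb] z] by linarith+
 qed
 qed
 then show ?thesis using dl R0 by (intro exI[of _ dl]) auto
qed

end

section \<open>Good paths and core points\<close>

context rel_carpet begin

lemma I_imageE: "i : I (h ` A) ==> EX sg:A. h sg : Q i"
 by (auto simp: meeting_def)

text \<open>If the ends of the path lie in no common closed disk, a subinterval with the same
  property avoids any given closed disk. Otherwise the path up to its first hit of disk n would stay
  in the closed disk of \<open>h p\<close>, which is disjoint from that of n.\<close>

lemma core_step_left:
 fixes h :: "real => complex"
 assumes h: "continuous_on {p..q} h" and pq: "p < q" and inv: "!!m. ~ (h p : cQ m & h q : cQ m)"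
 and n: "h p ~: cQ n"
 shows "EX q'. p < q' & q' <= q & (ALL m. ~ (h p : cQ m & h q' : cQ m)) & (ALL tu:{p..q'}. h tu ~: cQ n)"
proof (cases "EX tu:{p..q}. h tu : cQ n")
 case False
 then show ?thesis using pq inv by (intro exI[of _ q]) auto
next
 case True
 have cl: "closed {t : {a..b}. h t : cQ m}" if "p <= a" "b <= q" for a b m
 using continuous_closed_preimage[of "{a..b}" h "(cQ m)"] continuous_on_subset[OF h, of "{a..b}"] that
 by (auto simp: vimage_def Int_def conj_commute)
 define T where "T = {t : {p..q}. h t : cQ n}"
 have "compact T" unfolding T_def compact_eq_bounded_closed
 using cl[of p q n] by (auto intro: bounded_subset[OF bounded_closed_interval[of p q]])
 moreover have "T ~= {}" using True by (auto simp: T_def)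
 ultimately have "EX c:T. ALL t:T. c <= t" by (rule compact_attains_inf)
 then obtain c where c: "c : T" "!!t. t : T ==> c <= t" by blast
 have pc: "p < c" "c <= q" "h c : cQ n" using c(1) n by (auto simp: T_def order_le_less)
 have av: "h t ~: cQ n" if "t : {p..<c}" for t using c(2)[of t] that pc by (auto simp: T_def)
 show ?thesis
 proof (cases "EX q':{p<..<c}. ALL m. ~ (h p : cQ m & h q' : cQ m)")
 case True
 then obtain q' where q': "q' : {p<..<c}" "ALL m. ~ (h p : cQ m & h q' : cQ m)" by blast
 show ?thesis using q' pc av by (intro exI[of _ q']) auto
 next
 case False
 then have com: "EX m. h p : cQ m & h t : cQ m" if "t : {p<..<c}" for t using that by blast
 obtain m where m: "h p : cQ m" using com[of "(p + c)/2"] pc by auto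
 have "h t : cQ m" if t: "t : {p<..<c}" for t
 proof -
 obtain m' where m': "h p : cQ m'" "h t : cQ m'" using com[OF t] by blast
 then have "m' = m" using Q_disjoint[of m' m] m by blast
 then show ?thesis using m' by simp
 qed
 then have "{p<..<c} <= {t : {p..c}. h t : cQ m}" by auto
 then have "closure {p<..<c} <= {t : {p..c}. h t : cQ m}" using cl[of p c m] pc by (intro closure_minimal) auto
 moreover have "c : closure {p<..<c}" using pc by simp
 ultimately have "h c : cQ m" by blast
 then have "m = n" using Q_disjoint[of m n] pc by blast
 then show ?thesis using m n by blast
 qed
qed

lemma core_step:
 fixes h :: "real => complex"
 assumes h: "continuous_on {p..q} h" and pq: "p < q" and inv: "!!m. ~ (h p : cQ m & h q : cQ m)"
 shows "EX p' q'. p <= p' & p' < q' & q' <= q & (ALL m. ~ (h p' : cQ m & h q' : cQ m)) & (ALL tu:{p'..q'}. h tu ~: cQ n)"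
proof (cases "h p : cQ n")
 case False
 show ?thesis using core_step_left[OF h pq inv False] by (elim exE conjE) (intro exI conjI, auto)
next
 case True
 then have n: "h (- (- q)) ~: cQ n" using inv by simp
 have c: "continuous_on {-q..-p} (%t. h (- t))"
 by (intro continuous_on_compose2[OF h] continuous_intros) auto
 obtain q' where q': "- q < q'" "q' <= - p" "ALL m. ~ (h (- (- q)) : cQ m & h (- q') : cQ m)" "ALL tu:{-q..q'}. h (- tu) ~: cQ n"
 using core_step_left[OF c _ _ n] pq inv by auto
 have "h tu ~: cQ n" if "tu : {- q'..q}" for tu using q'(4)[rule_format, of "- tu"] that by auto
 then show ?thesis using q' by (intro exI[of _ "- q'"] exI[of _ q]) auto
qed

text \<open>Nested intervals as in Sierpinski's theorem on partitions of a continuum: step n avoids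
  the n-th closed disk, and the common point lies in none.\<close>

lemma core_between:
 fixes h :: "real => complex"
 assumes h: "continuous_on {s..t} h" and st: "s < t" and inv: "!!m. ~ (h s : cQ m & h t : cQ m)"
 shows "EX tu:{s..t}. ALL i. h tu ~: cQ i"
proof -
 define P where "P x \<longleftrightarrow> s <= fst x & fst x < snd x & snd x <= t & (ALL m. ~ (h (fst x) : cQ m & h (snd x) : cQ m))" for x
 define R where "R n x y \<longleftrightarrow> fst x <= fst y & snd y <= snd x & (ALL tu:{fst y..snd y}. h tu ~: cQ n)" for n x y
 have "EX f. ALL n. P (f n) & R n (f n) (f (Suc n))"
 proof (rule dependent_nat_choice)
 show "EX x. P x" by (rule exI[of _ "(s, t)"]) (use st inv in \<open>auto simp: P_def\<close>)
 fix x n assume "P x"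
 then have x: "s <= fst x" "fst x < snd x" "snd x <= t" "!!m. ~ (h (fst x) : cQ m & h (snd x) : cQ m)"
 unfolding P_def by blast+
 have "continuous_on {fst x..snd x} h" using x by (intro continuous_on_subset[OF h]) auto
 from core_step[OF this x(2,4), of n] obtain p q where
 "fst x <= p" "p < q" "q <= snd x" "ALL m. ~ (h p : cQ m & h q : cQ m)" "ALL tu:{p..q}. h tu ~: cQ n"
 by (elim exE conjE) (rule that)
 then show "EX y. P y & R n x y" using x by (intro exI[of _ "(p, q)"]) (simp add: P_def R_def)
 qed
 then obtain f where f: "!!n. P (f n)" "!!n. R n (f n) (f (Suc n))" by blast
 define F where "F n = {fst (f n)..snd (f n)}" for n
 have ne: "F n ~= {}" for n using f(1)[of n] by (simp add: F_def P_def)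
 have "F (Suc n) <= F n" for n using f(2)[of n] by (auto simp: F_def R_def)
 then have dec: "m <= n ==> F n <= F m" for m n using lift_Suc_antimono_le[of F] by blast
 have "\<Inter>(range F) ~= {}" using ne dec by (intro compact_nest) (auto simp: F_def)
 then obtain tu where tu: "!!n. tu : F n" by blast
 have "tu : {s..t}" using tu[of 0] f(1)[of 0] by (auto simp: F_def P_def)
 moreover have "h tu ~: cQ n" for n using tu[of "Suc n"] f(2)[of n] by (auto simp: F_def R_def)
 ultimately show ?thesis by blast
qed

section \<open>Generic segments as good paths\<close>

definition gl :: "(complex => real) => bool => real => bool" where
 "gl f b y \<longleftrightarrow> gline f b y & hausdorff 1 (range (lin b y) Int S) = 0 &
 (ALL s t. s <= t --> lin b y ` {s..t} <= Om --> nI (lin b y ` {s..t}) (Oe f) < iN)"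

lemma AE_gl: assumes "sob f" shows "AE y in lborel. gl f b y"
proof -
 have l: "l2loc (Oe f)" using assms by (simp add: sob_def)
 show ?thesis using AE_gline[OF assms, of b] hausdorff1_lines[of b] aep_lines[OF aep_l2loc[OF l], of b]
 proof eventually_elim
 case (elim y)
 have "nI (lin b y ` {s..t}) (Oe f) < iN" if st: "s <= t" "lin b y ` {s..t} <= Om" for s t
 proof -
 have c: "compact (lin b y ` {s..t})" by (intro compact_continuous_image cont_lin) auto
 have "ALL X L. X <= img ({s..t}, lin b y) --> compact L --> L <= Om --> X <= L --> nI X (Oe f) < iN"
 using elim(3)[THEN spec[of _ "{s..t}"]] st by (simp add: is_interval_cc)
 then show ?thesis using c st by (simp add: img_def)
 qed
 then show ?case using elim unfolding gl_def by blast
 qed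
qed

text \<open>All but finitely many disks carry less than \<open>e\<close>. Of the finitely many,
  those not touching the starting point are out of reach close to it, and those touching it are
  excluded by \<open>av\<close>.\<close>

lemma seg_small:
 assumes g: "gl f b y" and f: "fb f" and t: "tu < t" and sub: "lin b y ` {tu..t} <= Om" and z: "lin b y tu : S"
 and av: "!!i. lin b y tu : cQ i ==> lin b y ` {tu..t} Int Q i = {}" and e: "0 < e"
 shows "EX t'. tu < t' & t' <= t & nI (lin b y ` {tu..t'}) (Oe f) <= eN e &
 (ALL sg:{tu..t'}. lin b y sg : S --> (abs(f (lin b y tu) - f (lin b y sg))) <= e)"
proof -
 have "nI (lin b y ` {tu..t}) (Oe f) < iN" using g t sub by (simp add: gl_def)
 then obtain F where F: "finite F" "ns (I (lin b y ` {tu..t}) - F) (Oe f) < eN e"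
 using ns_tail e by (metis ennreal_less_zero_iff)
 define U where "U = - (\<Union>i\<in>{i : F. lin b y tu ~: cQ i}. (cQ i))"
 have "open U" "lin b y tu : U" using F by (auto simp: U_def intro!: open_Compl closed_UN)
 then obtain d where d: "d > 0" "ball (lin b y tu) d <= U" using open_contains_ball by blast
 define t' where "t' = min t (tu + d/2)"
 have t': "tu < t'" "t' <= t" "t' - tu < d" using t d by (auto simp: t'_def)
 have sb: "lin b y ` {tu..t'} <= lin b y ` {tu..t}" using t' by auto
 have "i ~: F" if i: "i : I (lin b y ` {tu..t'})" for i
 proof
 assume iF: "i : F"
 obtain sg where sg: "sg : {tu..t'}" "lin b y sg : Q i" using I_imageE[OF i] by blast
 then have "lin b y ` {tu..t} Int Q i ~= {}" using t' by force
 then have "lin b y tu ~: cQ i" using av by blast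
 then have "cQ i Int U = {}" using iF by (auto simp: U_def)
 moreover have "lin b y sg : U" using d(2) sg t' by (auto simp: subset_iff)
 ultimately show False using sg closure_subset by blast
 qed
 then have "I (lin b y ` {tu..t'}) <= I (lin b y ` {tu..t}) - F" using I_mono[OF sb] by blast
 then have "nI (lin b y ` {tu..t'}) (Oe f) <= ns (I (lin b y ` {tu..t}) - F) (Oe f)"
 by (intro ns_mono) auto
 then have W: "nI (lin b y ` {tu..t'}) (Oe f) <= eN e" using F(2) by (meson less_imp_le order_trans)
 have ok: "okset f (lin b y ` {tu..t'}) e"
 using g t' sb sub W e by (intro gline_okset[OF _ f]) (auto simp: gl_def)
 have "(abs(f (lin b y tu) - f (lin b y sg))) <= e" if "sg : {tu..t'}" "lin b y sg : S" for sg
 using ok z that t' unfolding okset_def by auto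
 then show ?thesis using t' W by blast
qed

lemma seg_contact:
 assumes g: "gl f b y" and t: "tu < t" and sub: "lin b y ` {tu..t} <= Om" and z: "lin b y tu : S"
 shows "EX i. EX sg:{tu..t}. i : I (lin b y ` {tu..t}) & lin b y sg : fr i"
proof -
 have "I (lin b y ` {tu..t}) ~= {}"
 proof (rule contact[OF _ sub])
 show "connected (lin b y ` {tu..t})" by (intro connected_continuous_image cont_lin) auto
 have "hausdorff 1 (lin b y ` {tu..t} Int S) <= hausdorff 1 (range (lin b y) Int S)" by (intro hausdorff_mono) auto
 then show "hausdorff 1 (lin b y ` {tu..t} Int S) = 0" using g by (simp add: gl_def)
 show "lin b y tu ~= lin b y t" using t dist_lin[of b y tu t] by (auto simp del: dist_lin)
 qed (use t in auto)
 then obtain i where i1: "i : I (lin b y ` {tu..t})" by blast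
 obtain sg where i: "i : I (lin b y ` {tu..t})" "sg : {tu..t}" "lin b y sg : Q i" using I_imageE[OF i1] i1 by blast
 then have "lin b y sg : cQ i" using closure_subset by blast
 then obtain a1 where "a1 : {tu..t}" "lin b y a1 : fr i"
 using first_hit[OF cont_lin z i(2)] by blast
 then show ?thesis using i by blast
qed

text \<open>Close to its start a generic segment meets disks outside \<open>B\<close>, and its
  values on their circles differ little from the value at the core point.\<close>

lemma core_in:
 assumes g: "gl f b y" and f: "fb f" and t: "tu < t" and sub: "lin b y ` {tu..t} <= Om"
 and z: "lin b y tu : S" "!!i. lin b y tu ~: cQ i"
 and U: "open U" "lin b y tu : U" "finite B" "!!k w. k ~: B ==> Q k Int U ~= {} ==> w : fr k ==> m <= f w & f w <= M"
 shows "m <= f (lin b y tu) & f (lin b y tu) <= M"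
proof -
 have "m - e <= f (lin b y tu)" "f (lin b y tu) <= M + e" if e: "0 < e" for e
 proof -
 obtain t' where t': "tu < t'" "t' <= t" "ALL sg:{tu..t'}. lin b y sg : S --> (abs(f (lin b y tu) - f (lin b y sg))) <= e"
 using seg_small[OF g f t sub z(1) _ e] z(2) by blast
 define U' where "U' = U - (\<Union>i\<in>B. (cQ i))"
 have "open U'" "lin b y tu : U'" using U z by (auto simp: U'_def intro!: open_Diff closed_UN)
 then obtain d where d: "d > 0" "ball (lin b y tu) d <= U'" using open_contains_ball by blast
 define t2 where "t2 = min t' (tu + d/2)"
 have t2: "tu < t2" "t2 <= t'" "t2 - tu < d" using t' d by (auto simp: t2_def)
 have s2: "lin b y ` {tu..t2} <= Om" using sub t2 t' by (force simp: image_subset_iff)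
 obtain i sg where i: "sg : {tu..t2}" "i : I (lin b y ` {tu..t2})" "lin b y sg : fr i"
 using seg_contact[OF g t2(1) s2 z(1)] by blast
 have "lin b y ` {tu..t2} <= U'" using d(2) t2 by (auto simp: subset_iff)
 then have "Q i Int U' ~= {}" using i(2) by (auto simp: meeting_def)
 then have "i ~: B" "Q i Int U ~= {}" using closure_subset[of "Q i"] by (auto simp: U'_def)
 then have "m <= f (lin b y sg) & f (lin b y sg) <= M" using U(4) i(3) by blast
 moreover have "lin b y sg : S" "sg : {tu..t'}" using i(1,3) t2 fr_S[of i] by auto
 then have "(abs(f (lin b y tu) - f (lin b y sg))) <= e" using t'(3) by blast
 ultimately show "m - e <= f (lin b y tu)" "f (lin b y tu) <= M + e" by (auto simp: abs_le_iff)
 qed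
 note eps = this
 have "m <= f (lin b y tu) + e" if "0 < e" for e using eps(1)[OF that] by linarith
 then have "m <= f (lin b y tu)" by (rule field_le_epsilon)
 moreover have "f (lin b y tu) <= M" using eps(2) by (rule field_le_epsilon)
 ultimately show ?thesis by blast
qed

text \<open>The conditions on good paths that every subpath inherits; \<open>good_gpath\<close>
  lists the remaining two.\<close>

definition gpath :: "(complex => real) => plane_path => bool" where
 "gpath f gm \<longleftrightarrow> gm : paths_in Om & hausdorff 1 (img gm Int S) = 0 &
 (ALL gm'. subpath_of gm' gm --> (ALL i:I (img gm'). ALL j:I (img gm'). eN (abs(Ms f i - Ms f j)) <= nI (img gm') (Oe f))) &
 (ALL gm'. subpath_of gm' gm --> img gm' \<subset>\<subset> Om --> nI (img gm') (Oe f) < iN)"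

lemma gpathD:
 assumes "gpath f gm"
 shows "gm : paths_in Om" "hausdorff 1 (img gm Int S) = 0"
 "!!gm' i j. subpath_of gm' gm ==> i : I (img gm') ==> j : I (img gm') ==> eN (abs(Ms f i - Ms f j)) <= nI (img gm') (Oe f)"
 "!!gm'. subpath_of gm' gm ==> img gm' \<subset>\<subset> Om ==> nI (img gm') (Oe f) < iN"
proof -
 show "gm : paths_in Om" using assms unfolding gpath_def by (elim conjE)
 show "hausdorff 1 (img gm Int S) = 0" using assms unfolding gpath_def by (elim conjE)
 fix gm' assume g: "subpath_of gm' gm"
 have a: "ALL gm'. subpath_of gm' gm --> (ALL i:I (img gm'). ALL j:I (img gm'). eN (abs(Ms f i - Ms f j)) <= nI (img gm') (Oe f))"
 using assms unfolding gpath_def by (elim conjE)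
 have b: "ALL gm'. subpath_of gm' gm --> img gm' \<subset>\<subset> Om --> nI (img gm') (Oe f) < iN"
 using assms unfolding gpath_def by (elim conjE)
 show "eN (abs(Ms f i - Ms f j)) <= nI (img gm') (Oe f)" if "i : I (img gm')" "j : I (img gm')" for i j
 using a[THEN spec, THEN mp, OF g] that by simp
 show "nI (img gm') (Oe f) < iN" if "img gm' \<subset>\<subset> Om"
 using b[THEN spec, THEN mp, OF g, THEN mp, OF that] .
qed

lemma subpath_trans: "subpath_of a b ==> subpath_of b c ==> subpath_of a c"
 by (auto simp: subpath_of_def)

lemma gpath_sub: assumes "gpath f gm" "subpath_of gm' gm" shows "gpath f gm'"
proof -
 have "hausdorff 1 (img gm Int S) = 0" using gpathD[OF assms(1)] by simp
 have "gm : paths_in Om" using gpathD[OF assms(1)] by simp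
 then have "gm' : paths_in Om" using subpath_in assms(2) by blast
 moreover have "hausdorff 1 (img gm' Int S) <= hausdorff 1 (img gm Int S)" using subpath_img[OF assms(2)] by (intro hausdorff_mono) auto
 then have "hausdorff 1 (img gm' Int S) = 0" using \<open>hausdorff 1 (img gm Int S) = 0\<close> by simp
 moreover have tr: "subpath_of gm'' gm' ==> subpath_of gm'' gm" for gm'' by (rule subpath_trans[OF _ assms(2)])
 ultimately show ?thesis unfolding gpath_def using gpathD(3,4)[OF assms(1) tr] by simp
qed

text \<open>The normalized version depends on \<open>G\<close> only through these disk data, so a
  real function with the same data can stand for it.\<close>

definition rep :: "(complex => ereal) => (complex => real) => bool" where
 "rep G f \<longleftrightarrow> fb f & (ALL i. peri_sup Q G i = ereal (Ms f i)) & (ALL i. osc Q G i = Oe f i)"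

lemma ereal_le_iff_ennreal: "(abs(ereal a - ereal b)) <= enn2ereal X \<longleftrightarrow> eN (abs(a - b)) <= X"
 by (simp add: less_eq_ennreal.rep_eq)

lemma good_gpath:
 assumes "rep G f"
 shows "gm : good_paths Om Q G \<longleftrightarrow> gpath f gm & (EX s:fst gm. EX t:fst gm. snd gm s ~= snd gm t) &
 (ns UNIV (O2 f) < iN --> nI (img gm) (Oe f) < iN)"
proof -
 have o: "osc Q G = (Oe f)" and p: "!!i. peri_sup Q G i = ereal (Ms f i)" using assms by (auto simp: rep_def)
 show ?thesis
 unfolding good_paths_def gpath_def sum_along_def ns_infsum o p ereal_le_iff_ennreal mem_Collect_eq
 by (simp only: simp_thms conj_ac imp_conjL)
qed

lemma access_path:
 assumes r: "rep G f" and x: "x : S" and g0: "gm0 : good_paths Om Q G" and a: "accesses Om Q x gm0 gm"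
 shows "gpath f gm" "EX p:img gm. p ~= x" "!!i. x : fr i ==> img gm Int Q i = {}"
proof -
 have g: "gpath f gm0" using g0 unfolding good_gpath[OF r] by (elim conjE)
 have nc: "EX s:fst gm0. EX t:fst gm0. snd gm0 s ~= snd gm0 t" using g0 unfolding good_gpath[OF r] by (elim conjE)
 have "gpath f gm & (EX p:img gm. p ~= x) & (ALL i. x : fr i --> img gm Int Q i = {})"
 proof (cases "x : img gm0 Int carpet_core Om Q")
 case True
 then have e: "gm = gm0" using a by (simp add: accesses_def)
 obtain s t where st: "s : fst gm0" "t : fst gm0" "snd gm0 s ~= snd gm0 t" using nc by blast
 then have "EX p:img gm0. p ~= x" unfolding img_def by (metis image_eqI)
 then show ?thesis using e g True by (simp add: carpet_core_def)
 next
 case False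
 then have b: "subpath_of gm gm0" "x ~: img gm" "ALL i. x : fr i --> img gm Int Q i = {}"
 using a unfolding accesses_def by (simp_all split: if_splits)
 have "img gm ~= {}" using b(1) by (simp add: img_def subpath_of_def)
 then have "EX p:img gm. p ~= x" using b(2) by (metis ex_in_conv)
 then show ?thesis using gpath_sub[OF g b(1)] b(3) by blast
 qed
 then show "gpath f gm" "EX p:img gm. p ~= x" "!!i. x : fr i ==> img gm Int Q i = {}" by blast+
qed

lemma ev_disks_to:
 "eventually P (disks_to Q gm x) \<longleftrightarrow> (EX r>0. ALL i:I (img gm). Q i <= ball x r --> P i)"
 unfolding disks_to_def
proof (subst eventually_INF_base)
 fix a c :: real assume "a : {0<..}" "c : {0<..}"
 then have m: "min a c : {0<..}" by auto
 have "ball x (min a c) <= ball x a" "ball x (min a c) <= ball x c" by auto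
 then have "{i : I (img gm). Q i <= ball x (min a c)} <= {i : I (img gm). Q i <= ball x a}"
 "{i : I (img gm). Q i <= ball x (min a c)} <= {i : I (img gm). Q i <= ball x c}" by blast+
 then show "EX r:{0<..}. principal {i : I (img gm). Q i <= ball x r} <= inf (principal {i : I (img gm). Q i <= ball x a}) (principal {i : I (img gm). Q i <= ball x c})"
 using m by (intro bexI[OF _ m]) auto
qed (auto simp: eventually_principal)

lemma Ms_fr: "fb f ==> x : fr i ==> (abs(Ms f i - f x)) <= Os f i"
proof -
 assume f: "fb f" and x: "x : fr i"
 have "Ms f i <= f x + Os f i" using O_ge[OF f _ x] by (intro Ms_least) (auto simp: abs_le_iff algebra_simps)
 then show ?thesis using Ms_upper[OF f x] by (simp add: abs_le_iff)
qed

text \<open>Between the last exit from disk i and the next hit of disk j the segment meets neither.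
  Their oscillations are therefore still unspent in the sum and pay for passing from circle values
  to suprema.\<close>

lemma gl_Ms:
 assumes g: "gl f b y" and f: "fb f" and J: "is_interval J" "bounded J" "lin b y ` J <= Om"
 and ij: "i ~= j" "p : J" "lin b y p : Q i" "q : J" "lin b y q : Q j" "p <= q"
 shows "eN (abs(Ms f i - Ms f j)) <= nI (lin b y ` J) (Oe f)"
proof -
 let ?h = "lin b y" and ?w = "%i. Oe f i"
 have con: "connected (?h ` {p..q})" by (intro connected_continuous_image cont_lin) auto
 have "lin b y p ~: Q j" using Q_unique[OF ij(3), of j] ij(1) closure_subset[of "Q j"] by blast
 then have "?h ` {p..q} Int fr j ~= {}"
 using ij by (intro connected_Int_frontier[OF con]) force+
 then obtain sg where sg: "sg : {p..q}" "?h sg : fr j" by blast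
 have S: "?h sg : S" using sg fr_S by blast
 have p: "p : {p..sg}" "?h p : cQ i" using sg ij closure_subset by auto
 obtain b1 where b1: "b1 : {p..sg}" "?h b1 : fr i" "ALL tu:{b1..sg}. ?h tu ~: Q i"
 using last_hit[OF cont_lin S p] by blast
 have S1: "?h b1 : S" using b1 fr_S by blast
 have q: "sg : {b1..sg}" "?h sg : cQ j" using b1 sg by (auto simp: frontier_def)
 obtain a1 where a1: "a1 : {b1..sg}" "?h a1 : fr j" "ALL tu:{b1..a1}. ?h tu ~: Q j"
 using first_hit[OF cont_lin S1 q] by blast
 have sub: "{b1..a1} <= {p..q}" "{p..q} <= J" using a1 b1 sg interval_sub[OF J(1) ij(2,4)] by auto
 let ?X = "I (?h ` {b1..a1})"
 have X: "?X <= I (?h ` J)" using sub by (intro I_mono image_mono) auto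
 have ni: "i ~: ?X" "j ~: ?X" using b1(3) a1 by (auto dest!: I_imageE)
 have iJ: "i : I (?h ` J)" "j : I (?h ` J)" using ij by (auto simp: meeting_def)
 have ug: "ug f ?w (J, ?h)" using g J ij(2) unfolding gl_def gline_def by blast
 have S2: "?h a1 : S" using a1(2) fr_S by blast
 have "b1 : {b1..a1}" "a1 : {b1..a1}" using a1 by auto
 then have "b1 : J" "a1 : J" "b1 <= a1" using sub by auto
 then have "eN (abs(f (?h b1) - f (?h a1))) <= ns ?X ?w"
 using ug S1 S2 unfolding ug_def fst_conv snd_conv by blast
 then have "eN (Os f i + Os f j) + eN (abs(f (?h b1) - f (?h a1))) <= ns {i, j} ?w + ns ?X ?w"
 using ij(1) O_nonneg[OF f] by (intro add_mono) (auto simp: ns_finite ennreal_plus)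
 also have "... = ns ({i, j} Un ?X) ?w" using ni by (intro ns_Un_disj[symmetric]) auto
 also have "... <= nI (?h ` J) ?w" using X iJ by (intro ns_mono) auto
 finally have le: "eN (Os f i + Os f j) + eN (abs(f (?h b1) - f (?h a1))) <= nI (?h ` J) ?w" .
 have "(abs(Ms f i - Ms f j)) <= (Os f i + Os f j) + (abs(f (?h b1) - f (?h a1)))"
 using Ms_fr[OF f b1(2)] Ms_fr[OF f a1(2)] by linarith
 then have "eN (abs(Ms f i - Ms f j)) <= eN ((Os f i + Os f j) + (abs(f (?h b1) - f (?h a1))))" by (rule ennreal_leI)
 also have "... = eN (Os f i + Os f j) + eN (abs(f (?h b1) - f (?h a1)))" using O_nonneg[OF f] by (intro ennreal_plus) auto
 finally show ?thesis using le by (rule order_trans)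
qed

lemma gl_gpath:
 assumes g: "gl f b y" and f: "fb f" and st: "s <= t" and sub: "lin b y ` {s..t} <= Om"
 shows "gpath f ({s..t}, lin b y)"
 unfolding gpath_def
proof (intro conjI allI impI ballI)
 show "({s..t}, lin b y) : paths_in Om" using st sub by (auto simp: paths_in_def is_plane_path_def img_def is_interval_cc cont_lin)
 have "hausdorff 1 (img ({s..t}, lin b y) Int S) <= hausdorff 1 (range (lin b y) Int S)" by (intro hausdorff_mono) (auto simp: img_def)
 then show "hausdorff 1 (img ({s..t}, lin b y) Int S) = 0" using g by (simp add: gl_def)
 fix gm' assume "subpath_of gm' ({s..t}, lin b y)"
 then have gm': "img gm' = lin b y ` fst gm'" "fst gm' <= {s..t}" "is_interval (fst gm')" by (auto simp: subpath_of_def img_def)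
 have bd: "bounded (fst gm')" using gm'(2) bounded_closed_interval bounded_subset by blast
 have sO: "lin b y ` fst gm' <= Om" using gm'(2) sub by blast
 show "eN (abs(Ms f i - Ms f j)) <= nI (img gm') (Oe f)" if i: "i : I (img gm')" and j: "j : I (img gm')" for i j
 proof (cases "i = j")
 case False
 obtain p where p: "p : fst gm'" "lin b y p : Q i" using I_imageE i gm'(1) by metis
 obtain q where q: "q : fst gm'" "lin b y q : Q j" using I_imageE j gm'(1) by metis
 show ?thesis
 using gl_Ms[OF g f gm'(3) bd sO False p q] gl_Ms[OF g f gm'(3) bd sO False[symmetric] q p] gm'(1)
 by (cases "p <= q") (auto simp: abs_minus_commute)
 qed simp
 have "nI (img gm') (Oe f) <= nI (lin b y ` {s..t}) (Oe f)"
 using gm' by (intro ns_mono I_mono) auto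
 also have "... < iN" using g st sub by (simp add: gl_def)
 finally show "nI (img gm') (Oe f) < iN" .
qed

lemma gl_good:
 assumes g: "gl f b y" and r: "rep G f" and st: "s < t" and sub: "lin b y ` {s..t} <= Om"
 shows "({s..t}, lin b y) : good_paths Om Q G"
 unfolding good_gpath[OF r]
proof (intro conjI impI)
 show "gpath f ({s..t}, lin b y)" using r st by (intro gl_gpath[OF g _ _ sub]) (auto simp: rep_def)
 have "lin b y s ~= lin b y t" using st dist_lin[of b y s t] by (auto simp del: dist_lin)
 then show "EX p:fst ({s..t}, lin b y). EX q:fst ({s..t}, lin b y). snd ({s..t}, lin b y) p ~= snd ({s..t}, lin b y) q"
 using st by (intro bexI[of _ s] bexI[of _ t]) auto
 show "nI (img ({s..t}, lin b y)) (Oe f) < iN" using g st sub by (simp add: gl_def img_def)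
qed

lemma ivt_first:
 fixes \<phi> :: "real => real"
 assumes c: "continuous_on {a..b} \<phi>" and ab: "a <= b" and r: "\<phi> a <= r" "r <= \<phi> b"
 shows "EX c:{a..b}. \<phi> c = r & (ALL sg:{a..c}. \<phi> sg <= r)"
proof -
 define T where "T = {sg : {a..b}. r <= \<phi> sg}"
 have "closed ({a..b} Int \<phi> -` {r..})" using c by (intro continuous_closed_preimage) auto
 then have "compact T" unfolding compact_eq_bounded_closed T_def
 by (auto simp: vimage_def Int_def intro: bounded_subset[OF bounded_closed_interval[of a b]])
 moreover have "b : T" using ab r by (simp add: T_def)
 then have "T ~= {}" by blast
 ultimately have "EX c:T. ALL t:T. c <= t" by (rule compact_attains_inf)
 then obtain d where d: "d : T" "!!t. t : T ==> d <= t" by blast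
 have dab: "a <= d" "d <= b" "r <= \<phi> d" using d(1) by (auto simp: T_def)
 have "continuous_on {a..d} \<phi>" using c dab by (intro continuous_on_subset[OF c]) auto
 then obtain e where e: "a <= e" "e <= d" "\<phi> e = r" using IVT'[of \<phi> a r d] r dab by blast
 then have "e : T" using dab by (simp add: T_def)
 then have "e = d" using d(2) e by force
 moreover have "\<phi> sg <= r" if "sg : {a..d}" for sg
 proof (cases "sg = d")
 case True then show ?thesis using e \<open>e = d\<close> by simp
 next
 case False
 then have "sg ~: T" using d(2)[of sg] that by auto
 then show ?thesis using that dab by (simp add: T_def)
 qed
 ultimately show ?thesis using e dab by auto
qed

lemma cross_first:
 fixes \<phi> :: "real => real"
 assumes c: "continuous_on J \<phi>" and J: "is_interval J" "a : J" "b : J" and r: "\<phi> a <= r" "r <= \<phi> b"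
 shows "EX c:J. \<phi> c = r & (ALL sg:{min a c..max a c}. sg : J & \<phi> sg <= r)"
proof (cases "a <= b")
 case True
 have sub: "{a..b} <= J" using interval_sub[OF J] .
 obtain d where d: "d : {a..b}" "\<phi> d = r" "ALL sg:{a..d}. \<phi> sg <= r"
 using ivt_first[OF continuous_on_subset[OF c sub] True r] by blast
 show ?thesis using d sub by (intro bexI[of _ d]) auto
next
 case False
 have sub: "{b..a} <= J" using interval_sub[OF J(1,3,2)] .
 have "continuous_on {-a..-b} (%t. \<phi> (- t))"
 by (intro continuous_on_compose2[OF continuous_on_subset[OF c sub]] continuous_intros) auto
 then obtain d where d: "d : {-a..-b}" "\<phi> (- d) = r" "ALL sg:{-a..d}. \<phi> (- sg) <= r"
 using ivt_first[of "- a" "- b" "%t. \<phi> (- t)" r] False r by auto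
 have "\<phi> sg <= r" if "sg : {- d..a}" for sg using d(3)[rule_format, of "- sg"] that by auto
 then show ?thesis using d(1,2) sub by (intro bexI[of _ "- d"]) auto
qed

lemma AE_not_negligible: "negligible (N :: real set) ==> AE r in lborel. r ~: N"
proof -
 assume "negligible N"
 then have "N : null_sets lebesgue" by (simp add: negligible_iff_null_sets)
 then have "AE r in lebesgue. r ~: N" by (rule AE_not_in)
 then show ?thesis by (simp add: AE_completion_iff)
qed

text \<open>A good path may tend to the boundary of \<open>Om\<close> at its ends. Between the first
  and last parameters in the ball, taken in the closed interval, every parameter belongs to the
  path, so this stretch has compact image in \<open>Om\<close>.\<close>

lemma gpath_local_finite:
 assumes gp: "gpath f gm" and R: "cball z R <= Om"
 shows "nI (snd gm ` {sg : fst gm. snd gm sg : cball z R}) (Oe f) < iN"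
proof (cases "{sg : fst gm. snd gm sg : cball z R} = {}")
 case True
 show ?thesis unfolding True by (simp add: meeting_def)
next
 case ne: False
 let ?J = "fst gm" and ?h = "snd gm"
 have J: "is_interval ?J" "bounded ?J" "continuous_on (closure ?J) ?h" and JO: "?h ` ?J <= Om"
 using gpathD(1)[OF gp] by (auto simp: paths_in_def is_plane_path_def img_def)
 define X where "X = {sg : closure ?J. ?h sg : cball z R}"
 have "closed (closure ?J Int ?h -` cball z R)" using J(3) by (intro continuous_closed_preimage) auto
 moreover have "closure ?J Int ?h -` cball z R = X" by (auto simp: X_def)
 ultimately have "closed X" by simp
 moreover have "bounded X" using bounded_closure[OF J(2)] by (rule bounded_subset) (auto simp: X_def)
 ultimately have cX: "compact X" by (simp add: compact_eq_bounded_closed)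
 have YX: "{sg : ?J. ?h sg : cball z R} <= X" using closure_subset by (auto simp: X_def)
 then have neX: "X ~= {}" using ne by blast
 have "EX c:X. ALL t:X. c <= t" by (rule compact_attains_inf[OF cX neX])
 then obtain al where al: "al : X" "!!t. t : X ==> al <= t" by blast
 have "EX c:X. ALL t:X. t <= c" by (rule compact_attains_sup[OF cX neX])
 then obtain be where be: "be : X" "!!t. t : X ==> t <= be" by blast
 have inJ: "sg : ?J" if sg: "sg : {al<..<be}" for sg
 proof -
 have "al : closure ?J" "be : closure ?J" using al be by (auto simp: X_def)
 then obtain a b where "a : ?J" "dist a al < sg - al" "b : ?J" "dist b be < be - sg"
 using sg unfolding closure_approachable by (metis diff_gt_0_iff_gt greaterThanLessThan_iff)
 then show ?thesis using interval_sub[OF J(1), of a b] by (auto simp: dist_real_def abs_less_iff)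
 qed
 have ab: "al <= be" using al be by blast
 have cl: "{al..be} <= closure ?J"
 proof
 fix sg assume "sg : {al..be}"
 then have "sg = al | sg = be | sg : {al<..<be}" by auto
 then show "sg : closure ?J" using inJ al(1) be(1) closure_subset by (auto simp: X_def)
 qed
 have hO: "?h ` {al..be} <= Om"
 proof
 fix w assume "w : ?h ` {al..be}"
 then obtain sg where sg: "sg : {al..be}" "w = ?h sg" by blast
 then have "sg : X | sg : {al<..<be}" using al(1) be(1) by (auto simp: order_le_less)
 then show "w : Om" using inJ JO R sg by (auto simp: X_def)
 qed
 have cK: "compact (?h ` {al..be})" using continuous_on_subset[OF J(3) cl] by (intro compact_continuous_image) auto
 define gm' where "gm' = (?J Int {al..be}, ?h)"
 have Ysub: "{sg : ?J. ?h sg : cball z R} <= ?J Int {al..be}" using YX al(2) be(2) by auto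
 have "subpath_of gm' gm" using J(1) Ysub ne by (auto simp: subpath_of_def gm'_def is_interval_cc intro!: is_interval_Int)
 moreover have "img gm' \<subset>\<subset> Om"
 proof -
 have "img gm' <= ?h ` {al..be}" by (auto simp: img_def gm'_def)
 then have "closure (img gm') <= ?h ` {al..be}" using cK by (intro closure_minimal) (auto simp: compact_imp_closed)
 then show ?thesis unfolding ccontained_def using cK hO
 by (meson bounded_subset closed_closure compact_eq_bounded_closed order_trans)
 qed
 ultimately have "nI (img gm') (Oe f) < iN" by (rule gpathD(4)[OF gp])
 moreover have "nI (?h ` {sg : ?J. ?h sg : cball z R}) (Oe f) <= nI (img gm') (Oe f)"
 using Ysub by (intro ns_mono I_mono) (auto simp: img_def gm'_def)
 ultimately show ?thesis by (rule order_le_less_trans[rotated])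
qed

end

section \<open>Values of normalized functions\<close>

context rel_carpet begin

text \<open>Along any good path through or towards a core point \<open>z\<close> the disk values tend to \<open>f z\<close>:
 small squares about \<open>z\<close> with small total oscillation meet both that path and the generic segment
 at \<open>z\<close> inside peripheral disks.\<close>
lemma path_limit:
 assumes f: "sob f" and gp: "gpath f gm" and p0: "p0 : img gm" "p0 ~= z"
 and z: "z = lin b y tu" "z : S" "!!i. z ~: cQ i"
 and g: "gl f b y" and t: "tu < t" "lin b y ` {tu..t} <= Om" and e: "0 < e"
 shows "EX r>0. ALL k:I (img gm). Q k <= ball z r --> (abs(Ms f k - f z)) <= e"
proof -
 let ?w = "%i. Oe f i" and ?J = "fst gm" and ?h = "snd gm"
 have fb: "fb f" and l2: "l2loc ?w" using f by (auto simp: sob_def)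
 have On: "ALL i. 0 <= Os f i" using O_nonneg[OF fb] by simp
 obtain C1 where C1: "C1 > 0" and CL: "!!x s e B rh P. 0 < s ==> 0 < e ==> (AE r in lborel. P r) ==> (ALL i. 0 <= rh i) ==>
 ns (I (ann x s) - B) (%i. eN ((rh i)^2)) <= eN (e^2) ==>
 (EX r. s < r & r < 2 * s & P r & ns (I (Tq x r) - B) (%i. eN (rh i)) <= eN (C1 * e))"
 using courant_leb by (elim exE conjE) (rule that, assumption, simp)
 \<comment> \<open>25 is the 24 of \<open>arc_vals\<close> plus one oscillation at the disk where
   the path crosses; the result is one third of \<open>e\<close>.\<close>
 define e' where "e' = e / (75 * C1)"
 have e': "0 < e'" "25 * (C1 * e') = e / 3" using e C1 by (auto simp: e'_def)
 have e3: "0 < e / 3" using e by simp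
 have "z : Om" using z S_sub by blast
 then obtain R where R: "R > 0" "cball z R <= Om" using open_Om open_contains_cball by blast
 define Y where "Y = ?h ` {sg : ?J. ?h sg : cball z R}"
 have "nI Y ?w < iN" unfolding Y_def by (rule gpath_local_finite[OF gp R(2)])
 from ns_tail[OF this e3] obtain F1 where F1: "finite F1" "ns (I Y - F1) ?w < eN (e/3)" by blast
 have "nI (cball z R) (%i. (?w i)^2) < iN" by (rule l2locD[OF l2 compact_cball R(2)])
 moreover have "0 < e'^2" using e' by simp
 ultimately have "EX F. finite F & ns (I (cball z R) - F) (%i. (?w i)^2) < eN (e'^2)" by (rule ns_tail)
 then obtain F3 where F3: "finite F3" "ns (I (cball z R) - F3) (%i. (?w i)^2) < eN (e'^2)" by blast
 obtain t' where t': "tu < t'" "t' <= t" "ALL sg:{tu..t'}. lin b y sg : S --> (abs(f (lin b y tu) - f (lin b y sg))) <= e/3"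
 using seg_small[OF g fb t, of "e/3"] z e3 by blast
 define U where "U = ball z R - (\<Union>i\<in>F1 Un F3. (cQ i))"
 have "open U" "z : U" using F1 F3 R z(3) by (auto simp: U_def intro!: open_Diff closed_UN)
 then obtain d where d: "d > 0" "ball z d <= U" using open_contains_ball by blast
 have r0: "ninf (p0 - z) > 0"
 proof -
 have "ninf (p0 - z) ~= 0" using p0 by simp
 then show ?thesis using ninf_nonneg[of "p0 - z"] by linarith
 qed
 \<comment> \<open>The square boundary lies in \<open>ball z d\<close>, where no disk of
   \<open>F1\<close> or \<open>F3\<close> is met, and both \<open>p0\<close> and the end of the
   generic segment stay outside, so both paths cross it.\<close>
 define s where "s = min (d/8) (min (ninf (p0 - z) / 4) ((t' - tu) / 4))"
 have s: "0 < s" "4 * s < d" "2 * s < ninf (p0 - z)" "2 * s < t' - tu"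
 using d(1) r0 t'(1) unfolding s_def by (auto simp: min_def)
 have cs: "csqr z r <= ball z d" if "r < 2 * s" for r
 proof
 fix w assume "w : csqr z r"
 then show "w : ball z d" using csqr_ninf(3)[of z w] that s by (simp add: csqr_def)
 qed
 have noF: "i ~: F1 Un F3" if "i : I X" "X <= ball z d" for i X
 using that d(2) closure_subset[of "Q i"] unfolding U_def meeting_def by blast
 have dR: "ball z d <= cball z R"
 proof -
 have "ball z d <= ball z R" using d(2) by (auto simp: U_def)
 then show ?thesis using ball_subset_cball by blast
 qed
 have annc: "ann z s <= ball z d"
 proof
 fix w assume "w : ann z s"
 then show "w : ball z d" using csqr_ninf(3)[of z w] s by (simp add: ann_def)
 qed
 have "I (ann z s) - {} <= I (cball z R) - F3" using noF[OF _ annc] I_mono[of "ann z s" "cball z R"] annc dR by blast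
 then have "ns (I (ann z s) - {}) (%i. eN ((Os f i)^2)) <= ns (I (cball z R) - F3) (%i. (?w i)^2)"
 using On by (intro ns_mono) (auto simp: ennreal_power)
 then have en: "ns (I (ann z s) - {}) (%i. eN ((Os f i)^2)) <= eN (e'^2)" using F3(2) by (meson less_imp_le order_trans)
 \<comment> \<open>The maximum-norm distance from z is 1-Lipschitz, so for almost every radius
   neither path crosses the square boundary at a carpet point. Crossings then lie inside disks,
   where \<open>vals\<close> compares values.\<close>
 let ?rh = "%w. ninf (w - z)"
 have lip: "(abs(?rh a - ?rh c)) <= dist a c" for a c by (rule ninf_diff_le)
 have n1: "negligible (?rh ` (img gm Int S))" by (rule h1_negligible[OF gpathD(2)[OF gp] lip])
 have n2: "negligible (?rh ` (range (lin b y) Int S))" by (rule h1_negligible[OF _ lip]) (use g in \<open>simp add: gl_def\<close>)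
 have "AE r in lborel. goodr f z r & r ~: ?rh ` (img gm Int S) & r ~: ?rh ` (range (lin b y) Int S)"
 using AE_goodr[OF f, of z] AE_not_negligible[OF n1] AE_not_negligible[OF n2] by eventually_elim simp
 from CL[OF s(1) e'(1) this On en] obtain r where r: "s < r" "r < 2 * s" "goodr f z r" "r ~: ?rh ` (img gm Int S)" "r ~: ?rh ` (range (lin b y) Int S)"
 and W: "nI (Tq z r) ?w <= eN (C1 * e')" by auto
 have r1: "0 < r" using r s by simp
 have dO: "ball z d <= Om" using dR R by blast
 have TqO: "Tq z r <= ball z d" using cs[OF r(2)] by (auto simp: Tq_def csqr_def)
 have W0: "0 <= C1 * e'" using C1 e' by simp
 let ?A = "hq z r ` {0..0 + 2 * pi}"
 have A: "?A = Tq z r" using Tq_image[OF r1, of z 0] by simp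
 have AO: "?A <= Om" unfolding A using TqO dO by blast
 have WA: "ns (I ?A) ?w <= eN (C1 * e')" unfolding A by (rule W)
 have inQ: "EX l. w : Q l" if "w : Tq z r" "w : img gm | w : range (lin b y)" for w
 proof -
 have "w ~: S" using that r(4,5) by (auto simp: Tq_def)
 moreover have "w : Om" using that TqO dO by blast
 ultimately show ?thesis using in_Om by blast
 qed
 define e2 where "e2 = lin b y (tu + r)"
 have e2T: "e2 : Tq z r" using r1 by (cases b) (auto simp: e2_def z(1) Tq_def ninf_def lin_def)
 obtain m where m: "e2 : Q m" using inQ[OF e2T] by (auto simp: e2_def)
 have tr: "tu + r : {tu..t'}" using r s by simp
 have "lin b y (tu + r) : cQ m" using m closure_subset by (auto simp: e2_def)
 from first_hit[OF cont_lin _ tr this] obtain a1 where a1: "a1 : {tu..t'}" "lin b y a1 : fr m" using z by blast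
 have fz: "(abs(f z - f (lin b y a1))) <= e/3" using t'(3) a1 fr_S z(1) by blast
 have fin: "(abs(Ms f k - f z)) <= e" if k: "k : I (img gm)" "Q k <= ball z s" for k
 proof -
 obtain tk where tk: "tk : ?J" "?h tk : Q k" using I_imageE k(1) unfolding img_def by metis
 obtain tp where tp: "tp : ?J" "?h tp = p0" using p0 by (auto simp: img_def)
 have J: "is_interval ?J" "bounded ?J" "continuous_on (closure ?J) ?h" and JO: "?h ` ?J <= Om"
 using gpathD(1)[OF gp] by (auto simp: paths_in_def is_plane_path_def img_def)
 have cJ: "continuous_on ?J (%sg. ?rh (?h sg))"
 using continuous_on_subset[OF J(3) closure_subset] by (intro continuous_intros)
 have "?rh (?h tk) <= r" using csqr_ninf(1)[of "?h tk" z s] tk k r by auto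
 moreover have "r <= ?rh (?h tp)" using tp r s by simp
 ultimately obtain t1 where t1: "t1 : ?J" "?rh (?h t1) = r" "!!sg. sg : {min tk t1..max tk t1} ==> sg : ?J & ?rh (?h sg) <= r"
 using cross_first[OF cJ J(1) tk(1) tp(1)] by blast
 define K where "K = {min tk t1..max tk t1}"
 have sp: "subpath_of (K, ?h) gm" using t1(3) by (auto simp: subpath_of_def K_def is_interval_cc)
 have e1T: "?h t1 : Tq z r" using t1 by (simp add: Tq_def)
 obtain l where l: "?h t1 : Q l" using inQ[OF e1T] t1(1) by (auto simp: img_def)
 have "tk : K" "t1 : K" by (auto simp: K_def)
 then have kl: "k : I (img (K, ?h))" "l : I (img (K, ?h))" using tk l by (auto simp: meeting_def img_def)
 have imc: "img (K, ?h) <= ball z d" using cs[OF r(2)] t1(3) by (auto simp: img_def K_def csqr_def)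
 have KJ: "K <= ?J" using t1(3) by (auto simp: K_def)
 have "img (K, ?h) <= Y"
 proof
 fix w assume w: "w : img (K, ?h)"
 then obtain sg where sg: "sg : K" "w = ?h sg" by (auto simp: img_def)
 have "w : cball z R" using w imc dR by blast
 then show "w : Y" unfolding Y_def using sg KJ by blast
 qed
 note I_mono[OF this]
 moreover have "i ~: F1" if "i : I (img (K, ?h))" for i using noF[OF that imc] by simp
 ultimately have "I (img (K, ?h)) <= I Y - F1" by blast
 then have "nI (img (K, ?h)) ?w <= ns (I Y - F1) ?w" by (intro ns_mono) auto
 then have "eN (abs(Ms f k - Ms f l)) <= eN (e/3)"
 using gpathD(3)[OF gp sp kl] F1(2) by (meson less_imp_le order_trans)
 then have 1: "(abs(Ms f k - Ms f l)) <= e/3" using e3 by (simp add: ennreal_le_iff)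
 obtain w where w: "w : fr l" using fr_ne by blast
 have "l : I (Tq z r)" using e1T l by (auto simp: meeting_def)
 then have "?w l <= eN (C1 * e')" using ns_single[of l _ ?w] W by (meson order_trans)
 then have 2: "(abs(Ms f l - f w)) <= C1 * e'" using Ms_fr[OF fb w] W0 by (simp add: ennreal_le_iff)
 have 3: "(abs(f w - f (lin b y a1))) <= 24 * (C1 * e')"
 proof (rule arc_vals[OF fb r(3) r1 AO _ order_refl WA W0])
 show "?h t1 : ?A" "e2 : ?A" using A e1T e2T by auto
 show "f w : vals f (?h t1)" "f (lin b y a1) : vals f e2" using vals_Q[OF l] vals_Q[OF m] w a1 by auto
 qed simp
 show ?thesis using 1 2 3 fz e'(2) by linarith
 qed
 then show ?thesis using s(1) by blast
qed

text \<open>At core points that start a generic segment normalization changes nothing: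
  \<open>path_limit\<close> turns the defining limes inferior into a limit, whatever path the
  definition selects.\<close>

lemma core_value:
 assumes f: "sob f" and r: "rep G f" and z: "z = lin b y tu" "z : S" "!!i. z ~: cQ i"
 and g: "gl f b y" and t: "tu < t" "lin b y ` {tu..t} <= Om" and u: "normalized_version Om Q G z = ereal c"
 shows "c = f z"
proof -
 have core: "z : carpet_core Om Q" using z by (auto simp: carpet_core_def frontier_def)
 let ?gm0 = "({tu..t}, lin b y)"
 have good: "?gm0 : good_paths Om Q G" by (rule gl_good[OF g r t])
 have "z : img ?gm0" using z t by (auto simp: img_def)
 then have ac: "accesses Om Q z ?gm0 ?gm0" using core by (simp add: accesses_def)
 have acc: "accessible Om Q G z" unfolding accessible_def using z(2) good ac by blast
 define gm where "gm = (SOME gm. EX gm0:good_paths Om Q G. accesses Om Q z gm0 gm)"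
 have "EX gm0:good_paths Om Q G. accesses Om Q z gm0 gm"
 unfolding gm_def using good ac by (intro someI_ex[of "%gm. EX gm0:good_paths Om Q G. accesses Om Q z gm0 gm"]) blast
 then obtain gm0 where g0: "gm0 : good_paths Om Q G" "accesses Om Q z gm0 gm" by blast
 note gp = access_path[OF r z(2) g0]
 obtain p0 where p0: "p0 : img gm" "p0 ~= z" using gp(2) by blast
 have L: "ereal c = Liminf (disks_to Q gm z) (peri_sup Q G)"
 using u acc by (simp add: normalized_version_def access_value_def gm_def)
 \<comment> \<open>For the trivial filter the limes inferior would be plus infinity, contrary to the
   finite value.\<close>
 then have nb: "disks_to Q gm z ~= bot" by (auto simp: top_ereal_def)
 have p: "peri_sup Q G = (%i. ereal (Ms f i))" using r by (auto simp: rep_def)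
 have "((%i. Ms f i) \<longlongrightarrow> f z) (disks_to Q gm z)"
 proof (rule tendstoI)
 fix e :: real assume "0 < e"
 then have e: "0 < e / 2" by simp
 obtain r' where "r' > 0" "ALL k:I (img gm). Q k <= ball z r' --> (abs(Ms f k - f z)) <= e / 2"
 using path_limit[OF f gp(1) p0 z g t e] by blast
 then show "\<forall>\<^sub>F k in disks_to Q gm z. dist (Ms f k) (f z) < e"
 unfolding ev_disks_to using \<open>0 < e\<close> by (force simp: dist_real_def)
 qed
 then have "((%i. ereal (Ms f i)) \<longlongrightarrow> ereal (f z)) (disks_to Q gm z)" by simp
 then have "Liminf (disks_to Q gm z) (peri_sup Q G) = ereal (f z)" unfolding p by (rule lim_imp_Liminf[OF nb])
 then show ?thesis using L by simp
qed

text \<open>Bounds are known for u and wanted for the function f that it normalizes. Where a generic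
  line leaves the closed disk for good, core points accumulate by \<open>core_between\<close>; there
  both functions agree, and f varies little along the line.\<close>

lemma exit_value:
 assumes f: "sob f" and r: "rep G f" and j: "j ~: B" "cQ j <= U" and U: "open U" "convex U" "U <= Om" "finite B"
 and u: "sob u" "!!y. y : S ==> ereal (u y) = normalized_version Om Q G y"
 and bd: "!!k w. k ~: B ==> Q k Int U ~= {} ==> w : fr k ==> m <= u w & u w <= M"
 shows "m - Os f j <= Ms f j & Ms f j <= M + Os f j"
proof -
 have fb: "fb f" using f by (simp add: sob_def)
 have fbu: "fb u" using u by (simp add: sob_def)
 obtain z0 where z0: "z0 : Q j" using Q_ne by blast
 have "AE y in lborel. gl f True y & gl u True y" using AE_gl[OF f, of True] AE_gl[OF u(1), of True] by eventually_elim simp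
 from perturb[OF open_Q z0 this] obtain z1 where z1: "z1 : Q j" "gl f True (phi True z1)" "gl u True (phi True z1)" by blast
 define y x0 where "y = phi True z1" and "x0 = phi False z1"
 have lz: "lin True y x0 = z1" using lin_phi(1)[of True z1] by (simp add: y_def x0_def)
 have gf: "gl f True y" and gu: "gl u True y" using z1 by (auto simp: y_def)
 let ?h = "lin True y"
 \<comment> \<open>The parameters in the closed disk; the largest one is where the line leaves it
   for the last time in this direction.\<close>
 define X where "X = {sg. x0 <= sg & ?h sg : cQ j}"
 have "closed X"
 proof -
 have "closed ({x0..} Int ?h -` (cQ j))" by (intro continuous_closed_preimage cont_lin) auto
 then show ?thesis by (simp add: X_def vimage_def Int_def)
 qed
 moreover have "sg <= x0 + dm j" if "sg : X" for sg
 proof -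
 have "dist (?h sg) (?h x0) <= dm j" using that z1 lz closure_subset by (intro closure_dist) (auto simp: X_def)
 then show ?thesis by simp
 qed
 then have "bounded X" by (intro bounded_subset[OF bounded_closed_interval[of x0 "x0 + dm j"]]) (auto simp: X_def)
 ultimately have "compact X" by (simp add: compact_eq_bounded_closed)
 moreover have "x0 : X" using z1 lz closure_subset by (auto simp: X_def)
 then have "X ~= {}" by blast
 ultimately have "EX c:X. ALL t:X. t <= c" by (rule compact_attains_sup)
 then obtain tu where tu: "tu : X" "!!t. t : X ==> t <= tu" by blast
 have tuc: "?h tu : cQ j" "x0 <= tu" using tu(1) by (auto simp: X_def)
 have out: "?h sg ~: cQ j" if "tu < sg" for sg using tu(2)[of sg] that tuc by (auto simp: X_def)
 have "?h tu ~: Q j"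
 proof
 assume "?h tu : Q j"
 then obtain d where d: "d > 0" "ball (?h tu) d <= Q j" using open_Q open_contains_ball by blast
 then have "?h (tu + d/2) : Q j" by (auto simp: subset_iff)
 then show False using out[of "tu + d/2"] d closure_subset by auto
 qed
 then have ef: "?h tu : fr j" using tuc fr_Q by blast
 then have eS: "?h tu : S" using fr_S by blast
 have "?h tu : U" using tuc j by blast
 then obtain d where d: "d > 0" "ball (?h tu) d <= U" using U open_contains_ball by blast
 define t where "t = tu + d/2"
 have t: "tu < t" using d by (simp add: t_def)
 have hU: "?h ` {tu..t} <= U" using d by (auto simp: t_def subset_iff)
 then have hO: "?h ` {tu..t} <= Om" using U by blast
 have eps: "m <= f (?h tu) + e" "f (?h tu) <= M + e" if e: "0 < e" for e
 proof -
 have av: "?h ` {tu..t} Int Q i = {}" if "?h tu : cQ i" for i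
 proof -
 have "i = j" using fr_unique[OF ef that] by simp
 moreover have "?h sg ~: Q j" if "sg : {tu..t}" for sg
 using out[of sg] \<open>?h tu ~: Q j\<close> that closure_subset by (cases "sg = tu") auto
 ultimately show ?thesis by blast
 qed
 obtain t' where t': "tu < t'" "t' <= t" "ALL sg:{tu..t'}. ?h sg : S --> (abs(f (?h tu) - f (?h sg))) <= e"
 using seg_small[OF gf fb t hO eS av e] by blast
 define t2 where "t2 = (tu + t') / 2"
 have t2: "tu < t2" "t2 < t'" using t' by (auto simp: t2_def)
 have "~ (?h tu : cQ m & ?h t2 : cQ m)" for m
 using fr_unique[OF ef, of m] out[OF t2(1)] by blast
 from core_between[OF cont_lin t2(1) this] obtain sg where sg: "sg : {tu..t2}" "!!i. ?h sg ~: cQ i" by blast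
 have sgU: "?h sg : U" using hU sg t2 t' by auto
 have sgS: "?h sg : S" using in_Om[of "?h sg"] sgU U sg(2) closure_subset by blast
 have sgt: "sg < t" using sg t2 t' by auto
 have "{sg..t} <= {tu..t}" using sg by auto
 then have hO2: "?h ` {sg..t} <= Om" using hO by blast
 have "m <= u (?h sg) & u (?h sg) <= M"
 by (rule core_in[OF gu fbu sgt hO2 sgS sg(2) U(1) sgU U(4) bd])
 moreover have "u (?h sg) = f (?h sg)"
 by (rule core_value[OF f r refl sgS sg(2) gf sgt hO2]) (use u(2)[OF sgS] in simp)
 moreover have "sg : {tu..t'}" using sg t2 by auto
 then have "(abs(f (?h tu) - f (?h sg))) <= e" using t'(3) sgS by blast
 ultimately show "m <= f (?h tu) + e" "f (?h tu) <= M + e" by auto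
 qed
 have "m <= f (?h tu)" using eps(1) by (rule field_le_epsilon)
 moreover have "f (?h tu) <= M" using eps(2) by (rule field_le_epsilon)
 ultimately show ?thesis using Ms_fr[OF fb ef] unfolding abs_le_iff by linarith
qed

text \<open>The values of u are limits inferior of disk values of f, which \<open>exit_value\<close>
  confines up to an oscillation that tends to 0. A disk of \<open>B\<close> does not interfere: the
  path avoids it if it touches y, and otherwise it stays away from y.\<close>

lemma norm_bound:
 assumes u: "sob u" "normalized ver Om Q (%x. ereal (u x))" and x: "x : S" and dl: "ball x dl <= Om"
 defines "B == {i. x : cQ i}"
 assumes bd: "!!k w. k ~: B ==> Q k Int ball x dl ~= {} ==> w : fr k ==> m <= u w & u w <= M"
 and y: "y : S Int ball x dl"
 shows "m <= u y & u y <= M"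
proof -
 obtain G where G: "G : W12_loc ver Om Q" and uG: "!!y. y : S ==> ereal (u y) = normalized_version Om Q G y"
 using u(2) unfolding normalized_def by blast
 define f where "f x = real_of_ereal (G x)" for x
 have f: "sob f" and r: "rep G f"
 using W12_locD[OF G] unfolding f_def[abs_def, symmetric] by (auto simp: rep_def sob_def f_def[abs_def])
 have fb: "fb f" and l2: "l2loc (Oe f)" using f by (auto simp: sob_def)
 have Bu: "i : B ==> j : B ==> i = j" for i j using Q_disjoint[of i j] by (auto simp: B_def)
 have fB: "finite B"
 proof (cases "B = {}")
 case False
 then obtain i where "i : B" by blast
 then have "B <= {i}" using Bu by blast
 then show ?thesis using finite_subset by blast
 qed simp
 have acc: "ereal m <= ereal (u y) & ereal (u y) <= ereal M" if y: "y : S" "y : ball x dl" and ac: "accessible Om Q G y" for y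
 proof -
 define gm where "gm = (SOME gm. EX gm0:good_paths Om Q G. accesses Om Q y gm0 gm)"
 have "EX gm. EX gm0:good_paths Om Q G. accesses Om Q y gm0 gm" using ac unfolding accessible_def by blast
 then have "EX gm0:good_paths Om Q G. accesses Om Q y gm0 gm" unfolding gm_def by (rule someI_ex)
 then obtain gm0 where g0: "gm0 : good_paths Om Q G" "accesses Om Q y gm0 gm" by blast
 have av: "!!i. y : fr i ==> img gm Int Q i = {}" by (rule access_path(3)[OF r y(1) g0])
 have L: "ereal (u y) = Liminf (disks_to Q gm y) (peri_sup Q G)"
 using uG[OF y(1)] ac by (simp add: normalized_version_def access_value_def gm_def)
 then have nb: "disks_to Q gm y ~= bot" by (auto simp: top_ereal_def)
 have ev: "\<forall>\<^sub>F k in disks_to Q gm y. ereal (m - e) <= peri_sup Q G k & peri_sup Q G k <= ereal (M + e)" if e: "0 < e" for e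
 proof -
 obtain R where R: "R > 0" "cball y R <= ball x dl" using y(2) open_ball open_contains_cball by blast
 have LO: "cball y R <= Om" using R dl by blast
 have "nI (cball y R) (O2 f) < iN" by (rule l2locD[OF l2 compact_cball LO])
 moreover have "0 < e^2" using e by simp
 ultimately have "EX F. finite F & ns (I (cball y R) - F) (O2 f) < eN (e^2)" by (rule ns_tail)
 then obtain F where F: "finite F" "ns (I (cball y R) - F) (O2 f) < eN (e^2)" by blast
 \<comment> \<open>A disk in a ball much smaller than these diameters cannot belong to
   \<open>F\<close>; the 1 keeps the set nonempty.\<close>
 define D where "D = insert 1 (dm ` F)"
 have D: "finite D" "D ~= {}" "!!d. d : D ==> 0 < d" using F dm_pos by (auto simp: D_def)
 have Dm: "0 < Min D" using D by (simp add: Min_gr_iff)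
 define W where "W = - (\<Union>i\<in>{i\<in>B. y ~: cQ i}. (cQ i))"
 have "open W" "y : W" using fB by (auto simp: W_def intro!: open_Compl closed_UN)
 then obtain d where d: "d > 0" "ball y d <= W" using open_contains_ball by blast
 define r' where "r' = min R (min d (Min D / 4))"
 have r': "0 < r'" "r' <= R" "r' <= d" "4 * r' <= Min D" using R d Dm by (auto simp: r'_def)
 have "ereal (m - e) <= peri_sup Q G k & peri_sup Q G k <= ereal (M + e)" if k: "k : I (img gm)" "Q k <= ball y r'" for k
 proof -
 have cl: "cQ k <= cball y r'" using k(2) by (intro closure_minimal) (auto simp: less_imp_le)
 have "cball y r' <= cball y R" using r' by (intro subset_cball)
 then have clU: "cQ k <= ball x dl" using cl R by blast
 have "k ~: F"
 proof
 assume "k : F"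
 then have "Min D <= dm k" using D by (intro Min_le) (auto simp: D_def)
 moreover have "dm k <= diameter (ball y r')" using k(2) by (intro diameter_subset) auto
 ultimately show False using r' by simp
 qed
 moreover have "k : I (cball y R)"
 proof -
 obtain w where "w : Q k" using Q_ne by blast
 then show ?thesis using k(2) r'(2) by (force simp: meeting_def)
 qed
 ultimately have "(Oe f k)^2 <= ns (I (cball y R) - F) (O2 f)"
 by (intro ns_single) auto
 then have "(Oe f k)^2 <= eN (e^2)" using F(2) by (meson less_imp_le order_trans)
 then have "(Os f k)^2 <= e^2" using O_nonneg[OF fb, of k] by (simp add: ennreal_power ennreal_le_iff)
 then have Oe: "Os f k <= e" using e by (meson less_imp_le power2_le_imp_le)
 have "k ~: B"
 proof
 assume kB: "k : B"
 show False
 proof (cases "y : cQ k")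
 case True
 then have "y : fr k" using cQ_S y(1) by blast
 then show False using av k(1) by (auto simp: meeting_def)
 next
 case False
 then have "cQ k Int W = {}" using kB by (auto simp: W_def)
 moreover have "Q k <= W" using k(2) d r' by (force simp: subset_iff)
 ultimately show False using Q_ne closure_subset by blast
 qed
 qed
 then have "m - Os f k <= Ms f k & Ms f k <= M + Os f k"
 by (rule exit_value[OF f r _ clU open_ball convex_ball dl fB u(1)]) (rule uG bd, assumption+)+
 then show ?thesis using r Oe by (auto simp: rep_def)
 qed
 then show ?thesis unfolding ev_disks_to using r'(1) by blast
 qed
 have 1: "ereal (m - e) <= ereal (u y)" if "0 < e" for e unfolding L
 by (rule Liminf_bounded) (rule eventually_mono[OF ev[OF that]], blast)
 have 2: "ereal (u y) <= ereal (M + e)" if "0 < e" for e unfolding L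
 by (rule Liminf_le[OF nb]) (rule eventually_mono[OF ev[OF that]], blast)
 have "m <= u y + e" if "0 < e" for e using 1[OF that] by (simp add: diff_le_eq)
 then have "m <= u y" by (rule field_le_epsilon)
 moreover have "u y <= M + e" if "0 < e" for e using 2[OF that] by simp
 then have "u y <= M" by (rule field_le_epsilon)
 ultimately show ?thesis by simp
 qed
 have lim: "m <= u y & u y <= M" if L: "ereal (u y) = Liminf (at y within A) (access_value Om Q G)" and A: "!!w. w : A ==> accessible Om Q G w" for A
 proof -
 have nb: "at y within A ~= bot" using L by (auto simp: top_ereal_def)
 have "\<forall>\<^sub>F w in at y within A. w : ball x dl"
 using y open_ball[of x dl] by (auto simp: eventually_at_topological)
 moreover have "\<forall>\<^sub>F w in at y within A. w : A" by (simp add: eventually_at_filter)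
 ultimately have ev: "\<forall>\<^sub>F w in at y within A. ereal m <= access_value Om Q G w & access_value Om Q G w <= ereal M"
 proof eventually_elim
 case (elim w)
 have ac: "accessible Om Q G w" using A elim by blast
 then have wS: "w : S" by (simp add: accessible_def)
 have "ereal (u w) = access_value Om Q G w" using uG[OF wS] ac by (simp add: normalized_version_def)
 then show ?case using acc[OF wS elim(1) ac] by simp
 qed
 have "ereal m <= ereal (u y)" unfolding L by (rule Liminf_bounded) (rule eventually_mono[OF ev], blast)
 moreover have "ereal (u y) <= ereal M" unfolding L by (rule Liminf_le[OF nb]) (rule eventually_mono[OF ev], blast)
 ultimately show ?thesis by simp
 qed
 show ?thesis
 proof (cases "accessible Om Q G y")
 case True
 then show ?thesis using acc y by auto
 next
 case na: False
 have "ereal (u y) = normalized_version Om Q G y" using uG y by blast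
 then show ?thesis using na unfolding normalized_version_def
 by (auto split: if_splits intro!: lim del: conjI)
 qed
qed

end

section \<open>Weak limits and subsequences\<close>

lemma ennreal_young: "0 < tu ==> sg * a <= ennreal tu * sg\<^sup>2 + eN (1 / tu) * (a::ennreal)^2"
proof (cases "sg = iN | a = iN")
 case True
 assume tu: "0 < tu"
 then have "ennreal tu ~= 0" "eN (1 / tu) ~= 0" by simp_all
 then show ?thesis using True by (auto simp: power2_eq_square ennreal_mult_top ennreal_top_mult ennreal_mult_eq_top_iff)
next
 case False
 assume tu: "0 < tu"
 obtain s t where st: "sg = eN s" "0 <= s" "a = eN t" "0 <= t" using False by (cases sg; cases a) auto
 have "0 <= (tu * s - t)^2" by simp
 then have "2 * (tu * (s * t)) <= tu^2 * s^2 + t^2" by (simp add: power2_eq_square algebra_simps)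
 moreover have "0 <= tu * (s * t)" using tu st by simp
 ultimately have "tu * (s * t) <= tu^2 * s^2 + t^2" by linarith
 also have "... = tu * (tu * s^2 + 1 / tu * t^2)" using tu by (simp add: power2_eq_square field_simps)
 finally have "s * t <= tu * s^2 + 1 / tu * t^2" using tu by simp
 then have "eN (s * t) <= eN (tu * s^2 + 1 / tu * t^2)" by (rule ennreal_leI)
 also have "... = eN (tu * s^2) + eN (1 / tu * t^2)" using tu by (intro ennreal_plus) auto
 also have "eN (tu * s^2) = ennreal tu * sg\<^sup>2" unfolding st(1) ennreal_power[OF st(2)] using tu by (intro ennreal_mult) auto
 also have "eN (1 / tu * t^2) = eN (1 / tu) * a\<^sup>2" unfolding st(3) ennreal_power[OF st(4)] using tu by (intro ennreal_mult) auto
 also have "eN (s * t) = sg * a" unfolding st(1,3) using st by (intro ennreal_mult) auto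
 finally show ?thesis .
qed

text \<open>Bounded energy and convergence of each coordinate give weak convergence: finitely many
  coordinates are handled by the limit, the rest by the tail of \<open>sg\<close>.\<close>

lemma l2_weak_zero:
 assumes sg: "ns A (%i. (sg i)^2) < iN" and a: "!!n::nat. ns A (%i. (a n i)^2) <= ennreal E" "0 <= E"
 and lim: "!!i. i : A ==> (%n. a n i) \<longlonglongrightarrow> 0" and e: "0 < e"
 shows "EX n. ns A (%i. sg i * a n i) <= eN e"
proof -
 \<comment> \<open>With this parameter the Young terms on the tail are at most \<open>e / 4\<close>
   and \<open>e / 2\<close>, which leaves \<open>e / 4\<close> for the finite part.\<close>
 define tu where "tu = 2 * (E + 1) / e"
 have tu: "0 < tu" using a(2) e by (simp add: tu_def)
 have "0 < e / (4 * tu)" using e tu by simp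
 from ns_tail[OF sg this] obtain F where F: "finite F" "ns (A - F) (%i. (sg i)^2) < eN (e / (4 * tu))" by blast
 have "(%n. \<Sum>i\<in>A Int F. sg i * a n i) \<longlonglongrightarrow> (\<Sum>i\<in>A Int F. 0)"
 proof (rule tendsto_sum)
 fix i assume i: "i : A Int F"
 have "(sg i)^2 <= ns A (%i. (sg i)^2)" using i by (intro ns_single) auto
 then have "(sg i)^2 < iN" using sg by (rule order_le_less_trans)
 then have "sg i < top" by (cases "sg i") (auto simp: power2_eq_square ennreal_top_mult)
 then have "(%n. sg i * a n i) \<longlonglongrightarrow> sg i * 0" using lim[of i] i by (intro ennreal_tendsto_cmult) auto
 then show "(%n. sg i * a n i) \<longlonglongrightarrow> 0" by simp
 qed
 then have "(%n. ns (A Int F) (%i. sg i * a n i)) \<longlonglongrightarrow> 0" using F by (simp add: ns_finite)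
 moreover have "(0::ennreal) < eN (e / 4)" using e by simp
 ultimately have "eventually (%n. ns (A Int F) (%i. sg i * a n i) < eN (e / 4)) sequentially" by (rule order_tendstoD)
 then obtain n where n: "ns (A Int F) (%i. sg i * a n i) < eN (e / 4)" by (auto simp: eventually_sequentially)
 have "ns (A - F) (%i. sg i * a n i) <= ns (A - F) (%i. ennreal tu * (sg i)^2 + eN (1 / tu) * (a n i)^2)"
 using ennreal_young[OF tu] by (intro ns_mono) auto
 also have "... = ennreal tu * ns (A - F) (%i. (sg i)^2) + eN (1 / tu) * ns (A - F) (%i. (a n i)^2)"
 by (simp add: ns_add ns_cmult)
 also have "... <= ennreal tu * eN (e / (4 * tu)) + eN (1 / tu) * ennreal E"
 proof (intro add_mono mult_left_mono)
 show "ns (A - F) (%i. (sg i)^2) <= eN (e / (4 * tu))" using F by simp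
 have "ns (A - F) (%i. (a n i)^2) <= ns A (%i. (a n i)^2)" by (intro ns_mono) auto
 then show "ns (A - F) (%i. (a n i)^2) <= ennreal E" using a(1) by (rule order_trans)
 qed auto
 also have "... = eN (tu * (e / (4 * tu))) + eN (1 / tu * E)" using tu a(2) by (simp only: ennreal_mult' less_imp_le zero_le_divide_1_iff)
 also have "... = eN (tu * (e / (4 * tu)) + 1 / tu * E)" using tu e a(2) by (intro ennreal_plus[symmetric]) auto
 also have "tu * (e / (4 * tu)) + 1 / tu * E <= 3 * e / 4"
 proof -
 have "1 / tu * E = e * E / (2 * (E + 1))" using a(2) e by (simp add: tu_def)
 also have "... <= e / 2" using a(2) e by (simp add: field_simps)
 finally have "1 / tu * E <= e / 2" .
 moreover have "tu * (e / (4 * tu)) = e / 4" using tu by simp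
 ultimately show ?thesis by linarith
 qed
 finally have 2: "ns (A - F) (%i. sg i * a n i) <= eN (3 * e / 4)" by (simp add: ennreal_leI)
 have "ns A (%i. sg i * a n i) = ns (A Int F) (%i. sg i * a n i) + ns (A - F) (%i. sg i * a n i)"
 by (subst ns_Un_disj[symmetric]) (auto simp: Int_Diff_Un)
 also have "... <= eN (e / 4) + eN (3 * e / 4)" using n 2 by (intro add_mono) auto
 also have "... = eN e" using e by (subst ennreal_plus[symmetric]) auto
 finally show ?thesis by blast
qed

text \<open>Picking the terms of a weakly null sequence almost orthogonal makes the weighted sum with the
 non-summable weights \<open>1/(k+1)\<close> square summable.\<close>
lemma weak_null_weight:
 assumes a: "!!n::nat. ns A (%i. (a n i)^2) <= ennreal E" "0 <= E" and lim: "!!i. i : A ==> (%n. a n i) \<longlonglongrightarrow> 0"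
 shows "EX rh. ns A (%i. (rh i)^2) < iN & (\<forall>X\<subseteq>A. ns X rh < iN --> (ALL e>0. EX n. ns X (a n) <= eN e))"
proof -
 define c :: "nat => real" where "c k = inverse (real (Suc k))" for k
 have c: "0 < c k" "c k <= 1" for k by (auto simp: c_def inverse_le_1_iff)
 \<comment> \<open>The permitted growth of energy at step k: a cross term made small by
   \<open>l2_weak_zero\<close>, and the square of the new term.\<close>
 define b where "b k = 2 * (1/2)^k + E * (c k)^2" for k
 have b0: "0 <= b k" for k using a(2) by (simp add: b_def)
 have "summable (%k. (c k)^2)"
 using inverse_power_summable[of 2, where 'a=real] unfolding c_def power_inverse[symmetric] by (subst summable_Suc_iff) simp
 then have sb: "summable b" unfolding b_def by (intro summable_add summable_mult summable_geometric) auto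
 define P where "P k sg \<longleftrightarrow> ns A (%i. (sg i)^2) <= eN (\<Sum>l<k. b l)" for k and sg :: "nat => ennreal"
 define R where "R k sg sg' \<longleftrightarrow> (EX n. sg' = (%i. sg i + eN (c k) * a n i))" for k and sg sg' :: "nat => ennreal"
 have "EX f. ALL k. P k (f k) & R k (f k) (f (Suc k))"
 proof (rule dependent_nat_choice)
 show "EX sg. P 0 sg" by (rule exI[of _ "%_. 0"]) (simp add: P_def)
 fix sg k assume P: "P k sg"
 then have "ns A (%i. (sg i)^2) <= eN (\<Sum>l<k. b l)" by (simp add: P_def)
 then have "ns A (%i. (sg i)^2) < iN" by (rule order_le_less_trans) simp
 from l2_weak_zero[OF this a lim, of "(1/2)^k"] obtain n where n: "ns A (%i. sg i * a n i) <= eN ((1/2)^k)" by auto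
 define sg' where "sg' i = sg i + eN (c k) * a n i" for i
 have "(sg' i)^2 <= (sg i)^2 + (2 * (sg i * a n i) + eN ((c k)^2) * (a n i)^2)" for i
 proof -
 have "(sg' i)^2 = (sg i)^2 + (eN (c k) * (2 * (sg i * a n i)) + (eN (c k))^2 * (a n i)^2)"
 unfolding sg'_def power2_sum power_mult_distrib by (simp add: ac_simps)
 also have "... <= (sg i)^2 + (1 * (2 * (sg i * a n i)) + (eN (c k))^2 * (a n i)^2)"
 using c[of k] by (intro add_mono mult_right_mono order_refl) (auto simp: ennreal_le_1)
 also have "(eN (c k))^2 = eN ((c k)^2)" using c[of k] by (intro ennreal_power) simp
 finally show ?thesis by simp
 qed
 then have "ns A (%i. (sg' i)^2) <= ns A (%i. (sg i)^2 + (2 * (sg i * a n i) + eN ((c k)^2) * (a n i)^2))"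
 by (intro ns_mono) auto
 also have "... = ns A (%i. (sg i)^2) + (2 * ns A (%i. sg i * a n i) + eN ((c k)^2) * ns A (%i. (a n i)^2))"
 by (simp only: ns_add ns_cmult)
 also have "... <= eN (\<Sum>l<k. b l) + (ennreal 2 * eN ((1/2)^k) + eN ((c k)^2) * ennreal E)"
 using P n a(1)[of n] unfolding P_def by (intro add_mono mult_mono) auto
 also have "ennreal 2 * eN ((1/2)^k) = eN (2 * (1/2)^k)" by (rule ennreal_mult[symmetric]) auto
 also have "eN ((c k)^2) * ennreal E = eN ((c k)^2 * E)" using a(2) by (intro ennreal_mult[symmetric]) auto
 also have "eN (2 * (1/2)^k) + eN ((c k)^2 * E) = eN (b k)"
 unfolding b_def using a(2) by (subst ennreal_plus[symmetric]) (auto simp: mult.commute)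
 also have "eN (\<Sum>l<k. b l) + eN (b k) = eN (\<Sum>l<Suc k. b l)"
 using b0 by (subst ennreal_plus[symmetric]) (auto intro: sum_nonneg)
 finally have "P (Suc k) sg'" by (simp add: P_def)
 moreover have "R k sg sg'" unfolding R_def sg'_def[abs_def] by blast
 ultimately show "EX sg'. P (Suc k) sg' & R k sg sg'" by blast
 qed
 then obtain f where f: "!!k. P k (f k)" "!!k. R k (f k) (f (Suc k))" by blast
 define rh where "rh i = (SUP k. f k i)" for i
 have fS: "f k i <= f (Suc k) i" for k i using f(2)[of k] by (auto simp: R_def)
 then have mono: "j <= k ==> f j i <= f k i" for j k i using lift_Suc_mono_le[of "%k. f k i"] by blast
 have sq: "(rh i)^2 <= (SUP k. (f k i)^2)" for i
 proof -
 have "(rh i)^2 = (SUP k. SUP l. f k i * f l i)"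
 unfolding rh_def power2_eq_square by (simp only: SUP_mult_right_ennreal SUP_mult_left_ennreal mult.commute)
 also have "... <= (SUP k. (f k i)^2)"
 proof (intro SUP_least)
 fix k l
 have "f k i * f l i <= f (max k l) i * f (max k l) i" by (intro mult_mono mono) auto
 also have "... = (f (max k l) i)^2" by (simp add: power2_eq_square)
 also have "... <= (SUP k. (f k i)^2)" by (rule SUP_upper) simp
 finally show "f k i * f l i <= (SUP k. (f k i)^2)" .
 qed
 finally show ?thesis .
 qed
 have inc: "incseq (%k i. (f k i)^2 * indicator A i)"
 by (rule incseq_SucI) (auto intro!: le_funI mult_right_mono power_mono fS)
 have "ns A (%i. (rh i)^2) <= ns A (%i. SUP k. (f k i)^2)" by (intro ns_mono sq) auto
 also have "... = (\<integral>\<^sup>+i. (SUP k. (f k i)^2 * indicator A i) \<partial>count_space UNIV)"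
 unfolding ns_def by (simp only: SUP_mult_right_ennreal)
 also have "... = (SUP k. ns A (%i. (f k i)^2))" unfolding ns_def by (rule nn_integral_monotone_convergence_SUP[OF inc]) simp
 also have "... <= eN (suminf b)"
 proof (rule SUP_least)
 fix k
 have "ns A (%i. (f k i)^2) <= eN (\<Sum>l<k. b l)" using f(1)[of k] by (simp add: P_def)
 also have "... <= eN (suminf b)" using sum_le_suminf[OF sb, of "{..<k}"] b0 by (intro ennreal_leI) auto
 finally show "ns A (%i. (f k i)^2) <= eN (suminf b)" .
 qed
 finally have fin: "ns A (%i. (rh i)^2) < iN" by (rule order_le_less_trans) simp
 have "EX n. ns X (a n) <= eN e" if X: "X <= A" and r: "ns X rh < iN" and e: "0 < e" for X and e :: real
 proof (rule ccontr)
 assume "~ ?thesis"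
 then have big: "eN e <= ns X (a n)" for n by (simp add: not_le less_imp_le)
 \<comment> \<open>Were all sums over \<open>X\<close> at least \<open>e\<close>, those of the
   partial weights would grow like \<open>e\<close> times the harmonic series.\<close>
 have low: "eN (e * (\<Sum>l<k. c l)) <= ns X (f k)" for k
 proof (induction k)
 case (Suc k)
 obtain n where n: "f (Suc k) = (%i. f k i + eN (c k) * a n i)" using f(2)[of k] by (auto simp: R_def)
 have "eN (e * (\<Sum>l<Suc k. c l)) = eN (e * (\<Sum>l<k. c l)) + eN (c k * e)"
 using e c by (subst ennreal_plus[symmetric]) (auto intro!: sum_nonneg mult_nonneg_nonneg simp: less_imp_le algebra_simps)
 also have "eN (c k * e) = eN (c k) * eN e" using c[of k] e by (intro ennreal_mult) auto
 also have "eN (e * (\<Sum>l<k. c l)) + eN (c k) * eN e <= ns X (f k) + eN (c k) * ns X (a n)"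
 using Suc big by (intro add_mono mult_left_mono) auto
 also have "... = ns X (f (Suc k))" unfolding n by (simp only: ns_add ns_cmult)
 finally show ?case .
 qed simp
 obtain r' where r': "ns X rh = eN r'" "0 <= r'" using r by (cases "ns X rh") auto
 have "(\<Sum>l<k. c l) <= r' / e" for k
 proof -
 have "ns X (f k) <= ns X rh" unfolding rh_def by (intro ns_mono SUP_upper) auto
 then have "eN (e * (\<Sum>l<k. c l)) <= eN r'" using low[of k] r'(1) by (metis order_trans)
 then have "e * (\<Sum>l<k. c l) <= r'" using r'(2) by (simp add: ennreal_le_iff)
 then show ?thesis using e by (simp add: field_simps)
 qed
 then have "summable c" using c by (intro summableI_nonneg_bounded[where x="r' / e"]) (auto simp: less_imp_le)
 then have "summable (%n. inverse (real n))" unfolding c_def[abs_def] by (subst (asm) summable_Suc_iff)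
 then show False using not_summable_harmonic[where 'a=real] by simp
 qed
 then show ?thesis using fin by blast
qed

section \<open>Equicontinuity and extraction of a subsequence\<close>

context rel_carpet begin

lemma equicont:
 fixes U :: "(complex => real) set"
 assumes U: "!!u. u : U ==> harm u & normalized ver Om Q (%x. ereal (u x))"
 and bd: "!!L. compact L ==> L <= Om ==> EX C. ALL u:U. ALL x:S Int L. (abs(u x)) <= C"
 and x: "x : S" and e: "0 < e"
 shows "EX dl>0. ALL u:U. ALL y:S Int ball x dl. (abs(u x - u y)) <= e"
proof -
 have hU: "!!u. u : U ==> harm u" using U by blast
 have "EX dl>0. ball x dl <= Om & (ALL u:U. EX m M. M - m <= e & (ALL j. j ~: {i. x : cQ i} --> Q j Int ball x dl ~= {} --> (ALL z:fr j. m <= u z & u z <= M)))"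
 by (rule equi_osc[OF _ _ x e]) (rule hU bd, assumption+)+
 then obtain dl where dl: "dl > 0" "ball x dl <= Om" and
 eq: "ALL u:U. EX m M. M - m <= e & (ALL j. j ~: {i. x : cQ i} --> Q j Int ball x dl ~= {} --> (ALL z:fr j. m <= u z & u z <= M))"
 by (elim exE conjE) (rule that)
 have "(abs(u x - u y)) <= e" if u: "u : U" and y: "y : S Int ball x dl" for u y
 proof -
 obtain m M where mM: "M - m <= e" and b: "ALL j. j ~: {i. x : cQ i} --> Q j Int ball x dl ~= {} --> (ALL z:fr j. m <= u z & u z <= M)"
 using bspec[OF eq u] by (elim exE conjE) (rule that)
 have sb: "sob u" and nm: "normalized ver Om Q (%x. ereal (u x))" using U[OF u] by (auto simp: harm_def)
 have b': "m <= u w & u w <= M" if "k ~: {i. x : cQ i}" "Q k Int ball x dl ~= {}" "w : fr k" for k w using b that by blast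
 have "m <= u y & u y <= M" by (rule norm_bound[OF sb nm x dl(2) _ y]) (rule b')
 moreover have "x : S Int ball x dl" using x dl by simp
 then have "m <= u x & u x <= M" by (rule norm_bound[OF sb nm x dl(2) _, rotated]) (rule b')
 ultimately show ?thesis using mM by (auto simp: abs_le_iff)
 qed
 then show ?thesis using dl(1) by blast
qed

text \<open>The carpet is relatively closed, so its traces on a compact exhaustion are compact;
  Arzela-Ascoli applies to each, and a diagonal sequence serves all.\<close>

lemma limit_exists:
 fixes u :: "nat => complex => real"
 assumes eqc: "!!x e. x : S ==> 0 < e ==> EX dl>0. ALL n. ALL y:S Int ball x dl. (abs(u n x - u n y)) <= e"
 and bd: "!!L. compact L ==> L <= Om ==> EX C. ALL n. ALL x:S Int L. (abs(u n x)) <= C"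
 shows "EX k v. strict_mono k & (ALL K. compact K --> K <= Om --> uniform_limit (S Int K) (%n. u (k n)) v sequentially)"
proof -
 obtain C :: "nat => complex set" where C0: "ALL n. compact (C n)" "ALL n. C n <= Om" "ALL K. compact K --> K <= Om --> (EX N. ALL n>=N. K <= C n)"
 using exhaust by (elim exE conjE) (rule that)
 have C: "!!n. compact (C n)" "!!n. C n <= Om" "!!K. compact K ==> K <= Om ==> EX N. ALL n>=N. K <= C n" using C0 by simp_all
 have cS: "compact (S Int C i)" for i
 proof -
 have "S Int C i = C i - (\<Union>j. Q j)" using C(2)[of i] by (auto simp: carpet_def)
 then show ?thesis using C(1) by (simp add: compact_diff open_UN)
 qed
 define P where "P i r \<longleftrightarrow> uniformly_convergent_on (S Int C i) (%n. u (r n))" for i and r :: "nat => nat"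
 have sub: "EX k. strict_mono k & P i (r \<circ> k)" for i and r :: "nat => nat"
 proof -
 obtain M where M: "ALL n. ALL x:S Int C i. (abs(u n x)) <= M" using bd[OF C(1,2)] by blast
 have eq: "EX d. 0 < d & (ALL n y. y : S Int C i & norm (x - y) < d --> norm (u (r n) x - u (r n) y) < e)"
 if x: "x : S Int C i" and e: "0 < e" for x and e :: real
 proof -
 have "x : S" "0 < e / 2" using x e by auto
 then obtain d where d: "d > 0" "ALL n. ALL y:S Int ball x d. (abs(u n x - u n y)) <= e / 2" using eqc by blast
 have "norm (u (r n) x - u (r n) y) < e" if "y : S Int C i" "norm (x - y) < d" for n y
 proof -
 have "y : S Int ball x d" using that by (auto simp: dist_norm)
 then have "(abs(u (r n) x - u (r n) y)) <= e / 2" using d(2) by blast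
 then show ?thesis using e by simp
 qed
 then show ?thesis using d(1) by blast
 qed
 obtain g k where "continuous_on (S Int C i) g" and k: "strict_mono (k :: nat => nat)"
 "!!e. 0 < e ==> EX N. ALL n x. n >= N & x : S Int C i --> norm (u (r (k n)) x - g x) < e"
 by (rule Arzela_Ascoli[OF cS, of i "%n. u (r n)" M]) (use M eq in auto)
 have "uniform_limit (S Int C i) (%n. u (r (k n))) g sequentially"
 unfolding uniform_limit_sequentially_iff using k(2) by (simp add: dist_norm) blast
 then have "P i (r \<circ> k)" unfolding P_def uniformly_convergent_on_def comp_def by blast
 then show ?thesis using k(1) by blast
 qed
 have PP: "P i (r \<circ> k2)" if P1: "P i (r \<circ> k1)" and j: "!!j. N <= j ==> EX j'. j <= j' & k2 j = k1 j'" for i N and r k1 k2 :: "nat => nat"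
 proof -
 obtain l where l: "uniform_limit (S Int C i) (%n. u ((r \<circ> k1) n)) l sequentially"
 using P1 unfolding P_def uniformly_convergent_on_def by blast
 have "uniform_limit (S Int C i) (%n. u ((r \<circ> k2) n)) l sequentially"
 unfolding uniform_limit_sequentially_iff
 proof (intro allI impI)
 fix e :: real assume "0 < e"
 then obtain N1 where N1: "ALL n>=N1. ALL x:S Int C i. dist (u ((r \<circ> k1) n) x) (l x) < e"
 using l unfolding uniform_limit_sequentially_iff by blast
 have "dist (u ((r \<circ> k2) n) x) (l x) < e" if n: "max N N1 <= n" and x: "x : S Int C i" for n x
 proof -
 obtain j' where j': "n <= j'" "k2 n = k1 j'" using j[of n] n by auto
 then show ?thesis using N1 n x by auto
 qed
 then show "EX N. ALL n>=N. ALL x:S Int C i. dist (u ((r \<circ> k2) n) x) (l x) < e" by blast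
 qed
 then show ?thesis unfolding P_def uniformly_convergent_on_def by blast
 qed
 obtain k where k: "strict_mono (k :: nat => nat)" "!!i. P i (id \<circ> k)"
 by (rule subsequence_diagonalization_lemma[of P id]) (rule sub, rule PP, assumption, blast+)
 define v where "v x = lim (%n. u (k n) x)" for x
 have lim: "uniform_limit (S Int C i) (%n. u (k n)) v sequentially" for i
 using k(2)[of i] unfolding P_def uniformly_convergent_uniform_limit_iff by (simp add: v_def[abs_def])
 have "uniform_limit (S Int K) (%n. u (k n)) v sequentially" if K: "compact K" "K <= Om" for K
 proof -
 obtain N where "K <= C N" using C(3)[OF K] by blast
 then show ?thesis using uniform_limit_on_subset[OF lim[of N]] by blast
 qed
 then show ?thesis using k(1) by blast
qed

end

section \<open>The limit is carpet-harmonic\<close>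

context rel_carpet begin

lemma O_close:
 assumes f: "fb f" and g: "fb g" and d: "!!x. x : fr i ==> (abs(f x - g x)) <= e"
 shows "(abs(Os f i - Os g i)) <= 2 * e"
proof -
 have "Os f i <= Os g i + 2 * e"
 proof (rule O_le[OF f])
 fix x y assume xy: "x : fr i" "y : fr i"
 show "f x - f y <= Os g i + 2 * e" using O_ge[OF g xy] d[OF xy(1)] d[OF xy(2)] by (simp add: abs_le_iff)
 qed
 moreover have "Os g i <= Os f i + 2 * e"
 proof (rule O_le[OF g])
 fix x y assume xy: "x : fr i" "y : fr i"
 show "g x - g y <= Os f i + 2 * e" using O_ge[OF f xy] d[OF xy(1)] d[OF xy(2)] by (simp add: abs_le_iff)
 qed
 ultimately show ?thesis by (simp add: abs_le_iff)
qed

end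

locale harm_limit = rel_carpet Om Q ver for Om :: "complex set" and Q :: "nat => complex set" and ver :: version +
 fixes w :: "nat => complex => real" and v :: "complex => real"
 assumes ch: "!!n. carpet_harmonic ver Om Q (%x. ereal (w n x))"
 and lim: "!!K. compact K ==> K <= Om ==> uniform_limit (S Int K) w v sequentially"
 and bd: "!!L. compact L ==> L <= Om ==> EX C. ALL n. ALL x:S Int L. (abs(w n x)) <= C"
begin

lemma harm_w: "harm (w n)" and sob_w: "sob (w n)" and fb_w: "fb (w n)"
 using carpet_harmonic_harm[OF ch] by (auto simp: harm_def sob_def)

lemma lim_close: "compact K ==> K <= Om ==> 0 < e ==> EX N. ALL n>=N. ALL x:S Int K. (abs(w n x - v x)) <= e"
 using lim[of K] unfolding uniform_limit_sequentially_iff dist_real_def by (meson less_imp_le)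

lemma v_bd: "compact L ==> L <= Om ==> EX C. ALL x:S Int L. (abs(v x)) <= C"
proof -
 assume L: "compact L" "L <= Om"
 obtain C where C: "ALL n. ALL x:S Int L. (abs(w n x)) <= C" using bd[OF L] by blast
 obtain N where N: "ALL n>=N. ALL x:S Int L. (abs(w n x - v x)) <= 1" using lim_close[OF L, of 1] by auto
 have "(abs(v x)) <= C + 1" if "x : S Int L" for x using C[rule_format, of x N] N[rule_format, of N x] that by (auto simp: abs_le_iff)
 then show ?thesis by blast
qed

lemma fr_K: "compact (fr i)" "fr i <= Om" "x : fr i ==> x : S Int fr i"
 using compact_fr fr_S S_sub by blast+

lemma fb_v: "fb v"
 unfolding fb_def
proof
 fix i
 obtain C where "ALL x:S Int fr i. (abs(v x)) <= C" using v_bd[OF fr_K(1,2)] by blast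
 then show "bounded (v ` fr i)" using fr_K(3) by (intro boundedI[of _ C]) auto
qed

lemma Os_lim: "(%n. Os (w n) i) \<longlonglongrightarrow> Os v i"
proof (rule LIMSEQ_I)
 fix e :: real assume e: "0 < e"
 then have "0 < e / 3" by simp
 from lim_close[OF fr_K(1,2) this] obtain N where N: "ALL n>=N. ALL x:S Int fr i. (abs(w n x - v x)) <= e / 3" by blast
 have "norm (Os (w n) i - Os v i) < e" if "N <= n" for n
 proof -
 have "(abs(Os (w n) i - Os v i)) <= 2 * (e / 3)" using N that fr_K(3) by (intro O_close[OF fb_w fb_v]) blast
 then show ?thesis using e by simp
 qed
 then show "EX N. ALL n>=N. norm (Os (w n) i - Os v i) < e" by blast
qed

lemma energy_bd: assumes L: "compact L" "L <= Om" shows "EX E>=0. ALL n. nI L (O2 (w n)) <= ennreal E"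
proof -
 obtain L' where L': "compact L'" "L' <= Om" and c: "ALL C>=0. EX E. ALL u. harm u --> (ALL x:S Int L'. (abs(u x)) <= C) -->
 nI L (O2 u) <= ennreal E"
 using caccioppoli[OF L] by (elim exE conjE) (rule that)
 obtain C where C: "ALL n. ALL x:S Int L'. (abs(w n x)) <= C" using bd[OF L'] by blast
 have "0 <= max C 0" by simp
 with c obtain E where E: "ALL u. harm u --> (ALL x:S Int L'. (abs(u x)) <= max C 0) --> nI L (O2 u) <= ennreal E" by blast
 have "nI L (O2 (w n)) <= ennreal E" for n
 using E[rule_format, OF harm_w] C by (auto simp: le_max_iff_disj)
 also have "ennreal E <= eN (max E 0)" by (intro ennreal_leI) simp
 finally show ?thesis by (intro exI[of _ "max E 0"]) auto
qed

lemma Os_sq_lim: "(%n. (Oe (w n) i)^2) \<longlonglongrightarrow> (Oe v i)^2"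
 unfolding ennreal_power[OF O_nonneg[OF fb_w]] ennreal_power[OF O_nonneg[OF fb_v]]
 by (intro tendsto_ennrealI tendsto_power Os_lim)

lemma Os_Fatou: assumes "\<forall>\<^sub>F n in sequentially. ns A (O2 (w n)) <= Z"
 shows "ns A (O2 v) <= Z"
proof -
 have "ns A (O2 v) = ns A (%i. liminf (%n. (Oe (w n) i)^2))"
 using lim_imp_Liminf[OF trivial_limit_sequentially Os_sq_lim] by (intro ns_cong) auto
 also have "... <= liminf (%n. ns A (O2 (w n)))" by (rule ns_Fatou)
 also have "... <= Z" by (rule Liminf_le[OF trivial_limit_sequentially assms])
 finally show ?thesis .
qed

lemma l2loc_v: "l2loc (Oe v)"
 unfolding l2loc_def
proof (intro allI impI)
 fix L assume "compact L" "L <= Om"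
 from energy_bd[OF this] obtain E where E: "ALL n. nI L (O2 (w n)) <= ennreal E" by blast
 have "nI L (O2 v) <= ennreal E" using E by (intro Os_Fatou) auto
 then show "nI L (O2 v) < iN" by (rule order_le_less_trans) simp
qed

text \<open>The index found must also make \<open>w n\<close> uniformly close to \<open>v\<close>,
  so the weight is built for the sequence shifted by \<open>N\<close>.\<close>

lemma weight_v:
 assumes L: "compact L" "L <= Om"
 shows "EX rh. ns UNIV (%i. (rh i)^2) < iN & (ALL X. X <= I L --> ns X rh < iN -->
 (ALL e>0. EX n>=N. ns X (%i. eN (abs(Os (w n) i - Os v i))) <= eN e))"
proof -
 obtain E where E: "E >= 0" "ALL n. nI L (O2 (w n)) <= ennreal E" using energy_bd[OF L] by blast
 have Ev: "nI L (O2 v) <= ennreal E" using E by (intro Os_Fatou) auto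
 define a where "a n i = eN (abs(Os (w (n + N)) i - Os v i))" for n i
 have a1: "nI L (%i. (a n i)^2) <= eN (4 * E)" for n
 proof -
 have "(a n i)^2 <= 2 * (Oe (w (n + N)) i)^2 + 2 * (Oe v i)^2" for i
 proof -
 have "a n i <= eN (Os (w (n + N)) i + Os v i)" unfolding a_def
 using O_nonneg[OF fb_w, of "n + N" i] O_nonneg[OF fb_v, of i] by (intro ennreal_leI) auto
 also have "... = Oe (w (n + N)) i + Oe v i"
 by (rule ennreal_plus[OF O_nonneg[OF fb_w] O_nonneg[OF fb_v]])
 finally have "(a n i)^2 <= (Oe (w (n + N)) i + Oe v i)^2" by (intro power_mono) auto
 then show ?thesis using sq_add_le order_trans by blast
 qed
 then have "nI L (%i. (a n i)^2) <= nI L (%i. 2 * (Oe (w (n + N)) i)^2 + 2 * (Oe v i)^2)"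
 by (intro ns_mono) auto
 also have "... = 2 * nI L (O2 (w (n + N))) + 2 * nI L (O2 v)"
 by (simp only: ns_add ns_cmult)
 also have "... <= 2 * ennreal E + 2 * ennreal E" using E(2) Ev by (intro add_mono mult_left_mono) auto
 also have "... = eN (4 * E)"
 proof -
 have "2 * ennreal E = eN (2 * E)" using ennreal_mult'[of 2 E] by simp
 then show ?thesis using E(1) by (simp add: ennreal_plus[symmetric] del: ennreal_plus)
 qed
 finally show ?thesis .
 qed
 have a2: "(%n. a n i) \<longlonglongrightarrow> 0" for i
 proof -
 have "(%n. Os (w (n + N)) i - Os v i) \<longlonglongrightarrow> Os v i - Os v i"
 by (rule tendsto_diff[OF LIMSEQ_ignore_initial_segment[OF Os_lim] tendsto_const])
 then have "(%n. (abs(Os (w (n + N)) i - Os v i))) \<longlonglongrightarrow> 0" by (simp add: tendsto_rabs_zero_iff)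
 then have "(%n. eN (abs(Os (w (n + N)) i - Os v i))) \<longlonglongrightarrow> ennreal 0" by (rule tendsto_ennrealI)
 then show ?thesis by (simp add: a_def)
 qed
 have "0 <= 4 * E" using E by simp
 from weak_null_weight[of "I L" a, OF a1 this a2] obtain rh where r: "nI L (%i. (rh i)^2) < iN"
 "\<forall>X\<subseteq>I L. ns X rh < iN --> (ALL e>0. EX n. ns X (a n) <= eN e)" by blast
 define rh' where "rh' i = rh i * indicator (I L) i" for i
 have "ns UNIV (%i. (rh' i)^2) = nI L (%i. (rh i)^2)"
 unfolding ns_def by (intro nn_integral_cong) (auto simp: rh'_def split: split_indicator)
 then have fin': "ns UNIV (%i. (rh' i)^2) < iN" using r(1) by simp
 have "EX n>=N. ns X (%i. eN (abs(Os (w n) i - Os v i))) <= eN e" if X: "X <= I L" and f: "ns X rh' < iN" and e: "0 < e" for X and e :: real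
 proof -
 have "ns X rh = ns X rh'" using X by (intro ns_cong) (auto simp: rh'_def)
 then have "ns X rh < iN" using f by simp
 then obtain n where "ns X (a n) <= eN e" using r(2) X e by blast
 then show ?thesis by (intro exI[of _ "n + N"]) (simp add: a_def[abs_def])
 qed
 then show ?thesis by (intro exI[of _ rh'] conjI allI impI fin')
qed

text \<open>Countably many weights, one for each compact set of an exhaustion and each shift, have
  finite sums on almost every path. On such a path some late oscillations are close to those of
  \<open>v\<close> in l1, and the inequalities for \<open>w n\<close> pass to the limit.\<close>

lemma aep_ug_v: "aep (ug v (Oe v))"
proof -
 obtain C :: "nat => complex set" where C0: "ALL n. compact (C n)" "ALL n. C n <= Om" "ALL K. compact K --> K <= Om --> (EX N. ALL n>=N. K <= C n)"
 using exhaust by (elim exE conjE) (rule that)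
 define P where "P m N rh \<longleftrightarrow> ns UNIV (%i. (rh i)^2) < iN & (ALL X. X <= I (C m) --> ns X rh < iN -->
 (ALL e>0. EX n>=N. ns X (%i. eN (abs(Os (w n) i - Os v i))) <= eN e))" for m N rh
 define rh where "rh m N = (SOME rh. P m N rh)" for m N
 have rh: "P m N (rh m N)" for m N
 proof -
 have "EX rh. P m N rh" unfolding P_def by (rule weight_v) (simp_all add: C0)
 then show ?thesis unfolding rh_def by (rule someI_ex)
 qed
 have r1: "ns UNIV (%i. (rh m N i)^2) < iN" for m N using rh[of m N] unfolding P_def by (elim conjE)
 have r2: "EX n>=N. ns X (%i. eN (abs(Os (w n) i - Os v i))) <= eN e"
 if "X <= I (C m)" "ns X (rh m N) < iN" "0 < e" for m N X e
 using conjunct2[OF rh[of m N, unfolded P_def], THEN spec, THEN mp, OF that(1), THEN mp, OF that(2), THEN spec, THEN mp, OF that(3)] .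
 have "aep (ug (w n) (Oe (w n)))" for n using sob_w by (simp add: sob_def)
 then have A1: "aep (%gm. ALL n. ug (w n) (Oe (w n)) gm)" by (rule aep_all)
 have "aep (%gm. ALL N. nI (img gm) (rh m N) < iN)" for m by (intro aep_all aep_l2 r1)
 then have A2: "aep (%gm. ALL m N. nI (img gm) (rh m N) < iN)" by (rule aep_all)
 show ?thesis
 proof (rule aep_mono[OF aep_conj[OF A1 A2]])
 fix gm assume g: "gm : paths_in Om" and "(ALL n. ug (w n) (Oe (w n)) gm) & (ALL m N. nI (img gm) (rh m N) < iN)"
 then have ugw: "!!n. ug (w n) (Oe (w n)) gm" and fin: "!!m N. nI (img gm) (rh m N) < iN" by simp_all
 show "ug v (Oe v) gm"
 unfolding ug_def
 proof (intro ballI impI)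
 fix s t assume st: "s : fst gm" "t : fst gm" "s <= t" and S: "snd gm s : S" "snd gm t : S"
 let ?X = "snd gm ` {s..t}"
 have sub: "{s..t} <= fst gm" using g st interval_sub by (auto simp: paths_in_def is_plane_path_def)
 have Xi: "?X <= img gm" using sub by (auto simp: img_def)
 have XO: "?X <= Om" using Xi g by (auto simp: paths_in_def)
 have cX: "compact ?X" using path_cont[OF g sub] by (intro compact_continuous_image) auto
 obtain m where m: "?X <= C m" using C0(3)[rule_format, OF cX XO] by blast
 have mem: "snd gm s : S Int ?X" "snd gm t : S Int ?X" using st S by auto
 show "eN (abs(v (snd gm s) - v (snd gm t))) <= ns (I ?X) (Oe v)"
 proof (rule ennreal_le_epsilon)
 fix e :: real assume e: "0 < e"
 then have e3: "0 < e / 3" by simp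
 obtain N where N: "ALL n>=N. ALL x:S Int ?X. (abs(w n x - v x)) <= e / 3" using lim_close[OF cX XO e3] by blast
 have "ns (I ?X) (rh m N) <= nI (img gm) (rh m N)" using Xi by (intro ns_mono I_mono) auto
 then have "ns (I ?X) (rh m N) < iN" using fin by (rule order_le_less_trans)
 from r2[OF I_mono[OF m] this e3] obtain n where n: "N <= n" "ns (I ?X) (%i. eN (abs(Os (w n) i - Os v i))) <= eN (e / 3)" by blast
 have "(abs(v (snd gm s) - v (snd gm t))) <= (abs(w n (snd gm s) - w n (snd gm t))) + 2 * (e / 3)"
 using N[rule_format, OF n(1) mem(1)] N[rule_format, OF n(1) mem(2)] by linarith
 then have "eN (abs(v (snd gm s) - v (snd gm t))) <= eN ((abs(w n (snd gm s) - w n (snd gm t))) + 2 * (e / 3))" by (rule ennreal_leI)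
 also have "... = eN (abs(w n (snd gm s) - w n (snd gm t))) + eN (2 * (e / 3))" using e by (intro ennreal_plus) auto
 also have "eN (abs(w n (snd gm s) - w n (snd gm t))) <= ns (I ?X) (Oe (w n))"
 using ugw[of n] st S unfolding ug_def by blast
 also have "... <= ns (I ?X) (%i. Oe v i + eN (abs(Os (w n) i - Os v i)))"
 proof (intro ns_mono order_refl)
 fix i
 have "Oe (w n) i <= eN (Os v i + (abs(Os (w n) i - Os v i)))" by (intro ennreal_leI) linarith
 then show "Oe (w n) i <= Oe v i + eN (abs(Os (w n) i - Os v i))"
 using O_nonneg[OF fb_v, of i] by (simp add: ennreal_plus)
 qed
 also have "... = ns (I ?X) (Oe v) + ns (I ?X) (%i. eN (abs(Os (w n) i - Os v i)))" by (rule ns_add)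
 also have "... <= ns (I ?X) (Oe v) + eN (e / 3)" using n(2) by (intro add_mono) auto
 finally have "eN (abs(v (snd gm s) - v (snd gm t))) <= ns (I ?X) (Oe v) + eN (e / 3) + eN (2 * (e / 3))"
 by (simp add: add_right_mono)
 also have "... = ns (I ?X) (Oe v) + eN e"
 using e unfolding add.assoc by (subst ennreal_plus[symmetric]) auto
 finally show "eN (abs(v (snd gm s) - v (snd gm t))) <= ns (I ?X) (Oe v) + eN e" .
 qed
 qed
 qed
qed

lemma sob_v: "sob v"
 using fb_v l2loc_v aep_ug_v by (simp add: sob_def)

section \<open>Gluing the limit to the sequence\<close>

lemma mix_le:
 fixes a b A B :: real
 assumes "0 <= p" "p <= 1" "a <= M" "b <= M" "d <= D"
 shows "(1 - p) * a + p * b + d <= M + D"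
proof -
 have "(1 - p) * a <= (1 - p) * M" "p * b <= p * M" using assms by (auto intro: mult_left_mono)
 then show ?thesis using assms(5) by (simp add: algebra_simps)
qed

text \<open>A convex combination of the two increments plus a product-rule error, in which the small
  difference of the functions multiplies the variation of the cutoff.\<close>

lemma Os_mix:
 assumes et: "!!x. 0 <= et x & et x <= 1" "!!x. x ~: K ==> et x = 0" "!!x y. (abs(et x - et y)) <= c * dist x y" and c: "0 <= c" and e: "0 <= e"
 and d: "fr i Int K ~= {} ==> (ALL x:fr i. (abs(v x - w n x)) <= e)" and fb: "fb (%x. w n x + et x * (v x - w n x))"
 shows "Os (%x. w n x + et x * (v x - w n x)) i <= max (Os (w n) i) (Os v i) + c * dm i * e"
proof (rule O_le[OF fb])
 fix x y assume xy: "x : fr i" "y : fr i"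
 have nn: "0 <= c * dm i * e" using c e dm_nonneg by simp
 have W: "w n x - w n y <= max (Os (w n) i) (Os v i)" and V: "v x - v y <= max (Os (w n) i) (Os v i)"
 using O_ge[OF fb_w xy, of n] O_ge[OF fb_v xy] by (auto simp: abs_le_iff le_max_iff_disj)
 show "w n x + et x * (v x - w n x) - (w n y + et y * (v y - w n y)) <= max (Os (w n) i) (Os v i) + c * dm i * e"
 proof (cases "fr i Int K = {}")
 case True
 then have "et x = 0" "et y = 0" using xy et(2) by blast+
 then show ?thesis using W nn by simp
 next
 case False
 have "dist x y <= dm i" using xy by (intro closure_dist) (auto simp: frontier_def)
 then have "(abs(et x - et y)) <= c * dm i" using et(3)[of x y] c by (meson mult_left_mono order_trans)
 moreover have "(abs(v y - w n y)) <= e" using d[OF False] xy by blast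
 ultimately have "(abs(et x - et y)) * (abs(v y - w n y)) <= c * dm i * e" using e by (intro mult_mono) (auto intro: order_trans[OF abs_ge_zero])
 then have D: "(et x - et y) * (v y - w n y) <= c * dm i * e" unfolding abs_mult[symmetric] by simp
 have "w n x + et x * (v x - w n x) - (w n y + et y * (v y - w n y)) =
 (1 - et x) * (w n x - w n y) + et x * (v x - v y) + (et x - et y) * (v y - w n y)" by (simp add: algebra_simps)
 also have "... <= max (Os (w n) i) (Os v i) + c * dm i * e" using et(1) by (intro mix_le W V D) auto
 finally show ?thesis .
 qed
qed

text \<open>Isolates \<open>a^2\<close>, to be cancelled against the energy of \<open>w n\<close>.
  What remains is either of order \<open>e\<close> or the positive part of
  \<open>b^2 - a^2\<close>.\<close>

lemma max_sq_ineq: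
 fixes a b e D :: real
 assumes x: "0 <= x" "x <= max a b + D * e" and "0 <= a" "0 <= b" "0 <= D" "0 <= e"
 shows "x^2 <= a^2 + (e * a^2 + ((1 + e) * max 0 (b^2 - a^2) + (e + e^2) * D^2))"
proof -
 define m where "m = max a b"
 have m: "m^2 = a^2 + max 0 (b^2 - a^2)" using assms by (auto simp: m_def max_def power_mono_iff)
 have "x^2 <= (m + D * e)^2" using x by (intro power_mono) (auto simp: m_def)
 also have "... = m^2 + e * (2 * m * D) + e^2 * D^2" by (simp add: power2_eq_square algebra_simps)
 also have "... <= m^2 + e * (m^2 + D^2) + e^2 * D^2"
 proof -
 have "0 <= (m - D)^2" by simp
 then have "2 * m * D <= m^2 + D^2" by (simp add: power2_eq_square algebra_simps)
 then show ?thesis using assms by (intro add_mono mult_left_mono) auto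
 qed
 also have "... = a^2 + (e * a^2 + ((1 + e) * max 0 (b^2 - a^2) + (e + e^2) * D^2))" unfolding m by (simp add: algebra_simps)
 finally show ?thesis .
qed

text \<open>The competitor for \<open>w n\<close> is \<open>v\<close> plus the variation on the
  disks meeting \<open>V\<close>, and returns to \<open>w n\<close> through the cutoff. On the
  transition disks strong convergence is not at hand, but the positive part of the energy excess of
  \<open>v\<close> over \<open>w n\<close> is dominated by the energy of \<open>v\<close> and tends
  to 0.\<close>

theorem v_harmonic: "carpet_harmonic ver Om Q (%x. ereal (v x))"
 unfolding carpet_harmonic_def
proof (intro conjI allI impI)
 show "(%x. ereal (v x)) : W12_loc ver Om Q" by (rule sob_W12_loc[OF sob_v v_bd])
 fix V ze assume "open V & V \<subset>\<subset> Om & ze : W12 ver Om Q & (ALL x:S - V. ze x = 0)"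
 then have V: "open V" "V \<subset>\<subset> Om" and ze: "ze : W12 ver Om Q" "!!x. x : S - V ==> ze x = 0" by blast+
 define z where "z x = real_of_ereal (ze x)" for x
 have zel: "ze : W12_loc ver Om Q" using ze by (simp add: W12_def)
 have sz: "sob z" and zfr: "!!i x. x : fr i ==> ze x = ereal (z x)"
 using W12_locD(1,5)[OF zel] unfolding z_def[abs_def] by blast+
 have fz: "fb z" using sz by (simp add: sob_def)
 have oscz: "osc Q (%x. ereal (f x) + ze x) i = Oe (%x. f x + z x) i" if f: "fb f" for f i
 proof -
 have "osc Q (%x. ereal (f x) + ze x) i = osc Q (%x. ereal (f x + z x)) i"
 unfolding osc_def peri_sup_def peri_inf_def using zfr by (simp cong: SUP_cong INF_cong)
 then show ?thesis using osc_eq[OF fb_add[OF f fz]] by simp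
 qed
 define Z where "Z = nI V (O2 (%x. v x + z x))"
 have cV: "compact (closure V)" "closure V <= Om" using V by (auto simp: ccontained_def)
 \<comment> \<open>The cutoff will be 1 on all closed disks touching \<open>closure V\<close>, so
   that on their circles the competitor is exactly \<open>v x + z x\<close>.\<close>
 obtain V1 where V1: "open V1" "V1 \<subset>\<subset> Om" "closure V <= V1" "ALL i. cQ i Int closure V ~= {} --> cQ i <= V1"
 using encl[OF cV] by (elim exE conjE) (rule that)
 have c1: "compact (closure V1)" "closure V1 <= Om" using V1 by (auto simp: ccontained_def)
 obtain et K c where K: "compact K" "K <= Om" and c: "c >= 0" and et: "ALL x. 0 <= et x & et x <= 1" "ALL x:closure V1. et x = 1"
 "ALL x. x ~: K --> et x = (0::real)" "ALL x y. (abs(et x - et y)) <= c * dist x y"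
 using cutoff[OF c1] by (elim exE conjE) (rule that)
 have "compact (K Un closure V1)" "K Un closure V1 <= Om" using K c1 by auto
 from encl[OF this] obtain V2 where V2: "open V2" "V2 \<subset>\<subset> Om" "K Un closure V1 <= V2"
 "ALL i. cQ i Int (K Un closure V1) ~= {} --> cQ i <= V2"
 by (elim exE conjE) (rule that)
 define K2 where "K2 = closure V2"
 have K2: "compact K2" "K2 <= Om" "V2 <= K2" using V2 closure_subset by (auto simp: ccontained_def K2_def)
 \<comment> \<open>The transition disks: the variation vanishes on their circles, but the cutoff may
   vary there.\<close>
 define T where "T = I V2 - I V"
 have "V <= V2" using V1(3) V2(3) closure_subset[of V] closure_subset[of V1] by blast
 then have IV: "I V2 = I V Un T" "I V Int T = {}" using I_mono[of V V2] by (auto simp: T_def)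
 have Tsub: "T <= I K2" using I_mono[OF K2(3)] by (auto simp: T_def)
 obtain E where E: "E >= 0" "ALL n. nI K2 (O2 (w n)) <= ennreal E" using energy_bd[OF K2(1,2)] by blast
 have ET: "ns T (O2 (w n)) <= ennreal E" for n
 proof -
 have "ns T (O2 (w n)) <= nI K2 (O2 (w n))" using Tsub by (intro ns_mono) auto
 then show ?thesis using E(2) order_trans by blast
 qed
 define h where "h n x = et x * (v x - w n x)" for n x
 have th: "tst (h n)" for n
 proof -
 obtain C1 where C1: "ALL x:S Int K. (abs(v x)) <= C1" using v_bd[OF K] by blast
 obtain C2 where C2: "ALL n. ALL x:S Int K. (abs(w n x)) <= C2" using bd[OF K] by blast
 have fbm: "fb (%x. v x + - w n x)" by (intro fb_add fb_uminus fb_v fb_w)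
 have g1: "aep (ug (%x. v x + - w n x) (%i. Oe v i + Oe (w n) i))"
 proof (rule aep_mono[OF aep_conj])
 show "aep (ug v (Oe v))" by (rule aep_ug_v)
 show "aep (ug (w n) (Oe (w n)))" using sob_w by (simp add: sob_def)
 fix gm assume "ug v (Oe v) gm & ug (w n) (Oe (w n)) gm"
 then show "ug (%x. v x + - w n x) (%i. Oe v i + Oe (w n) i) gm"
 by (intro ug_add) (simp_all add: ug_uminus)
 qed
 have g2: "l2loc (%i. Oe v i + Oe (w n) i)"
 using sob_w[of n] by (intro l2loc_add l2loc_v) (simp add: sob_def)
 have g3: "Oe (%x. v x + - w n x) i <= Oe v i + Oe (w n) i" for i
 proof -
 have "Os (%x. v x + - w n x) i <= Os v i + Os (w n) i"
 using O_add[OF fb_v fb_uminus[OF fb_w], of n i] O_uminus[OF fb_w, of n i] by simp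
 then have "Oe (%x. v x + - w n x) i <= eN (Os v i + Os (w n) i)" by (rule ennreal_leI)
 then show ?thesis by (simp add: ennreal_plus[OF O_nonneg[OF fb_v] O_nonneg[OF fb_w]])
 qed
 have g4: "(abs(v x + - w n x)) <= max 0 (C1 + C2)" if "x : S Int K" for x
 using C1[rule_format, OF that] C2[rule_format, OF that, of n] by (auto simp: le_max_iff_disj abs_le_iff)
 have "tst (%x. et x * (v x + - w n x))"
 proof (rule tst_cutoff[OF K c _ _ _ g1 g2 g3 fbm max.cobounded1[of 0 "C1 + C2"]])
 show "0 <= et x & et x <= 1" "(abs(et x - et y)) <= c * dist x y" for x y using et(1,4) by simp_all
 show "et x = 0" if "x ~: K" for x using et(3) that by simp
 show "(abs(v x + - w n x)) <= max 0 (C1 + C2)" if "x : S Int K" for x using that by (rule g4)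
 qed
 then show ?thesis by (simp add: h_def[abs_def])
 qed
 define f where "f n x = w n x + (z x + h n x)" for n x
 have fbf: "fb (f n)" for n unfolding f_def[abs_def] by (intro fb_add fb_w fz tst_fb th)
 have min: "nI V2 (O2 (w n)) <= nI V2 (O2 (f n))" for n
 proof -
 let ?ze = "%x. ereal (real_of_ereal (ze x) + h n x)"
 have "?ze : W12 ver Om Q" by (rule W12_add[OF ze(1) th])
 moreover have "?ze x = 0" if "x : S - V2" for x
 proof -
 have "x : S - V" "x ~: K" using that \<open>V <= V2\<close> V2(3) by blast+
 then show ?thesis using ze(2)[of x] et(3) by (simp add: h_def)
 qed
 ultimately have "energy Q V2 (%x. ereal (w n x)) <= energy Q V2 (%x. ereal (w n x) + ?ze x)"
 using ch[of n] V2(1,2) unfolding carpet_harmonic_def by blast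
 then show ?thesis unfolding energy_def ns_infsum
 using osc_eq[OF fb_w, of n] osc_eq[OF fbf, of n] by (simp add: f_def[abs_def] z_def)
 qed
 have fV: "Os (f n) i = Os (%x. v x + z x) i" if i: "i : I V" for n i
 proof (rule O_cong)
 fix x assume x: "x : fr i"
 have "cQ i Int closure V ~= {}" using i closure_subset[of V] closure_subset[of "Q i"] by (auto simp: meeting_def)
 then have "x : closure V1" using V1(4) x closure_subset by (auto simp: frontier_def)
 then show "f n x = v x + z x" using et(2) by (simp add: f_def h_def)
 qed
 have z0: "z x = 0" if i: "i ~: I V" and x: "x : fr i" for i x
 proof -
 have "x ~: V" using open_I_closure[OF V(1), of i] i x by (auto simp: frontier_def)
 then have "ze x = 0" using ze(2) x fr_S by blast
 then show ?thesis by (simp add: z_def)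
 qed
 have fT: "(Oe (f n) i)^2 <= (Oe (w n) i)^2 + (eN e * (Oe (w n) i)^2 +
 (eN (1 + e) * eN (max 0 ((Os v i)^2 - (Os (w n) i)^2)) + eN ((e + e^2) * c^2) * eN ((dm i)^2)))"
 if i: "i : T" and e: "0 <= e" and close: "ALL x:S Int K2. (abs(w n x - v x)) <= e" for n i e
 proof -
 let ?g = "%x. w n x + et x * (v x - w n x)"
 have "Os (f n) i = Os ?g i" using z0 i by (intro O_cong) (auto simp: f_def h_def T_def)
 also have "... <= max (Os (w n) i) (Os v i) + c * dm i * e"
 proof (rule Os_mix[where K=K])
 show "0 <= et x & et x <= 1" "x ~: K ==> et x = 0" "(abs(et x - et y)) <= c * dist x y" for x y using et by blast+
 show "fb ?g" using fb_add[OF fb_w tst_fb[OF th], of n n] by (simp add: h_def[abs_def])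
 show "ALL x:fr i. (abs(v x - w n x)) <= e" if fK: "fr i Int K ~= {}"
 proof
 fix x assume x: "x : fr i"
 have "cQ i <= K2" using V2(4) fK K2(3) by (auto simp: frontier_def)
 then have "x : S Int K2" using x fr_S by (auto simp: frontier_def)
 then show "(abs(v x - w n x)) <= e" using close by (simp add: abs_minus_commute)
 qed
 qed (use c e in auto)
 finally have "(Os (f n) i)^2 <= (Os (w n) i)^2 + (e * (Os (w n) i)^2 + ((1 + e) * max 0 ((Os v i)^2 - (Os (w n) i)^2) + (e + e^2) * (c * dm i)^2))"
 using O_nonneg[OF fbf] O_nonneg[OF fb_w] O_nonneg[OF fb_v] c dm_nonneg e by (intro max_sq_ineq) auto
 then have "eN ((Os (f n) i)^2) <= eN ((Os (w n) i)^2 + (e * (Os (w n) i)^2 + ((1 + e) * max 0 ((Os v i)^2 - (Os (w n) i)^2) + (e + e^2) * (c * dm i)^2)))"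
 by (rule ennreal_leI)
 also have "... = eN ((Os (w n) i)^2) + (eN (e * (Os (w n) i)^2) + (eN ((1 + e) * max 0 ((Os v i)^2 - (Os (w n) i)^2)) + eN ((e + e^2) * (c * dm i)^2)))"
 proof -
 have p: "eN (a + b) = eN a + eN b" if "0 <= a" "0 <= b" for a b :: real using that by (rule ennreal_plus)
 have nn: "0 <= (1 + e) * max 0 ((Os v i)^2 - (Os (w n) i)^2)" "0 <= (e + e^2) * (c * dm i)^2" "0 <= e * (Os (w n) i)^2"
 using e by auto
 show ?thesis using nn by (subst p, simp, (intro add_nonneg_nonneg; simp), subst p, simp, (intro add_nonneg_nonneg; simp), subst p, simp_all)
 qed
 also have "eN (e * (Os (w n) i)^2) = eN e * eN ((Os (w n) i)^2)" using e by (intro ennreal_mult) auto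
 also have "eN ((1 + e) * max 0 ((Os v i)^2 - (Os (w n) i)^2)) = eN (1 + e) * eN (max 0 ((Os v i)^2 - (Os (w n) i)^2))"
 using e by (intro ennreal_mult) auto
 also have "eN ((e + e^2) * (c * dm i)^2) = eN ((e + e^2) * c^2) * eN ((dm i)^2)"
 using e by (subst ennreal_mult[symmetric]) (auto simp: power_mult_distrib mult.assoc)
 finally show ?thesis by (simp add: ennreal_power O_nonneg[OF fbf] O_nonneg[OF fb_w])
 qed
 define d where "d n = ns T (%i. eN (max 0 ((Os v i)^2 - (Os (w n) i)^2)))" for n
 have "d \<longlonglongrightarrow> 0" unfolding d_def[abs_def]
 proof (rule ns_dominated)
 have "ns T (O2 v) <= nI K2 (O2 v)" using Tsub by (intro ns_mono) auto
 also have "... < iN" by (rule l2locD[OF l2loc_v K2(1,2)])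
 finally show "ns T (O2 v) < iN" .
 show "eN (max 0 ((Os v i)^2 - (Os (w n) i)^2)) <= (Oe v i)^2" for n i
 unfolding ennreal_power[OF O_nonneg[OF fb_v]] by (intro ennreal_leI) auto
 fix i
 have "(%n. max 0 ((Os v i)^2 - (Os (w n) i)^2)) \<longlonglongrightarrow> max 0 ((Os v i)^2 - (Os v i)^2)"
 by (intro tendsto_max tendsto_const tendsto_diff tendsto_power Os_lim)
 then have "(%n. max 0 ((Os v i)^2 - (Os (w n) i)^2)) \<longlonglongrightarrow> 0" by simp
 then have "(%n. eN (max 0 ((Os v i)^2 - (Os (w n) i)^2))) \<longlonglongrightarrow> ennreal 0" by (rule tendsto_ennrealI)
 then show "(%n. eN (max 0 ((Os v i)^2 - (Os (w n) i)^2))) \<longlonglongrightarrow> 0" by simp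
 qed
 have "ns T (%i. eN ((dm i)^2)) <= nI K2 (%i. eN ((dm i)^2))" using Tsub by (intro ns_mono) auto
 also have "... < iN" by (rule sum_diam_sq) (use K2 compact_imp_bounded in auto)
 finally obtain D where D: "ns T (%i. eN ((dm i)^2)) = ennreal D" "0 <= D" by (cases "ns T (%i. eN ((dm i)^2))") auto
 have "nI V (O2 v) <= Z"
 proof (rule ennreal_le_epsilon)
 fix dl :: real assume dl: "0 < dl"
 \<comment> \<open>The quotient bounds the linear error terms by \<open>dl / 3\<close> together; the
   1 gives \<open>1 + e <= 2\<close> and \<open>e^2 <= e\<close>.\<close>
 define e where "e = min 1 (dl / (3 * (E + 2 * c^2 * D + 1)))"
 have q: "0 < E + 2 * c^2 * D + 1" using E D by (simp add: add_nonneg_pos)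
 have e: "0 < e" "e <= 1" using dl q by (auto simp: e_def)
 have "e * (E + 2 * c^2 * D + 1) <= dl / (3 * (E + 2 * c^2 * D + 1)) * (E + 2 * c^2 * D + 1)"
 using q by (intro mult_right_mono) (auto simp: e_def)
 also have "dl / (3 * t) * t = dl / 3" if "0 < t" for t using that by simp
 note this[OF q]
 finally have eq: "e * (E + 2 * c^2 * D + 1) <= dl / 3" .
 have "(0::ennreal) < eN (dl / 6)" using dl by simp
 from order_tendstoD(2)[OF \<open>d \<longlonglongrightarrow> 0\<close> this] obtain N1 where N1: "!!n. n >= N1 ==> d n < eN (dl / 6)" by (auto simp: eventually_sequentially)
 obtain N2 where N2: "ALL n>=N2. ALL x:S Int K2. (abs(w n x - v x)) <= e" using lim_close[OF K2(1,2) e(1)] by blast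
 have "nI V (O2 (w n)) <= Z + ennreal dl" if n: "n >= max N1 N2" for n
 proof -
 let ?A = "%i. (Oe (w n) i)^2"
 let ?r = "eN e * ns T ?A + (eN (1 + e) * d n + eN ((e + e^2) * c^2) * ennreal D)"
 have "ns T ?A + nI V ?A = nI V2 ?A" using IV ns_Un_disj[of "I V" T ?A] by (simp add: add.commute)
 also have "... <= nI V2 (O2 (f n))" by (rule min)
 also have "... = nI V (O2 (f n)) + ns T (O2 (f n))" using IV ns_Un_disj by simp
 also have "nI V (O2 (f n)) = Z" unfolding Z_def using fV by (intro ns_cong) auto
 also have "ns T (O2 (f n)) <= ns T (%i. ?A i + (eN e * ?A i +
 (eN (1 + e) * eN (max 0 ((Os v i)^2 - (Os (w n) i)^2)) + eN ((e + e^2) * c^2) * eN ((dm i)^2))))"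
 using e n N2 by (intro ns_mono fT order_refl) auto
 also have "... = ns T ?A + ?r" unfolding ns_add ns_cmult d_def D(1) ..
 \<comment> \<open>The energy of \<open>w n\<close> on the transition disks is finite and
   cancels.\<close>
 finally have "ns T ?A + nI V ?A <= ns T ?A + (Z + ?r)" by (simp add: ac_simps)
 moreover have "ns T ?A < top" using ET[of n] by (rule order_le_less_trans) simp
 ultimately have "nI V ?A <= Z + ?r" by (subst (asm) ennreal_add_left_cancel_le) auto
 also have "?r <= ennreal dl"
 proof -
 have "?r <= eN e * ennreal E + (ennreal 2 * eN (dl / 6) + eN (2 * e * c^2) * ennreal D)"
 proof (intro add_mono mult_mono ET)
 show "d n <= eN (dl / 6)" using N1[of n] n by simp
 have "e^2 <= e" using e by (simp add: power2_eq_square mult_left_le)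
 then show "eN ((e + e^2) * c^2) <= eN (2 * e * c^2)" by (intro ennreal_leI mult_right_mono) auto
 show "eN (1 + e) <= ennreal 2" using e by (intro ennreal_leI) simp
 qed auto
 also have "eN e * ennreal E = eN (e * E)" using e E by (intro ennreal_mult[symmetric]) auto
 also have "ennreal 2 * eN (dl / 6) = eN (dl / 3)" using dl by (subst ennreal_mult[symmetric]) auto
 also have "eN (2 * e * c^2) * ennreal D = eN (2 * e * c^2 * D)" using e D by (intro ennreal_mult[symmetric]) auto
 also have "eN (dl / 3) + eN (2 * e * c^2 * D) = eN (dl / 3 + 2 * e * c^2 * D)" using e D dl by (intro ennreal_plus[symmetric]) auto
 also have "eN (e * E) + eN (dl / 3 + 2 * e * c^2 * D) = eN (e * E + (dl / 3 + 2 * e * c^2 * D))"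
 using e D E dl by (intro ennreal_plus[symmetric]) auto
 also have "... <= ennreal dl"
 proof (rule ennreal_leI)
 have "e * E + 2 * e * c^2 * D + e = e * (E + 2 * c^2 * D + 1)" by (simp add: algebra_simps)
 then show "e * E + (dl / 3 + 2 * e * c^2 * D) <= dl" using e eq dl by linarith
 qed
 finally show ?thesis .
 qed
 finally show ?thesis by (simp add: add_left_mono)
 qed
 then show "nI V (O2 v) <= Z + ennreal dl" by (intro Os_Fatou eventually_sequentiallyI[of "max N1 N2"])
 qed
 then show "energy Q V (%x. ereal (v x)) <= energy Q V (%x. ereal (v x) + ze x)"
 unfolding energy_def ns_infsum Z_def by (simp add: osc_eq[OF fb_v] oscz[OF fb_v])
qed

end

section \<open>The limit is normalized\<close>

context rel_carpet begin

text \<open>Near x only finitely many disks have diameter at least \<open>r / 2\<close>, and those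
  not touching x keep a distance from it.\<close>

lemma small_disks:
 assumes x: "x : S" and r: "0 < r"
 shows "EX d>0. d <= r & (ALL k. Q k Int ball x d ~= {} --> x ~: cQ k --> Q k <= ball x r)"
proof -
 define F where "F = {i : I (cball x r). r / 2 <= dm i}"
 have F: "finite F" unfolding F_def by (rule finite_large) (use r in auto)
 define U where "U = - (\<Union>i\<in>{i : F. x ~: cQ i}. (cQ i))"
 have "open U" "x : U" using F by (auto simp: U_def intro!: open_Compl closed_UN)
 then obtain d0 where d0: "d0 > 0" "ball x d0 <= U" using open_contains_ball by blast
 define d where "d = min d0 (r / 2)"
 have d: "0 < d" "d <= d0" "d <= r / 2" using d0 r by (auto simp: d_def)
 have "Q k <= ball x r" if k: "Q k Int ball x d ~= {}" and nk: "x ~: cQ k" for k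
 proof -
 obtain z where z: "z : Q k" "z : ball x d" using k by blast
 have "z : U" using z d d0(2) by auto
 have "k ~: F"
 proof
 assume "k : F"
 then have "cQ k Int U = {}" using nk by (auto simp: U_def)
 then show False using z \<open>z : U\<close> closure_subset by blast
 qed
 moreover have "k : I (cball x r)" using z d r by (auto simp: meeting_def)
 ultimately have dk: "dm k < r / 2" by (simp add: F_def)
 show ?thesis
 proof
 fix y assume "y : Q k"
 then have "dist z y <= dm k" using z closure_subset by (intro closure_dist) auto
 then show "y : ball x r" using z d dk dist_triangle[of x y z] by simp
 qed
 qed
 then show ?thesis using d r by (intro exI[of _ d]) auto
qed

lemma access_closure: "accesses Om Q x gm0 gm ==> x : closure (img gm)"
 using closure_subset[of "img gm0"] by (auto simp: accesses_def split: if_splits)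

text \<open>Rules out the trivial filter, for which a limes inferior is plus infinity. Near x the
  path has a nondegenerate piece, which meets a disk by \<open>contact\<close>; that disk does not
  touch x and is small.\<close>

lemma access_nontrivial:
 assumes gp: "gpath f gm" and p: "p : img gm" "p ~= x" and x: "x : S" "x : closure (img gm)"
 and av: "!!i. x : fr i ==> img gm Int Q i = {}"
 shows "disks_to Q gm x ~= bot"
proof
 assume "disks_to Q gm x = bot"
 then have "eventually (%_. False) (disks_to Q gm x)" by simp
 then obtain r where r: "r > 0" "ALL i:I (img gm). ~ Q i <= ball x r" unfolding ev_disks_to by blast
 obtain d where d: "d > 0" "ALL k. Q k Int ball x d ~= {} --> x ~: cQ k --> Q k <= ball x r" using small_disks[OF x(1) r(1)] by blast
 define l where "l = min d (dist p x) / 2"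
 have l: "0 < l" "l < d" "l < dist p x" using d p by (auto simp: l_def min_def)
 let ?J = "fst gm" and ?h = "snd gm"
 have J: "is_interval ?J" "continuous_on (closure ?J) ?h" and JO: "?h ` ?J <= Om"
 using gpathD(1)[OF gp] by (auto simp: paths_in_def is_plane_path_def img_def)
 have cJ: "continuous_on ?J ?h" using continuous_on_subset[OF J(2) closure_subset] .
 obtain a where a: "a : img gm" "dist a x < l" using x(2) l(1) unfolding closure_approachable by blast
 obtain ta tp where t: "ta : ?J" "?h ta = a" "tp : ?J" "?h tp = p" using a p by (auto simp: img_def)
 have cd: "continuous_on ?J (%sg. dist (?h sg) x)" using cJ by (intro continuous_intros)
 obtain c where c: "c : ?J" "dist (?h c) x = l" "ALL sg:{min ta c..max ta c}. sg : ?J & dist (?h sg) x <= l"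
 using cross_first[OF cd J(1) t(1,3), of l] a t l by auto
 define X where "X = ?h ` {min ta c..max ta c}"
 have sub: "{min ta c..max ta c} <= ?J" using c(3) by blast
 have Xi: "X <= img gm" using sub by (auto simp: X_def img_def)
 have "I X ~= {}"
 proof (rule contact)
 show "connected X" unfolding X_def by (intro connected_continuous_image continuous_on_subset[OF cJ sub]) auto
 show "X <= Om" using Xi JO by (auto simp: img_def)
 have "hausdorff 1 (X Int S) <= hausdorff 1 (img gm Int S)" using Xi by (intro hausdorff_mono) auto
 then show "hausdorff 1 (X Int S) = 0" using gpathD(2)[OF gp] by simp
 show "a : X" "?h c : X" using t(2) by (auto simp: X_def)
 show "a ~= ?h c" using a c by auto
 qed
 then obtain k where k: "k : I X" by blast
 then have ki: "k : I (img gm)" using I_mono[OF Xi] by blast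
 have "X <= ball x d" using c(3) l by (auto simp: X_def dist_commute)
 then have "Q k Int ball x d ~= {}" using k by (auto simp: meeting_def)
 moreover have "x ~: cQ k"
 proof
 assume "x : cQ k"
 then have "x : fr k" using cQ_S x(1) by blast
 then show False using av ki by (auto simp: meeting_def)
 qed
 ultimately have "Q k <= ball x r" using d(2) by blast
 then show False using r(2) ki by blast
qed

text \<open>Disks close to x carry values close to \<open>f x\<close>, so the limes inferior is a
  limit along a proper filter, independently of the path selected.\<close>

lemma access_value_cont:
 assumes r: "rep G f" and cont: "!!x e. x : S ==> 0 < e ==> EX dl>0. ALL y:S Int ball x dl. (abs(f x - f y)) <= e"
 and ac: "accessible Om Q G x"
 shows "access_value Om Q G x = ereal (f x)"
proof -
 have xS: "x : S" using ac by (simp add: accessible_def)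
 define gm where "gm = (SOME gm. EX gm0:good_paths Om Q G. accesses Om Q x gm0 gm)"
 have "EX gm. EX gm0:good_paths Om Q G. accesses Om Q x gm0 gm" using ac unfolding accessible_def by blast
 then have "EX gm0:good_paths Om Q G. accesses Om Q x gm0 gm" unfolding gm_def by (rule someI_ex)
 then obtain gm0 where g0: "gm0 : good_paths Om Q G" "accesses Om Q x gm0 gm" by blast
 note gp = access_path[OF r xS g0]
 obtain p where p: "p : img gm" "p ~= x" using gp(2) by blast
 have nb: "disks_to Q gm x ~= bot" by (rule access_nontrivial[OF gp(1) p xS access_closure[OF g0(2)] gp(3)])
 have fb: "fb f" and ps: "peri_sup Q G = (%i. ereal (Ms f i))" using r by (auto simp: rep_def)
 have "((%i. Ms f i) \<longlongrightarrow> f x) (disks_to Q gm x)"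
 proof (rule tendstoI)
 fix e :: real assume e: "0 < e"
 then have "0 < e / 2" by simp
 from cont[OF xS this] obtain dl where dl: "dl > 0" "ALL y:S Int ball x dl. (abs(f x - f y)) <= e / 2" by blast
 have "dist (Ms f k) (f x) < e" if k: "Q k <= ball x (dl/2)" for k
 proof -
 have cl: "cQ k <= cball x (dl/2)" using k by (intro closure_minimal) (auto simp: less_imp_le)
 have b: "(abs(f x - f y)) <= e / 2" if "y : fr k" for y
 proof -
 have "y : cball x (dl/2)" "y : S" using cl that fr_S by (auto simp: frontier_def)
 then show ?thesis using dl by auto
 qed
 obtain y where y: "y : fr k" using fr_ne by blast
 have "f w <= f x + e / 2" if "w : fr k" for w using b[OF that] by linarith
 then have "Ms f k <= f x + e / 2" by (rule Ms_least)
 moreover have "f x - e / 2 <= Ms f k" using b[OF y] Ms_upper[OF fb y] by linarith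
 ultimately have "(abs(Ms f k - f x)) < e" using e by linarith
 then show ?thesis by (simp add: dist_real_def)
 qed
 then show "\<forall>\<^sub>F k in disks_to Q gm x. dist (Ms f k) (f x) < e"
 unfolding ev_disks_to using dl(1) by (intro exI[of _ "dl/2"]) auto
 qed
 then have "((%i. ereal (Ms f i)) \<longlongrightarrow> ereal (f x)) (disks_to Q gm x)" by simp
 then have "Liminf (disks_to Q gm x) (peri_sup Q G) = ereal (f x)" unfolding ps by (rule lim_imp_Liminf[OF nb])
 then show ?thesis by (simp add: access_value_def gm_def)
qed

lemma exit_accessible:
 assumes g: "gl f b y" and r: "rep G f" and st: "s <= t" and sub: "lin b y ` {s..t} <= Om"
 and ends: "lin b y s : cQ i & lin b y t ~: cQ i | lin b y t : cQ i & lin b y s ~: cQ i"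
 shows "EX tu:{s..t}. lin b y tu : fr i & accessible Om Q G (lin b y tu)"
proof -
 let ?h = "lin b y"
 define X where "X = {sg : {s..t}. ?h sg : cQ i}"
 have "closed ({s..t} Int ?h -` (cQ i))" by (intro continuous_closed_preimage cont_lin) auto
 then have cX: "compact X" unfolding compact_eq_bounded_closed X_def
 by (auto simp: vimage_def Int_def intro: bounded_subset[OF bounded_closed_interval[of s t]])
 have Xne: "X ~= {}" using ends st by (auto simp: X_def)
 have inj: "?h p = ?h q ==> p = q" for p q using dist_lin[of b y p q] by (simp del: dist_lin)
 \<comment> \<open>Next to the crossing the open segment \<open>{p<..<q}\<close> stays off the
   closed disk and ends at the crossing, as access to a point of the circle requires.\<close>
 have *: "?h tu : fr i & accessible Om Q G (?h tu)"
 if t': "tu : X" "p < q" "{p..q} <= {s..t}" "tu = p | tu = q" "ALL sg:{p<..<q}. sg ~: X" for tu p q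
 proof -
 have av: "?h sg ~: cQ i" if "sg : {p<..<q}" for sg using t'(3,5) that by (force simp: X_def)
 have tuc: "tu : closure {p<..<q}" using t'(2,4) by auto
 have "?h ` closure {p<..<q} <= closure (?h ` {p<..<q})" by (rule image_closure_subset[OF cont_lin closed_closure closure_subset])
 then have cl: "?h tu : closure (?h ` {p<..<q})" using tuc by blast
 have "?h ` {p<..<q} <= - cQ i" using av by blast
 then have "?h tu ~: Q i" using cl closure_subset[of "Q i"] open_Q[of i]
 by (metis (no_types, lifting) IntI Int_commute compl_le_swap1 disjoint_eq_subset_Compl empty_iff open_Int_closure_eq_empty subset_trans)
 then have ef: "?h tu : fr i" using t'(1) fr_Q by (auto simp: X_def)
 then have S: "?h tu : S" using fr_S by blast
 have good: "({p..q}, ?h) : good_paths Om Q G" using t'(2,3) sub by (intro gl_good[OF g r]) auto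
 have "accesses Om Q (?h tu) ({p..q}, ?h) ({p<..<q}, ?h)"
 proof -
 have "?h tu ~: carpet_core Om Q" using ef by (auto simp: carpet_core_def)
 moreover have "?h tu ~: ?h ` {p<..<q}" using inj t'(4) by force
 moreover have "?h ` {p<..<q} Int Q j = {}" if "?h tu : fr j" for j
 proof -
 have "i = j" using fr_unique[OF ef, of j] that by (simp add: frontier_def)
 then show ?thesis using av closure_subset by blast
 qed
 ultimately show ?thesis using t'(2) cl by (auto simp: accesses_def subpath_of_def img_def is_interval_oo)
 qed
 then show ?thesis using ef S good unfolding accessible_def by blast
 qed
 show ?thesis
 proof (cases "?h t : cQ i")
 case False
 have "EX c:X. ALL t:X. t <= c" by (rule compact_attains_sup[OF cX Xne])
 then obtain tu where tu: "tu : X" "!!sg. sg : X ==> sg <= tu" by blast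
 have ts: "s <= tu" "tu < t" using tu(1) False by (auto simp: X_def order_le_less)
 have "sg ~: X" if "sg : {tu<..<t}" for sg using tu(2)[of sg] that by auto
 then have "?h tu : fr i & accessible Om Q G (?h tu)" using ts by (intro *[OF tu(1) ts(2)]) auto
 then show ?thesis using ts by (intro bexI[of _ tu]) auto
 next
 case True
 have "EX c:X. ALL t:X. c <= t" by (rule compact_attains_inf[OF cX Xne])
 then obtain tu where tu: "tu : X" "!!sg. sg : X ==> tu <= sg" by blast
 have "?h s ~: cQ i" using ends True by blast
 then have ts: "s < tu" "tu <= t" using tu(1) by (auto simp: X_def order_le_less)
 have "sg ~: X" if "sg : {s<..<tu}" for sg using tu(2)[of sg] that by auto
 then have "?h tu : fr i & accessible Om Q G (?h tu)" using ts by (intro *[OF tu(1) ts(1)]) auto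
 then show ?thesis using ts by (intro bexI[of _ tu]) auto
 qed
qed

section \<open>Density of accessible points\<close>

lemma lin_seg_sqr: "lin b y s : sqr x e ==> lin b y t : sqr x e ==> lin b y ` {min s t..max s t} <= sqr x e"
 using lin_in_sqr[of b y "min s t" x e "max s t"] by (auto simp: min_def max_def split: if_splits)

text \<open>Inside a small square an L-shaped path of generic lines leads from the disk to its
  exterior; on the leg where it leaves the closed disk it crosses the circle at an accessible
  point.\<close>

lemma accessible_fr:
 assumes f: "sob f" and r: "rep G f" and x: "x : fr i" and e: "0 < e"
 shows "EX z:fr i. z : ball x e & accessible Om Q G z"
proof -
 have "x : ball x e Int Om" using x e fr_S S_sub by auto
 moreover have "open (ball x e Int Om)" by (intro open_Int open_ball open_Om)
 ultimately obtain d where d: "d > 0" "sqr x d <= ball x e Int Om" using sqr_in_open by blast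
 have "AE y in lborel. gl f True y" "AE y in lborel. gl f False y" using AE_gl[OF f] by auto
 then have ae: "AE y in lborel. gl f True y & gl f False y" by eventually_elim simp
 have ex: "EX z:U. gl f True (Im z) & gl f False (Re z)" if U: "open U" "z0 : U" for U z0
 proof -
 obtain c where c: "c > 0" "sqr z0 c <= U" using sqr_in_open[OF U] by blast
 obtain p where p: "Im z0 - c < p" "p < Im z0 + c" "gl f True p" using AE_interval[OF ae, of "Im z0 - c" "Im z0 + c"] c by auto
 obtain q where q: "Re z0 - c < q" "q < Re z0 + c" "gl f False q" using AE_interval[OF ae, of "Re z0 - c" "Re z0 + c"] c by auto
 have "Complex q p : sqr z0 c" using p q by (auto simp: sqr_def ninf_def)
 then show ?thesis using c p q by (intro bexI[of _ "Complex q p"]) auto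
 qed
 have xs: "x : sqr x d" using d(1) by (rule sqr_center)
 have "sqr x d Int cQ i ~= {}" using x xs by (auto simp: frontier_def)
 then have "sqr x d Int Q i ~= {}" by (simp add: open_Int_closure_eq_empty)
 then obtain a0 where a0: "a0 : sqr x d Int Q i" by blast
 have "open (sqr x d Int Q i)" by (intro open_Int open_sqr open_Q)
 from ex[OF this a0] obtain a where a: "a : Q i" "a : sqr x d" "gl f True (Im a)" "gl f False (Re a)" by blast
 have "sqr x d Int closure (- cQ i) ~= {}" using x xs fr_outer[of i] by blast
 then have "sqr x d Int - cQ i ~= {}" by (subst (asm) open_Int_closure_eq_empty) simp_all
 then obtain b0 where b0: "b0 : sqr x d Int - cQ i" by blast
 have "open (sqr x d Int - cQ i)" by (intro open_Int open_sqr open_Compl closed_closure)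
 from ex[OF this b0] obtain b where b: "b ~: cQ i" "b : sqr x d" "gl f True (Im b)" "gl f False (Re b)" by blast
 define c where "c = Complex (Re b) (Im a)"
 have c: "c : sqr x d" unfolding c_def by (rule sqr_cross[OF a(2) b(2)])
 have ac: "a : cQ i" using a closure_subset by blast
 have seg: "EX z:fr i. z : ball x e & accessible Om Q G z"
 if g: "gl f bb y" and st: "lin bb y s : sqr x d" "lin bb y t : sqr x d" "lin bb y s : cQ i" "lin bb y t ~: cQ i" for bb y s t
 proof -
 have s1: "lin bb y ` {min s t..max s t} <= sqr x d" by (rule lin_seg_sqr[OF st(1,2)])
 then have s2: "lin bb y ` {min s t..max s t} <= Om" using d by blast
 have "EX tu:{min s t..max s t}. lin bb y tu : fr i & accessible Om Q G (lin bb y tu)"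
 by (rule exit_accessible[OF g r _ s2]) (use st in \<open>auto simp: min_def max_def\<close>)
 then show ?thesis using s1 d by blast
 qed
 show ?thesis
 proof (cases "c : cQ i")
 case False
 have "lin True (Im a) (Re a) = a" "lin True (Im a) (Re b) = c" by (auto simp: lin_def c_def)
 then show ?thesis using seg[OF a(3), of "Re a" "Re b"] a c ac False by simp
 next
 case True
 have "lin False (Re b) (Im a) = c" "lin False (Re b) (Im b) = b" by (auto simp: lin_def c_def)
 then show ?thesis using seg[OF b(4), of "Im a" "Im b"] b c True by simp
 qed
qed

lemma accessible_dense:
 assumes f: "sob f" and r: "rep G f" and x: "x : S" and e: "0 < e"
 shows "EX z:ball x e. accessible Om Q G z"
proof -
 have "EX i. fr i Int ball x (e/2) ~= {}"
 proof -
 have "open (ball x (e/2) Int Om)" "x : ball x (e/2) Int Om" using x e S_sub by auto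
 then obtain i where i: "i : I (ball x (e/2) Int Om)" using open_meets_Q[of "ball x (e/2) Int Om"] by blast
 then have "i : I (ball x (e/2))" using I_mono[of "ball x (e/2) Int Om" "ball x (e/2)"] by blast
 moreover have "x : ball x (e/2) Int S" using x e by simp
 then have "ball x (e/2) Int S ~= {}" by blast
 ultimately have "ball x (e/2) Int fr i ~= {}" by (intro cross connected_ball)
 then show ?thesis by blast
 qed
 then obtain i x' where x': "x' : fr i" "x' : ball x (e/2)" by blast
 have "0 < e/2" using e by simp
 from accessible_fr[OF f r x'(1) this] obtain z where z: "z : ball x' (e/2)" "accessible Om Q G z" by blast
 have "dist x z < e" using z(1) x'(2) dist_triangle[of x z x'] by simp
 then show ?thesis using z(2) by auto
qed

text \<open>For continuous f every limes inferior in the definition is a limit with value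
  \<open>f x\<close>, provided that none is taken over a trivial filter. That is the density of
  accessible points, in the carpet and along each circle.\<close>

lemma continuous_normalized:
 assumes f: "sob f" and W: "(%x. ereal (f x)) : W12_loc ver Om Q"
 and cont: "!!x e. x : S ==> 0 < e ==> EX dl>0. ALL y:S Int ball x dl. (abs(f x - f y)) <= e"
 shows "normalized ver Om Q (%x. ereal (f x))"
proof -
 define G where "G x = ereal (f x)" for x
 have fb: "fb f" using f by (simp add: sob_def)
 have r: "rep G f" using fb peri_sup_eq[OF fb] osc_eq[OF fb] by (simp add: rep_def G_def[abs_def])
 have av: "accessible Om Q G y ==> access_value Om Q G y = ereal (f y)" for y by (rule access_value_cont[OF r cont])
 have lim: "Liminf (at x within A) (access_value Om Q G) = ereal (f x)"
 if x: "x : S" "x ~: A" and A: "!!y. y : A ==> accessible Om Q G y" and ne: "!!e. 0 < e ==> A Int ball x e ~= {}" for x A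
 proof (rule lim_imp_Liminf)
 have "x islimpt A" unfolding islimpt_approachable
 proof (intro allI impI)
 fix e :: real assume "0 < e"
 then obtain z where "z : A" "z : ball x e" using ne by blast
 then show "EX x':A. x' ~= x & dist x' x < e" using x(2) by (intro bexI[of _ z]) (auto simp: dist_commute)
 qed
 then show "at x within A ~= bot" by (simp add: trivial_limit_within)
 have "(f \<longlongrightarrow> f x) (at x within A)"
 proof (rule tendstoI)
 fix e :: real assume e: "0 < e"
 then have "0 < e / 2" by simp
 from cont[OF x(1) this] obtain dl where dl: "dl > 0" "ALL y:S Int ball x dl. (abs(f x - f y)) <= e / 2" by blast
 have "dist (f y) (f x) < e" if "y : A" "dist y x < dl" for y
 proof -
 have "y : S Int ball x dl" using A[OF that(1)] that(2) by (simp add: accessible_def dist_commute)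
 then have "(abs(f x - f y)) <= e / 2" using dl(2) by blast
 then show ?thesis using e by (simp add: dist_real_def abs_minus_commute)
 qed
 then show "\<forall>\<^sub>F y in at x within A. dist (f y) (f x) < e" unfolding eventually_at using dl(1) by blast
 qed
 then have "((%y. ereal (f y)) \<longlongrightarrow> ereal (f x)) (at x within A)" by simp
 moreover have "\<forall>\<^sub>F y in at x within A. ereal (f y) = access_value Om Q G y"
 unfolding eventually_at_filter using av A by simp
 ultimately show "(access_value Om Q G \<longlongrightarrow> ereal (f x)) (at x within A)" by (rule Lim_transform_eventually)
 qed
 have "ereal (f x) = normalized_version Om Q G x" if x: "x : S" for x
 proof (cases "accessible Om Q G x")
 case True
 then show ?thesis using av by (simp add: normalized_version_def)
 next
 case na: False
 show ?thesis
 proof (cases "EX i. x : fr i")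
 case True
 then obtain i where i: "x : fr i" by blast
 have the: "(THE i. x : fr i) = i"
 proof (rule the_equality)
 show "x : fr i" by (rule i)
 fix j assume "x : fr j"
 then have "x : cQ j" unfolding frontier_def by blast
 then show "j = i" using fr_unique[OF i] by metis
 qed
 have "Liminf (at x within {y : fr i. accessible Om Q G y}) (access_value Om Q G) = ereal (f x)"
 proof (rule lim[OF x])
 show "x ~: {y : fr i. accessible Om Q G y}" using na by simp
 show "accessible Om Q G y" if "y : {y : fr i. accessible Om Q G y}" for y using that by simp
 show "{y : fr i. accessible Om Q G y} Int ball x e ~= {}" if "0 < e" for e
 using accessible_fr[OF f r i that] by blast
 qed
 then show ?thesis using na True by (simp add: normalized_version_def the)
 next
 case False
 have "Liminf (at x within {y. accessible Om Q G y}) (access_value Om Q G) = ereal (f x)"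
 proof (rule lim[OF x])
 show "x ~: {y. accessible Om Q G y}" using na by simp
 show "accessible Om Q G y" if "y : {y. accessible Om Q G y}" for y using that by simp
 show "{y. accessible Om Q G y} Int ball x e ~= {}" if "0 < e" for e
 using accessible_dense[OF f r x that] by blast
 qed
 then show ?thesis using na False by (simp add: normalized_version_def)
 qed
 qed
 then show ?thesis unfolding normalized_def using W unfolding G_def[abs_def] by blast
qed

end

lemma (in harm_limit) limit_cont:
 assumes eqc: "!!x e. x : S ==> 0 < e ==> EX dl>0. ALL n. ALL y:S Int ball x dl. (abs(w n x - w n y)) <= e" and x: "x : S" and e: "0 < e"
 shows "EX dl>0. ALL y:S Int ball x dl. (abs(v x - v y)) <= e"
proof -
 have e3: "0 < e / 3" using e by simp
 from eqc[OF x this] obtain dl where dl: "dl > 0" "ALL n. ALL y:S Int ball x dl. (abs(w n x - w n y)) <= e / 3" by blast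
 have "(abs(v x - v y)) <= e" if y: "y : S Int ball x dl" for y
 proof -
 have "compact {x, y}" "{x, y} <= Om" using x y S_sub by auto
 from lim_close[OF this e3] obtain n where "(abs(w n x - v x)) <= e / 3" "(abs(w n y - v y)) <= e / 3" using x y by auto
 moreover have "(abs(w n x - w n y)) <= e / 3" using dl(2) y by blast
 ultimately show ?thesis by linarith
 qed
 then show ?thesis using dl(1) by blast
qed

theorem corollary2p86:
  fixes \<Omega> :: "complex set" and Q :: "nat \<Rightarrow> complex set"
    and ver :: version and u :: "nat \<Rightarrow> complex \<Rightarrow> real"
  assumes "relative_sierpinski_carpet \<Omega> Q"
    and "standing_assumptions \<Omega> Q"
    and "\<And>n. carpet_harmonic ver \<Omega> Q (\<lambda>x. ereal (u n x))"
    and "\<And>n. normalized ver \<Omega> Q (\<lambda>x. ereal (u n x))"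
    and "\<And>K. compact K \<Longrightarrow> K \<subseteq> \<Omega> \<Longrightarrow> \<exists>C. \<forall>n. \<forall>x\<in>carpet \<Omega> Q \<inter> K. \<bar>u n x\<bar> \<le> C"
  shows "\<exists>(r :: nat \<Rightarrow> nat) (v :: complex \<Rightarrow> real).
           strict_mono r \<and>
           carpet_harmonic ver \<Omega> Q (\<lambda>x. ereal (v x)) \<and>
           normalized ver \<Omega> Q (\<lambda>x. ereal (v x)) \<and>
           (\<forall>K. compact K \<and> K \<subseteq> \<Omega> \<longrightarrow>
              uniform_limit (carpet \<Omega> Q \<inter> K) (\<lambda>n. u (r n)) v sequentially)"
proof -
  interpret C: rel_carpet \<Omega> Q ver by unfold_locales (rule assms)+
  have h: "C.harm w \<and> normalized ver \<Omega> Q (\<lambda>x. ereal (w x))" if "w \<in> range u" for w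
    using that C.carpet_harmonic_harm[OF assms(3)] assms(4) by auto
  have eqc: "\<exists>\<delta>>0. \<forall>n. \<forall>y\<in>carpet \<Omega> Q \<inter> ball x \<delta>. \<bar>u n x - u n y\<bar> \<le> e" if x: "x \<in> carpet \<Omega> Q" and e: "0 < e" for x e
  proof -
    have "\<exists>\<delta>>0. \<forall>w\<in>range u. \<forall>y\<in>carpet \<Omega> Q \<inter> ball x \<delta>. \<bar>w x - w y\<bar> \<le> e"
    proof (rule C.equicont[OF h _ x e])
      fix L :: "complex set" assume "compact L" "L \<subseteq> \<Omega>"
      from assms(5)[OF this] show "\<exists>C. \<forall>w\<in>range u. \<forall>x\<in>carpet \<Omega> Q \<inter> L. \<bar>w x\<bar> \<le> C" by auto
    qed
    then show ?thesis by auto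
  qed
  have "\<exists>k v. strict_mono k \<and> (\<forall>K. compact K \<longrightarrow> K \<subseteq> \<Omega> \<longrightarrow> uniform_limit (carpet \<Omega> Q \<inter> K) (\<lambda>n. u (k n)) v sequentially)"
    by (rule C.limit_exists) (rule eqc assms(5), assumption+)+
  then obtain r v where r: "strict_mono r" and lim: "\<forall>K. compact K \<longrightarrow> K \<subseteq> \<Omega> \<longrightarrow> uniform_limit (carpet \<Omega> Q \<inter> K) (\<lambda>n. u (r n)) v sequentially"
    by (elim exE conjE) (rule that)
  interpret L: harm_limit \<Omega> Q ver "\<lambda>n. u (r n)" v
  proof unfold_locales
    show "carpet_harmonic ver \<Omega> Q (\<lambda>x. ereal (u (r n) x))" for n by (rule assms(3))
    show "uniform_limit (carpet \<Omega> Q \<inter> K) (\<lambda>n. u (r n)) v sequentially" if "compact K" "K \<subseteq> \<Omega>" for K using lim that by simp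
    show "\<exists>C. \<forall>n. \<forall>x\<in>carpet \<Omega> Q \<inter> L. \<bar>u (r n) x\<bar> \<le> C" if "compact L" "L \<subseteq> \<Omega>" for L using assms(5)[OF that] by blast
  qed
  \<comment> \<open>Local equicontinuity of the sequence passes to the limit and supplies the
    hypothesis from which \<open>continuous_normalized\<close> obtains normalization.\<close>
  have cont: "\<exists>\<delta>>0. \<forall>y\<in>carpet \<Omega> Q \<inter> ball x \<delta>. \<bar>v x - v y\<bar> \<le> e" if "x \<in> carpet \<Omega> Q" "0 < e" for x e
  proof (rule L.limit_cont[OF _ that])
    fix x e assume "x \<in> carpet \<Omega> Q" "0 < (e::real)"
    from eqc[OF this] show "\<exists>\<delta>>0. \<forall>n. \<forall>y\<in>carpet \<Omega> Q \<inter> ball x \<delta>. \<bar>u (r n) x - u (r n) y\<bar> \<le> e" by blast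
  qed
  have "normalized ver \<Omega> Q (\<lambda>x. ereal (v x))"
    using L.v_harmonic unfolding carpet_harmonic_def by (intro C.continuous_normalized[OF L.sob_v _ cont]) auto
  then show ?thesis using r lim L.v_harmonic by blast
qed

end
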